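(* Let $\omega\subset\mathbb R^2$ be a bounded $C^1$ domain and let $\Omega=\mathbb R\times\omega$. Then there exists a minimizer of the micromagnetic energy $E$ in $\tilde A(\Omega)$, i.e. there is $m^*\in\tilde A(\Omega)$ with $E(m^* )=\inf_{m\in\tilde A(\Omega)}E(m)$.
   Context: Points of $\Omega=\mathbb R\times\omega$ are written $(x,y,z)$ with $x\in\mathbb R$, $(y,z)\in\omega$. A magnetization is a map $m\colon\Omega\to\mathbb S^2$ (unit sphere in $\mathbb R^3$), extended by $0$ to $\mathbb R^3\setminus\Omega$. Its energy is $$E(m)=\int_\Omega|\nabla m|^2+\int_{\mathbb R^3}|\nabla u|^2,$$ where $u$ is a weak solution of $\triangle u=\mathrm{div}\, m$ in $\mathbb R^3$, i.e. $\nabla u\in L^2(\mathbb R^3)$ and $\int_{\mathbb R^3}\nabla u\cdot\nabla\varphi=\int_\Omega m\cdot\nabla\varphi$ for all $\varphi\in C_0^\infty(\mathbb R^3)$. The admissible class is $\tilde A(\Omega)=\{m\colon\Omega\to\mathbb S^2 : m-\bar e\in H^1(\Omega)\}$, where $\bar e(x,y,z)=(-1,0,0)$ if $x<-1$, $\bar e(x,y,z)=(x,0,0)$ if $-1\le x\le 1$, and $\bar e(x,y,z)=(1,0,0)$ if $x>1$. *)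

theory Defs
  imports "HOL-Analysis.Analysis"
begin

section \<open>Test functions\<close>

abbreviation pderiv_at :: "'a::euclidean_space \<Rightarrow> ('a \<Rightarrow> real) \<Rightarrow> 'a \<Rightarrow> real" where
  "pderiv_at b f x \<equiv> frechet_derivative f (at x) b"

fun C_k :: "nat \<Rightarrow> ('a::euclidean_space \<Rightarrow> real) \<Rightarrow> bool" where
  "C_k 0 f \<longleftrightarrow> continuous_on UNIV f"
| "C_k (Suc k) f \<longleftrightarrow> (\<forall>x. f differentiable at x) \<and> (\<forall>b\<in>Basis. C_k k (pderiv_at b f))"

definition test_functions :: "'a::euclidean_space set \<Rightarrow> ('a \<Rightarrow> real) set" where
  "test_functions U =
    {f. (\<forall>k. C_k k f) \<and> compact (closure {x. f x \<noteq> 0}) \<and> closure {x. f x \<noteq> 0} \<subseteq> U}"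


section \<open>Weak derivatives and Sobolev spaces\<close>

text \<open>
  Functions on an open set \<open>U\<close> are total functions whose values outside \<open>U\<close> are irrelevant.
  Elements of the function spaces are representatives, not equivalence classes.
\<close>

definition L2 :: "'a::euclidean_space set \<Rightarrow> ('a \<Rightarrow> 'b::euclidean_space) set" where
  "L2 U = {f. f \<in> borel_measurable (lebesgue_on U)
            \<and> integrable (lebesgue_on U) (\<lambda>x. (norm (f x))\<^sup>2)}"

definition locally_integrable_on ::
    "('a::euclidean_space \<Rightarrow> 'b::euclidean_space) \<Rightarrow> 'a set \<Rightarrow> bool"
    (infixr \<open>locally'_integrable'_on\<close> 46) where
  "f locally_integrable_on U \<longleftrightarrow> (\<forall>K. compact K \<and> K \<subseteq> U \<longrightarrow> set_integrable lebesgue K f)"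

definition has_weak_pderiv ::
    "'a::euclidean_space set \<Rightarrow> 'a \<Rightarrow> ('a \<Rightarrow> 'b::euclidean_space) \<Rightarrow> ('a \<Rightarrow> 'b) \<Rightarrow> bool" where
  "has_weak_pderiv U b f g \<longleftrightarrow>
     f locally_integrable_on U \<and> g locally_integrable_on U \<and>
     (\<forall>\<phi>\<in>test_functions U.
        (LINT x|lebesgue_on U. pderiv_at b \<phi> x *\<^sub>R f x) = - (LINT x|lebesgue_on U. \<phi> x *\<^sub>R g x))"

text \<open>Determined only almost everywhere on \<open>U\<close>, and unspecified if there is no weak derivative.\<close>

definition weak_pderiv ::
    "'a::euclidean_space set \<Rightarrow> 'a \<Rightarrow> ('a \<Rightarrow> 'b::euclidean_space) \<Rightarrow> 'a \<Rightarrow> 'b" where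
  "weak_pderiv U b f = (SOME g. has_weak_pderiv U b f g)"

definition weakly_differentiable_on ::
    "('a::euclidean_space \<Rightarrow> 'b::euclidean_space) \<Rightarrow> 'a set \<Rightarrow> bool"
    (infixr \<open>weakly'_differentiable'_on\<close> 46) where
  "f weakly_differentiable_on U \<longleftrightarrow> (\<forall>b\<in>Basis. \<exists>g. has_weak_pderiv U b f g)"

definition H1 :: "'a::euclidean_space set \<Rightarrow> ('a \<Rightarrow> 'b::euclidean_space) set" where
  "H1 U = {f. f \<in> L2 U \<and> f weakly_differentiable_on U \<and> (\<forall>b\<in>Basis. weak_pderiv U b f \<in> L2 U)}"

definition dirichlet_energy ::
    "'a::euclidean_space set \<Rightarrow> ('a \<Rightarrow> 'b::euclidean_space) \<Rightarrow> ennreal" where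
  "dirichlet_energy U f =
     (if f weakly_differentiable_on U
      then \<integral>\<^sup>+x. ennreal (\<Sum>b\<in>Basis. (norm (weak_pderiv U b f x))\<^sup>2) \<partial>lebesgue_on U
      else \<infinity>)"


section \<open>Planar domains with \<open>C\<^sup>1\<close> boundary\<close>

text \<open>
  Near each boundary point, in a suitable orthonormal frame \<open>(e, n)\<close>, the domain is the part
  strictly above the graph of a \<open>C\<^sup>1\<close> function.
\<close>

definition C1_domain :: "(real \<times> real) set \<Rightarrow> bool" where
  "C1_domain S \<longleftrightarrow>
     open S \<and> connected S \<and> S \<noteq> {} \<and>
     (\<forall>p\<in>frontier S. \<exists>r>0. \<exists>e n \<gamma>.
        norm e = 1 \<and> norm n = 1 \<and> e \<bullet> n = 0 \<and> \<gamma> C1_differentiable_on UNIV \<and>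
        S \<inter> ball p r = {q \<in> ball p r. q \<bullet> n > \<gamma> (q \<bullet> e)})"


section \<open>The micromagnetic energy\<close>

text \<open>
  Space is \<open>real \<times> real \<times> real\<close>, whose norm and inner product are the Euclidean ones.
  The extension of a magnetization by \<open>0\<close> outside \<open>\<Omega>\<close> enters by restricting
  the right-hand integral below to \<open>\<Omega>\<close>.
\<close>

type_synonym space = "real \<times> real \<times> real"

definition stray_field_potential :: "space set \<Rightarrow> (space \<Rightarrow> space) \<Rightarrow> (space \<Rightarrow> real) \<Rightarrow> bool" where
  "stray_field_potential \<Omega> m u \<longleftrightarrow>
     u weakly_differentiable_on UNIV \<and> (\<forall>b\<in>Basis. weak_pderiv UNIV b u \<in> L2 UNIV) \<and>
     (\<forall>\<phi>\<in>test_functions UNIV.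
        (LINT x|lebesgue. (\<Sum>b\<in>Basis. weak_pderiv UNIV b u x * pderiv_at b \<phi> x))
        = (LINT x|lebesgue_on \<Omega>. (\<Sum>b\<in>Basis. (m x \<bullet> b) * pderiv_at b \<phi> x)))"

text \<open>
  The gradient of a potential is unique almost everywhere, since a harmonic function with
  square-integrable gradient is constant; the choice of the potential is therefore immaterial.
\<close>

definition stray_field_energy :: "space set \<Rightarrow> (space \<Rightarrow> space) \<Rightarrow> ennreal" where
  "stray_field_energy \<Omega> m =
     (if \<exists>u. stray_field_potential \<Omega> m u
      then dirichlet_energy UNIV (SOME u. stray_field_potential \<Omega> m u)
      else \<infinity>)"

definition energy :: "space set \<Rightarrow> (space \<Rightarrow> space) \<Rightarrow> ennreal" where
  "energy \<Omega> m = dirichlet_energy \<Omega> m + stray_field_energy \<Omega> m"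

fun e_bar :: "space \<Rightarrow> space" where
  "e_bar (x, y, z) = (if x < -1 then (-1, 0, 0) else if x \<le> 1 then (x, 0, 0) else (1, 0, 0))"

definition admissible :: "space set \<Rightarrow> (space \<Rightarrow> space) set" where
  "admissible \<Omega> = {m. m \<in> \<Omega> \<rightarrow> sphere 0 1 \<and> (\<lambda>p. m p - e_bar p) \<in> H1 \<Omega>}"

end

theory Submission
 imports Defs "HOL-Complex_Analysis.Great_Picard"
begin

text \<open>
The direct method, in a setting that is only invariant under translations along the wire and has
a nonconvex constraint. On each unit cell of the wire, a Poincare inequality and the stray field
equation, tested with a cutoff times a transversal coordinate, bound the transversal components of
the magnetization and the oscillation of the axial one by the energy near that cell. So all but
boundedly many cells carry a magnetization close to \<open>+1\<close> or \<open>-1\<close> in the axial direction, and suitable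
translations keep a transition from \<open>-1\<close> to \<open>+1\<close> in a bounded region. A minimizing sequence of
translates converges almost everywhere along a subsequence, which preserves the constraint. Almost
minimal averages of its tails converge strongly, by the parallelogram identity, to a state with
the same magnetization, and this bounds the energy of the limit.
\<close>

text \<open>A limit of translates with finite energy may be a constant state, which lies outside the
  class, so a change of sign must survive. The energy bounds the number of cells without a definite
  sign but not their mutual distances, which may grow along the sequence. A pigeonhole argument over
  widely separated length scales therefore finds a scale at which no two such cells have their
  distance; a translate centred accordingly has its transition in a window of fixed size, while the
  constant stretches on both sides grow. That the limit belongs to the class is recovered
  afterwards, from the signs of its averages and its finite energy alone.

  The triples of a magnetization of norm at most 1, its gradients and its stray field form a set
  that is closed under midpoints, and the energy is a squared norm of such a triple. The constraint
  of norm 1 would destroy this convexity and is kept apart. Since the energy refers to an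
  arbitrarily chosen potential, a uniqueness theorem for stray fields is needed to return from
  triples to magnetizations.\<close>

abbreviation nn_lborel :: "('a::euclidean_space => ennreal) => ennreal" (binder "\<N> " 10) where
 "nn_lborel f \<equiv> nn_integral lborel f"
notation indicator ("\<I>")
abbreviation borel_functions :: "('a::topological_space => 'b::topological_space) set" ("\<B>") where
 "\<B> \<equiv> borel_measurable borel"

section \<open>Smooth functions and test functions\<close>

definition nabla :: "('a::euclidean_space => real) => 'a => 'a" where
 "nabla f x = (\<Sum>b\<in>Basis. pderiv_at b f x *\<^sub>R b)"

definition smooth :: "('a::euclidean_space => real) => bool" where
 "smooth f \<longleftrightarrow> (\<forall>k. C_k k f)"

lemma frechet_derivative_eqI:
 "(f has_derivative f') (at x) ==> frechet_derivative f (at x) v = f' v"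
 using frechet_derivative_at by metis

lemma nabla_inner:
 assumes "f differentiable at x"
 shows "nabla f x \<bullet> v = frechet_derivative f (at x) v"
proof -
 interpret linear "frechet_derivative f (at x)"
  using assms by (metis bounded_linear.linear frechet_derivative_works has_derivative_bounded_linear)
 have "frechet_derivative f (at x) v = frechet_derivative f (at x) (\<Sum>b\<in>Basis. (v \<bullet> b) *\<^sub>R b)"
  by (simp add: euclidean_representation)
 also have "... = (\<Sum>b\<in>Basis. (v \<bullet> b) * frechet_derivative f (at x) b)"
  by (simp add: sum scaleR)
 also have "... = nabla f x \<bullet> v"
  by (simp add: nabla_def inner_sum_left inner_sum_right inner_commute mult.commute)
 finally show ?thesis by simp
qed

lemma nabla_has_derivative:
 assumes "f differentiable at x"
 shows "(f has_derivative (%v. nabla f x \<bullet> v)) (at x)"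
 using assms by (simp add: nabla_inner frechet_derivative_works[symmetric])

lemma nabla_eqI:
 assumes "(f has_derivative (%v. g \<bullet> v)) (at x)"
 shows "nabla f x = g"
proof -
 have "nabla f x \<bullet> v = g \<bullet> v" for v
  using assms nabla_inner[of f x v] frechet_derivative_eqI[OF assms] by (auto simp: differentiable_def)
 then show ?thesis by (metis inner_commute vector_eq_rdot)
qed

lemma C_k_Suc_imp: "C_k (Suc k) f ==> C_k k f"
proof (induction k arbitrary: f)
 case 0
 then show ?case
  by (auto simp: continuous_on_eq_continuous_at differentiable_imp_continuous_within)
next
 case (Suc k)
 then show ?case by auto
qed

lemma C_k_const: "C_k k (%x. c)"
 by (induction k arbitrary: c) (auto)

lemma C_k_add: "C_k k f ==> C_k k g ==> C_k k (%x. f x + g x)"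
proof (induction k arbitrary: f g)
 case 0 then show ?case by (auto intro: continuous_intros)
next
 case (Suc k)
 have "pderiv_at b (%x. f x + g x) = (%x. pderiv_at b f x + pderiv_at b g x)" for b
  using Suc.prems by (intro ext frechet_derivative_eqI)
   (auto intro!: derivative_eq_intros simp: frechet_derivative_works)
 then show ?case using Suc by auto
qed

lemma C_k_mult: "C_k k f ==> C_k k g ==> C_k k (%x. f x * g x)"
proof (induction k arbitrary: f g)
 case 0 then show ?case by (auto intro: continuous_intros)
next
 case (Suc k)
 have eq: "pderiv_at b (%x. f x * g x) = (%x. f x * pderiv_at b g x + pderiv_at b f x * g x)" for b
  using Suc.prems by (intro ext frechet_derivative_eqI)
   (auto intro!: derivative_eq_intros simp: frechet_derivative_works)
 have "C_k k f" "C_k k g" using Suc.prems C_k_Suc_imp by auto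
 then have "C_k k (pderiv_at b (%x. f x * g x))" if "b \<in> Basis" for b
  using Suc that unfolding eq by (intro C_k_add) auto
 then show ?case using Suc.prems by auto
qed

lemma smooth_const: "smooth (%x. c)"
 and smooth_add: "smooth f ==> smooth g ==> smooth (%x. f x + g x)"
 and smooth_mult: "smooth f ==> smooth g ==> smooth (%x. f x * g x)"
 by (auto simp: smooth_def C_k_const C_k_add C_k_mult)

lemma smooth_diff: "smooth f ==> smooth g ==> smooth (%x. f x - g x)"
 using smooth_add[OF _ smooth_mult[OF smooth_const[of "-1"]], of f g] by simp

lemma smooth_prod: "(!!i. i \<in> I ==> smooth (f i)) ==> smooth (%x. \<Prod>i\<in>I. f i x)"
 by (induction I rule: infinite_finite_induct) (auto intro: smooth_const smooth_mult)

lemma smooth_inner: "smooth (%x. x \<bullet> c)"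
proof -
 have "pderiv_at b (%x. x \<bullet> c) = (%x. b \<bullet> c)" for b :: 'a
  by (intro ext frechet_derivative_eqI) (auto intro!: derivative_eq_intros)
 then have "C_k k (%x::'a. x \<bullet> c)" for k
  by (cases k) (auto intro!: continuous_intros C_k_const)
 then show ?thesis by (simp add: smooth_def)
qed

lemma smooth_norm_sq: "smooth (%x. (norm (x - p))\<^sup>2)"
proof -
 have eq: "pderiv_at b (%x. (norm (x - p))\<^sup>2) = (%x. 2 * (x \<bullet> b) + - 2 * (p \<bullet> b))" for b :: 'a
  unfolding power2_norm_eq_inner
  by (intro ext frechet_derivative_eqI)
   (auto intro!: derivative_eq_intros simp: inner_diff_left inner_diff_right inner_commute)
 have d: "(%x. (norm (x - p))\<^sup>2) differentiable at x" for x :: 'a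
 proof -
  have "((%x. (norm (x - p))\<^sup>2) has_derivative (%h. (x - p) \<bullet> h + h \<bullet> (x - p))) (at x)"
   unfolding power2_norm_eq_inner by (auto intro!: derivative_eq_intros)
  then show ?thesis by (auto simp: differentiable_def)
 qed
 have "C_k k (%x::'a. (norm (x - p))\<^sup>2)" for k
 proof (cases k)
  case (Suc j)
  have "C_k j (%x::'a. 2 * (x \<bullet> b) + - 2 * (p \<bullet> b))" for b
   using smooth_inner[of b] by (intro C_k_add C_k_mult C_k_const) (auto simp: smooth_def)
  then show ?thesis using d by (simp add: Suc eq)
 qed (auto intro!: continuous_intros)
 then show ?thesis by (simp add: smooth_def)
qed

lemma smooth_differentiable: "smooth f ==> f differentiable at x"
 unfolding smooth_def by (metis C_k.simps(2))

lemma smooth_pderiv: "smooth f ==> b \<in> Basis ==> smooth (pderiv_at b f)"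
 unfolding smooth_def by (metis C_k.simps(2))

lemma smooth_nabla_inner:
 assumes "smooth f" shows "smooth (%x. nabla f x \<bullet> v)"
proof -
 have "smooth (%x. \<Sum>b\<in>B. pderiv_at b f x * (b \<bullet> v))" if "B \<subseteq> Basis" for B
 proof -
  have "finite B" using that finite_Basis finite_subset by blast
  then show ?thesis using that
   by (induction B rule: finite_induct)
    (auto intro!: smooth_const smooth_add smooth_mult smooth_pderiv[OF assms])
 qed
 then show ?thesis by (simp add: nabla_def inner_sum_left)
qed

lemma smooth_continuous: "smooth f ==> continuous_on S f"
 unfolding smooth_def by (metis C_k.simps(1) continuous_on_subset subset_UNIV)

lemma continuous_on_nabla:
 assumes "smooth f" shows "continuous_on S (nabla f)"
 unfolding nabla_def
 by (intro continuous_intros smooth_continuous smooth_pderiv assms)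

text \<open>The derivative of 1/f is a product of 1/f twice with a derivative of f, so the induction
  hypothesis for 1/f itself closes the step.\<close>

lemma smooth_inverse:
 assumes "smooth f" "!!x. f x ~= 0"
 shows "smooth (%x. inverse (f x))"
proof -
 have d: "(%x. inverse (f x)) differentiable at x" for x
  using assms smooth_differentiable by (auto intro: differentiable_inverse)
 have eq: "pderiv_at b (%x. inverse (f x)) = (%x. (-1) * (inverse (f x) * (pderiv_at b f x * inverse (f x))))" for b
  using assms smooth_differentiable[OF assms(1)] by (intro ext frechet_derivative_eqI)
   (auto intro!: derivative_eq_intros simp: frechet_derivative_works)
 have "C_k k (%x. inverse (f x))" for k
 proof (induction k)
  case 0 then show ?case using assms smooth_continuous by (auto intro!: continuous_intros)
 next
  case (Suc k)
  have "C_k k (pderiv_at b (%x. inverse (f x)))" if "b \<in> Basis" for b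
   unfolding eq using Suc smooth_pderiv[OF assms(1) that]
   by (intro C_k_mult C_k_const) (auto simp: smooth_def)
  then show ?case using d by simp
 qed
 then show ?thesis by (simp add: smooth_def)
qed

text \<open>The derivative of \<open>\<psi> (f x)\<close> contains another member of the family, so
  the induction on the order of differentiability runs over all of \<Psi> at once. Closure of \<Psi>
  under differentiation replaces a chain rule of higher order.\<close>

lemma smooth_compose:
 fixes \<Psi> :: "(real => real) set"
 assumes \<Psi>: "!!\<psi>. \<psi> \<in> \<Psi> ==> \<exists>\<psi>'\<in>\<Psi>. \<forall>t. (\<psi> has_real_derivative \<psi>' t) (at t)"
  and f: "smooth f" and "\<psi> \<in> \<Psi>"
 shows "smooth (%x. \<psi> (f x))"
proof -
 have "C_k k (%x. \<psi> (f x))" if "\<psi> \<in> \<Psi>" for k \<psi>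
  using that
 proof (induction k arbitrary: \<psi>)
  case 0
  obtain \<psi>' where "!!t. (\<psi> has_real_derivative \<psi>' t) (at t)" using \<Psi> 0 by blast
  then have c: "isCont \<psi> t" for t by (rule DERIV_isCont)
  have "continuous_on UNIV (%x. \<psi> (f x))"
   using smooth_continuous[OF f, of UNIV] c
   by (auto simp: continuous_on_eq_continuous_at intro: isCont_o2)
  then show ?case by simp
 next
  case (Suc k)
  obtain \<psi>' where "\<psi>' \<in> \<Psi>" and D: "!!t. (\<psi> has_real_derivative \<psi>' t) (at t)" using \<Psi> Suc by blast
  have h: "((%x. \<psi> (f x)) has_derivative (%v. \<psi>' (f x) * frechet_derivative f (at x) v)) (at x)" for x
   using DERIV_compose_FDERIV[OF D smooth_differentiable[OF f, of x, unfolded frechet_derivative_works]]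
   by (simp add: mult.commute)
  have "pderiv_at b (%x. \<psi> (f x)) = (%x. \<psi>' (f x) * pderiv_at b f x)" for b
   using h by (intro ext frechet_derivative_eqI)
  then have "C_k k (pderiv_at b (%x. \<psi> (f x)))" if "b \<in> Basis" for b
   using Suc.IH[OF \<open>\<psi>' \<in> \<Psi>\<close>] smooth_pderiv[OF f that] by (auto intro!: C_k_mult simp: smooth_def)
  moreover have "(%x. \<psi> (f x)) differentiable at x" for x
   using h by (auto simp: differentiable_def)
  ultimately show ?case by simp
 qed
 then show ?thesis using assms by (simp add: smooth_def)
qed

text \<open>The functions \<open>p(1/t) exp(-1/t)\<close>, extended by zero to \<open>t <= 0\<close>, form a family
 closed under differentiation.\<close>

definition bump :: "real poly => real => real" where
 "bump p t = (if t > 0 then poly p (inverse t) * exp (- inverse t) else 0)"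

lemma poly_exp_tendsto_0: "((%s. poly p s * exp (- s)) \<longlongrightarrow> (0::real)) at_top"
proof -
 have "((%s. \<Sum>i\<le>degree p. coeff p i * (s ^ i / exp s)) \<longlongrightarrow> (\<Sum>i\<le>degree p. coeff p i * 0)) at_top"
  by (intro tendsto_intros tendsto_power_div_exp_0)
 then show ?thesis
  by (simp add: poly_altdef sum_distrib_right exp_minus divide_inverse mult.assoc)
qed

lemma bump_tendsto_0: "(bump p \<longlongrightarrow> 0) (at 0)"
proof (rule filterlim_split_at)
 show "(bump p \<longlongrightarrow> 0) (at_left 0)"
  by (rule Lim_transform_eventually[where f="%_. 0"])
   (auto simp: bump_def eventually_at_filter)
 have "((%t. poly p (inverse t) * exp (- inverse t)) \<longlongrightarrow> 0) (at_right 0)"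
  using filterlim_compose[OF poly_exp_tendsto_0 filterlim_inverse_at_top_right] .
 then show "(bump p \<longlongrightarrow> 0) (at_right 0)"
  by (rule Lim_transform_eventually) (auto simp: bump_def eventually_at_filter)
qed

text \<open>With \<open>s = 1/t\<close> one has \<open>ds/dt = - s^2\<close>, so differentiating
  \<open>poly p s * exp (- s)\<close> in t multiplies \<open>p - pderiv p\<close> by the square of
  the variable, which is the factor \<open>[:0, 0, 1:]\<close>.\<close>

definition bump_deriv :: "real poly => real poly" where
 "bump_deriv p = [:0, 0, 1:] * (p - pderiv p)"

lemma bump_has_derivative: "(bump p has_real_derivative bump (bump_deriv p) t) (at t)"
proof -
 consider "t < 0" | "t = 0" | "t > 0" by linarith
 then show ?thesis
 proof cases
  case 1
  have "((%_. 0) has_real_derivative 0) (at t)" by simp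
  then have "(bump p has_real_derivative 0) (at t)"
   by (rule has_field_derivative_transform_within_open[of _ _ _ "{..<0}"])
    (use 1 in \<open>auto simp: bump_def\<close>)
  then show ?thesis using 1 by (simp add: bump_def)
 next
  case 2
  \<comment> \<open>Dividing by h multiplies the polynomial in 1/h by its variable, so the
    difference quotient at 0 is again a member of the family.\<close>
  have "((%h. bump (pCons 0 p) h) \<longlongrightarrow> 0) (at 0)" by (rule bump_tendsto_0)
  moreover have "bump (pCons 0 p) h = (bump p (0 + h) - bump p 0) / h" for h
   by (auto simp: bump_def field_simps)
  ultimately have "(bump p has_real_derivative 0) (at 0)"
   by (simp add: DERIV_def)
  then show ?thesis using 2 by (simp add: bump_def)
 next
  case 3
  have "((%t. poly p (inverse t) * exp (- inverse t)) has_real_derivative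
   poly (bump_deriv p) (inverse t) * exp (- inverse t)) (at t)"
   using 3 by (auto intro!: derivative_eq_intros simp: bump_deriv_def)
    (auto simp: field_simps power2_eq_square)
  then have "(bump p has_real_derivative poly (bump_deriv p) (inverse t) * exp (- inverse t)) (at t)"
   by (rule has_field_derivative_transform_within_open[of _ _ _ "{0<..}"])
    (use 3 in \<open>auto simp: bump_def\<close>)
  then show ?thesis using 3 by (simp add: bump_def)
 qed
qed

lemma smooth_bump: "smooth f ==> smooth (%x. bump p (f x))"
 by (rule smooth_compose[of "range bump"]) (auto intro: bump_has_derivative)

lemma continuous_on_bump [continuous_intros]: "continuous_on S f ==> continuous_on S (%x. bump p (f x))"
 using bump_has_derivative
 by (metis DERIV_continuous_on continuous_on_compose2 has_field_derivative_at_within subset_UNIV)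

lemma bump_1: "bump 1 t = (if t > 0 then exp (- inverse t) else 0)"
 by (simp add: bump_def)

lemma bump_1_bounds: "0 <= bump 1 t" "bump 1 t <= 1" "t > 0 ==> bump 1 t > 0" "t <= 0 ==> bump 1 t = 0"
 by (auto simp: bump_1)

section \<open>Supports, translations and bounds of test functions\<close>

lemma test_functionsI:
 assumes "smooth \<phi>" "compact K" "K \<subseteq> U" "!!x. x \<notin> K ==> \<phi> x = 0"
 shows "\<phi> \<in> test_functions U"
proof -
 have "closure {x. \<phi> x ~= 0} \<subseteq> K"
  using assms by (intro closure_minimal compact_imp_closed) auto
 moreover have "bounded {x. \<phi> x ~= 0}"
  by (rule bounded_subset[OF compact_imp_bounded[OF assms(2)]]) (use assms in auto)
 ultimately show ?thesis using assms by (auto simp: test_functions_def smooth_def)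
qed

lemma test_functionsE:
 assumes "\<phi> \<in> test_functions U"
 obtains K where "compact K" "K \<subseteq> U" "!!x. x \<notin> K ==> \<phi> x = 0" "!!x. x \<notin> K ==> nabla \<phi> x = 0"
proof -
 let ?K = "closure {x. \<phi> x ~= 0}"
 have "nabla \<phi> x = 0" if "x \<notin> ?K" for x
 proof -
  have "((%_. 0) has_derivative (%v. 0 \<bullet> v)) (at x)" by simp
  then have "(\<phi> has_derivative (%v. 0 \<bullet> v)) (at x)"
   by (rule has_derivative_transform_within_open[of _ _ _ _ "- ?K"])
    (use that closure_subset in force)+
  then show ?thesis by (rule nabla_eqI)
 qed
 moreover have "\<phi> x = 0" if "x \<notin> ?K" for x
  using that closure_subset[of "{x. \<phi> x ~= 0}"] by auto
 moreover have "compact ?K" "?K \<subseteq> U" using assms by (simp_all add: test_functions_def)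
 ultimately show thesis by (intro that[of ?K])
qed

lemma test_smooth: "\<phi> \<in> test_functions U ==> smooth \<phi>"
 by (simp add: test_functions_def smooth_def)

lemma test_pderiv: "\<phi> \<in> test_functions U ==> frechet_derivative \<phi> (at x) v = nabla \<phi> x \<bullet> v"
 by (simp add: nabla_inner smooth_differentiable test_smooth)

lemma test_functions_mono: "U \<subseteq> V ==> test_functions U \<subseteq> test_functions V"
 by (auto simp: test_functions_def)

lemma test_nabla_inner:
 assumes "\<phi> \<in> test_functions U" shows "(%x. nabla \<phi> x \<bullet> v) \<in> test_functions U"
proof -
 obtain K where "compact K" "K \<subseteq> U" "!!x. x \<notin> K ==> \<phi> x = 0" "!!x. x \<notin> K ==> nabla \<phi> x = 0"
  using assms by (rule test_functionsE) blast
 then show ?thesis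
  by (intro test_functionsI[of _ K]) (auto intro: smooth_nabla_inner test_smooth assms)
qed

lemma nabla_shift:
 assumes "smooth \<phi>" shows "nabla (%x. \<phi> (x - a)) x = nabla \<phi> (x - a)"
proof (rule nabla_eqI)
 have "(\<phi> has_derivative (%v. nabla \<phi> (x - a) \<bullet> v)) (at (x - a))"
  by (intro nabla_has_derivative smooth_differentiable assms)
 moreover have "((%x. x - a) has_derivative (%v. v)) (at x)"
  by (auto intro!: derivative_eq_intros)
 ultimately show "((%x. \<phi> (x - a)) has_derivative (%v. nabla \<phi> (x - a) \<bullet> v)) (at x)"
  using has_derivative_compose by fastforce
qed

lemma smooth_shift:
 assumes "smooth \<phi>" shows "smooth (%x. \<phi> (x - a))"
proof -
 have "C_k k (%x. f (x - a))" if "C_k k f" for k f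
  using that
 proof (induction k arbitrary: f)
  case 0 then show ?case by (auto intro!: continuous_on_compose2[of UNIV f] continuous_intros)
 next
  case (Suc k)
  have h: "((%x. f (x - a)) has_derivative frechet_derivative f (at (x - a))) (at x)" for x
  proof -
   have "(f has_derivative frechet_derivative f (at (x - a))) (at (x - a))"
    using Suc.prems by (simp add: frechet_derivative_works[symmetric])
   moreover have "((%x. x - a) has_derivative (%v. v)) (at x)"
    by (auto intro!: derivative_eq_intros)
   ultimately show ?thesis using has_derivative_compose by fastforce
  qed
  then have "pderiv_at b (%x. f (x - a)) = (%x. pderiv_at b f (x - a))" for b
   by (intro ext frechet_derivative_eqI)
  moreover have "(%x. f (x - a)) differentiable at x" for x
   using h by (auto simp: differentiable_def)
  ultimately show ?case using Suc.IH[of "pderiv_at b f" for b] Suc.prems by simp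
 qed
 then show ?thesis using assms by (simp add: smooth_def)
qed

lemma test_shift:
 assumes "\<phi> \<in> test_functions U" "!!x. x \<in> U ==> x + a \<in> V"
 shows "(%x. \<phi> (x - a)) \<in> test_functions V"
proof -
 obtain K where K: "compact K" "K \<subseteq> U" "!!x. x \<notin> K ==> \<phi> x = 0" "!!x. x \<notin> K ==> nabla \<phi> x = 0"
  using assms(1) by (rule test_functionsE) blast
 show ?thesis
 proof (rule test_functionsI)
  show "smooth (%x. \<phi> (x - a))" using assms smooth_shift test_smooth by blast
  show "compact ((+) a ` K)" using K by (intro compact_translation)
  show "(+) a ` K \<subseteq> V" using K assms(2) by (auto simp: add.commute)
  fix x assume "x \<notin> (+) a ` K"
  then have "x - a \<notin> K" by (auto simp: image_iff algebra_simps)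
  then show "\<phi> (x - a) = 0" using K by simp
 qed
qed

lemma continuous_compact_support_bounded:
 fixes f :: "'a::euclidean_space => 'b::real_normed_vector"
 assumes "continuous_on UNIV f" "compact K" "!!x. x \<notin> K ==> f x = 0"
 obtains B where "B > 0" "!!x. norm (f x) <= B"
proof -
 have "bounded (f ` K)"
  by (intro compact_imp_bounded compact_continuous_image continuous_on_subset[OF assms(1)] assms(2)) simp
 then obtain B where "B > 0" "!!x. x \<in> K ==> norm (f x) <= B" by (auto simp: bounded_pos)
 then show thesis using assms(3) by (intro that[of B]) (metis norm_zero less_imp_le)+
qed

lemma test_bounded:
 assumes "\<phi> \<in> test_functions U"
 obtains K B where "compact K" "K \<subseteq> U" "B > 0"
  "!!x. \<bar>\<phi> x\<bar> <= B * \<I> K x" "!!x. norm (nabla \<phi> x) <= B * \<I> K x"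
proof -
 obtain K where K: "compact K" "K \<subseteq> U" "!!x. x \<notin> K ==> \<phi> x = 0" "!!x. x \<notin> K ==> nabla \<phi> x = 0"
  using assms by (rule test_functionsE) blast
 obtain B1 where "B1 > 0" "!!x. norm (\<phi> x) <= B1"
  using continuous_compact_support_bounded[OF smooth_continuous[OF test_smooth[OF assms]] K(1,3)] by blast
 moreover obtain B2 where "B2 > 0" "!!x. norm (nabla \<phi> x) <= B2"
  using continuous_compact_support_bounded[OF continuous_on_nabla[OF test_smooth[OF assms]] K(1,4)] by blast
 ultimately show thesis using K
  by (intro that[of K "max B1 B2"]) (auto simp: indicator_def le_max_iff_disj)
qed

lemma test_borel [measurable (raw)]:
 assumes "\<phi> \<in> test_functions U"
 shows "\<phi> \<in> \<B>" "nabla \<phi> \<in> \<B>"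
 using assms by (auto intro!: borel_measurable_continuous_onI smooth_continuous continuous_on_nabla test_smooth)

section \<open>Integration\<close>

text \<open>Local integrability for Borel functions and \<open>lborel\<close>. Product measures and
  invariance under translations are convenient there, so everything except the passage from and to
  the given definitions is done with Borel representatives.\<close>

definition loc_int :: "'a::euclidean_space set => ('a => 'b::euclidean_space) => bool" where
 "loc_int U f \<longleftrightarrow> (\<forall>K. compact K & K \<subseteq> U --> set_integrable lborel K f)"

lemma nn_integral_shift:
 fixes a :: "'a::euclidean_space"
 assumes [measurable]: "F \<in> \<B>"
 shows "(\<N> x. F (x + a)) = (\<N> x. F x)"
 by (subst (2) lborel_distr_plus[of a, symmetric]) (simp add: nn_integral_distr add.commute)

lemma integral_shift:
 fixes a :: "'a::euclidean_space" and F :: "'a => 'b::euclidean_space"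
 assumes [measurable]: "F \<in> \<B>"
 shows "(LBINT x. F (x + a)) = (LBINT x. F x)"
 by (subst (2) lborel_distr_plus[of a, symmetric]) (simp add: integral_distr add.commute)

lemma integrable_shift:
 fixes a :: "'a::euclidean_space" and F :: "'a => 'b::euclidean_space"
 assumes "integrable lborel F"
 shows "integrable lborel (%x. F (x + a))"
proof -
 have [measurable]: "F \<in> \<B>" using assms by auto
 have "integrable (distr lborel borel ((+) a)) F"
  using assms by (simp add: lborel_distr_plus)
 then show ?thesis by (subst (asm) integrable_distr_eq) (simp_all add: add.commute)
qed

text \<open>A product that is not integrable has integral 0, so that case is trivial; otherwise this
  is the inequality for nonnegative functions, applied to the absolute values.\<close>

lemma Cauchy_Schwarz_integral:
 fixes h k :: "'a => real"
 assumes [measurable]: "h \<in> borel_measurable M" "k \<in> borel_measurable M"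
 shows "ennreal ((\<integral>x. h x * k x \<partial>M)\<^sup>2) <= (\<integral>\<^sup>+x. ennreal ((h x)\<^sup>2) \<partial>M) * (\<integral>\<^sup>+x. ennreal ((k x)\<^sup>2) \<partial>M)"
proof (cases "integrable M (%x. h x * k x)")
 case True
 have "ennreal ((\<integral>x. h x * k x \<partial>M)\<^sup>2) = (ennreal (norm (\<integral>x. h x * k x \<partial>M)))\<^sup>2"
  by (simp add: ennreal_power)
 also have "... <= (\<integral>\<^sup>+x. ennreal (norm (h x * k x)) \<partial>M)\<^sup>2"
  by (intro power_mono integral_norm_bound_ennreal True) auto
 also have "... = (\<integral>\<^sup>+x. ennreal \<bar>h x\<bar> * ennreal \<bar>k x\<bar> \<partial>M)\<^sup>2"
  by (simp add: abs_mult ennreal_mult)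
 also have "... <= (\<integral>\<^sup>+x. (ennreal \<bar>h x\<bar>)\<^sup>2 \<partial>M) * (\<integral>\<^sup>+x. (ennreal \<bar>k x\<bar>)\<^sup>2 \<partial>M)"
  by (intro Cauchy_Schwarz_nn_integral) auto
 finally show ?thesis by (simp add: ennreal_power)
qed (simp add: not_integrable_integral_eq)

lemma loc_int_mult:
 fixes f :: "'a::euclidean_space => 'b::euclidean_space"
 assumes "loc_int U f" and [measurable]: "f \<in> \<B>" "\<psi> \<in> \<B>"
  and "compact K" "K \<subseteq> U" "!!x. \<bar>\<psi> x\<bar> <= B * \<I> K x"
 shows "integrable lborel (%x. \<psi> x *\<^sub>R f x)"
proof (rule Bochner_Integration.integrable_bound)
 show "integrable lborel (%x. B *\<^sub>R (\<I> K x *\<^sub>R f x))"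
  using assms(1,4,5) by (intro integrable_scaleR_right) (auto simp: loc_int_def set_integrable_def)
 show "AE x in lborel. norm (\<psi> x *\<^sub>R f x) <= norm (B *\<^sub>R \<I> K x *\<^sub>R f x)"
 proof (rule AE_I2)
  fix x show "norm (\<psi> x *\<^sub>R f x) <= norm (B *\<^sub>R \<I> K x *\<^sub>R f x)"
   using assms(6)[of x] by (cases "x \<in> K") (auto intro!: mult_right_mono)
 qed
qed simp

lemma loc_int_test:
 fixes f :: "'a::euclidean_space => 'b::euclidean_space"
 assumes "loc_int U f" "f \<in> \<B>" "\<phi> \<in> test_functions U"
 shows "integrable lborel (%x. \<phi> x *\<^sub>R f x)"
proof -
 obtain K B where "compact K" "K \<subseteq> U" "B > 0"
  "!!x. \<bar>\<phi> x\<bar> <= B * \<I> K x" "!!x. norm (nabla \<phi> x) <= B * \<I> K x"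
  using test_bounded[OF assms(3)] by blast
 then show ?thesis using assms test_borel[OF assms(3)] by (intro loc_int_mult[of U f \<phi> K B])
qed

lemma loc_int_subset: "loc_int U f ==> V \<subseteq> U ==> loc_int V f"
 by (auto simp: loc_int_def)

lemma loc_int_add: "loc_int U f ==> loc_int U g ==> loc_int U (%x. f x + g x)"
 by (auto simp: loc_int_def intro: set_integral_add)

lemma loc_int_diff: "loc_int U f ==> loc_int U g ==> loc_int U (%x. f x - g x)"
 by (auto simp: loc_int_def intro: set_integral_diff)

lemma loc_int_scale: "loc_int U f ==> loc_int U (%x. c *\<^sub>R f x)"
 by (simp add: loc_int_def)

lemma loc_int_inner:
 "loc_int U g ==> loc_int U (%x. g x \<bullet> v)"
 by (auto simp: loc_int_def set_integrable_def simp flip: inner_scaleR_left)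

lemma loc_int_bounded:
 fixes f :: "'a::euclidean_space => 'b::euclidean_space"
 assumes [measurable]: "f \<in> \<B>" and "!!x. norm (f x) <= B"
 shows "loc_int U f"
 unfolding loc_int_def
proof safe
 fix K :: "'a set" assume K: "compact K"
 have [measurable]: "K \<in> sets borel" using K by (simp add: borel_compact)
 have "set_integrable lborel K (%x. B)"
  using emeasure_compact_finite[OF K]
  by (simp add: set_integrable_def integrable_indicator_iff)
 then show "set_integrable lborel K f"
  unfolding set_integrable_def
  by (rule Bochner_Integration.integrable_bound)
   (use assms(2) in \<open>auto simp: indicator_def intro!: AE_I2 order_trans[OF _ abs_ge_self]\<close>)
qed

lemma square_integrable_imp_loc_int:
 fixes f :: "'a::euclidean_space => 'b::euclidean_space"
 assumes [measurable]: "f \<in> \<B>"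
  and fin: "!!K. compact K ==> K \<subseteq> U ==> (\<N> x. \<I> K x * ennreal ((norm (f x))\<^sup>2)) < \<infinity>"
 shows "loc_int U f"
 unfolding loc_int_def set_integrable_def
proof safe
 fix K :: "'a set" assume K: "compact K" "K \<subseteq> U"
 have [measurable]: "K \<in> sets borel" using K by (simp add: borel_compact)
 have "ennreal (norm (\<I> K x *\<^sub>R f x)) <= \<I> K x + \<I> K x * ennreal ((norm (f x))\<^sup>2)" for x
 proof -
  have "norm (f x) <= 1 + (norm (f x))\<^sup>2"
   using zero_le_power2[of "norm (f x) - 1/2"] by (simp add: power2_diff power_divide)
  then have "ennreal (norm (f x)) <= 1 + ennreal ((norm (f x))\<^sup>2)"
   by (metis ennreal_1 ennreal_leI ennreal_plus zero_le_one zero_le_power2)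
  then show ?thesis by (auto simp: indicator_def)
 qed
 then have "(\<N> x. ennreal (norm (\<I> K x *\<^sub>R f x)))
  <= (\<N> x. \<I> K x + \<I> K x * ennreal ((norm (f x))\<^sup>2))"
  by (intro nn_integral_mono)
 also have "... = emeasure lborel K + (\<N> x. \<I> K x * ennreal ((norm (f x))\<^sup>2))"
  by (simp add: nn_integral_add)
 also have "... < \<infinity>" using fin[OF K] emeasure_compact_finite[OF K(1)] by (auto simp: less_top)
 finally show "integrable lborel (%x. \<I> K x *\<^sub>R f x)"
  by (intro integrableI_bounded) auto
qed

section \<open>The fundamental lemma of the calculus of variations\<close>

lemma AE_local:
 fixes U :: "'a::euclidean_space set"
 assumes "!!x. x \<in> U ==> \<exists>V. open V & x \<in> V & (AE y in lborel. y \<in> V --> P y)"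
 shows "AE y in lborel. y \<in> U --> P y"
proof -
 define \<F> where "\<F> = {V. open V & (AE y in lborel. y \<in> V --> P y)}"
 obtain \<G> where \<G>: "\<G> \<subseteq> \<F>" "countable \<G>" "\<Union>\<G> = \<Union>\<F>"
  using Lindelof[of \<F>] by (auto simp: \<F>_def)
 have "AE y in lborel. \<forall>V\<in>\<G>. y \<in> V --> P y"
  using \<G> by (subst AE_ball_countable) (auto simp: \<F>_def)
 moreover have "U \<subseteq> \<Union>\<G>"
 proof
  fix x assume "x \<in> U"
  then show "x \<in> \<Union>\<G>" using assms[of x] unfolding \<G>(3) unfolding \<F>_def by blast
 qed
 ultimately show ?thesis by (auto elim!: eventually_mono)
qed

text \<open>The product over the coordinates of \<open>exp (-1/(n t))\<close>, for the two distances
  t to the faces, gives test functions that vanish outside the box and tend to 1 inside. The larger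
  closed box is the compact set that carries the dominating function.\<close>

lemma integral_box_eq_0:
 fixes f :: "'a::euclidean_space => real"
 assumes [measurable]: "f \<in> \<B>" and f: "loc_int U f"
  and z: "!!\<phi>. \<phi> \<in> test_functions U ==> (LBINT x. \<phi> x * f x) = 0"
  and ab: "box a b \<subseteq> cbox c d" "cbox c d \<subseteq> U"
 shows "(LBINT x. \<I> (box a b) x * f x) = 0"
proof -
 define \<phi> where "\<phi> n x = (\<Prod>i\<in>Basis. bump 1 (real (Suc n) * (x \<bullet> i - a \<bullet> i)) * bump 1 (real (Suc n) * (b \<bullet> i - x \<bullet> i)))"
  for n and x :: 'a
 have sm: "smooth (\<phi> n)" for n
  unfolding \<phi>_def
  by (intro smooth_prod smooth_mult smooth_bump smooth_diff smooth_inner smooth_const)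
 have 0: "\<phi> n x = 0" if "x \<notin> box a b" for n x
 proof -
  obtain i where "i \<in> Basis" "x \<bullet> i <= a \<bullet> i \<or> b \<bullet> i <= x \<bullet> i"
   using \<open>x \<notin> box a b\<close> by (auto simp: mem_box not_less)
  then show ?thesis unfolding \<phi>_def
   by (intro prod_zero[OF finite_Basis] bexI[of _ i])
    (auto intro!: bump_1_bounds(4) mult_nonneg_nonpos)
 qed
 have test: "\<phi> n \<in> test_functions U" for n
  using ab 0 by (intro test_functionsI[of _ "cbox c d"] sm) auto
 have bd: "0 <= \<phi> n x" "\<phi> n x <= 1" for n x
  unfolding \<phi>_def by (auto intro!: prod_nonneg prod_le_1 mult_nonneg_nonneg mult_le_one bump_1_bounds)
 have lim: "(%n. \<phi> n x) \<longlonglongrightarrow> \<I> (box a b) x" for x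
 proof (cases "x \<in> box a b")
  case True
  have b1: "(%n. bump 1 (real (Suc n) * t)) \<longlonglongrightarrow> 1" if "t > 0" for t
  proof -
   have "(%n. exp (- (inverse (real (Suc n)) * inverse t))) \<longlonglongrightarrow> exp (- (0 * inverse t))"
    by (intro tendsto_intros LIMSEQ_inverse_real_of_nat)
   then show ?thesis using that by (simp add: bump_1 zero_less_mult_iff inverse_mult_distrib)
  qed
  have "(%n. \<phi> n x) \<longlonglongrightarrow> (\<Prod>i\<in>(Basis::'a set). 1 * 1)"
   unfolding \<phi>_def using True by (intro tendsto_prod tendsto_mult b1) (auto simp: mem_box)
  then show ?thesis using True by simp
 qed (simp add: 0)
 have "(%n. \<integral>x. \<phi> n x * f x \<partial>lborel) \<longlonglongrightarrow> (LBINT x. \<I> (box a b) x * f x)"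
 proof (rule integral_dominated_convergence[where w="%x. \<bar>\<I> (cbox c d) x * f x\<bar>"])
  show "!!i. (%x. \<phi> i x * f x) \<in> borel_measurable lborel"
   using test_borel(1)[OF test] by simp
  show "integrable lborel (%x. \<bar>\<I> (cbox c d) x * f x\<bar>)"
   using f ab by (auto simp: loc_int_def set_integrable_def)
  show "AE x in lborel. (%i. \<phi> i x * f x) \<longlonglongrightarrow> \<I> (box a b) x * f x"
   by (intro AE_I2 tendsto_mult lim tendsto_const)
  show "AE x in lborel. norm (\<phi> i x * f x) <= \<bar>\<I> (cbox c d) x * f x\<bar>" for i
  proof (rule AE_I2)
   fix x show "norm (\<phi> i x * f x) <= \<bar>\<I> (cbox c d) x * f x\<bar>"
    using subsetD[OF ab(1), of x] 0[of x i] bd[of i x]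
    by (cases "x \<in> box a b") (auto simp: abs_mult intro!: mult_left_le_one_le)
  qed
 qed simp
 then show ?thesis using z[OF test] by (simp add: LIMSEQ_const_iff)
qed

text \<open>Locally f is cut off to a box whose closure lies in U. Boxes are stable under
  intersection and generate the Borel sets, so the integrals of the cut-off function vanish over
  every Borel set, and therefore the function vanishes almost everywhere.\<close>

theorem fundamental_lemma:
 fixes f :: "'a::euclidean_space => real"
 assumes "open U" and [measurable]: "f \<in> \<B>" and f: "loc_int U f"
  and z: "!!\<phi>. \<phi> \<in> test_functions U ==> (LBINT x. \<phi> x * f x) = 0"
 shows "AE x in lborel. x \<in> U --> f x = 0"
proof (rule AE_local)
 fix x assume "x \<in> U"
 then obtain c d where cd: "x \<in> box c d" "cbox c d \<subseteq> U"
  using \<open>open U\<close> open_contains_cbox by metis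
 define F where "F y = \<I> (box c d) y * f y" for y
 have [measurable]: "F \<in> \<B>" by (simp add: F_def[abs_def])
 have "integrable lborel (%x. \<I> (box c d) x *\<^sub>R f x)"
  by (rule loc_int_mult[OF f _ _ compact_cbox cd(2), where B=1])
   (auto simp: indicator_def box_subset_cbox[THEN subsetD])
 then have F: "integrable lborel F" by (simp add: F_def[abs_def])
 have box0: "set_lebesgue_integral lborel (box a b) F = 0" for a b
 proof -
  obtain a' b' where e: "box a b \<inter> box c d = box a' b'" using box_Int_box[of a b c d] by blast
  have sub: "box a' b' \<subseteq> cbox c d" using e box_subset_cbox[of c d] by auto
  have "(LBINT x. \<I> (box a' b') x * f x) = 0"
   by (rule integral_box_eq_0[OF assms(2) f z sub cd(2)])
  moreover have "\<I> (box a b) x *\<^sub>R F x = \<I> (box a' b') x * f x" for x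
   unfolding F_def e[symmetric] by (simp add: indicator_def)
  ultimately show ?thesis by (simp add: set_lebesgue_integral_def)
 qed
 have "set_lebesgue_integral lborel UNIV F = set_lebesgue_integral lborel (box c d) F"
  by (auto simp: set_lebesgue_integral_def F_def indicator_def intro!: Bochner_Integration.integral_cong)
 then have U0: "integral\<^sup>L lborel F = 0" using box0 by (simp add: set_lebesgue_integral_def)
 have si: "set_integrable lborel A F" if "A \<in> sets borel" for A
  using integrable_mult_indicator[of A lborel F] F that by (simp add: set_integrable_def)
 have "set_lebesgue_integral lborel A F = 0" if "A \<in> sets lborel" for A
 proof -
  have st: "Int_stable (range (%(a, b). box a b::'a set))" by (auto simp: Int_stable_def box_Int_box)
  have sub: "range (%(a, b). box a b::'a set) \<subseteq> Pow UNIV" by simp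
  have s: "sigma_sets UNIV (range (%(a, b). box a b::'a set)) = sets borel"
   by (simp add: borel_eq_box)
  have "A \<in> sigma_sets UNIV (range (%(a, b). box a b::'a set))" using that s by simp
  from st sub this show ?thesis
  proof (induction rule: sigma_sets_induct_disjoint)
   case (basic A) then show ?case using box0 by auto
  next
   case empty show ?case by (simp add: set_lebesgue_integral_def)
  next
   case (compl A)
   then have A: "A \<in> sets borel" using s by simp
   then have "set_lebesgue_integral lborel ((UNIV - A) \<union> A) F =
    set_lebesgue_integral lborel (UNIV - A) F + set_lebesgue_integral lborel A F"
    by (intro set_integral_Un si) auto
   then show ?case using compl U0 by (simp add: set_lebesgue_integral_def)
  next
   case (union B)
   have B: "!!i. B i \<in> sets borel" using union s by auto
   have "set_lebesgue_integral lborel (\<Union>i. B i) F = (\<Sum>i. set_lebesgue_integral lborel (B i) F)"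
    using union(1) B by (intro lebesgue_integral_countable_add si) (auto simp: disjoint_family_on_def)
   then show ?case using union by simp
  qed
 qed
 from sigma_finite_measure.density_zero[OF sigma_finite_lborel F this] have "AE x in lborel. F x = 0" .
 then have "AE y in lborel. y \<in> box c d --> f y = 0"
  by (auto simp: F_def)
 then show "\<exists>V. open V & x \<in> V & (AE y in lborel. y \<in> V --> f y = 0)"
  using cd open_box by blast
qed

section \<open>Weak gradients\<close>

text \<open>The weak gradient of a scalar function as one vector field, with Borel representatives.
  The equation is stated for every direction v and not only along the basis, because translations in
  arbitrary directions are used below.\<close>

definition wgrad :: "'a::euclidean_space set => ('a => real) => ('a => 'a) => bool" where
 "wgrad U f g \<longleftrightarrow> f \<in> \<B> & g \<in> \<B> & loc_int U f & loc_int U g &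
  (\<forall>\<phi>\<in>test_functions U. \<forall>v.
    (LBINT x. (nabla \<phi> x \<bullet> v) * f x) = - (LBINT x. \<phi> x * (g x \<bullet> v)))"

lemma wgradD:
 assumes "wgrad U f g"
 shows "f \<in> \<B>" "g \<in> \<B>" "loc_int U f" "loc_int U g"
  "\<phi> \<in> test_functions U ==>
   (LBINT x. (nabla \<phi> x \<bullet> v) * f x) = - (LBINT x. \<phi> x * (g x \<bullet> v))"
 using assms by (auto simp: wgrad_def)

lemma wgrad_subset: "wgrad U f g ==> V \<subseteq> U ==> wgrad V f g"
 using test_functions_mono[of V U] by (auto simp: wgrad_def intro: loc_int_subset)

lemma wgrad_lincomb:
 assumes f: "wgrad U f g" and h: "wgrad U h k"
 shows "wgrad U (%x. c * f x + d * h x) (%x. c *\<^sub>R g x + d *\<^sub>R k x)"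
proof -
 note [measurable] = wgradD(1,2)[OF f] wgradD(1,2)[OF h]
 have "(LBINT x. (nabla \<phi> x \<bullet> v) * (c * f x + d * h x))
   = - (LBINT x. \<phi> x * ((c *\<^sub>R g x + d *\<^sub>R k x) \<bullet> v))" if \<phi>: "\<phi> \<in> test_functions U" for \<phi> v
 proof -
  have 1: "integrable lborel (%x. (nabla \<phi> x \<bullet> v) * f x)" "integrable lborel (%x. (nabla \<phi> x \<bullet> v) * h x)"
   using loc_int_test[OF wgradD(3,1)[OF f] test_nabla_inner[OF \<phi>]]
    loc_int_test[OF wgradD(3,1)[OF h] test_nabla_inner[OF \<phi>]] by simp_all
  have 2: "integrable lborel (%x. \<phi> x * (g x \<bullet> v))" "integrable lborel (%x. \<phi> x * (k x \<bullet> v))"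
   using loc_int_test[OF loc_int_inner[OF wgradD(4)[OF f]] _ \<phi>]
    loc_int_test[OF loc_int_inner[OF wgradD(4)[OF h]] _ \<phi>] by simp_all
  have "(LBINT x. (nabla \<phi> x \<bullet> v) * (c * f x + d * h x)) =
   (LBINT x. c * ((nabla \<phi> x \<bullet> v) * f x) + d * ((nabla \<phi> x \<bullet> v) * h x))"
   by (simp add: algebra_simps)
  also have "... = c * (LBINT x. (nabla \<phi> x \<bullet> v) * f x) + d * (LBINT x. (nabla \<phi> x \<bullet> v) * h x)"
   using 1 by simp
  also have "... = - (c * (LBINT x. \<phi> x * (g x \<bullet> v)) + d * (LBINT x. \<phi> x * (k x \<bullet> v)))"
   using wgradD(5)[OF f \<phi>] wgradD(5)[OF h \<phi>] by simp
  also have "... = - (LBINT x. c * (\<phi> x * (g x \<bullet> v)) + d * (\<phi> x * (k x \<bullet> v)))"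
   using 2 by simp
  finally show ?thesis by (simp add: algebra_simps inner_add_left)
 qed
 moreover have "loc_int U (%x. c * f x + d * h x)"
  using loc_int_add[OF loc_int_scale[of U f c] loc_int_scale[of U h d]] wgradD[OF f] wgradD[OF h] by simp
 moreover have "loc_int U (%x. c *\<^sub>R g x + d *\<^sub>R k x)"
  by (intro loc_int_add loc_int_scale wgradD[OF f] wgradD[OF h])
 ultimately show ?thesis by (auto simp: wgrad_def)
qed

lemma wgrad_diff: "wgrad U f g ==> wgrad U h k ==> wgrad U (%x. f x - h x) (%x. g x - k x)"
 using wgrad_lincomb[of U f g h k 1 "-1"] by simp


section \<open>Translations and weak gradients\<close>

lemma open_segment_translates:
 fixes U :: "'a::euclidean_space set"
 assumes "open U"
 shows "open {x. \<forall>t\<in>{0..1}. x + t *\<^sub>R v \<in> U}"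
 unfolding open_contains_ball
proof (rule ballI)
 fix x assume x: "x \<in> {x. \<forall>t\<in>{0..1}. x + t *\<^sub>R v \<in> U}"
 let ?S = "(%t. x + t *\<^sub>R v) ` {0..1::real}"
 have c: "compact ?S" by (intro compact_continuous_image continuous_intros) auto
 have s: "?S \<subseteq> U" using x by auto
 obtain e where e: "e > 0" "(\<Union>y\<in>?S. ball y e) \<subseteq> U"
  using compact_subset_open_imp_ball_epsilon_subset[OF c assms s] by blast
 have "y + t *\<^sub>R v \<in> U" if "y \<in> ball x e" "t \<in> {0..1}" for y t
 proof -
  have "y + t *\<^sub>R v \<in> ball (x + t *\<^sub>R v) e" using that by (simp add: dist_norm)
  then show ?thesis using e(2) that by blast
 qed
 then have "ball x e \<subseteq> {x. \<forall>t\<in>{0..1}. x + t *\<^sub>R v \<in> U}" by blast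
 then show "\<exists>e>0. ball x e \<subseteq> {x. \<forall>t\<in>{0..1}. x + t *\<^sub>R v \<in> U}"
  using e(1) by blast
qed

lemma integrable_pair_bounded:
 fixes h :: "real \<times> 'a::euclidean_space => real"
 assumes [measurable]: "h \<in> borel_measurable (lborel \<Otimes>\<^sub>M lborel)"
  and b: "!!t. (\<N> x. ennreal \<bar>h (t, x)\<bar>) <= C * \<I> {0..1} t" and C: "C < \<infinity>"
 shows "integrable (lborel \<Otimes>\<^sub>M lborel) h"
proof (rule integrableI_bounded)
 have "(\<integral>\<^sup>+p. ennreal (norm (h p)) \<partial>(lborel \<Otimes>\<^sub>M lborel)) = (\<N> t. (\<N> x. ennreal \<bar>h (t, x)\<bar>))"
  by (subst lborel.nn_integral_fst[symmetric]) auto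
 also have "... <= (\<N> t. C * \<I> {0..1} (t::real))"
  by (intro nn_integral_mono b)
 also have "... = C" by (simp add: nn_integral_cmult)
 finally show "(\<integral>\<^sup>+p. ennreal (norm (h p)) \<partial>(lborel \<Otimes>\<^sub>M lborel)) < \<infinity>" using C by simp
qed simp

lemma compact_segment_translates:
 fixes K :: "'a::euclidean_space set"
 assumes "compact K"
 shows "compact {x + t *\<^sub>R v | x t. x \<in> K & t \<in> {0..1::real}}"
proof -
 have "{x + t *\<^sub>R v | x t. x \<in> K & t \<in> {0..1::real}} = (%(x, t). x + t *\<^sub>R v) ` (K \<times> {0..1})" by auto blast
 moreover have "compact ..."
  unfolding case_prod_unfold
  by (intro compact_continuous_image compact_Times assms compact_Icc continuous_intros)
 ultimately show ?thesis by simp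
qed

text \<open>For every t the translate of K lies in one compact subset of U, the union of all
  segments; this bounds the inner integral independently of t, and Tonelli applies.\<close>

lemma integrable_segment_average:
 fixes h :: "'a::euclidean_space => real"
 assumes [measurable]: "h \<in> \<B>" "\<psi> \<in> \<B>"
  and h: "loc_int U h"
  and K: "compact K" "!!x t. x \<in> K ==> t \<in> {0..1} ==> x + t *\<^sub>R v \<in> U"
  and \<psi>: "!!x. \<bar>\<psi> x\<bar> <= B * \<I> K x"
 shows "integrable (lborel \<Otimes>\<^sub>M lborel) (%(t, x). \<I> {0..1} t * (\<psi> x * h (x + t *\<^sub>R v)))"
proof (rule integrable_pair_bounded)
 define K' where "K' = {x + t *\<^sub>R v | x t. x \<in> K & t \<in> {0..1::real}}"
 have K': "compact K'" "K' \<subseteq> U"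
  using compact_segment_translates[OF K(1)] K(2) by (auto simp: K'_def)
 then have [measurable]: "K' \<in> sets borel" by (simp add: borel_compact)
 have iK: "set_integrable lborel K' h" using h K' by (simp add: loc_int_def)
 define C where "C = (\<N> x. ennreal \<bar>B\<bar> * ennreal \<bar>\<I> K' x * h x\<bar>)"
 have "(\<N> x. ennreal (norm (\<I> K' x *\<^sub>R h x))) < \<infinity>"
  using iK unfolding set_integrable_def integrable_iff_bounded by blast
 then show "C < \<infinity>" by (simp add: C_def nn_integral_cmult ennreal_mult_less_top)
 show "(%(t, x). \<I> {0..1} t * (\<psi> x * h (x + t *\<^sub>R v))) \<in> borel_measurable (lborel \<Otimes>\<^sub>M lborel)"
  by measurable
 fix t
 show "(\<N> x. ennreal \<bar>case (t, x) of (t, x) => \<I> {0..1} t * (\<psi> x * h (x + t *\<^sub>R v))\<bar>)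
  <= C * \<I> {0..1} t"
 proof (cases "t \<in> {0..1}")
  case True
  have "(\<N> x. ennreal \<bar>\<psi> x * h (x + t *\<^sub>R v)\<bar>)
   <= (\<N> x. ennreal \<bar>B\<bar> * ennreal \<bar>\<I> K' (x + t *\<^sub>R v) * h (x + t *\<^sub>R v)\<bar>)"
  proof (intro nn_integral_mono)
   fix x
   have "\<bar>\<psi> x\<bar> <= \<bar>B\<bar> * \<I> K' (x + t *\<^sub>R v)"
    using \<psi>[of x] True by (cases "x \<in> K") (auto simp: K'_def indicator_def)
   then have "\<bar>\<psi> x * h (x + t *\<^sub>R v)\<bar> <= \<bar>B\<bar> * \<bar>\<I> K' (x + t *\<^sub>R v) * h (x + t *\<^sub>R v)\<bar>"
    by (simp add: abs_mult mult_right_mono flip: mult.assoc)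
   then show "ennreal \<bar>\<psi> x * h (x + t *\<^sub>R v)\<bar> <= ennreal \<bar>B\<bar> * ennreal \<bar>\<I> K' (x + t *\<^sub>R v) * h (x + t *\<^sub>R v)\<bar>"
    by (simp add: ennreal_leI flip: ennreal_mult)
  qed
  also have "... = C"
   unfolding C_def by (rule nn_integral_shift[where F="%x. ennreal \<bar>B\<bar> * ennreal \<bar>\<I> K' x * h x\<bar>"]) simp
  finally show ?thesis using True by simp
 qed simp
qed

text \<open>A fundamental theorem of calculus along segments. Against a test function the difference
  \<open>f (x + v) - f x\<close> becomes a difference of translates of the test function, to which
  the classical theorem applies. Fubini and the weak equation for each translate turn it into the
  averaged gradient, and the fundamental lemma removes the test function.\<close>

theorem wgrad_translation:
 fixes U :: "'a::euclidean_space set" and v :: 'a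
 assumes U: "open U" and w: "wgrad U f g"
 defines "V \<equiv> {x. \<forall>t\<in>{0..1}. x + t *\<^sub>R v \<in> U}"
 shows "AE x in lborel. x \<in> V --> f (x + v) - f x = (LBINT t. \<I> {0..1} t * (g (x + t *\<^sub>R v) \<bullet> v))"
proof -
 note [measurable] = wgradD(1,2)[OF w]
 have V: "open V" unfolding V_def by (rule open_segment_translates[OF U])
 have VU: "x + t *\<^sub>R v \<in> U" if "x \<in> V" "t \<in> {0..1}" for x t using that by (auto simp: V_def)
 define gv where "gv x = g x \<bullet> v" for x
 have gv: "loc_int U gv" and [measurable]: "gv \<in> \<B>"
  using loc_int_inner[OF wgradD(4)[OF w]] by (simp_all add: gv_def[abs_def])
 define W where "W x = (LBINT t. \<I> {0..1} t * gv (x + t *\<^sub>R v))" for x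
 have [measurable]: "W \<in> \<B>" unfolding W_def[abs_def] by measurable
 have lW: "loc_int V W"
  unfolding loc_int_def
 proof safe
  fix K assume K: "compact K" "K \<subseteq> V"
  have [measurable]: "K \<in> sets borel" using K by (simp add: borel_compact)
  have "integrable (lborel \<Otimes>\<^sub>M lborel) (%(t, x). \<I> {0..1} t * (\<I> K x * gv (x + t *\<^sub>R v)))"
   using K VU by (intro integrable_segment_average[OF _ _ gv K(1), where B=1]) (auto simp: indicator_def)
  from lborel_pair.integrable_snd[OF this]
  have "integrable lborel (%x. \<integral>t. \<I> K x * (\<I> {0..1} t * gv (x + t *\<^sub>R v)) \<partial>lborel)"
   by (simp add: mult.left_commute)
  then show "set_integrable lborel K W"
   by (simp add: set_integrable_def W_def)
 qed
 have lf: "loc_int V f" using VU[where t=0] wgradD(3)[OF w] by (auto intro: loc_int_subset)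
 have lfv: "loc_int V (%x. f (x + v))"
  unfolding loc_int_def
 proof safe
  fix K assume K: "compact K" "K \<subseteq> V"
  have "set_integrable lborel ((+) v ` K) f"
  proof -
   have "compact ((+) v ` K)" using K by (intro compact_translation)
   moreover have "(+) v ` K \<subseteq> U" using K VU[where t=1] by (auto simp: add.commute)
   ultimately show ?thesis using wgradD(3)[OF w] by (simp add: loc_int_def)
  qed
  from integrable_shift[OF this[unfolded set_integrable_def], of v]
  show "set_integrable lborel K (%x. f (x + v))"
   by (simp add: set_integrable_def indicator_def image_iff add.commute[of v])
 qed
 have "AE x in lborel. x \<in> V --> (f (x + v) - f x) - W x = 0"
 proof (rule fundamental_lemma[OF V])
  show "loc_int V (%x. (f (x + v) - f x) - W x)" by (intro loc_int_diff lf lfv lW)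
  fix \<phi> assume \<phi>: "\<phi> \<in> test_functions V"
  note [measurable] = test_borel[OF \<phi>]
  obtain K B where K: "compact K" "K \<subseteq> V" "B > 0" "!!x. \<bar>\<phi> x\<bar> <= B * \<I> K x"
   "!!x. norm (nabla \<phi> x) <= B * \<I> K x" using test_bounded[OF \<phi>] by blast
  have i1: "integrable lborel (%x. \<phi> x * f x)" "integrable lborel (%x. \<phi> x * f (x + v))" "integrable lborel (%x. \<phi> x * W x)"
   using loc_int_test[OF lf _ \<phi>] loc_int_test[OF lfv _ \<phi>] loc_int_test[OF lW _ \<phi>] by simp_all
  have U_test: "(%x. \<phi> (x - t *\<^sub>R v)) \<in> test_functions U" if "t \<in> {0..1}" for t
   using test_shift[OF \<phi>] VU that by blast
  have i2: "integrable lborel (%x. \<phi> (x - v) * f x)" "integrable lborel (%x. \<phi> x * f x)"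
   using loc_int_test[OF wgradD(3,1)[OF w] U_test[of 1]] i1 by simp_all
  define D where "D t x = nabla \<phi> (x - t *\<^sub>R v) \<bullet> v" for t :: real and x
  have D_meas [measurable]: "(%p. D (fst p) (snd p)) \<in> borel_measurable (lborel \<Otimes>\<^sub>M lborel)"
   unfolding D_def by measurable
  have ftc: "\<phi> (x - v) - \<phi> x = - (LBINT t. \<I> {0..1} t * D t x)" for x
  proof -
   have "(LBINT t. \<I> {0..1} t *\<^sub>R (- D t x)) = \<phi> (x - 1 *\<^sub>R v) - \<phi> (x - 0 *\<^sub>R v)"
   proof (rule integral_FTC_atLeastAtMost)
    show "continuous_on {0..1} (%t. - D t x)" unfolding D_def
     by (intro continuous_intros continuous_on_compose2[OF continuous_on_nabla[OF test_smooth[OF \<phi>], of UNIV]]) auto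
    fix t :: real
    have "(\<phi> has_derivative (%u. nabla \<phi> (x - t *\<^sub>R v) \<bullet> u)) (at (x - t *\<^sub>R v))"
     by (intro nabla_has_derivative smooth_differentiable test_smooth[OF \<phi>])
    moreover have "((%t. x - t *\<^sub>R v) has_derivative (%s. - (s *\<^sub>R v))) (at t within {0..1})"
     by (auto intro!: derivative_eq_intros)
    ultimately have "((%t. \<phi> (x - t *\<^sub>R v)) has_derivative (%s. nabla \<phi> (x - t *\<^sub>R v) \<bullet> (- (s *\<^sub>R v)))) (at t within {0..1})"
     by (rule has_derivative_compose[rotated])
    then show "((%t. \<phi> (x - t *\<^sub>R v)) has_vector_derivative - D t x) (at t within {0..1})"
     by (simp add: has_vector_derivative_def D_def)
   qed simp
   then show ?thesis by simp
  qed
  have i3: "integrable (lborel \<Otimes>\<^sub>M lborel) (%(t, x). \<I> {0..1} t * (D t x * f x))"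
  proof (rule integrable_pair_bounded)
   define K' where "K' = {x + t *\<^sub>R v | x t. x \<in> K & t \<in> {0..1::real}}"
   have K': "compact K'" "K' \<subseteq> U"
    using compact_segment_translates[OF K(1)] K(2) VU by (auto simp: K'_def)
   then have [measurable]: "K' \<in> sets borel" by (simp add: borel_compact)
   define C where "C = (\<N> x. ennreal (B * norm v) * ennreal \<bar>\<I> K' x * f x\<bar>)"
   have "set_integrable lborel K' f" using wgradD(3)[OF w] K' by (simp add: loc_int_def)
   then have "(\<N> x. ennreal (norm (\<I> K' x *\<^sub>R f x))) < \<infinity>"
    unfolding set_integrable_def integrable_iff_bounded by blast
   then show "C < \<infinity>" by (simp add: C_def nn_integral_cmult ennreal_mult_less_top)
   show "(%(t, x). \<I> {0..1} t * (D t x * f x)) \<in> borel_measurable (lborel \<Otimes>\<^sub>M lborel)"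
    by measurable
   fix t
   show "(\<N> x. ennreal \<bar>case (t, x) of (t, x) => \<I> {0..1} t * (D t x * f x)\<bar>) <= C * \<I> {0..1} t"
   proof (cases "t \<in> {0..1}")
    case True
    have "ennreal \<bar>D t x * f x\<bar> <= ennreal (B * norm v) * ennreal \<bar>\<I> K' x * f x\<bar>" for x
    proof -
     have "\<bar>D t x\<bar> <= norm (nabla \<phi> (x - t *\<^sub>R v)) * norm v"
      unfolding D_def by (rule Cauchy_Schwarz_ineq2)
     also have "... <= (B * \<I> K (x - t *\<^sub>R v)) * norm v"
      by (intro mult_right_mono K) simp
     also have "... <= (B * norm v) * \<I> K' x"
     proof (cases "x - t *\<^sub>R v \<in> K")
      case in_K: True
      have "x = (x - t *\<^sub>R v) + t *\<^sub>R v" by simp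
      then have "x \<in> K'" using in_K True unfolding K'_def by blast
      then show ?thesis using in_K by simp
     qed (use K in simp)
     finally have "\<bar>D t x * f x\<bar> <= (B * norm v) * \<bar>\<I> K' x * f x\<bar>"
      by (simp add: abs_mult mult_right_mono flip: mult.assoc)
     then show ?thesis using K(3) by (simp add: ennreal_leI flip: ennreal_mult)
    qed
    then show ?thesis using True by (auto simp: C_def intro!: nn_integral_mono)
   qed simp
  qed
  have i4: "integrable (lborel \<Otimes>\<^sub>M lborel) (%(t, x). \<I> {0..1} t * (\<phi> x * gv (x + t *\<^sub>R v)))"
   using K(2) VU K(4) by (intro integrable_segment_average[OF _ _ gv K(1)]) auto
  have "(LBINT x. \<phi> x * (f (x + v) - f x)) = (LBINT x. \<phi> x * f (x + v)) - (LBINT x. \<phi> x * f x)"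
   using i1 by (simp add: right_diff_distrib)
  also have "(LBINT x. \<phi> x * f (x + v)) = (LBINT x. \<phi> (x - v) * f x)"
   using integral_shift[of "%x. \<phi> (x - v) * f x" v] by simp
  also have "... - (LBINT x. \<phi> x * f x) = (LBINT x. (\<phi> (x - v) - \<phi> x) * f x)"
   using i2 by (simp add: left_diff_distrib)
  also have "... = - (LBINT x. (LBINT t. \<I> {0..1} t * (D t x * f x)))"
   by (simp add: ftc flip: mult.assoc)
  also have "(LBINT x. (LBINT t. \<I> {0..1} t * (D t x * f x)))
   = (LBINT t. (LBINT x. \<I> {0..1} t * (D t x * f x)))"
   by (rule lborel_pair.Fubini_integral[OF i3])
  also have "... = (LBINT t. - (LBINT x. \<I> {0..1} t * (\<phi> x * gv (x + t *\<^sub>R v))))"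
  proof (rule Bochner_Integration.integral_cong[OF refl])
   fix t :: real
   show "(LBINT x. \<I> {0..1} t * (D t x * f x)) = - (LBINT x. \<I> {0..1} t * (\<phi> x * gv (x + t *\<^sub>R v)))"
   proof (cases "t \<in> {0..1}")
    case True
    \<comment> \<open>For fixed t this is the defining equation of the weak gradient for the
      translate of \<phi> by t v, whose support lies in U because \<phi> is supported in V.\<close>
    have "(LBINT x. D t x * f x) = - (LBINT x. \<phi> (x - t *\<^sub>R v) * gv x)"
     using wgradD(5)[OF w U_test[OF True], of v]
     by (simp add: nabla_shift[OF test_smooth[OF \<phi>]] D_def gv_def)
    also have "(LBINT x. \<phi> (x - t *\<^sub>R v) * gv x) = (LBINT x. \<phi> x * gv (x + t *\<^sub>R v))"
     using integral_shift[of "%x. \<phi> (x - t *\<^sub>R v) * gv x" "t *\<^sub>R v"] by simp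
    finally show ?thesis using True by simp
   qed simp
  qed
  also have "... = - (LBINT x. (LBINT t. \<I> {0..1} t * (\<phi> x * gv (x + t *\<^sub>R v))))"
   using lborel_pair.Fubini_integral[OF i4] by simp
  also have "(LBINT x. (LBINT t. \<I> {0..1} t * (\<phi> x * gv (x + t *\<^sub>R v)))) = (LBINT x. \<phi> x * W x)"
   by (simp add: W_def mult.left_commute)
  finally have e: "(LBINT x. \<phi> x * (f (x + v) - f x)) = (LBINT x. \<phi> x * W x)" by simp
  have "integrable lborel (%x. \<phi> x * (f (x + v) - f x))" using i1 by (simp add: right_diff_distrib)
  then show "(LBINT x. \<phi> x * ((f (x + v) - f x) - W x)) = 0"
   using e i1(3) by (simp add: right_diff_distrib[of _ "f _ - f _"])
 qed simp
 then show ?thesis by (simp add: W_def gv_def)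
qed

text \<open>Cauchy-Schwarz in the parameter of the segment, then Tonelli and invariance under each
  translation by t v. Only the segments that start in A have to stay in U, so A may reach up to the
  boundary of U.\<close>

theorem wgrad_translation_bound:
 fixes U :: "'a::euclidean_space set"
 assumes U: "open U" and w: "wgrad U f g"
  and [measurable]: "A \<in> sets borel" and A: "!!x t. x \<in> A ==> t \<in> {0..1} ==> x + t *\<^sub>R v \<in> U"
 shows "(\<N> x. \<I> A x * ennreal ((f (x + v) - f x)\<^sup>2))
  <= ennreal ((norm v)\<^sup>2) * (\<N> x. \<I> U x * ennreal ((norm (g x))\<^sup>2))"
proof -
 note [measurable] = wgradD(1,2)[OF w] borel_open[OF U]
 have "AE x in lborel. \<I> A x * ennreal ((f (x + v) - f x)\<^sup>2)
  <= (\<N> t. \<I> {0..1} t * (\<I> A x * ennreal ((norm v)\<^sup>2 * (norm (g (x + t *\<^sub>R v)))\<^sup>2)))"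
  using wgrad_translation[OF U w, of v]
 proof eventually_elim
  fix x assume h: "x \<in> {x. \<forall>t\<in>{0..1}. x + t *\<^sub>R v \<in> U} -->
   f (x + v) - f x = (LBINT t. \<I> {0..1} t * (g (x + t *\<^sub>R v) \<bullet> v))"
  show "\<I> A x * ennreal ((f (x + v) - f x)\<^sup>2)
   <= (\<N> t. \<I> {0..1} t * (\<I> A x * ennreal ((norm v)\<^sup>2 * (norm (g (x + t *\<^sub>R v)))\<^sup>2)))"
  proof (cases "x \<in> A")
   case True
   then have "f (x + v) - f x = (LBINT t. \<I> {0..1} t * (g (x + t *\<^sub>R v) \<bullet> v))"
    using h A by blast
   \<comment> \<open>The indicator is doubled so that one copy plays the constant function 1 on the
     unit interval in Cauchy-Schwarz.\<close>
   also have "... = (LBINT t. \<I> {0..1} t * (\<I> {0..1} t * (g (x + t *\<^sub>R v) \<bullet> v)))"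
    by (simp flip: mult.assoc indicator_inter_arith)
   finally have "ennreal ((f (x + v) - f x)\<^sup>2) <= (\<N> t. ennreal ((\<I> {0..1::real} t)\<^sup>2))
     * (\<N> t. ennreal ((\<I> {0..1} t * (g (x + t *\<^sub>R v) \<bullet> v))\<^sup>2))"
    using Cauchy_Schwarz_integral[of "\<I> {0..1}" lborel "%t. \<I> {0..1} t * (g (x + t *\<^sub>R v) \<bullet> v)"]
    by simp
   also have "(\<N> t. ennreal ((\<I> {0..1::real} t)\<^sup>2)) = (\<N> t. \<I> {0..1::real} t)"
    by (intro nn_integral_cong) (simp add: indicator_def)
   also have "... = 1" by simp
   also have "1 * (\<N> t. ennreal ((\<I> {0..1} t * (g (x + t *\<^sub>R v) \<bullet> v))\<^sup>2))
    <= (\<N> t. \<I> {0..1} t * (\<I> A x * ennreal ((norm v)\<^sup>2 * (norm (g (x + t *\<^sub>R v)))\<^sup>2)))"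
    unfolding mult_1
   proof (intro nn_integral_mono)
    fix t :: real
    have "(g (x + t *\<^sub>R v) \<bullet> v)\<^sup>2 <= (norm v)\<^sup>2 * (norm (g (x + t *\<^sub>R v)))\<^sup>2"
     using Cauchy_Schwarz_ineq[of "g (x + t *\<^sub>R v)" v] by (simp add: power2_norm_eq_inner mult.commute)
    then show "ennreal ((\<I> {0..1} t * (g (x + t *\<^sub>R v) \<bullet> v))\<^sup>2)
     <= \<I> {0..1} t * (\<I> A x * ennreal ((norm v)\<^sup>2 * (norm (g (x + t *\<^sub>R v)))\<^sup>2))"
     using True by (auto simp: indicator_def intro: ennreal_leI)
   qed
   finally show ?thesis using True by simp
  qed simp
 qed
 then have "(\<N> x. \<I> A x * ennreal ((f (x + v) - f x)\<^sup>2))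
  <= (\<N> x. \<integral>\<^sup>+t. \<I> {0..1} t * (\<I> A x * ennreal ((norm v)\<^sup>2 * (norm (g (x + t *\<^sub>R v)))\<^sup>2)) \<partial>lborel)"
  by (rule nn_integral_mono_AE)
 also have "... = (\<N> t. \<integral>\<^sup>+x. \<I> {0..1} t * (\<I> A x * ennreal ((norm v)\<^sup>2 * (norm (g (x + t *\<^sub>R v)))\<^sup>2)) \<partial>lborel)"
  by (rule lborel_pair.Fubini') measurable
 also have "... <= (\<N> t. \<I> {0..1::real} t * (ennreal ((norm v)\<^sup>2) * (\<N> x. \<I> U x * ennreal ((norm (g x))\<^sup>2))))"
 proof (intro nn_integral_mono)
  fix t :: real
  show "(\<N> x. \<I> {0..1} t * (\<I> A x * ennreal ((norm v)\<^sup>2 * (norm (g (x + t *\<^sub>R v)))\<^sup>2)))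
   <= \<I> {0..1} t * (ennreal ((norm v)\<^sup>2) * (\<N> x. \<I> U x * ennreal ((norm (g x))\<^sup>2)))"
  proof (cases "t \<in> {0..1}")
   case True
   have "(\<N> x. \<I> A x * ennreal ((norm v)\<^sup>2 * (norm (g (x + t *\<^sub>R v)))\<^sup>2))
    <= (\<N> x. ennreal ((norm v)\<^sup>2) * (\<I> U (x + t *\<^sub>R v) * ennreal ((norm (g (x + t *\<^sub>R v)))\<^sup>2)))"
    using A True by (intro nn_integral_mono) (auto simp: indicator_def ennreal_mult)
   also have "... = ennreal ((norm v)\<^sup>2) * (\<N> x. \<I> U (x + t *\<^sub>R v) * ennreal ((norm (g (x + t *\<^sub>R v)))\<^sup>2))"
    by (rule nn_integral_cmult) measurable
   also have "(\<N> x. \<I> U (x + t *\<^sub>R v) * ennreal ((norm (g (x + t *\<^sub>R v)))\<^sup>2))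
    = (\<N> x. \<I> U x * ennreal ((norm (g x))\<^sup>2))"
    by (rule nn_integral_shift[where F="%x. \<I> U x * ennreal ((norm (g x))\<^sup>2)"]) measurable
   finally show ?thesis using True by simp
  qed simp
 qed
 also have "... = ennreal ((norm v)\<^sup>2) * (\<N> x. \<I> U x * ennreal ((norm (g x))\<^sup>2))"
  by (simp add: nn_integral_multc)
 finally show ?thesis .
qed

section \<open>The Poincare inequality\<close>

text \<open>The square of the L2 norm over U, with values in the extended half line.\<close>

definition gnorm :: "'a::euclidean_space set => ('a => 'b::euclidean_space) => ennreal" where
 "gnorm U g = (\<N> x. \<I> U x * ennreal ((norm (g x))\<^sup>2))"

lemma emeasure_bounded_eq: "bounded A ==> emeasure lborel A = ennreal (measure lborel A)"
 by (intro emeasure_eq_ennreal_measure) (metis emeasure_bounded_finite infinity_ennreal_def less_irrefl)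

lemma ennreal_max_0_right: "ennreal (max c 0) = ennreal c"
 by (cases "c >= 0") (auto simp: ennreal_neg max_def)

text \<open>This double integral replaces the distance to the mean in the Poincare inequality. It
  admits two different sets, so estimates can be chained from set to set.\<close>

definition osc :: "'a::euclidean_space set => 'a set => ('a => real) => ennreal" where
 "osc A B f = (\<N> x. \<integral>\<^sup>+y. \<I> A x * \<I> B y * ennreal ((f x - f y)\<^sup>2) \<partial>lborel)"

lemma osc_mono: "A \<subseteq> A' ==> B \<subseteq> B' ==> osc A B f <= osc A' B' f"
 unfolding osc_def by (intro nn_integral_mono mult_right_mono mult_mono) (auto simp: indicator_def)

lemma osc_sym:
 assumes [measurable]: "A \<in> sets borel" "B \<in> sets borel" "f \<in> \<B>"
 shows "osc A B f = osc B A f"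
proof -
 have "osc A B f = (\<N> y. \<integral>\<^sup>+x. \<I> A x * \<I> B y * ennreal ((f x - f y)\<^sup>2) \<partial>lborel)"
  unfolding osc_def by (rule lborel_pair.Fubini') measurable
 then show ?thesis by (simp add: osc_def power2_commute mult.commute)
qed

lemma ennreal_square_triangle:
 "ennreal ((a - c)\<^sup>2) <= 2 * ennreal ((a - b)\<^sup>2) + 2 * ennreal ((b - c)\<^sup>2)"
proof -
 have "(a - c)\<^sup>2 <= 2 * (a - b)\<^sup>2 + 2 * (b - c)\<^sup>2"
  using zero_le_power2[of "(a - b) - (b - c)"] by (simp add: power2_eq_square algebra_simps)
 then have "ennreal ((a - c)\<^sup>2) <= ennreal (2 * (a - b)\<^sup>2 + 2 * (b - c)\<^sup>2)" by (rule ennreal_leI)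
 also have "... = 2 * ennreal ((a - b)\<^sup>2) + 2 * ennreal ((b - c)\<^sup>2)"
  by (simp add: ennreal_mult)
 finally show ?thesis .
qed

text \<open>Integrate \<open>ennreal_square_triangle\<close> with a middle point y that runs through
  B; the measure of B appears on the left because the left side does not depend on y.\<close>

lemma osc_trans:
 assumes [measurable]: "A \<in> sets borel" "B \<in> sets borel" "C \<in> sets borel" "f \<in> \<B>"
 shows "emeasure lborel B * osc A C f <= 2 * emeasure lborel C * osc A B f + 2 * emeasure lborel A * osc B C f"
proof -
 let ?i = "%x y z. \<I> A x * \<I> B y * \<I> C z :: ennreal"
 have "emeasure lborel B * osc A C f
  = (\<N> x. \<integral>\<^sup>+z. \<integral>\<^sup>+y. ?i x y z * ennreal ((f x - f z)\<^sup>2) \<partial>lborel \<partial>lborel)"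
 proof -
  have "(\<N> y. ?i x y z * ennreal ((f x - f z)\<^sup>2)) =
   emeasure lborel B * (\<I> A x * \<I> C z * ennreal ((f x - f z)\<^sup>2))" for x z
  proof -
   have "(\<N> y. ?i x y z * ennreal ((f x - f z)\<^sup>2))
    = (\<N> y. (\<I> A x * \<I> C z * ennreal ((f x - f z)\<^sup>2)) * \<I> B y)"
    by (simp add: mult_ac)
   also have "... = (\<I> A x * \<I> C z * ennreal ((f x - f z)\<^sup>2)) * emeasure lborel B"
    by (rule nn_integral_cmult_indicator) simp
   finally show ?thesis by (simp add: mult_ac)
  qed
  then show ?thesis by (simp add: osc_def nn_integral_cmult)
 qed
 also have "... <= (\<N> x. \<integral>\<^sup>+z. \<integral>\<^sup>+y. ?i x y z * (2 * ennreal ((f x - f y)\<^sup>2) + 2 * ennreal ((f y - f z)\<^sup>2)) \<partial>lborel \<partial>lborel)"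
  by (intro nn_integral_mono mult_left_mono ennreal_square_triangle) auto
 also have "... = (\<N> x. \<integral>\<^sup>+z. \<integral>\<^sup>+y. ?i x y z * (2 * ennreal ((f x - f y)\<^sup>2)) \<partial>lborel \<partial>lborel)
  + (\<N> x. \<integral>\<^sup>+z. \<integral>\<^sup>+y. ?i x y z * (2 * ennreal ((f y - f z)\<^sup>2)) \<partial>lborel \<partial>lborel)"
  by (simp add: distrib_left nn_integral_add)
 also have "(\<N> x. \<integral>\<^sup>+z. \<integral>\<^sup>+y. ?i x y z * (2 * ennreal ((f x - f y)\<^sup>2)) \<partial>lborel \<partial>lborel)
  = 2 * emeasure lborel C * osc A B f"
 proof -
  define J where "J x = (\<N> y. \<I> A x * \<I> B y * ennreal ((f x - f y)\<^sup>2))" for x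
  have [measurable]: "J \<in> \<B>" unfolding J_def[abs_def] by measurable
  have J: "osc A B f = (\<N> x. J x)" by (simp add: osc_def J_def)
  have e: "(\<N> y. ?i x y z * (2 * ennreal ((f x - f y)\<^sup>2))) = (2 * J x) * \<I> C z" for x z
  proof -
   have "(\<N> y. ?i x y z * (2 * ennreal ((f x - f y)\<^sup>2))) =
    (\<N> y. \<I> C z * (2 * (\<I> A x * \<I> B y * ennreal ((f x - f y)\<^sup>2))))"
    by (intro nn_integral_cong) (simp add: mult_ac)
   then show ?thesis
    by (simp add: nn_integral_cmult J_def mult.commute)
  qed
  have "(\<N> z. (2 * J x) * \<I> C z) = (2 * emeasure lborel C) * J x" for x
   by (subst nn_integral_cmult_indicator) (simp_all add: mult_ac)
  then show ?thesis unfolding e J by (simp add: nn_integral_cmult)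
 qed
 also have "(\<N> x. \<integral>\<^sup>+z. \<integral>\<^sup>+y. ?i x y z * (2 * ennreal ((f y - f z)\<^sup>2)) \<partial>lborel \<partial>lborel)
  = 2 * emeasure lborel A * osc C B f"
 proof -
  define J where "J z = (\<N> y. \<I> C z * \<I> B y * ennreal ((f z - f y)\<^sup>2))" for z
  have [measurable]: "J \<in> \<B>" unfolding J_def[abs_def] by measurable
  have J: "osc C B f = (\<N> x. J x)" by (simp add: osc_def J_def)
  have e: "(\<N> y. ?i x y z * (2 * ennreal ((f y - f z)\<^sup>2))) =
   (2 * \<I> A x) * J z" for x z
  proof -
   have "(\<N> y. ?i x y z * (2 * ennreal ((f y - f z)\<^sup>2))) =
    (\<N> y. (2 * \<I> A x) * (\<I> C z * \<I> B y * ennreal ((f z - f y)\<^sup>2)))"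
    by (intro nn_integral_cong) (simp add: mult_ac power2_commute[of "f z"])
   also have "... = (2 * \<I> A x) * J z"
    unfolding J_def by (rule nn_integral_cmult) measurable
   finally show ?thesis .
  qed
  have "(\<N> z. (2 * \<I> A x) * J z) = (2 * \<I> A x) * osc C B f" for x
   unfolding J by (rule nn_integral_cmult) simp
  then show ?thesis unfolding e
   by (simp add: nn_integral_multc nn_integral_cmult)
 qed
 finally show ?thesis using osc_sym[of C B f] by simp
qed

text \<open>After the substitution \<open>y = x + v\<close> each v contributes a translation
  estimate on the part of A whose translate by v is still in A, where convexity keeps the segments
  inside. Only v of length at most R occur, whence the volume of the ball.\<close>

lemma osc_convex:
 assumes U: "open U" and w: "wgrad U f g" and [measurable]: "A \<in> sets borel"
  and A: "convex A" "A \<subseteq> U" "!!x y. x \<in> A ==> y \<in> A ==> dist x y <= R"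
 shows "osc A A f <= ennreal (R\<^sup>2) * emeasure lborel (cball (0::'a::euclidean_space) R) * gnorm (U::'a set) g"
proof -
 note [measurable] = wgradD(1,2)[OF w]
 have [measurable]: "cball (0::'a) R \<in> sets borel" by (simp add: borel_closed)
 have "osc A A f = (\<N> x. \<integral>\<^sup>+v. \<I> A x * \<I> A (v + x) * ennreal ((f x - f (v + x))\<^sup>2) \<partial>lborel)"
  unfolding osc_def
  by (intro nn_integral_cong nn_integral_shift[symmetric, where F="%y. \<I> A _ * \<I> A y * ennreal ((f _ - f y)\<^sup>2)"])
   measurable
 also have "... = (\<N> v. \<integral>\<^sup>+x. \<I> A x * \<I> A (v + x) * ennreal ((f x - f (v + x))\<^sup>2) \<partial>lborel)"
  by (rule lborel_pair.Fubini') measurable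
 also have "... <= (\<N> v. \<I> (cball (0::'a) R) v * (ennreal (R\<^sup>2) * gnorm U g))"
 proof (intro nn_integral_mono)
  fix v :: 'a
  define Av where "Av = {x. x \<in> A & v + x \<in> A}"
  have [measurable]: "Av \<in> sets borel" unfolding Av_def by measurable
  have "(\<N> x. \<I> A x * \<I> A (v + x) * ennreal ((f x - f (v + x))\<^sup>2))
   = (\<N> x. \<I> Av x * ennreal ((f (x + v) - f x)\<^sup>2))"
   by (intro nn_integral_cong) (auto simp: Av_def indicator_def power2_commute add.commute)
  also have "... <= \<I> (cball 0 R) v * (ennreal (R\<^sup>2) * gnorm U g)"
  proof (cases "norm v <= R")
   case True
   have "(\<N> x. \<I> Av x * ennreal ((f (x + v) - f x)\<^sup>2)) <= ennreal ((norm v)\<^sup>2) * gnorm U g"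
    unfolding gnorm_def
   proof (rule wgrad_translation_bound[OF U w])
    fix x and t :: real assume "x \<in> Av" "t \<in> {0..1}"
    then have "(1 - t) *\<^sub>R x + t *\<^sub>R (v + x) \<in> A"
     using A(1) by (auto simp: Av_def convex_alt)
    then show "x + t *\<^sub>R v \<in> U" using A(2) by (auto simp: algebra_simps)
   qed simp
   also have "... <= ennreal (R\<^sup>2) * gnorm U g"
    using True by (intro mult_right_mono ennreal_leI power_mono) auto
   finally show ?thesis using True by simp
  next
   case False
   have "Av = {}"
    using A(3) False by (fastforce simp: Av_def dist_norm)
   then show ?thesis by simp
  qed
  finally show "(\<N> x. \<I> A x * \<I> A (v + x) * ennreal ((f x - f (v + x))\<^sup>2))
   <= \<I> (cball 0 R) v * (ennreal (R\<^sup>2) * gnorm U g)" .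
 qed
 also have "... = ennreal (R\<^sup>2) * emeasure lborel (cball (0::'a) R) * gnorm U g"
  by (subst nn_integral_multc) (simp_all add: mult_ac)
 finally show ?thesis .
qed

text \<open>A Poincare estimate between neighbourhoods of two points, which may lie on the boundary
  of U. The global inequality becomes a question about a relation that is symmetric and, through
  points of U, transitive.\<close>

definition linked :: "'a::euclidean_space set => 'a => 'a => bool" where
 "linked U p q \<longleftrightarrow> (\<exists>V W c. open V & open W & bounded V & bounded W & p \<in> V & q \<in> W &
  (\<forall>f g. wgrad U f g --> osc (V \<inter> U) (W \<inter> U) f <= ennreal c * gnorm U g))"

lemma linked_sym:
 assumes "open U" "linked U p q" shows "linked U q p"
proof -
 obtain V W c where *: "open V" "open W" "bounded V" "bounded W" "p \<in> V" "q \<in> W"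
  "!!f g. wgrad U f g ==> osc (V \<inter> U) (W \<inter> U) f <= ennreal c * gnorm U g"
  using assms(2) unfolding linked_def by blast
 have "osc (W \<inter> U) (V \<inter> U) f <= ennreal c * gnorm U g" if "wgrad U f g" for f g
  using *(7)[OF that] osc_sym[of "V \<inter> U" "W \<inter> U" f] *(1,2) assms(1) wgradD(1)[OF that] by simp
 then show ?thesis unfolding linked_def using * by blast
qed

text \<open>The overlap of the two neighbourhoods of q is an open part of U around q and so has
  positive measure; the estimate that \<open>osc_trans\<close> gives through it can be divided by
  this measure.\<close>

lemma linked_trans:
 fixes U :: "'a::euclidean_space set"
 assumes U: "open U" and "linked U p q" "linked U q s" "q \<in> U"
 shows "linked U p s"
proof -
 obtain V W c where 1: "open V" "open W" "bounded V" "bounded W" "p \<in> V" "q \<in> W"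
  "!!f g. wgrad U f g ==> osc (V \<inter> U) (W \<inter> U) f <= ennreal c * gnorm U g"
  using assms(2) unfolding linked_def by blast
 obtain W' Z d where 2: "open W'" "open Z" "bounded W'" "bounded Z" "q \<in> W'" "s \<in> Z"
  "!!f g. wgrad U f g ==> osc (W' \<inter> U) (Z \<inter> U) f <= ennreal d * gnorm U g"
  using assms(3) unfolding linked_def by blast
 define B where "B = W \<inter> W' \<inter> U"
 have fin: "emeasure lborel A < \<infinity>" if "bounded A" for A :: "'a set"
  using emeasure_bounded_finite[OF that] .
 have B: "open B" "q \<in> B" "bounded B"
  using 1 2 U \<open>q \<in> U\<close> by (auto simp: B_def)
 define b v z where "b = measure lborel B" and "v = measure lborel (V \<inter> U)" and "z = measure lborel (Z \<inter> U)"
 have b: "emeasure lborel B = ennreal b" and v: "emeasure lborel (V \<inter> U) = ennreal v" "v >= 0"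
  and z: "emeasure lborel (Z \<inter> U) = ennreal z" "z >= 0"
  unfolding b_def v_def z_def using B(3) 1(3) 2(4) by (auto intro!: emeasure_bounded_eq bounded_Int)
 have "b > 0"
 proof -
  obtain r where "r > 0" "ball q r \<subseteq> B" using B by (auto simp: open_contains_ball)
  then have "measure lborel (ball q r) <= b" unfolding b_def
   using B emeasure_bounded_finite[OF B(3)] by (intro measure_mono_fmeasurable) (auto intro: fmeasurableI)
  then show ?thesis using content_ball_gt_0_iff[of q r] \<open>r > 0\<close> by linarith
 qed
 \<comment> \<open>The constants in \<open>linked\<close> may be negative; \<open>ennreal\<close>
   sends such numbers to 0, so the maximum does not change the estimates.\<close>
 define c' where "c' = max c 0"
 define d' where "d' = max d 0"
 have "osc (V \<inter> U) (Z \<inter> U) f <= ennreal ((2 * z * c' + 2 * v * d') / b) * gnorm U g" if w: "wgrad U f g" for f g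
 proof -
  have "osc (V \<inter> U) B f <= ennreal c' * gnorm U g"
   using osc_mono[of "V \<inter> U" "V \<inter> U" B "W \<inter> U" f] 1(7)[OF w]
   by (auto simp: B_def c'_def ennreal_max_0_right intro: order_trans)
  moreover have "osc B (Z \<inter> U) f <= ennreal d' * gnorm U g"
   using osc_mono[of B "W' \<inter> U" "Z \<inter> U" "Z \<inter> U" f] 2(7)[OF w]
   by (auto simp: B_def d'_def ennreal_max_0_right intro: order_trans)
  moreover have "ennreal b * osc (V \<inter> U) (Z \<inter> U) f <= 2 * ennreal z * osc (V \<inter> U) B f + 2 * ennreal v * osc B (Z \<inter> U) f"
   using osc_trans[of "V \<inter> U" B "Z \<inter> U" f] 1(1) 2(2) B(1) U wgradD(1)[OF w] b v(1) z(1) by simp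
  ultimately have "ennreal b * osc (V \<inter> U) (Z \<inter> U) f <= 2 * ennreal z * (ennreal c' * gnorm U g) + 2 * ennreal v * (ennreal d' * gnorm U g)"
   by (meson add_mono mult_left_mono order_trans zero_le)
  also have "... = ennreal (2 * z * c' + 2 * v * d') * gnorm U g"
   using v z by (simp add: ennreal_mult c'_def d'_def distrib_left distrib_right mult_ac)
  finally have "ennreal (1 / b) * (ennreal b * osc (V \<inter> U) (Z \<inter> U) f) <= ennreal (1 / b) * (ennreal (2 * z * c' + 2 * v * d') * gnorm U g)"
   by (rule mult_left_mono) simp
  moreover have "ennreal (1 / b) * ennreal b = 1" using \<open>b > 0\<close> by (simp flip: ennreal_mult)
  moreover have "ennreal (1 / b) * ennreal (2 * z * c' + 2 * v * d') = ennreal ((2 * z * c' + 2 * v * d') / b)"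
   using \<open>b > 0\<close> v(2) z(2) by (subst ennreal_mult[symmetric]) (auto simp: c'_def d'_def)
  ultimately show ?thesis by (simp only: mult.assoc[symmetric] mult_1)
 qed
 then show ?thesis unfolding linked_def using 1 2 by blast
qed

lemma linked_ball:
 fixes U :: "'a::euclidean_space set"
 assumes U: "open U" "ball p r \<subseteq> U" "x \<in> ball p r" "y \<in> ball p r"
 shows "linked U x y"
proof -
 have "osc (ball p r) (ball p r) f <= ennreal ((2 * r)\<^sup>2) * emeasure lborel (cball (0::'a) (2 * r)) * gnorm U g"
  if "wgrad U f g" for f g
 proof (rule osc_convex[OF U(1) that])
  fix x y assume "x \<in> ball p r" "y \<in> ball p r"
  then show "dist x y <= 2 * r" using dist_triangle[of x y p] by (auto simp: dist_commute)
 qed (use U in auto)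
 moreover have "emeasure lborel (cball (0::'a) (2 * r)) = ennreal (measure lborel (cball (0::'a) (2 * r)))"
  by (intro emeasure_bounded_eq) simp
 ultimately have "osc (ball p r \<inter> U) (ball p r \<inter> U) f <= ennreal ((2 * r)\<^sup>2 * measure lborel (cball (0::'a) (2 * r))) * gnorm U g"
  if "wgrad U f g" for f g
  using that U(2) by (simp add: Int_absorb2 ennreal_mult)
 then show ?thesis unfolding linked_def using U(3,4) by (blast intro: open_ball bounded_ball)
qed

text \<open>The part of U near p may have an irregular shape, but its translate by v lies in a ball
  inside U. The translation bound compares f with its translate, and the estimate for convex sets is
  used only in that ball.\<close>

lemma linked_translate:
 fixes U :: "'a::euclidean_space set"
 assumes U: "open U" and r: "r > 0" and seg: "!!x t. x \<in> U ==> x \<in> ball p r ==> t \<in> {0..1} ==> x + t *\<^sub>R v \<in> U"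
  and pv: "p + v \<in> U"
 shows "linked U p (p + v)"
proof -
 obtain r' where r': "r' > 0" "ball (p + v) r' \<subseteq> U" using U pv by (auto simp: open_contains_ball)
 define \<rho> where "\<rho> = min r r'"
 have \<rho>: "\<rho> > 0" "ball p \<rho> \<subseteq> ball p r" "ball (p + v) \<rho> \<subseteq> U" using r r' by (auto simp: \<rho>_def)
 define A where "A = ball p \<rho> \<inter> U"
 define W where "W = ball (p + v) \<rho>"
 have [measurable]: "A \<in> sets borel" "W \<in> sets borel" using U by (auto simp: A_def W_def)
 define mW where "mW = measure lborel W"
 have mW: "emeasure lborel W = ennreal mW"
  unfolding mW_def W_def by (intro emeasure_bounded_eq) simp
 define mB where "mB = measure lborel (cball (0::'a) (2 * \<rho>))"
 have mB: "emeasure lborel (cball (0::'a) (2 * \<rho>)) = ennreal mB"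
  unfolding mB_def by (intro emeasure_bounded_eq) simp
 define R2 where "R2 = (2 * \<rho>)\<^sup>2"
 have mp: "mW >= 0" "mB >= 0" "R2 >= 0" by (simp_all add: mW_def mB_def R2_def)
 have "osc A W f <= ennreal (2 * mW * (norm v)\<^sup>2 + 2 * (R2 * mB)) * gnorm U g" if w: "wgrad U f g" for f g
 proof -
  note [measurable] = wgradD(1)[OF w]
  have WW: "osc W W f <= ennreal R2 * emeasure lborel (cball (0::'a) (2 * \<rho>)) * gnorm U g"
   unfolding R2_def
  proof (rule osc_convex[OF U w])
   fix x y assume "x \<in> W" "y \<in> W"
   then show "dist x y <= 2 * \<rho>" using dist_triangle[of x y "p + v"] by (auto simp: W_def dist_commute)
  qed (use \<rho> in \<open>auto simp: W_def\<close>)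
  have "osc A W f <= (\<N> x. \<integral>\<^sup>+y. \<I> A x * \<I> W y * (2 * ennreal ((f x - f (x + v))\<^sup>2) + 2 * ennreal ((f (x + v) - f y)\<^sup>2)) \<partial>lborel)"
   unfolding osc_def by (intro nn_integral_mono mult_left_mono ennreal_square_triangle) auto
  also have "... <= (\<N> x. \<integral>\<^sup>+y. (2 * (\<I> A x * ennreal ((f (x + v) - f x)\<^sup>2))) * \<I> W y
    + 2 * (\<I> W (x + v) * \<I> W y * ennreal ((f (x + v) - f y)\<^sup>2)) \<partial>lborel)"
   by (intro nn_integral_mono) (auto simp: indicator_def A_def W_def power2_commute dist_norm)
  also have "... = 2 * (\<N> x. \<I> A x * ennreal ((f (x + v) - f x)\<^sup>2)) * emeasure lborel W
   + 2 * (\<N> x. \<integral>\<^sup>+y. \<I> W (x + v) * \<I> W y * ennreal ((f (x + v) - f y)\<^sup>2) \<partial>lborel)"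
   by (simp add: nn_integral_add nn_integral_cmult nn_integral_multc)
  also have "(\<N> x. \<integral>\<^sup>+y. \<I> W (x + v) * \<I> W y * ennreal ((f (x + v) - f y)\<^sup>2) \<partial>lborel) = osc W W f"
   unfolding osc_def
   by (rule nn_integral_shift[where F="%x. \<integral>\<^sup>+y. \<I> W x * \<I> W y * ennreal ((f x - f y)\<^sup>2) \<partial>lborel"]) measurable
  finally have OA: "osc A W f <= 2 * (\<N> x. \<I> A x * ennreal ((f (x + v) - f x)\<^sup>2)) * emeasure lborel W + 2 * osc W W f" .
  have TA: "(\<N> x. \<I> A x * ennreal ((f (x + v) - f x)\<^sup>2)) <= ennreal ((norm v)\<^sup>2) * gnorm U g"
   unfolding gnorm_def
   by (rule wgrad_translation_bound[OF U w]) (use seg \<rho>(2) U in \<open>auto simp: A_def\<close>)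
  have "2 * (\<N> x. \<I> A x * ennreal ((f (x + v) - f x)\<^sup>2)) * emeasure lborel W + 2 * osc W W f
   <= 2 * (ennreal ((norm v)\<^sup>2) * gnorm U g) * ennreal mW + 2 * (ennreal R2 * ennreal mB * gnorm U g)"
   using WW TA unfolding mW mB by (intro add_mono mult_right_mono mult_left_mono) auto
  also have "... = ennreal (2 * mW * (norm v)\<^sup>2 + 2 * (R2 * mB)) * gnorm U g"
   using mp by (simp add: ennreal_mult distrib_left distrib_right mult_ac)
  finally show ?thesis using OA by (rule order_trans[rotated])
 qed
 moreover have "W \<inter> U = W" using \<rho>(3) by (auto simp: W_def)
 ultimately have "!!f g. wgrad U f g ==> osc (ball p \<rho> \<inter> U) (W \<inter> U) f <= ennreal (2 * mW * (norm v)\<^sup>2 + 2 * (R2 * mB)) * gnorm U g"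
  by (simp add: A_def)
 moreover have "open W" "bounded W" "p + v \<in> W" "p \<in> ball p \<rho>" using \<rho>(1) by (auto simp: W_def)
 ultimately show ?thesis unfolding linked_def by (blast intro: open_ball bounded_ball)
qed

text \<open>Points of U are linked because U is connected and small balls are convex; a boundary
  point in K is linked to an interior one by the inward translation in \<open>acc\<close>. A finite
  cover of \<open>K \<times> K\<close> by products of linked neighbourhoods then adds up to the
  claim.\<close>

theorem poincare:
 fixes U :: "'a::euclidean_space set"
 assumes U: "open U" "connected U" and K: "compact K"
  and acc: "!!p. p \<in> K ==> p \<notin> U ==> \<exists>r>0. \<exists>v. p + v \<in> U & (\<forall>x\<in>U \<inter> ball p r. \<forall>t\<in>{0..1}. x + t *\<^sub>R v \<in> U)"
 shows "\<exists>c\<ge>0. \<forall>f g. wgrad U f g --> osc (K \<inter> U) (K \<inter> U) f <= ennreal c * gnorm U g"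
proof -
 have UU: "linked U p q" if "p \<in> U" "q \<in> U" for p q
 proof (rule connected_equivalence_relation[OF U(2) that])
  fix a assume "a \<in> U"
  then obtain r where r: "r > 0" "ball a r \<subseteq> U" using U(1) by (auto simp: open_contains_ball)
  then show "\<exists>T. openin (top_of_set U) T & a \<in> T & (\<forall>x\<in>T. linked U a x)"
   using U(1) linked_ball[OF U(1) r(2)] by (intro exI[of _ "ball a r"]) (auto simp: openin_open_eq)
 qed (use linked_sym[OF U(1)] linked_trans[OF U(1)] in blast)+
 have KU: "\<exists>q\<in>U. linked U p q" if "p \<in> K" for p
 proof (cases "p \<in> U")
  case False
  then show ?thesis using acc[OF that False] linked_translate[OF U(1)] by (metis IntI)
 qed (use UU in blast)
 have KK: "linked U p q" if "p \<in> K" "q \<in> K" for p q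
 proof -
  obtain p' q' where *: "p' \<in> U" "linked U p p'" "q' \<in> U" "linked U q q'" using KU \<open>p \<in> K\<close> \<open>q \<in> K\<close> by blast
  then show ?thesis
   using linked_trans[OF U(1) linked_trans[OF U(1) \<open>linked U p p'\<close> UU] linked_sym[OF U(1)]] by simp
 qed
 have "\<forall>z\<in>K \<times> K. \<exists>V W c. open V & open W & fst z \<in> V & snd z \<in> W &
  (\<forall>f g. wgrad U f g --> osc (V \<inter> U) (W \<inter> U) f <= ennreal c * gnorm U g)"
  using KK unfolding linked_def by fastforce
 then obtain V W c where VW: "!!z. z \<in> K \<times> K ==> open (V z) & open (W z) & fst z \<in> V z & snd z \<in> W z &
  (\<forall>f g. wgrad U f g --> osc (V z \<inter> U) (W z \<inter> U) f <= ennreal (c z) * gnorm U g)"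
  by metis
 have "compact (K \<times> K)" using K by (intro compact_Times)
 then obtain I where I: "I \<subseteq> K \<times> K" "finite I" "K \<times> K \<subseteq> (\<Union>z\<in>I. V z \<times> W z)"
 proof (rule compactE_image[of _ "K \<times> K" "%z. V z \<times> W z"])
  show "K \<times> K \<subseteq> (\<Union>z\<in>K \<times> K. V z \<times> W z)"
   using VW by (force simp: mem_Times_iff)
 qed (use VW in \<open>auto intro!: open_Times\<close>)
 have "osc (K \<inter> U) (K \<inter> U) f <= ennreal (\<Sum>z\<in>I. max (c z) 0) * gnorm U g" if w: "wgrad U f g" for f g
 proof -
  note [measurable] = wgradD(1)[OF w] borel_open[OF U(1)]
  have [measurable]: "V z \<in> sets borel" "W z \<in> sets borel" if "z \<in> I" for z
   using VW[of z] that I by auto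
  have "osc (K \<inter> U) (K \<inter> U) f <= (\<N> x. \<integral>\<^sup>+y. (\<Sum>z\<in>I. \<I> (V z \<inter> U) x * \<I> (W z \<inter> U) y * ennreal ((f x - f y)\<^sup>2)) \<partial>lborel)"
   unfolding osc_def
  proof (intro nn_integral_mono)
   fix x y
   show "\<I> (K \<inter> U) x * \<I> (K \<inter> U) y * ennreal ((f x - f y)\<^sup>2) \<le>
    (\<Sum>z\<in>I. \<I> (V z \<inter> U) x * \<I> (W z \<inter> U) y * ennreal ((f x - f y)\<^sup>2))"
   proof (cases "x \<in> K \<inter> U & y \<in> K \<inter> U")
    case True
    then obtain z where z: "z \<in> I" "x \<in> V z" "y \<in> W z" using I(3) by blast
    have "\<I> (V z \<inter> U) x * \<I> (W z \<inter> U) y * ennreal ((f x - f y)\<^sup>2) \<le>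
     (\<Sum>z\<in>I. \<I> (V z \<inter> U) x * \<I> (W z \<inter> U) y * ennreal ((f x - f y)\<^sup>2))"
     using I(2) z(1) by (intro member_le_sum) auto
    then show ?thesis using True z by simp
   qed (auto simp: indicator_def)
  qed
  also have "... = (\<Sum>z\<in>I. osc (V z \<inter> U) (W z \<inter> U) f)"
   unfolding osc_def by (simp add: nn_integral_sum)
  also have "... <= (\<Sum>z\<in>I. ennreal (max (c z) 0) * gnorm U g)"
   using VW w I(1) by (intro sum_mono) (auto simp: ennreal_max_0_right)
  also have "... = ennreal (\<Sum>z\<in>I. max (c z) 0) * gnorm U g"
   by (simp flip: sum_distrib_right)
  finally show ?thesis .
 qed
 then show ?thesis by (intro exI[of _ "\<Sum>z\<in>I. max (c z) 0"]) (auto intro: sum_nonneg)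
qed

section \<open>Strong limits\<close>

text \<open>Completeness of L2 on an increasing sequence of sets, with one subsequence that
  converges almost everywhere on all of them. By Fatou the whole sequence converges in norm, because
  it is Cauchy.\<close>

lemma locally_L2_Cauchy:
 fixes F :: "nat => 'a::euclidean_space => 'b::euclidean_space"
 assumes F [measurable]: "!!n. F n \<in> \<B>"
  and K [measurable]: "!!j. K j \<in> sets borel" and mono: "!!j. K j \<subseteq> K (Suc j)"
  and cau: "!!j \<epsilon>. \<epsilon> > 0 ==> \<exists>N. \<forall>n\<ge>N. \<forall>m\<ge>N. gnorm (K j) (%x. F n x - F m x) <= ennreal \<epsilon>"
 obtains r G where "strict_mono (r :: nat => nat)" "G \<in> \<B>"
  "AE x in lborel. x \<in> (\<Union>j. K j) --> (%n. F (r n) x) \<longlonglongrightarrow> G x"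
  "!!j. (%n. gnorm (K j) (%x. F n x - G x)) \<longlonglongrightarrow> 0"
proof -
 have "\<exists>N. \<forall>n\<ge>N. \<forall>m\<ge>N. gnorm (K j) (%x. F n x - F m x) <= ennreal ((1/4) ^ j)" for j
  by (rule cau) simp
 then obtain N where N: "!!j n m. n >= N j ==> m >= N j ==> gnorm (K j) (%x. F n x - F m x) <= ennreal ((1/4) ^ j)"
  by metis
 \<comment> \<open>The sum over all \<open>N i\<close> makes r strictly increasing and at least
   \<open>N n\<close>.\<close>
 define r where "r n = (\<Sum>i\<le>n. N i) + n" for n
 have r: "strict_mono r" by (auto simp: strict_mono_Suc_iff r_def)
 have rN: "r n >= N n" for n
 proof -
  have "N n <= (\<Sum>i\<le>n. N i)" by (rule member_le_sum) auto
  then show ?thesis by (simp add: r_def)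
 qed
 have Kle: "K j \<subseteq> K (n + j)" for j n
  using lift_Suc_mono_le[of K j "n + j"] mono by auto
 define d where "d n x = norm (F (r (Suc n)) x - F (r n) x)" for n x
 have [measurable]: "d n \<in> \<B>" for n unfolding d_def[abs_def] by measurable
 have step: "gnorm (K n) (%x. F (r (Suc n)) x - F (r n) x) <= ennreal ((1/4) ^ n)" for n
  using rN[of n] strict_monoD[OF r, of n "Suc n"] by (intro N) auto
 have AEj: "AE x in lborel. x \<in> K j --> convergent (%n. F (r n) x)" for j
 proof -
  \<comment> \<open>The squared differences are bounded by 4^-n, so the weights 2^n leave a
    convergent series; at the same time they are large enough to sum the differences
    themselves.\<close>
  have "(\<N> x. (\<Sum>n. \<I> (K j) x * ennreal (2 ^ (n + j) * (d (n + j) x)\<^sup>2)))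
   = (\<Sum>n. \<integral>\<^sup>+x. \<I> (K j) x * ennreal (2 ^ (n + j) * (d (n + j) x)\<^sup>2) \<partial>lborel)"
   by (intro nn_integral_suminf) measurable
  also have "... <= (\<Sum>n. ennreal ((1/2) ^ (n + j)))"
  proof (intro suminf_le summableI)
   fix n
   have "(\<N> x. \<I> (K j) x * ennreal (2 ^ (n + j) * (d (n + j) x)\<^sup>2))
    <= (\<N> x. ennreal (2 ^ (n + j)) * (\<I> (K (n + j)) x * ennreal ((d (n + j) x)\<^sup>2)))"
    using Kle[of j n] by (intro nn_integral_mono) (auto simp: indicator_def ennreal_mult)
   also have "... = ennreal (2 ^ (n + j)) * gnorm (K (n + j)) (%x. F (r (Suc (n + j))) x - F (r (n + j)) x)"
    unfolding gnorm_def d_def by (rule nn_integral_cmult) measurable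
   also have "... <= ennreal (2 ^ (n + j)) * ennreal ((1/4) ^ (n + j))"
    by (intro mult_left_mono step) simp
   also have "... = ennreal ((1/2) ^ (n + j))"
    by (simp flip: ennreal_mult power_mult_distrib)
   finally show "(\<N> x. \<I> (K j) x * ennreal (2 ^ (n + j) * (d (n + j) x)\<^sup>2)) <= ennreal ((1/2) ^ (n + j))" .
  qed
  also have "... < \<infinity>"
  proof -
   have "summable (%n. (1/2::real) ^ (n + j))" by (subst summable_iff_shift) (simp add: summable_geometric)
   then show ?thesis by (subst suminf_ennreal2) (auto simp: less_top)
  qed
  finally have "(\<N> x. (\<Sum>n. \<I> (K j) x * ennreal (2 ^ (n + j) * (d (n + j) x)\<^sup>2))) ~= \<infinity>"
   by simp
  then have "AE x in lborel. (\<Sum>n. \<I> (K j) x * ennreal (2 ^ (n + j) * (d (n + j) x)\<^sup>2)) ~= \<infinity>"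
   by (intro nn_integral_PInf_AE) measurable
  then show ?thesis
  proof eventually_elim
   fix x assume h: "(\<Sum>n. \<I> (K j) x * ennreal (2 ^ (n + j) * (d (n + j) x)\<^sup>2)) ~= \<infinity>"
   show "x \<in> K j --> convergent (%n. F (r n) x)"
   proof
    assume "x \<in> K j"
    then have "summable (%n. 2 ^ (n + j) * (d (n + j) x)\<^sup>2)"
     using h by (intro summable_suminf_not_top) auto
    moreover have "summable (%n. (1/2::real) ^ (n + j))" by (subst summable_iff_shift) (simp add: summable_geometric)
    ultimately have s: "summable (%n. (1/2) ^ (n + j) + 2 ^ (n + j) * (d (n + j) x)\<^sup>2)"
     by (rule summable_add[rotated])
    have "summable (%n. d (n + j) x)"
    proof (rule summable_comparison_test'[OF s])
     fix n :: nat
     define a :: real where "a = 2 ^ (n + j)"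
     have a: "a > 0" "(1/2) ^ (n + j) = 1 / a" by (simp_all add: a_def power_one_over)
     have d0: "d (n + j) x >= 0" by (simp add: d_def)
     \<comment> \<open>One of the two terms dominates, according to whether
       \<open>a * d (n + j) x\<close> is at most 1. Both are summable for
       \<open>a = 2 ^ (n + j)\<close>.\<close>
     have "d (n + j) x <= 1 / a + a * (d (n + j) x)\<^sup>2"
     proof (cases "a * d (n + j) x <= 1")
      case True
      then have "d (n + j) x <= 1 / a" using a by (simp add: field_simps)
      then show ?thesis using a by (simp add: add_increasing2)
     next
      case False
      then have "d (n + j) x * 1 <= d (n + j) x * (a * d (n + j) x)" using d0 by (intro mult_left_mono) auto
      then have "d (n + j) x <= a * (d (n + j) x)\<^sup>2" by (simp add: power2_eq_square mult_ac)
      then show ?thesis using a by (simp add: add_increasing)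
     qed
     then show "norm (d (n + j) x) <= (1/2) ^ (n + j) + 2 ^ (n + j) * (d (n + j) x)\<^sup>2"
      using d0 a by (simp add: a_def)
    qed
    then have "summable (%n. d n x)" by (subst (asm) summable_iff_shift)
    then have "summable (%n. F (r (Suc n)) x - F (r n) x)"
     unfolding d_def by (rule summable_norm_cancel)
    then have "convergent (%n. \<Sum>i<n. F (r (Suc i)) x - F (r i) x)"
     by (simp add: summable_iff_convergent)
    moreover have "(\<Sum>i<n. F (r (Suc i)) x - F (r i) x) = F (r n) x - F (r 0) x" for n
     by (induction n) auto
    ultimately have "convergent (%n. F (r n) x - F (r 0) x)" by simp
    then have "convergent (%n. (F (r n) x - F (r 0) x) + F (r 0) x)"
     by (intro convergent_add convergent_const)
    then show "convergent (%n. F (r n) x)" by simp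
   qed
  qed
 qed
 define G where "G x = lim (%n. F (r n) x)" for x
 have [measurable]: "G \<in> \<B>"
  unfolding G_def[abs_def] by (rule borel_measurable_lim_metric) simp
 have AEK: "AE x in lborel. \<forall>j. x \<in> K j --> (%n. F (r n) x) \<longlonglongrightarrow> G x"
  unfolding AE_all_countable G_def using AEj by (simp add: convergent_LIMSEQ_iff)
 have lim: "(%n. gnorm (K j) (%x. F n x - G x)) \<longlonglongrightarrow> 0" for j
 proof (rule order_tendstoI)
  fix \<epsilon> :: ennreal assume "0 < \<epsilon>"
  then obtain m where m: "0 < m" "m < \<epsilon>" using dense by blast
  then have "m = ennreal (enn2real m)" by (intro ennreal_enn2real[symmetric]) (auto simp: less_top[symmetric])
  then obtain e where e: "0 < e" "ennreal e < \<epsilon>"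
   using m by (metis ennreal_less_zero_iff)
  obtain M where M: "!!n m. n >= M ==> m >= M ==> gnorm (K j) (%x. F n x - F m x) <= ennreal e"
   using cau[OF e(1)] by blast
  have "gnorm (K j) (%x. F n x - G x) <= ennreal e" if n: "n >= M" for n
  proof -
   \<comment> \<open>Fatou along the subsequence, with n fixed.\<close>
   have "gnorm (K j) (%x. F n x - G x)
    = (\<N> x. liminf (%m. \<I> (K j) x * ennreal ((norm (F n x - F (r m) x))\<^sup>2)))"
    unfolding gnorm_def
   proof (rule nn_integral_cong_AE)
    show "AE x in lborel. \<I> (K j) x * ennreal ((norm (F n x - G x))\<^sup>2) =
     liminf (%m. \<I> (K j) x * ennreal ((norm (F n x - F (r m) x))\<^sup>2))"
     using AEK
    proof eventually_elim
     fix x assume h: "\<forall>j. x \<in> K j --> (%n. F (r n) x) \<longlonglongrightarrow> G x"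
     show "\<I> (K j) x * ennreal ((norm (F n x - G x))\<^sup>2) =
      liminf (%m. \<I> (K j) x * ennreal ((norm (F n x - F (r m) x))\<^sup>2))"
     proof (cases "x \<in> K j")
      case True
      then have l: "(%m. ennreal ((norm (F n x - F (r m) x))\<^sup>2)) \<longlonglongrightarrow> ennreal ((norm (F n x - G x))\<^sup>2)"
       using h by (intro tendsto_intros) auto
      show ?thesis using True lim_imp_Liminf[OF _ l] by simp
     qed (simp add: Liminf_const)
    qed
   qed
   also have "... <= liminf (%m. gnorm (K j) (%x. F n x - F (r m) x))"
    unfolding gnorm_def by (rule nn_integral_liminf) measurable
   also have "... <= ennreal e"
   proof (rule Liminf_le)
    show "\<forall>\<^sub>F m in sequentially. gnorm (K j) (%x. F n x - F (r m) x) <= ennreal e"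
     using eventually_ge_at_top[of M]
    proof eventually_elim
     fix m assume "M <= m"
     then show "gnorm (K j) (%x. F n x - F (r m) x) <= ennreal e"
      using n seq_suble[OF r, of m] by (intro M) auto
    qed
   qed simp
   finally show ?thesis .
  qed
  then show "\<forall>\<^sub>F n in sequentially. gnorm (K j) (%x. F n x - G x) < \<epsilon>"
   using e(2) by (auto simp: eventually_sequentially intro: order.strict_trans1)
 qed simp
 show thesis
  using AEK by (intro that[OF r _ _ lim]) (auto elim!: eventually_mono)
qed

lemma nn_integral_Cauchy_Schwarz_weight:
 fixes k h :: "'a => real"
 assumes [measurable]: "k \<in> borel_measurable M" "h \<in> borel_measurable M" and "!!x. k x >= 0" "!!x. h x >= 0"
 shows "(\<integral>\<^sup>+x. ennreal (k x * h x) \<partial>M)\<^sup>2 <= (\<integral>\<^sup>+x. ennreal (k x) \<partial>M) * (\<integral>\<^sup>+x. ennreal (k x * (h x)\<^sup>2) \<partial>M)"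
proof -
 have e: "ennreal (k x * h x) = ennreal (sqrt (k x)) * ennreal (sqrt (k x) * h x)"
  "(ennreal (sqrt (k x)))\<^sup>2 = ennreal (k x)" "(ennreal (sqrt (k x) * h x))\<^sup>2 = ennreal (k x * (h x)\<^sup>2)" for x
  using assms(3,4)[of x] by (simp_all add: ennreal_power power_mult_distrib flip: ennreal_mult mult.assoc)
 show ?thesis unfolding e(1)
  using Cauchy_Schwarz_nn_integral[of "%x. ennreal (sqrt (k x))" M "%x. ennreal (sqrt (k x) * h x)"]
  by (simp add: e(2,3))
qed

lemma gnorm_mono: "A \<subseteq> B ==> gnorm A f <= gnorm B f"
 unfolding gnorm_def by (intro nn_integral_mono mult_right_mono) (auto simp: indicator_def)

lemma gnorm_triangle:
 fixes f g h :: "'a::euclidean_space => 'b::euclidean_space"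
 assumes [measurable]: "U \<in> sets borel" "f \<in> \<B>" "g \<in> \<B>" "h \<in> \<B>"
 shows "gnorm U (%x. f x - h x) <= 2 * gnorm U (%x. f x - g x) + 2 * gnorm U (%x. g x - h x)"
proof -
 have *: "ennreal ((norm (a - c))\<^sup>2) <= 2 * ennreal ((norm (a - b))\<^sup>2) + 2 * ennreal ((norm (b - c))\<^sup>2)" for a b c :: 'b
 proof -
  have "norm (a - c) <= norm (a - b) + norm (b - c)"
   using norm_triangle_ineq[of "a - b" "b - c"] by simp
  then have "(norm (a - c))\<^sup>2 <= (norm (a - b) + norm (b - c))\<^sup>2" by (intro power_mono) auto
  also have "... <= 2 * (norm (a - b))\<^sup>2 + 2 * (norm (b - c))\<^sup>2"
   using zero_le_power2[of "norm (a - b) - norm (b - c)"] by (simp add: power2_eq_square algebra_simps)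
  finally have "ennreal ((norm (a - c))\<^sup>2) <= ennreal (2 * (norm (a - b))\<^sup>2 + 2 * (norm (b - c))\<^sup>2)" by (rule ennreal_leI)
  then show ?thesis by (simp add: ennreal_mult)
 qed
 have "gnorm U (%x. f x - h x) <= (\<N> x. 2 * (\<I> U x * ennreal ((norm (f x - g x))\<^sup>2))
  + 2 * (\<I> U x * ennreal ((norm (g x - h x))\<^sup>2)))"
  unfolding gnorm_def using * by (intro nn_integral_mono) (auto simp: indicator_def)
 then show ?thesis by (simp add: gnorm_def nn_integral_add nn_integral_cmult)
qed

lemma gnorm_minus_commute: "gnorm U (%x. f x - g x) = gnorm U (%x. g x - f x)"
 by (simp add: gnorm_def norm_minus_commute)

text \<open>In particular a function is close to its averages where it oscillates little.\<close>

lemma weighted_average_osc: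
 fixes f a :: "'a::euclidean_space => real"
 assumes [measurable]: "f \<in> \<B>" "a \<in> \<B>" "A \<in> sets borel" "B \<in> sets borel"
  and B: "bounded B" and a: "!!x. \<bar>a x\<bar> <= M * \<I> B x" and f: "integrable lborel (%x. a x * f x)"
 shows "gnorm A (%x. (LBINT y. a y) * f x - (LBINT y. a y * f y)) <= ennreal (M\<^sup>2 * measure lborel B) * osc A B f"
proof -
 have a0: "a x = 0" if "x \<notin> B" for x using a[of x] that by simp
 have a_int: "integrable lborel a"
 proof (rule Bochner_Integration.integrable_bound)
  show "integrable lborel (%x. M * \<I> B x)"
   using emeasure_bounded_finite[OF B] by (simp add: integrable_indicator_iff)
  show "AE x in lborel. norm (a x) <= norm (M * \<I> B x)"
   using a by (auto intro!: AE_I2 order_trans[OF _ abs_ge_self])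
 qed simp
 have a2: "(\<N> y. ennreal ((a y)\<^sup>2)) <= ennreal (M\<^sup>2 * measure lborel B)"
 proof -
  have "(\<N> y. ennreal ((a y)\<^sup>2)) <= (\<N> y. ennreal (M\<^sup>2) * \<I> B y)"
  proof (intro nn_integral_mono)
   fix y
   have "\<bar>a y\<bar>\<^sup>2 <= (M * \<I> B y)\<^sup>2" using a by (intro power_mono) auto
   then show "ennreal ((a y)\<^sup>2) <= ennreal (M\<^sup>2) * \<I> B y"
    using a0[of y] by (cases "y \<in> B") (auto intro: ennreal_leI)
  qed
  also have "... = ennreal (M\<^sup>2 * measure lborel B)"
   by (subst nn_integral_cmult_indicator) (simp_all add: emeasure_bounded_eq[OF B] ennreal_mult)
  finally show ?thesis .
 qed
 have pt: "ennreal (((LBINT y. a y) * f x - (LBINT y. a y * f y))\<^sup>2)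
  <= ennreal (M\<^sup>2 * measure lborel B) * (\<N> y. \<I> B y * ennreal ((f x - f y)\<^sup>2))" for x
 proof -
  have "(LBINT y. a y) * f x - (LBINT y. a y * f y) = (LBINT y. a y * f x - a y * f y)"
   using a_int f by simp
  also have "... = (LBINT y. a y * (\<I> B y * (f x - f y)))"
   using a0 by (intro Bochner_Integration.integral_cong) (auto simp: indicator_def algebra_simps)
  finally have "ennreal (((LBINT y. a y) * f x - (LBINT y. a y * f y))\<^sup>2)
   <= (\<N> y. ennreal ((a y)\<^sup>2)) * (\<N> y. ennreal ((\<I> B y * (f x - f y))\<^sup>2))"
   using Cauchy_Schwarz_integral[of a lborel "%y. \<I> B y * (f x - f y)"] by simp
  also have "(\<N> y. ennreal ((\<I> B y * (f x - f y))\<^sup>2)) = (\<N> y. \<I> B y * ennreal ((f x - f y)\<^sup>2))"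
   by (intro nn_integral_cong) (simp add: indicator_def)
  finally show ?thesis using a2 by (meson mult_right_mono order_trans zero_le)
 qed
 have "gnorm A (%x. (LBINT y. a y) * f x - (LBINT y. a y * f y))
  <= (\<N> x. \<I> A x * (ennreal (M\<^sup>2 * measure lborel B) * (\<N> y. \<I> B y * ennreal ((f x - f y)\<^sup>2))))"
  unfolding gnorm_def using pt by (intro nn_integral_mono mult_left_mono) auto
 also have "... = (\<N> x. ennreal (M\<^sup>2 * measure lborel B) * (\<N> y. \<I> A x * \<I> B y * ennreal ((f x - f y)\<^sup>2)))"
 proof (intro nn_integral_cong)
  fix x
  have "(\<N> y. \<I> A x * (\<I> B y * ennreal ((f x - f y)\<^sup>2)))
   = \<I> A x * (\<N> y. \<I> B y * ennreal ((f x - f y)\<^sup>2))"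
   by (rule nn_integral_cmult) measurable
  then show "\<I> A x * (ennreal (M\<^sup>2 * measure lborel B) * (\<N> y. \<I> B y * ennreal ((f x - f y)\<^sup>2)))
   = ennreal (M\<^sup>2 * measure lborel B) * (\<N> y. \<I> A x * \<I> B y * ennreal ((f x - f y)\<^sup>2))"
   by (simp add: mult_ac)
 qed
 also have "... = ennreal (M\<^sup>2 * measure lborel B) * osc A B f"
  unfolding osc_def by (rule nn_integral_cmult) measurable
 finally show ?thesis .
qed

lemma L2_integral_limit:
 fixes f :: "nat => 'a::euclidean_space => real"
 assumes [measurable]: "!!n. f n \<in> \<B>" "f0 \<in> \<B>" "\<psi> \<in> \<B>" "K \<in> sets borel"
  and K: "bounded K" "!!x. \<bar>\<psi> x\<bar> <= B * \<I> K x"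
  and i: "!!n. integrable lborel (%x. \<psi> x * f n x)" "integrable lborel (%x. \<psi> x * f0 x)"
  and lim: "(%n. gnorm K (%x. f n x - f0 x)) \<longlonglongrightarrow> 0"
 shows "(%n. \<integral>x. \<psi> x * f n x \<partial>lborel) \<longlonglongrightarrow> (LBINT x. \<psi> x * f0 x)"
proof -
 define D where "D n = (LBINT x. \<psi> x * f n x) - (LBINT x. \<psi> x * f0 x)" for n
 define c where "c = (\<N> x. ennreal ((\<psi> x)\<^sup>2))"
 have psi0: "\<psi> x = 0" if "x \<notin> K" for x using K(2)[of x] that by simp
 have "c <= (\<N> y. ennreal (B\<^sup>2) * \<I> K y)"
  unfolding c_def
 proof (intro nn_integral_mono)
  fix y
  have "\<bar>\<psi> y\<bar>\<^sup>2 <= (B * \<I> K y)\<^sup>2" using K by (intro power_mono) auto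
  then show "ennreal ((\<psi> y)\<^sup>2) <= ennreal (B\<^sup>2) * \<I> K y"
   using psi0[of y] by (cases "y \<in> K") (auto intro: ennreal_leI)
 qed
 also have "... < \<infinity>"
  by (subst nn_integral_cmult_indicator) (simp_all add: emeasure_bounded_eq[OF K(1)] ennreal_mult_less_top)
 finally have c: "c ~= \<infinity>" by simp
 have "ennreal ((D n)\<^sup>2) <= c * gnorm K (%x. f n x - f0 x)" for n
 proof -
  have "D n = (LBINT x. \<psi> x * (\<I> K x * (f n x - f0 x)))"
  proof -
   have "D n = (LBINT x. \<psi> x * f n x - \<psi> x * f0 x)" unfolding D_def using i by simp
   then show ?thesis using psi0
    by (simp add: indicator_def algebra_simps cong: if_cong) (intro Bochner_Integration.integral_cong, auto simp: indicator_def algebra_simps)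
  qed
  then have "ennreal ((D n)\<^sup>2) <= c * (\<N> x. ennreal ((\<I> K x * (f n x - f0 x))\<^sup>2))"
   unfolding c_def using Cauchy_Schwarz_integral[of \<psi> lborel "%x. \<I> K x * (f n x - f0 x)"] by simp
  also have "(\<N> x. ennreal ((\<I> K x * (f n x - f0 x))\<^sup>2)) = gnorm K (%x. f n x - f0 x)"
   unfolding gnorm_def by (intro nn_integral_cong) (simp add: indicator_def)
  finally show ?thesis .
 qed
 moreover have up: "(%n. c * gnorm K (%x. f n x - f0 x)) \<longlonglongrightarrow> 0"
  using ennreal_tendsto_cmult[OF _ lim, of c] c by (simp add: less_top)
 ultimately have "(%n. ennreal ((D n)\<^sup>2)) \<longlonglongrightarrow> 0"
  by (intro tendsto_sandwich[OF _ _ tendsto_const up]) (auto intro!: always_eventually)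
 then have "(%n. ennreal ((D n)\<^sup>2)) \<longlonglongrightarrow> ennreal 0" by simp
 then have "(%n. (D n)\<^sup>2) \<longlonglongrightarrow> 0" by (rule tendsto_ennrealD) auto
 from tendsto_real_sqrt[OF this] have "(%n. \<bar>D n\<bar>) \<longlonglongrightarrow> 0" by simp
 then have "D \<longlonglongrightarrow> 0" by (rule tendsto_rabs_zero_cancel)
 then show ?thesis unfolding D_def by (simp add: LIM_zero_iff)
qed

text \<open>A single member of the sequence within finite L2 distance of the limit on K passes its
  integrability on.\<close>

lemma loc_int_L2_limit:
 fixes f :: "nat => 'a::euclidean_space => 'b::euclidean_space"
 assumes [measurable]: "!!n. f n \<in> \<B>" "f0 \<in> \<B>"
  and f: "!!n. loc_int U (f n)"
  and lim: "!!K. compact K ==> K \<subseteq> U ==> (%n. gnorm K (%x. f n x - f0 x)) \<longlonglongrightarrow> 0"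
 shows "loc_int U f0"
 unfolding loc_int_def
proof safe
 fix K assume K: "compact K" "K \<subseteq> U"
 have "\<forall>\<^sub>F n in sequentially. gnorm K (%x. f n x - f0 x) < 1"
  using order_tendstoD(2)[OF lim[OF K]] by simp
 then obtain n where n: "gnorm K (%x. f n x - f0 x) < 1" by (auto simp: eventually_sequentially)
 have "loc_int K (%x. f n x - f0 x)"
 proof (rule square_integrable_imp_loc_int)
  fix K' assume "K' \<subseteq> K"
  then have "gnorm K' (%x. f n x - f0 x) < \<infinity>"
   using n gnorm_mono[of K' K "%x. f n x - f0 x"] by (auto simp: top.not_eq_extremum intro: le_less_trans order.strict_trans)
  then show "(\<N> x. \<I> K' x * ennreal ((norm (f n x - f0 x))\<^sup>2)) < \<infinity>" by (simp add: gnorm_def)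
 qed simp
 then have b: "set_integrable lborel K (%x. f n x - f0 x)" using K by (simp add: loc_int_def)
 have a: "set_integrable lborel K (f n)" using f[of n] K by (simp add: loc_int_def)
 from set_integral_diff(1)[OF a b] show "set_integrable lborel K f0" by simp
qed

lemma gnorm_inner_limit:
 assumes "(%n. gnorm K (%x. g n x - g0 x)) \<longlonglongrightarrow> 0"
  and [measurable]: "K \<in> sets borel" "!!n. g n \<in> \<B>" "g0 \<in> \<B>"
 shows "(%n. gnorm K (%x. g n x \<bullet> v - g0 x \<bullet> v)) \<longlonglongrightarrow> 0"
proof (rule tendsto_sandwich[OF _ _ tendsto_const])
 have "(%n. ennreal ((norm v)\<^sup>2) * gnorm K (%x. g n x - g0 x)) \<longlonglongrightarrow> ennreal ((norm v)\<^sup>2) * 0"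
  by (intro ennreal_tendsto_cmult assms) simp
 then show "(%n. ennreal ((norm v)\<^sup>2) * gnorm K (%x. g n x - g0 x)) \<longlonglongrightarrow> 0" by simp
 have "gnorm K (%x. g n x \<bullet> v - g0 x \<bullet> v) <= ennreal ((norm v)\<^sup>2) * gnorm K (%x. g n x - g0 x)" for n
 proof -
  have "gnorm K (%x. g n x \<bullet> v - g0 x \<bullet> v) <= (\<N> x. ennreal ((norm v)\<^sup>2) * (\<I> K x * ennreal ((norm (g n x - g0 x))\<^sup>2)))"
   unfolding gnorm_def
  proof (intro nn_integral_mono)
   fix x
   have "(g n x \<bullet> v - g0 x \<bullet> v)\<^sup>2 <= (norm v)\<^sup>2 * (norm (g n x - g0 x))\<^sup>2"
    using Cauchy_Schwarz_ineq[of "g n x - g0 x" v] by (simp add: inner_diff_left power2_norm_eq_inner mult.commute)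
   then show "\<I> K x * ennreal ((norm (g n x \<bullet> v - g0 x \<bullet> v))\<^sup>2)
    <= ennreal ((norm v)\<^sup>2) * (\<I> K x * ennreal ((norm (g n x - g0 x))\<^sup>2))"
    by (auto simp: indicator_def intro: ennreal_leI simp flip: ennreal_mult)
  qed
  also have "... = ennreal ((norm v)\<^sup>2) * gnorm K (%x. g n x - g0 x)"
   unfolding gnorm_def by (rule nn_integral_cmult) measurable
  finally show ?thesis .
 qed
 then show "\<forall>\<^sub>F n in sequentially. gnorm K (%x. g n x \<bullet> v - g0 x \<bullet> v) <= ennreal ((norm v)\<^sup>2) * gnorm K (%x. g n x - g0 x)"
  by (intro always_eventually) auto
qed auto

text \<open>Both sides of the weak equation are integrals against bounded functions of compact
  support, which local L2 convergence preserves.\<close>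

theorem wgrad_limit:
 fixes f :: "nat => 'a::euclidean_space => real"
 assumes w: "!!n. wgrad U (f n) (g n)"
  and [measurable]: "f0 \<in> \<B>" "g0 \<in> \<B>"
  and lf: "!!K. compact K ==> K \<subseteq> U ==> (%n. gnorm K (%x. f n x - f0 x)) \<longlonglongrightarrow> 0"
  and lg: "!!K. compact K ==> K \<subseteq> U ==> (%n. gnorm K (%x. g n x - g0 x)) \<longlonglongrightarrow> 0"
 shows "wgrad U f0 g0"
proof -
 note [measurable] = wgradD(1,2)[OF w]
 have l: "loc_int U f0" "loc_int U g0"
  by (rule loc_int_L2_limit[of f, OF _ _ wgradD(3)[OF w] lf] loc_int_L2_limit[of g, OF _ _ wgradD(4)[OF w] lg]; simp)+
 have "(LBINT x. (nabla \<phi> x \<bullet> v) * f0 x) = - (LBINT x. \<phi> x * (g0 x \<bullet> v))" if \<phi>: "\<phi> \<in> test_functions U" for \<phi> v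
 proof -
  note [measurable] = test_borel[OF \<phi>]
  obtain K B where K: "compact K" "K \<subseteq> U" "B > 0" "!!x. \<bar>\<phi> x\<bar> <= B * \<I> K x"
   "!!x. norm (nabla \<phi> x) <= B * \<I> K x" using test_bounded[OF \<phi>] by blast
  have [measurable]: "K \<in> sets borel" using K by (simp add: borel_compact)
  have K': "bounded K" using K by (simp add: compact_imp_bounded)
  have nb: "\<bar>nabla \<phi> x \<bullet> v\<bar> <= (B * norm v) * \<I> K x" for x
  proof -
   have "\<bar>nabla \<phi> x \<bullet> v\<bar> <= norm (nabla \<phi> x) * norm v" by (rule Cauchy_Schwarz_ineq2)
   also have "... <= (B * \<I> K x) * norm v" by (intro mult_right_mono K) simp
   finally show ?thesis by (simp add: mult_ac)
  qed
  have lim1: "(%n. \<integral>x. (nabla \<phi> x \<bullet> v) * f n x \<partial>lborel) \<longlonglongrightarrow> (LBINT x. (nabla \<phi> x \<bullet> v) * f0 x)"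
  proof (rule L2_integral_limit[OF _ _ _ _ K' nb _ _ lf[OF K(1,2)]])
   show "integrable lborel (%x. (nabla \<phi> x \<bullet> v) * f n x)" for n
    using loc_int_test[OF wgradD(3,1)[OF w] test_nabla_inner[OF \<phi>]] by simp
   show "integrable lborel (%x. (nabla \<phi> x \<bullet> v) * f0 x)"
    using loc_int_test[OF l(1) _ test_nabla_inner[OF \<phi>]] by simp
  qed simp_all
  have lim2: "(%n. \<integral>x. \<phi> x * (g n x \<bullet> v) \<partial>lborel) \<longlonglongrightarrow> (LBINT x. \<phi> x * (g0 x \<bullet> v))"
  proof (rule L2_integral_limit[OF _ _ _ _ K' K(4)])
   show "integrable lborel (%x. \<phi> x * (g n x \<bullet> v))" for n
    using loc_int_test[OF loc_int_inner[OF wgradD(4)[OF w]] _ \<phi>] by simp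
   show "integrable lborel (%x. \<phi> x * (g0 x \<bullet> v))"
    using loc_int_test[OF loc_int_inner[OF l(2)] _ \<phi>] by simp
   show "(%n. gnorm K (%x. g n x \<bullet> v - g0 x \<bullet> v)) \<longlonglongrightarrow> 0"
    by (rule gnorm_inner_limit[OF lg[OF K(1,2)]]) simp_all
  qed simp_all
  have "(%n. \<integral>x. (nabla \<phi> x \<bullet> v) * f n x \<partial>lborel) \<longlonglongrightarrow> - (LBINT x. \<phi> x * (g0 x \<bullet> v))"
   unfolding wgradD(5)[OF w \<phi>] by (rule tendsto_minus[OF lim2])
  then show ?thesis by (rule LIMSEQ_unique[OF lim1])
 qed
 then show ?thesis using l by (simp add: wgrad_def)
qed

text \<open>Discrete integration by parts: difference quotients are moved from the test function to
  f by a translation, and the Lipschitz bounds dominate them as the step tends to 0.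
  Differentiability almost everywhere is a hypothesis, because it is evident for the explicit
  profiles considered here.\<close>

theorem wgrad_lipschitz:
 fixes f :: "'a::euclidean_space => real" and g :: "'a => 'a"
 assumes lip: "!!x y. \<bar>f x - f y\<bar> <= L * norm (x - y)"
  and [measurable]: "g \<in> \<B>" and gL: "!!x. norm (g x) <= L"
  and D: "AE x in lborel. (f has_derivative (%v. g x \<bullet> v)) (at x)"
 shows "wgrad UNIV f g"
proof -
 have "L-lipschitz_on UNIV f"
  using order_trans[OF norm_ge_zero gL[of 0]] lip
  by (simp add: lipschitz_on_def dist_norm)
 then have cont: "continuous_on UNIV f" by (rule lipschitz_on_continuous_on)
 then have [measurable]: "f \<in> \<B>" by (rule borel_measurable_continuous_onI)
 have lf: "loc_int U f" for U unfolding loc_int_def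
 proof safe
  fix K :: "'a set" assume K: "compact K"
  show "set_integrable lborel K f"
   unfolding set_integrable_def
   by (rule borel_integrable_compact[OF K continuous_on_subset[OF cont]]) simp
 qed
 have lg: "loc_int UNIV g" using gL by (intro loc_int_bounded) auto
 have "(LBINT x. (nabla \<phi> x \<bullet> v) * f x) = - (LBINT x. \<phi> x * (g x \<bullet> v))" if \<phi>: "\<phi> \<in> test_functions UNIV" for \<phi> v
 proof -
  note [measurable] = test_borel[OF \<phi>]
  obtain K B where K0: "compact K" "K \<subseteq> UNIV" "B > 0" "!!x. \<bar>\<phi> x\<bar> <= B * \<I> K x"
   "!!x. norm (nabla \<phi> x) <= B * \<I> K x" using test_bounded[OF \<phi>] by blast
  note K = K0(1,3,4,5)
  define h where "h n = inverse (real (Suc n))" for n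
  have h: "h n > 0" "h n <= 1" for n by (auto simp: h_def field_simps)
  have hlim: "h \<longlonglongrightarrow> 0" unfolding h_def[abs_def] by (rule LIMSEQ_inverse_real_of_nat)
  have quot: "(%n. (F (x + h n *\<^sub>R w) - F x) / h n) \<longlonglongrightarrow> F' w"
   if "(F has_derivative F') (at x)" for F :: "'a => real" and F' x w
  proof -
   have "((%t. F (x + t *\<^sub>R w)) has_derivative (%t. F' (t *\<^sub>R w))) (at 0)"
    by (rule has_derivative_compose[of "%t. x + t *\<^sub>R w", where s=UNIV and x=0, simplified])
     (auto intro!: derivative_eq_intros that)
   then have "((%t. F (x + t *\<^sub>R w)) has_real_derivative F' w) (at 0)"
   proof -
    have "(%t. F' (t *\<^sub>R w)) = (*) (F' w)"
     using linear_simps(5)[OF has_derivative_bounded_linear[OF that]] by (auto simp: mult.commute)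
    then show ?thesis using \<open>((%t. F (x + t *\<^sub>R w)) has_derivative _) (at 0)\<close> by (simp add: has_field_derivative_def)
   qed
   then have "((%t. (F (x + t *\<^sub>R w) - F x) / t) \<longlongrightarrow> F' w) (at 0)"
    by (simp add: DERIV_def)
   moreover have "filterlim h (at 0) sequentially"
    using hlim h(1) by (simp add: filterlim_at less_imp_neq[symmetric])
   ultimately show ?thesis by (rule filterlim_compose)
  qed
  \<comment> \<open>One compact set for all steps: it contains the supports of \<phi> and of
    \<open>\<phi> (x + h n *\<^sub>R v)\<close> for every n.\<close>
  define K' where "K' = {x + t *\<^sub>R (- v) | x t. x \<in> K & t \<in> {0..1::real}}"
  have K': "compact K'" unfolding K'_def by (rule compact_segment_translates[OF K(1)])
  have [measurable]: "K' \<in> sets borel" "K \<in> sets borel" using K' K by (auto intro: borel_compact)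
  have KK': "K \<subseteq> K'" unfolding K'_def by force
  have out: "\<phi> (x + h n *\<^sub>R v) - \<phi> x = 0" if "x \<notin> K'" for x n
  proof -
   have "x + h n *\<^sub>R v \<notin> K"
   proof
    assume "x + h n *\<^sub>R v \<in> K"
    moreover have "x = (x + h n *\<^sub>R v) + h n *\<^sub>R (- v)" by simp
    moreover have "h n \<in> {0..1}" using h[of n] by auto
    ultimately have "x \<in> K'" unfolding K'_def by blast
    then show False using that by simp
   qed
   moreover have "x \<notin> K" using that KK' by auto
   ultimately show ?thesis using K(3)[of x] K(3)[of "x + h n *\<^sub>R v"] by simp
  qed
  have lipphi: "\<bar>\<phi> x - \<phi> y\<bar> <= B * norm (x - y)" for x y
  proof -
   have "norm (\<phi> x - \<phi> y) <= B * norm (x - y)"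
   proof (rule differentiable_bound[of UNIV \<phi> "%x v. nabla \<phi> x \<bullet> v"])
    fix z
    show "(\<phi> has_derivative (%v. nabla \<phi> z \<bullet> v)) (at z within UNIV)"
     using nabla_has_derivative[OF smooth_differentiable[OF test_smooth[OF \<phi>]]] by simp
    have "norm (nabla \<phi> z) <= B" using K(4)[of z] K(2) by (cases "z \<in> K") auto
    then show "onorm (%v. nabla \<phi> z \<bullet> v) <= B"
     using order_trans[OF Cauchy_Schwarz_ineq2 mult_right_mono[OF _ norm_ge_zero]]
     by (intro onorm_bound) (auto simp: K(2) less_imp_le)
   qed auto
   then show ?thesis by simp
  qed
  define A where "A n x = (\<phi> (x + h n *\<^sub>R v) - \<phi> x) / h n * f x" for n x
  define A' where "A' n x = \<phi> x * ((f (x + h n *\<^sub>R (- v)) - f x) / h n)" for n x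
  have eq: "(LBINT x. A n x) = (LBINT x. A' n x)" for n
  proof -
   have c: "continuous_on UNIV (%x. \<phi> x * f (x + w))" for w
    by (intro continuous_intros smooth_continuous test_smooth[OF \<phi>] continuous_on_compose2[OF cont]) auto
   have i1: "integrable lborel (%x. \<phi> x * f (x + w))" for w
   proof -
    have "set_integrable lborel K (%x. \<phi> x * f (x + w))"
     unfolding set_integrable_def
     by (rule borel_integrable_compact[OF K(1) continuous_on_subset[OF c]]) simp
    moreover have "\<I> K x *\<^sub>R (\<phi> x * f (x + w)) = \<phi> x * f (x + w)" for x
     using K(3)[of x] by (cases "x \<in> K") auto
    ultimately show ?thesis by (simp only: set_integrable_def)
   qed
   have i2: "integrable lborel (%x. \<phi> (x + h n *\<^sub>R v) * f x)"
    using integrable_shift[OF i1[of "- (h n *\<^sub>R v)"], of "h n *\<^sub>R v"] by simp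
   have "(LBINT x. \<phi> (x + h n *\<^sub>R v) * f x) = (LBINT x. \<phi> x * f (x + h n *\<^sub>R (- v)))"
    using integral_shift[of "%x. \<phi> x * f (x - h n *\<^sub>R v)" "h n *\<^sub>R v"] by simp
   moreover have "(LBINT x. A n x) = ((LBINT x. \<phi> (x + h n *\<^sub>R v) * f x) - (LBINT x. \<phi> x * f x)) / h n"
    unfolding A_def using i2 i1[of 0] by (simp add: left_diff_distrib diff_divide_distrib)
   moreover have "(LBINT x. A' n x) = ((LBINT x. \<phi> x * f (x + h n *\<^sub>R (- v))) - (LBINT x. \<phi> x * f x)) / h n"
    unfolding A'_def using i1[of "h n *\<^sub>R (- v)"] i1[of 0] by (simp add: right_diff_distrib diff_divide_distrib)
   ultimately show ?thesis by simp
  qed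
  have "(%n. \<integral>x. A n x \<partial>lborel) \<longlonglongrightarrow> (LBINT x. (nabla \<phi> x \<bullet> v) * f x)"
  proof (rule integral_dominated_convergence[where w="%x. (B * norm v) * \<bar>\<I> K' x * f x\<bar>"])
   show "integrable lborel (%x. (B * norm v) * \<bar>\<I> K' x * f x\<bar>)"
    using lf[of UNIV] K' by (intro integrable_mult_right integrable_abs) (auto simp: loc_int_def set_integrable_def)
   show "AE x in lborel. (%n. A n x) \<longlonglongrightarrow> (nabla \<phi> x \<bullet> v) * f x"
    unfolding A_def
    by (intro AE_I2 tendsto_mult tendsto_const quot nabla_has_derivative smooth_differentiable test_smooth[OF \<phi>])
   show "AE x in lborel. norm (A n x) <= (B * norm v) * \<bar>\<I> K' x * f x\<bar>" for n
   proof (rule AE_I2)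
    fix x
    show "norm (A n x) <= (B * norm v) * \<bar>\<I> K' x * f x\<bar>"
    proof (cases "x \<in> K'")
     case True
     have "\<bar>\<phi> (x + h n *\<^sub>R v) - \<phi> x\<bar> / h n <= B * norm v"
      using lipphi[of "x + h n *\<^sub>R v" x] h[of n] by (simp add: field_simps)
     then have "\<bar>\<phi> (x + h n *\<^sub>R v) - \<phi> x\<bar> / h n * \<bar>f x\<bar> <= (B * norm v) * \<bar>f x\<bar>"
      by (rule mult_right_mono) simp
     then show ?thesis using True h[of n] by (simp add: A_def abs_mult)
    qed (simp add: A_def out)
   qed
  qed (simp_all add: A_def)
  moreover have "(%n. \<integral>x. A' n x \<partial>lborel) \<longlonglongrightarrow> (LBINT x. \<phi> x * (g x \<bullet> (- v)))"
  proof (rule integral_dominated_convergence[where w="%x. (L * norm v) * (B * \<I> K x)"])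
   show "integrable lborel (%x. (L * norm v) * (B * \<I> K x))"
    using emeasure_compact_finite[OF K(1)] by (simp add: integrable_indicator_iff)
   show "AE x in lborel. (%n. A' n x) \<longlonglongrightarrow> \<phi> x * (g x \<bullet> (- v))"
    using D
   proof eventually_elim
    fix x assume "(f has_derivative (%v. g x \<bullet> v)) (at x)"
    then show "(%n. A' n x) \<longlonglongrightarrow> \<phi> x * (g x \<bullet> (- v))"
     unfolding A'_def by (intro tendsto_mult tendsto_const quot)
   qed
   show "AE x in lborel. norm (A' n x) <= (L * norm v) * (B * \<I> K x)" for n
   proof (rule AE_I2)
    fix x
    have "\<bar>f (x + h n *\<^sub>R (- v)) - f x\<bar> / h n <= L * norm v"
     using lip[of "x + h n *\<^sub>R (- v)" x] h[of n] by (simp add: field_simps)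
    then have "\<bar>f (x + h n *\<^sub>R (- v)) - f x\<bar> / h n * \<bar>\<phi> x\<bar> <= (L * norm v) * (B * \<I> K x)"
     using K(3)[of x] h[of n] order_trans[OF norm_ge_zero gL[of 0]] by (intro mult_mono) auto
    then show "norm (A' n x) <= (L * norm v) * (B * \<I> K x)"
     using h[of n] by (simp add: A'_def abs_mult mult.commute)
   qed
  qed (simp_all add: A'_def)
  ultimately have "(LBINT x. (nabla \<phi> x \<bullet> v) * f x) = (LBINT x. \<phi> x * (g x \<bullet> (- v)))"
   unfolding eq by (rule LIMSEQ_unique)
  then show ?thesis by simp
 qed
 then show ?thesis using lf lg by (simp add: wgrad_def)
qed

lemma wgrad_const: "wgrad U (%x. c) (%x. 0)"
 by (rule wgrad_subset[OF wgrad_lipschitz[where L=0]]) auto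

text \<open>Potentials are fixed only up to constants and need not converge. Normalised to mean zero
  over the first ball, they form a Cauchy sequence on every ball by the Poincare inequality, and
  their local limit is a potential for H.\<close>

theorem gradients_closed:
 fixes H :: "'a::euclidean_space => 'a"
 assumes w: "!!n. wgrad UNIV (u n) (Hs n)" and [measurable]: "H \<in> \<B>"
  and lim: "(%n. gnorm UNIV (%x. Hs n x - H x)) \<longlonglongrightarrow> 0"
 obtains u0 where "wgrad UNIV u0 H"
proof -
 note [measurable] = wgradD(1,2)[OF w]
 define K :: "nat => 'a set" where "K j = cball 0 (real j + 1)" for j
 have K: "compact (K j)" "bounded (K j)" and [measurable]: "K j \<in> sets borel" for j by (auto simp: K_def)
 have Kmono: "K i \<subseteq> K j" if "i <= j" for i j using that by (auto simp: K_def)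
 have "\<exists>c\<ge>0. \<forall>f g. wgrad UNIV f g --> osc (K j \<inter> UNIV) (K j \<inter> UNIV) f <= ennreal c * gnorm UNIV g" for j
  by (rule poincare[OF open_UNIV connected_UNIV K(1)]) auto
 then obtain c where c: "!!j. c j >= 0" "!!j f g. wgrad UNIV f g ==> osc (K j) (K j) f <= ennreal (c j) * gnorm UNIV g"
  by (metis Int_UNIV_right)
 define \<mu> where "\<mu> = measure lborel (K 0)"
 have mu: "\<mu> > 0" unfolding \<mu>_def K_def by simp
 define av where "av n = (LBINT x. \<I> (K 0) x * u n x) / \<mu>" for n
 define v where "v n x = u n x - av n" for n x
 have wv: "wgrad UNIV (v n) (Hs n)" for n
  using wgrad_diff[OF w wgrad_const] by (simp add: v_def[abs_def])
 note [measurable] = wgradD(1)[OF wv]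
 have iu: "integrable lborel (%x. \<I> (K 0) x * u n x)" for n
  using wgradD(3)[OF w, of n] K(1)[of 0] by (simp add: loc_int_def set_integrable_def)
 have est: "gnorm (K j) (%x. v n x - v m x) <= ennreal (c j / \<mu>) * gnorm UNIV (%x. Hs n x - Hs m x)" for j n m
 proof -
  define f where "f x = u n x - u m x" for x
  have wf: "wgrad UNIV f (%x. Hs n x - Hs m x)" unfolding f_def[abs_def] by (rule wgrad_diff[OF w w])
  note [measurable] = wgradD(1)[OF wf]
  have "(LBINT x. \<I> (K 0) x * f x) = \<mu> * (av n - av m)"
   using iu mu by (simp add: f_def av_def right_diff_distrib)
  moreover have "(LBINT y. \<I> (K 0) y) = \<mu>" by (simp add: \<mu>_def)
  ultimately have "gnorm (K j) (%x. \<mu> * f x - \<mu> * (av n - av m)) <= ennreal (1\<^sup>2 * \<mu>) * osc (K j) (K 0) f"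
   using weighted_average_osc[of f "\<I> (K 0)" "K j" "K 0" 1] iu[of n] iu[of m]
   by (simp add: f_def right_diff_distrib K \<mu>_def)
  also have "gnorm (K j) (%x. \<mu> * f x - \<mu> * (av n - av m)) = ennreal (\<mu>\<^sup>2) * gnorm (K j) (%x. v n x - v m x)"
  proof -
   have "\<I> (K j) x * ennreal ((norm (\<mu> * f x - \<mu> * (av n - av m)))\<^sup>2)
    = ennreal (\<mu>\<^sup>2) * (\<I> (K j) x * ennreal ((norm (v n x - v m x))\<^sup>2))" for x
   proof -
    have "\<mu> * f x - \<mu> * (av n - av m) = \<mu> * (v n x - v m x)" by (simp add: f_def v_def algebra_simps)
    then show ?thesis by (simp add: power_mult_distrib ennreal_mult indicator_def)
   qed
   then show ?thesis unfolding gnorm_def by (simp add: nn_integral_cmult)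
  qed
  also have "ennreal (1\<^sup>2 * \<mu>) * osc (K j) (K 0) f <= ennreal \<mu> * (ennreal (c j) * gnorm UNIV (%x. Hs n x - Hs m x))"
   using osc_mono[of "K j" "K j" "K 0" "K j" f] Kmono[of 0 j] c(2)[OF wf, of j]
   by (simp add: mult_left_mono order_trans[of "osc (K j) (K 0) f"])
  finally have "ennreal (1 / \<mu>\<^sup>2) * (ennreal (\<mu>\<^sup>2) * gnorm (K j) (%x. v n x - v m x))
   <= ennreal (1 / \<mu>\<^sup>2) * (ennreal \<mu> * (ennreal (c j) * gnorm UNIV (%x. Hs n x - Hs m x)))"
   by (rule mult_left_mono) simp
  moreover have "ennreal (1 / \<mu>\<^sup>2) * ennreal (\<mu>\<^sup>2) = 1" using mu by (simp flip: ennreal_mult)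
  moreover have "ennreal (1 / \<mu>\<^sup>2) * ennreal \<mu> * ennreal (c j) = ennreal (c j / \<mu>)"
   using mu c(1)[of j] by (simp add: power2_eq_square flip: ennreal_mult)
  ultimately show ?thesis by (simp only: mult.assoc[symmetric] mult_1)
 qed
 have cau: "\<exists>N. \<forall>n\<ge>N. \<forall>m\<ge>N. gnorm (K j) (%x. v n x - v m x) <= ennreal \<epsilon>" if "\<epsilon> > 0" for j \<epsilon>
 proof -
  define q where "q = c j / \<mu>"
  \<comment> \<open>Chosen so that \<open>q * (4 * \<delta>)\<close> is at most \<epsilon>; the
    factor 4 comes from the triangle inequality for squares, and \<open>q + 1\<close> keeps the
    denominator positive.\<close>
  define \<delta> where "\<delta> = (\<epsilon> / 4) / (q + 1)"
  have cm: "q >= 0" using c(1)[of j] mu by (simp add: q_def)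
  then have "\<delta> > 0" using that by (simp add: \<delta>_def)
  then have "\<forall>\<^sub>F n in sequentially. gnorm UNIV (%x. Hs n x - H x) < ennreal \<delta>"
   by (intro order_tendstoD(2)[OF lim]) simp
  then obtain N where N: "!!n. n >= N ==> gnorm UNIV (%x. Hs n x - H x) < ennreal \<delta>"
   by (auto simp: eventually_sequentially)
  have "gnorm (K j) (%x. v n x - v m x) <= ennreal \<epsilon>" if "n >= N" "m >= N" for n m
  proof -
   have "gnorm UNIV (%x. Hs n x - Hs m x) <= 2 * gnorm UNIV (%x. Hs n x - H x) + 2 * gnorm UNIV (%x. H x - Hs m x)"
    by (rule gnorm_triangle) measurable
   also have "... <= 2 * ennreal \<delta> + 2 * ennreal \<delta>"
    using N[OF that(1)] N[OF that(2)] unfolding gnorm_minus_commute[of UNIV H]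
    by (intro add_mono mult_left_mono) auto
   also have "... = ennreal (4 * \<delta>)" using \<open>\<delta> > 0\<close> by (simp add: ennreal_mult flip: distrib_right)
   finally have "gnorm (K j) (%x. v n x - v m x) <= ennreal q * ennreal (4 * \<delta>)"
    using est[of j n m] unfolding q_def by (meson mult_left_mono order_trans zero_le)
   also have "... = ennreal (q * (4 * \<delta>))" using cm \<open>\<delta> > 0\<close> by (intro ennreal_mult[symmetric]) auto
   also have "q * (4 * \<delta>) <= (q + 1) * (4 * \<delta>)" using \<open>\<delta> > 0\<close> by (intro mult_right_mono) auto
   also have "... = 4 * ((q + 1) * \<delta>)" by (rule mult.left_commute)
   also have "(q + 1) * \<delta> = \<epsilon> / 4"
   proof -
    have "q + 1 ~= 0" using cm by linarith
    from nonzero_eq_divide_eq[OF this, of \<delta> "\<epsilon> / 4"] have "\<delta> * (q + 1) = \<epsilon> / 4" unfolding \<delta>_def by blast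
    then show ?thesis by (simp only: mult.commute)
   qed
   also have "4 * (\<epsilon> / 4) = \<epsilon>" by simp
   finally show ?thesis by (simp add: ennreal_leI)
  qed
  then show ?thesis by blast
 qed
 have K1: "K j \<in> sets borel" "K j \<subseteq> K (Suc j)" for j using Kmono[of j "Suc j"] by simp_all
 obtain r G where "strict_mono (r :: nat => nat)" and G: "G \<in> \<B>"
  "AE x in lborel. x \<in> (\<Union>j. K j) --> (%n. v (r n) x) \<longlonglongrightarrow> G x"
  "!!j. (%n. gnorm (K j) (%x. v n x - G x)) \<longlonglongrightarrow> 0"
  using locally_L2_Cauchy[of v K, OF wgradD(1)[OF wv] K1 cau] by blast
 note [measurable] = G(1)
 have sub0: "(%n. gnorm A (F n)) \<longlonglongrightarrow> 0" if "(%n. gnorm B (F n)) \<longlonglongrightarrow> 0" "A \<subseteq> B"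
  for A B :: "'a set" and F :: "nat => 'a => 'c::euclidean_space"
  by (rule tendsto_sandwich[OF _ _ tendsto_const that(1)]) (auto intro!: always_eventually gnorm_mono that(2))
 have "wgrad UNIV G H"
 proof (rule wgrad_limit[OF wv])
  fix L :: "'a set" assume "compact L"
  then obtain B where B: "!!x. x \<in> L ==> norm x <= B" by (meson bounded_iff compact_imp_bounded)
  obtain j :: nat where "B <= real j" using real_arch_simple by blast
  then have "L \<subseteq> K j" using B by (force simp: K_def)
  then show "(%n. gnorm L (%x. v n x - G x)) \<longlonglongrightarrow> 0" by (rule sub0[OF G(3)])
  show "(%n. gnorm L (%x. Hs n x - H x)) \<longlonglongrightarrow> 0" by (rule sub0[OF lim]) simp
 qed simp_all
 then show thesis by (rule that)
qed

section \<open>Compactness\<close>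

text \<open>Averages against the Lipschitz tent kernel converge at all points once they converge at
 the points of a countable dense set; by the translation bound they approximate
 the functions themselves.\<close>

definition tent :: "real => 'a::euclidean_space => real" where
 "tent \<rho> y = max 0 (1 - norm y / \<rho>)"

lemma tent_facts:
 assumes "\<rho> > 0"
 shows "0 <= tent \<rho> y" "tent \<rho> y <= 1" "norm y >= \<rho> ==> tent \<rho> y = 0"
  "\<bar>tent \<rho> y - tent \<rho> z\<bar> <= norm (y - z) / \<rho>"
proof -
 show "\<bar>tent \<rho> y - tent \<rho> z\<bar> <= norm (y - z) / \<rho>"
 proof -
  have "\<bar>norm y / \<rho> - norm z / \<rho>\<bar> = \<bar>norm y - norm z\<bar> / \<rho>" using assms by (simp flip: diff_divide_distrib)
  also have "... <= norm (y - z) / \<rho>" using assms norm_triangle_ineq3[of y z] by (intro divide_right_mono) auto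
  finally show ?thesis unfolding tent_def by (auto simp: max_def abs_if split: if_splits)
 qed
qed (use assms in \<open>auto simp: tent_def\<close>)

lemma tent_borel [measurable]: "tent \<rho> \<in> \<B>"
 unfolding tent_def[abs_def] by measurable

lemma tent_integral_pos:
 assumes "\<rho> > 0" shows "(LBINT y. tent \<rho> (y::'a::euclidean_space)) > 0" "integrable lborel (tent \<rho> :: 'a => real)"
proof -
 show i: "integrable lborel (tent \<rho> :: 'a => real)"
 proof (rule Bochner_Integration.integrable_bound)
  show "integrable lborel (\<I> (cball (0::'a) \<rho>) :: 'a => real)"
   using emeasure_compact_finite[of "cball (0::'a) \<rho>"] by (simp add: integrable_indicator_iff borel_closed)
  show "AE x in lborel. norm (tent \<rho> x) <= norm (\<I> (cball (0::'a) \<rho>) x :: real)"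
   using tent_facts[where 'a='a, OF assms] by (intro AE_I2) (auto simp: indicator_def abs_of_nonneg)
 qed simp
 have "0 < (1/2) * measure lborel (ball (0::'a) (\<rho> / 2))" using assms by simp
 also have "... = (LBINT y. (1/2) * \<I> (ball (0::'a) (\<rho> / 2)) y)" by simp
 also have "... <= (LBINT y. tent \<rho> (y::'a))"
 proof (rule integral_mono[OF _ i])
  show "integrable lborel (%y. (1/2) * \<I> (ball (0::'a) (\<rho> / 2)) y :: real)"
   using emeasure_bounded_finite[OF bounded_ball, of "0::'a" "\<rho>/2"] by (simp add: integrable_indicator_iff)
  fix y :: 'a
  show "(1/2) * \<I> (ball (0::'a) (\<rho> / 2)) y <= tent \<rho> y"
   using assms by (auto simp: tent_def indicator_def max_def field_simps)
 qed
 finally show "(LBINT y. tent \<rho> (y::'a)) > 0" .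
qed

text \<open>A criterion of Riesz-Kolmogorov type. Boundedness makes the averages of one radius
  Lipschitz uniformly in n; the hypothesis on translations makes the functions uniformly close to
  these averages on sets with a neighbourhood in U.\<close>

theorem translation_compactness:
 fixes f :: "nat => 'a::euclidean_space => 'b::euclidean_space"
 assumes U: "open U" and f [measurable]: "!!n. f n \<in> \<B>" and bd: "!!n x. norm (f n x) <= 1"
  and C: "C >= 0" and tr: "!!n A v. A \<in> sets borel ==> (!!x t. x \<in> A ==> t \<in> {0..1} ==> x + t *\<^sub>R v \<in> U) ==>
   gnorm A (%x. f n (x + v) - f n x) <= ennreal (C * (norm v)\<^sup>2)"
 obtains r g where "strict_mono (r :: nat => nat)" "g \<in> \<B>"
  "AE x in lborel. x \<in> U --> (%n. f (r n) x) \<longlonglongrightarrow> g x"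
proof -
 define \<rho> where "\<rho> j = inverse (real (Suc j))" for j
 have rho: "\<rho> j > 0" "\<rho> j <= 1" for j by (auto simp: \<rho>_def field_simps)
 have rholim: "\<rho> \<longlonglongrightarrow> 0" unfolding \<rho>_def[abs_def] by (rule LIMSEQ_inverse_real_of_nat)
 define a where "a j n x = (LBINT y. tent (\<rho> j) (y - x) *\<^sub>R f n y)" for j n x
 have [measurable]: "a j n \<in> \<B>" for j n unfolding a_def[abs_def] by measurable
 define c where "c j = (LBINT y. tent (\<rho> j) (y::'a))" for j
 have c: "c j > 0" for j unfolding c_def by (rule tent_integral_pos[OF rho(1)])
 have tshift: "integrable lborel (%y. tent (\<rho> j) (y - x))" "(LBINT y. tent (\<rho> j) (y - x)) = c j" for j and x :: 'a
  using integrable_shift[OF tent_integral_pos(2)[OF rho(1)[of j]], of "- x"] integral_shift[of "tent (\<rho> j)" "- x"]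
  by (simp_all add: c_def)
 have ai: "integrable lborel (%y. tent (\<rho> j) (y - x) *\<^sub>R f n y)" for j n x
  by (rule Bochner_Integration.integrable_bound[OF tshift(1)[of j x]])
   (use tent_facts(1)[where 'a='a, OF rho(1)] bd in \<open>auto simp: mult_left_le\<close>)
 have a_bd: "norm (a j n x) <= c j" for j n x
 proof -
  have "norm (a j n x) <= (LBINT y. norm (tent (\<rho> j) (y - x) *\<^sub>R f n y))" unfolding a_def by (rule integral_norm_bound)
  also have "... <= (LBINT y. tent (\<rho> j) (y - x))"
   using ai tshift(1) tent_facts(1)[where 'a='a, OF rho(1)] bd by (intro integral_mono integrable_norm) (auto simp: mult_left_le abs_of_nonneg)
  finally show ?thesis by (simp add: tshift)
 qed
 define V where "V = measure lborel (cball (0::'a) 2)"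
 \<comment> \<open>For \<open>norm (x - z) <= 1\<close> both kernels are supported in the ball of
   radius 2 about x, because \<open>\<rho> j <= 1\<close>; so one volume V serves all points and all
   radii.\<close>
 have a_lip: "norm (a j n x - a j n z) <= V / \<rho> j * norm (x - z)" if xz: "norm (x - z) <= 1" for j n x z
 proof -
  have Vx: "measure lborel (cball x 2) = V" by (simp add: V_def content_cball)
  have ib: "integrable lborel (%y. norm (x - z) / \<rho> j * \<I> (cball x 2) y)"
   using emeasure_compact_finite[OF compact_cball, of x 2] by (simp add: integrable_indicator_iff borel_closed)
  have "a j n x - a j n z = (LBINT y. tent (\<rho> j) (y - x) *\<^sub>R f n y - tent (\<rho> j) (y - z) *\<^sub>R f n y)"
   unfolding a_def using ai by simp
  then have "norm (a j n x - a j n z) <= (LBINT y. norm (tent (\<rho> j) (y - x) *\<^sub>R f n y - tent (\<rho> j) (y - z) *\<^sub>R f n y))"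
   by (simp add: integral_norm_bound)
  also have "... <= (LBINT y. norm (x - z) / \<rho> j * \<I> (cball x 2) y)"
  proof (rule integral_mono[OF integrable_norm[OF Bochner_Integration.integrable_diff[OF ai ai]] ib])
   fix y
   have "norm (tent (\<rho> j) (y - x) *\<^sub>R f n y - tent (\<rho> j) (y - z) *\<^sub>R f n y) = \<bar>tent (\<rho> j) (y - x) - tent (\<rho> j) (y - z)\<bar> * norm (f n y)"
    by (simp flip: scaleR_diff_left)
   also have "... <= \<bar>tent (\<rho> j) (y - x) - tent (\<rho> j) (y - z)\<bar>" using bd by (simp add: mult_left_le)
   also have "... <= norm (x - z) / \<rho> j * \<I> (cball x 2) y"
   proof (cases "y \<in> cball x 2")
    case True
    then show ?thesis using tent_facts(4)[where 'a='a, OF rho(1)[of j], of "y - x" "y - z"] by (simp add: norm_minus_commute)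
   next
    case False
    then have "norm (y - x) > 2" by (simp add: dist_norm norm_minus_commute)
    moreover have "norm (y - z) >= norm (y - x) - norm (x - z)"
     using norm_triangle_ineq4[of "y - z" "x - z"] by simp
    ultimately have "norm (y - x) >= \<rho> j" "norm (y - z) >= \<rho> j" using xz rho(2)[of j] by linarith+
    then show ?thesis using False tent_facts(3)[where 'a='a, OF rho(1)] by simp
   qed
   finally show "norm (tent (\<rho> j) (y - x) *\<^sub>R f n y - tent (\<rho> j) (y - z) *\<^sub>R f n y) <= norm (x - z) / \<rho> j * \<I> (cball x 2) y" .
  qed
  also have "... = V / \<rho> j * norm (x - z)" by (simp add: Vx)
  finally show ?thesis .
 qed
 obtain D :: "'a set" where D: "countable D" "!!X. open X ==> X ~= {} ==> \<exists>d\<in>D. d \<in> X"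
  using countable_dense_setE by blast
 have "c j <= V" for j
 proof -
  have "c j <= (LBINT y. \<I> (cball (0::'a) 2) y)"
   unfolding c_def
  proof (rule integral_mono[OF tent_integral_pos(2)[OF rho(1)]])
   show "integrable lborel (\<I> (cball (0::'a) 2) :: 'a => real)"
    using emeasure_compact_finite[of "cball (0::'a) 2"] by (simp add: integrable_indicator_iff borel_closed)
   fix y :: 'a
   show "tent (\<rho> j) y <= \<I> (cball 0 2) y"
    using tent_facts[where 'a='a, OF rho(1)[of j], of y] rho(2)[of j] by (cases "norm y <= 2") auto
  qed
  then show ?thesis by (simp add: V_def)
 qed
 then have "norm (a j n q) <= V" for j n q using order_trans[OF a_bd[of j n q]] by blast
 then have bdV: "!!n p. p \<in> UNIV \<times> D ==> norm (a (fst p) n (snd p)) <= V" by simp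
 have cnt: "countable ((UNIV :: nat set) \<times> D)" using D(1) by simp
 \<comment> \<open>A diagonal argument over the countable set of pairs of a radius and a point of
   the dense set.\<close>
 obtain s where s: "strict_mono (s :: nat => nat)"
   "!!p. p \<in> UNIV \<times> D ==> \<exists>l. (%n. a (fst p) (s n) (snd p)) \<longlonglongrightarrow> l"
  using function_convergent_subsequence[OF cnt, where f="%n p. a (fst p) n (snd p)" and M=V, OF bdV] by blast
 have conv: "convergent (%n. a j (s n) x)" for j x
 proof (rule Cauchy_convergent, rule CauchyI)
  fix e :: real assume e: "e > 0"
  define \<delta> where "\<delta> = min 1 (e / (3 * (V / \<rho> j + 1)))"
  have V0: "V / \<rho> j >= 0" using rho(1)[of j] by (simp add: V_def)
  then have d: "\<delta> > 0" "\<delta> <= 1" using e by (auto simp: \<delta>_def)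
  obtain q where q: "q \<in> D" "q \<in> ball x \<delta>" using D(2)[of "ball x \<delta>"] d by auto
  have xq: "norm (a j n x - a j n q) < e / 3" for n
  proof -
   have n: "norm (x - q) < \<delta>" using q by (simp add: dist_norm)
   then have "norm (a j n x - a j n q) <= V / \<rho> j * norm (x - q)" using d by (intro a_lip) auto
   also have "... <= (V / \<rho> j + 1) * norm (x - q)" by (intro mult_right_mono) auto
   also have "... < (V / \<rho> j + 1) * \<delta>" using n V0 by (intro mult_strict_left_mono) auto
   also have "... <= (V / \<rho> j + 1) * (e / (3 * (V / \<rho> j + 1)))" using V0 by (intro mult_left_mono) (auto simp: \<delta>_def)
   also have "... = e / 3"
   proof -
    have "t * (e / (3 * t)) = e / 3" if "t ~= 0" for t :: real using that by simp
    from this[of "V / \<rho> j + 1"] show ?thesis using V0 by linarith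
   qed
   finally show ?thesis .
  qed
  have "Cauchy (%n. a j (s n) q)" using s(2)[of "(j, q)"] q by (auto intro: LIMSEQ_imp_Cauchy)
  then obtain M where M: "!!m n. m >= M ==> n >= M ==> norm (a j (s m) q - a j (s n) q) < e / 3"
   using e CauchyD[of "%n. a j (s n) q" "e / 3"] by auto
  have "norm (a j (s m) x - a j (s n) x) < e" if "m >= M" "n >= M" for m n
  proof -
   have "a j (s m) x - a j (s n) x = (a j (s m) x - a j (s m) q) + (a j (s m) q - a j (s n) q) - (a j (s n) x - a j (s n) q)" by simp
   then have "norm (a j (s m) x - a j (s n) x) <= norm (a j (s m) x - a j (s m) q) + norm (a j (s m) q - a j (s n) q) + norm (a j (s n) x - a j (s n) q)"
    by (metis (no_types, lifting) norm_triangle_ineq norm_triangle_ineq4 add_right_mono order_trans)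
   then show ?thesis using xq[of "s m"] xq[of "s n"] M[OF that] by linarith
  qed
  then show "\<exists>M. \<forall>m\<ge>M. \<forall>n\<ge>M. norm (a j (s m) x - a j (s n) x) < e" by blast
 qed
 define A where "A j x = lim (%n. a j (s n) x)" for j x
 have [measurable]: "A j \<in> \<B>" for j
  unfolding A_def[abs_def] by (rule borel_measurable_lim_metric) simp
 have A: "(%n. a j (s n) x) \<longlonglongrightarrow> A j x" for j x using conv by (simp add: A_def convergent_LIMSEQ_iff)
 have A_bd: "norm (A j x) <= c j" for j x
  using a_bd by (intro Lim_norm_ubound[OF _ A]) auto
 \<comment> \<open>Cauchy-Schwarz with the weight \<open>tent\<close>, of total mass
   \<open>c j\<close>, and then the hypothesis on translations for each v shorter than
   \<open>\<rho> j\<close>.\<close>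
 have near: "gnorm K (%x. c j *\<^sub>R f n x - a j n x) <= ennreal ((c j)\<^sup>2 * (C * (\<rho> j)\<^sup>2))"
  if K: "K \<in> sets borel" "!!x. x \<in> K ==> ball x (\<rho> j) \<subseteq> U" for K j n
 proof -
  note [measurable] = K(1)
  have pt: "ennreal ((norm (c j *\<^sub>R f n x - a j n x))\<^sup>2) <= ennreal (c j) * (\<N> v. ennreal (tent (\<rho> j) v * (norm (f n (x + v) - f n x))\<^sup>2))" for x
  proof -
   have "(LBINT v. tent (\<rho> j) v *\<^sub>R f n (x + v)) = a j n x"
    unfolding a_def using integral_shift[of "%y. tent (\<rho> j) (y - x) *\<^sub>R f n y" x] by (simp add: add.commute)
   have i: "integrable lborel (%v. tent (\<rho> j) v *\<^sub>R f n (x + v))"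
    using integrable_shift[OF ai[of j x n], of x] by (simp add: add.commute)
   have i': "integrable lborel (%v::'a. tent (\<rho> j) v *\<^sub>R f n x)"
    by (intro integrable_scaleR_left tent_integral_pos(2)[OF rho(1)])
   have e: "c j *\<^sub>R f n x - a j n x = (LBINT v. tent (\<rho> j) v *\<^sub>R f n x - tent (\<rho> j) v *\<^sub>R f n (x + v))"
   proof -
    have "(LBINT v. tent (\<rho> j) (v::'a) *\<^sub>R f n x) = c j *\<^sub>R f n x"
     unfolding c_def by (rule Bochner_Integration.integral_scaleR_left) (rule tent_integral_pos(2)[OF rho(1)])
    then show ?thesis
     using Bochner_Integration.integral_diff[OF i' i] \<open>(LBINT v. tent (\<rho> j) v *\<^sub>R f n (x + v)) = a j n x\<close> by simp
   qed
   have "ennreal (norm (c j *\<^sub>R f n x - a j n x)) <= (\<N> v. ennreal (norm (tent (\<rho> j) v *\<^sub>R f n x - tent (\<rho> j) v *\<^sub>R f n (x + v))))"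
    unfolding e by (rule integral_norm_bound_ennreal[OF Bochner_Integration.integrable_diff[OF i' i]])
   also have "... = (\<N> v. ennreal (tent (\<rho> j) v * norm (f n (x + v) - f n x)))"
    using tent_facts(1)[where 'a='a, OF rho(1)]
    by (intro nn_integral_cong) (simp add: norm_minus_commute abs_of_nonneg flip: scaleR_diff_right)
   finally have "(ennreal (norm (c j *\<^sub>R f n x - a j n x)))\<^sup>2 <= (\<N> v. ennreal (tent (\<rho> j) v * norm (f n (x + v) - f n x)))\<^sup>2"
    by (rule power_mono) simp
   also have "... <= (\<N> v. ennreal (tent (\<rho> j) (v::'a))) * (\<N> v. ennreal (tent (\<rho> j) v * (norm (f n (x + v) - f n x))\<^sup>2))"
    using tent_facts(1)[where 'a='a, OF rho(1)] by (intro nn_integral_Cauchy_Schwarz_weight) auto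
   also have "(\<N> v. ennreal (tent (\<rho> j) (v::'a))) = ennreal (c j)"
    unfolding c_def using tent_integral_pos(2)[OF rho(1)] tent_facts(1)[where 'a='a, OF rho(1)] by (intro nn_integral_eq_integral) auto
   finally show ?thesis by (simp add: ennreal_power)
  qed
  have "gnorm K (%x. c j *\<^sub>R f n x - a j n x)
   <= (\<N> x. \<integral>\<^sup>+v. ennreal (c j) * (\<I> K x * ennreal (tent (\<rho> j) v * (norm (f n (x + v) - f n x))\<^sup>2)) \<partial>lborel)"
   unfolding gnorm_def
  proof (intro nn_integral_mono)
   fix x
   have "(\<N> v. ennreal (c j) * (\<I> K x * ennreal (tent (\<rho> j) v * (norm (f n (x + v) - f n x))\<^sup>2)))
    = ennreal (c j) * (\<I> K x * (\<N> v. ennreal (tent (\<rho> j) v * (norm (f n (x + v) - f n x))\<^sup>2)))"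
    by (simp add: nn_integral_cmult)
   then show "\<I> K x * ennreal ((norm (c j *\<^sub>R f n x - a j n x))\<^sup>2)
    <= (\<N> v. ennreal (c j) * (\<I> K x * ennreal (tent (\<rho> j) v * (norm (f n (x + v) - f n x))\<^sup>2)))"
    using pt[of x] by (cases "x \<in> K") auto
  qed
  also have "... = (\<N> v. \<integral>\<^sup>+x. ennreal (c j) * (\<I> K x * ennreal (tent (\<rho> j) v * (norm (f n (x + v) - f n x))\<^sup>2)) \<partial>lborel)"
   by (rule lborel_pair.Fubini') measurable
  also have "... <= (\<N> v. ennreal (c j * (C * (\<rho> j)\<^sup>2)) * ennreal (tent (\<rho> j) (v::'a)))"
  proof (intro nn_integral_mono)
   fix v :: 'a
   have t0: "tent (\<rho> j) v >= 0" by (rule tent_facts(1)[where 'a='a, OF rho(1)])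
   have "(\<N> x. ennreal (c j) * (\<I> K x * ennreal (tent (\<rho> j) v * (norm (f n (x + v) - f n x))\<^sup>2)))
    = (\<N> x. ennreal (c j * tent (\<rho> j) v) * (\<I> K x * ennreal ((norm (f n (x + v) - f n x))\<^sup>2)))"
    using t0 c[of j] by (intro nn_integral_cong) (simp add: ennreal_mult mult_ac)
   also have "... = ennreal (c j * tent (\<rho> j) v) * gnorm K (%x. f n (x + v) - f n x)"
    unfolding gnorm_def by (rule nn_integral_cmult) measurable
   also have "... <= ennreal (c j * (C * (\<rho> j)\<^sup>2)) * ennreal (tent (\<rho> j) v)"
   proof (cases "norm v < \<rho> j")
    case True
    have "gnorm K (%x. f n (x + v) - f n x) <= ennreal (C * (norm v)\<^sup>2)"
    proof (rule tr[OF K(1)])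
     fix x and t :: real assume xt: "x \<in> K" "t \<in> {0..1}"
     have "norm (t *\<^sub>R v) <= norm v" using xt by (simp add: mult_left_le_one_le)
     then have "x + t *\<^sub>R v \<in> ball x (\<rho> j)" using True by (simp add: dist_norm)
     then show "x + t *\<^sub>R v \<in> U" using K(2)[OF xt(1)] by blast
    qed
    also have "... <= ennreal (C * (\<rho> j)\<^sup>2)"
     using True C by (intro ennreal_leI mult_left_mono power_mono) auto
    finally have "ennreal (c j * tent (\<rho> j) v) * gnorm K (%x. f n (x + v) - f n x)
     <= ennreal (c j * tent (\<rho> j) v) * ennreal (C * (\<rho> j)\<^sup>2)" by (rule mult_left_mono) simp
    also have "... = ennreal (c j * (C * (\<rho> j)\<^sup>2)) * ennreal (tent (\<rho> j) v)"
     using t0 c[of j] C by (simp add: mult_ac flip: ennreal_mult)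
    finally show ?thesis .
   next
    case False
    then show ?thesis using tent_facts(3)[where 'a='a, OF rho(1)] by simp
   qed
   finally show "(\<N> x. ennreal (c j) * (\<I> K x * ennreal (tent (\<rho> j) v * (norm (f n (x + v) - f n x))\<^sup>2)))
    <= ennreal (c j * (C * (\<rho> j)\<^sup>2)) * ennreal (tent (\<rho> j) v)" .
  qed
  also have "... = ennreal (c j * (C * (\<rho> j)\<^sup>2)) * ennreal (c j)"
  proof -
   have "(\<N> v. ennreal (tent (\<rho> j) (v::'a))) = ennreal (c j)"
    unfolding c_def using tent_integral_pos(2)[OF rho(1)] tent_facts(1)[where 'a='a, OF rho(1)] by (intro nn_integral_eq_integral) auto
   then show ?thesis by (simp add: nn_integral_cmult)
  qed
  also have "... = ennreal ((c j)\<^sup>2 * (C * (\<rho> j)\<^sup>2))"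
  proof -
   have "c j * (C * (\<rho> j)\<^sup>2) * c j = (c j)\<^sup>2 * (C * (\<rho> j)\<^sup>2)" by (simp add: power2_eq_square)
   then show ?thesis using c[of j] C by (simp flip: ennreal_mult)
  qed
  finally show ?thesis .
 qed
 obtain K where K: "!!n. compact (K n)" "!!n. K n \<subseteq> U" "!!n. K n \<subseteq> interior (K (Suc n))" "\<Union>(range K) = U"
  using open_Union_compact_subsets[OF U] by metis
 have [measurable]: "K i \<in> sets borel" for i using K(1) by (simp add: borel_compact)
 have cau: "\<exists>N. \<forall>n\<ge>N. \<forall>m\<ge>N. gnorm (K i) (%x. f (s n) x - f (s m) x) <= ennreal \<epsilon>" if eps: "\<epsilon> > 0" for i \<epsilon>
 proof -
  obtain e where e: "e > 0" "(\<Union>x\<in>K i. ball x e) \<subseteq> U"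
   using compact_subset_open_imp_ball_epsilon_subset[OF K(1) U K(2)] by blast
  \<comment> \<open>Two nested triangle inequalities for squares, each applied to two functions,
    produce the factor 8. The other half of \<epsilon> is left to the convergence of the averages,
    through \<eta>.\<close>
  have "(%j. 8 * (C * (\<rho> j)\<^sup>2)) \<longlonglongrightarrow> 8 * (C * 0\<^sup>2)" by (intro tendsto_intros rholim)
  then have "(%j. 8 * (C * (\<rho> j)\<^sup>2)) \<longlonglongrightarrow> 0" by (simp only: power_zero_numeral mult_zero_right)
  from order_tendstoD(2)[OF this, of "\<epsilon> / 2"] eps
  have "\<forall>\<^sub>F j in sequentially. 8 * (C * (\<rho> j)\<^sup>2) < \<epsilon> / 2" by simp
  moreover have "\<forall>\<^sub>F j in sequentially. \<rho> j < e" by (rule order_tendstoD(2)[OF rholim e(1)])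
  ultimately obtain j where j: "8 * (C * (\<rho> j)\<^sup>2) < \<epsilon> / 2" "\<rho> j < e"
   by (metis (mono_tags, lifting) eventually_conj_iff eventually_sequentially order_refl)
  have sub: "ball x (\<rho> j) \<subseteq> U" if "x \<in> K i" for x
   using e(2) j(2) that by (meson UN_subset_iff less_imp_le order_trans subset_ball)
  note near' = near[OF \<open>K i \<in> sets borel\<close> sub]
  have "(%n. gnorm (K i) (%x. a j (s n) x - A j x)) \<longlonglongrightarrow> (\<integral>\<^sup>+x. 0 \<partial>(lborel :: 'a measure))"
   unfolding gnorm_def
  proof (rule nn_integral_dominated_convergence[where w="%x. ennreal ((2 * c j)\<^sup>2) * \<I> (K i) x"])
   show "(\<N> x. ennreal ((2 * c j)\<^sup>2) * \<I> (K i) x) < \<infinity>"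
    by (subst nn_integral_cmult_indicator) (simp_all add: emeasure_bounded_eq[OF compact_imp_bounded[OF K(1)]] ennreal_mult_less_top)
   show "AE x in lborel. \<I> (K i) x * ennreal ((norm (a j (s n) x - A j x))\<^sup>2) <= ennreal ((2 * c j)\<^sup>2) * \<I> (K i) x" for n
   proof (rule AE_I2)
    fix x
    have "norm (a j (s n) x - A j x) <= 2 * c j"
     using norm_triangle_ineq4[of "a j (s n) x" "A j x"] a_bd[of j "s n" x] A_bd[of j x] by linarith
    then have "(norm (a j (s n) x - A j x))\<^sup>2 <= (2 * c j)\<^sup>2" by (intro power_mono) auto
    then show "\<I> (K i) x * ennreal ((norm (a j (s n) x - A j x))\<^sup>2) <= ennreal ((2 * c j)\<^sup>2) * \<I> (K i) x"
     by (cases "x \<in> K i") (auto intro: ennreal_leI)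
   qed
   show "AE x in lborel. (%n. \<I> (K i) x * ennreal ((norm (a j (s n) x - A j x))\<^sup>2)) \<longlonglongrightarrow> 0"
   proof (rule AE_I2)
    fix x
    have "(%n. ennreal ((norm (a j (s n) x - A j x))\<^sup>2)) \<longlonglongrightarrow> ennreal ((norm (A j x - A j x))\<^sup>2)"
     by (intro tendsto_intros A)
    then have l: "(%n. ennreal ((norm (a j (s n) x - A j x))\<^sup>2)) \<longlonglongrightarrow> 0"
     by (simp only: diff_self norm_zero power_zero_numeral ennreal_0)
    show "(%n. \<I> (K i) x * ennreal ((norm (a j (s n) x - A j x))\<^sup>2)) \<longlonglongrightarrow> 0"
    proof (cases "x \<in> K i")
     case True
     then show ?thesis using l by (simp only: indicator_simps mult_1)
    qed simp
   qed
  qed simp_all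
  moreover define \<eta> where "\<eta> = (c j)\<^sup>2 * \<epsilon> / 16"
  have eta: "\<eta> > 0" using c[of j] eps by (simp add: \<eta>_def)
  ultimately have "\<forall>\<^sub>F n in sequentially. gnorm (K i) (%x. a j (s n) x - A j x) < ennreal \<eta>"
   by (intro order_tendstoD(2)) auto
  then obtain N where N: "!!n. n >= N ==> gnorm (K i) (%x. a j (s n) x - A j x) < ennreal \<eta>"
   by (auto simp: eventually_sequentially)
  have "gnorm (K i) (%x. f (s n) x - f (s m) x) <= ennreal \<epsilon>" if nm: "n >= N" "m >= N" for n m
  proof -
   have one: "gnorm (K i) (%x. c j *\<^sub>R f (s n) x - A j x) <= 2 * ennreal ((c j)\<^sup>2 * (C * (\<rho> j)\<^sup>2)) + 2 * ennreal \<eta>" if "n >= N" for n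
   proof -
    have "gnorm (K i) (%x. c j *\<^sub>R f (s n) x - A j x) <= 2 * gnorm (K i) (%x. c j *\<^sub>R f (s n) x - a j (s n) x) + 2 * gnorm (K i) (%x. a j (s n) x - A j x)"
     by (rule gnorm_triangle) measurable
    also have "... <= 2 * ennreal ((c j)\<^sup>2 * (C * (\<rho> j)\<^sup>2)) + 2 * ennreal \<eta>"
     using N[OF that] near'[of "s n"] by (intro add_mono mult_left_mono) auto
    finally show ?thesis .
   qed
   have "gnorm (K i) (%x. c j *\<^sub>R f (s n) x - c j *\<^sub>R f (s m) x)
    <= 2 * gnorm (K i) (%x. c j *\<^sub>R f (s n) x - A j x) + 2 * gnorm (K i) (%x. A j x - c j *\<^sub>R f (s m) x)"
    by (rule gnorm_triangle) measurable
   also have "... <= 2 * (2 * ennreal ((c j)\<^sup>2 * (C * (\<rho> j)\<^sup>2)) + 2 * ennreal \<eta>) + 2 * (2 * ennreal ((c j)\<^sup>2 * (C * (\<rho> j)\<^sup>2)) + 2 * ennreal \<eta>)"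
    unfolding gnorm_minus_commute[of _ "A j"] using one nm by (intro add_mono mult_left_mono) auto
   also have "... = ennreal (8 * ((c j)\<^sup>2 * (C * (\<rho> j)\<^sup>2)) + 8 * \<eta>)"
   proof -
    define X where "X = (c j)\<^sup>2 * (C * (\<rho> j)\<^sup>2)"
    have X0: "X >= 0" using C by (simp add: X_def)
    define Z where "Z = 2 * X + 2 * \<eta>"
    have Z: "2 * ennreal X + 2 * ennreal \<eta> = ennreal Z" "Z >= 0"
     using eta X0 by (simp_all add: ennreal_mult Z_def)
    have "2 * ennreal Z + 2 * ennreal Z = ennreal (4 * Z)"
     using Z(2) by (simp add: ennreal_mult flip: distrib_right)
    moreover have "4 * Z = 8 * X + 8 * \<eta>" by (simp add: Z_def)
    ultimately show ?thesis unfolding X_def[symmetric] Z(1) by simp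
   qed
   also have "... <= ennreal ((c j)\<^sup>2 * \<epsilon>)"
   proof (rule ennreal_leI)
    have "8 * ((c j)\<^sup>2 * (C * (\<rho> j)\<^sup>2)) = (c j)\<^sup>2 * (8 * (C * (\<rho> j)\<^sup>2))" by simp
    also have "... <= (c j)\<^sup>2 * (\<epsilon> / 2)" using j(1) by (intro mult_left_mono) auto
    also have "... = (c j)\<^sup>2 * \<epsilon> / 2" by (rule times_divide_eq_right)
    finally have "8 * ((c j)\<^sup>2 * (C * (\<rho> j)\<^sup>2)) <= (c j)\<^sup>2 * \<epsilon> / 2" .
    moreover have "8 * \<eta> = (c j)\<^sup>2 * \<epsilon> / 2" unfolding \<eta>_def by linarith
    ultimately show "8 * ((c j)\<^sup>2 * (C * (\<rho> j)\<^sup>2)) + 8 * \<eta> <= (c j)\<^sup>2 * \<epsilon>" by linarith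
   qed
   also have "gnorm (K i) (%x. c j *\<^sub>R f (s n) x - c j *\<^sub>R f (s m) x) = ennreal ((c j)\<^sup>2) * gnorm (K i) (%x. f (s n) x - f (s m) x)"
   proof -
    have "\<I> (K i) x * ennreal ((norm (c j *\<^sub>R f (s n) x - c j *\<^sub>R f (s m) x))\<^sup>2)
     = ennreal ((c j)\<^sup>2) * (\<I> (K i) x * ennreal ((norm (f (s n) x - f (s m) x))\<^sup>2))" for x
     by (simp add: power_mult_distrib ennreal_mult mult_ac flip: scaleR_diff_right)
    then show ?thesis unfolding gnorm_def by (simp add: nn_integral_cmult)
   qed
   finally have "ennreal (1 / (c j)\<^sup>2) * (ennreal ((c j)\<^sup>2) * gnorm (K i) (%x. f (s n) x - f (s m) x))
    <= ennreal (1 / (c j)\<^sup>2) * ennreal ((c j)\<^sup>2 * \<epsilon>)" by (rule mult_left_mono) simp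
   moreover have "ennreal (1 / (c j)\<^sup>2) * ennreal ((c j)\<^sup>2) = 1" using c[of j] by (simp flip: ennreal_mult)
   moreover have "ennreal (1 / (c j)\<^sup>2) * ennreal ((c j)\<^sup>2 * \<epsilon>) = ennreal \<epsilon>"
    using c[of j] eps by (simp flip: ennreal_mult)
   ultimately show ?thesis by (simp only: mult.assoc[symmetric] mult_1)
  qed
  then show ?thesis by blast
 qed
 have K1: "K i \<in> sets borel" "K i \<subseteq> K (Suc i)" for i using K(3)[of i] interior_subset by auto
 obtain r g where "strict_mono (r :: nat => nat)" "g \<in> \<B>"
  "AE x in lborel. x \<in> (\<Union>i. K i) --> (%n. f (s (r n)) x) \<longlonglongrightarrow> g x"
  "!!i. (%n. gnorm (K i) (%x. f (s n) x - g x)) \<longlonglongrightarrow> 0"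
  using locally_L2_Cauchy[of "%n. f (s n)" K, OF f K1 cau] by blast
 then show thesis using s(1) K(4) by (intro that[of "s \<circ> r" g]) (auto intro: strict_mono_o)
qed

section \<open>A Liouville theorem\<close>

text \<open>The rescaled mollifiers \<open>\<sigma>\<^sup>n \<beta>'(1 - \<sigma>\<^sup>2 |y|\<^sup>2)\<close> differ by Laplacians of test
 functions, so that the mean of a harmonic field \<open>g\<close> against them does not depend on \<open>\<sigma>\<close>;
 for a square integrable field it tends to zero as \<open>\<sigma> \<rightarrow> 0\<close>.\<close>

definition beta1 :: "real => real" where "beta1 = bump (bump_deriv 1)"
definition beta2 :: "real => real" where "beta2 = bump (bump_deriv (bump_deriv 1))"
definition ball_arg :: "real => 'a::euclidean_space => 'a => real" where
 "ball_arg \<sigma> p y = 1 - \<sigma>\<^sup>2 * (norm (y - p))\<^sup>2"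

lemma beta1_deriv: "(beta1 has_real_derivative beta2 t) (at t)"
 unfolding beta1_def beta2_def by (rule bump_has_derivative)

lemma beta1_nonneg: "beta1 t >= 0" and beta1_pos: "t > 0 ==> beta1 t > 0"
 by (auto simp: beta1_def bump_def bump_deriv_def)

text \<open>The argument \<open>ball_arg\<close> never exceeds 1, so this range suffices; for
  negative t the function is 0.\<close>

lemma bump_bounded: obtains M where "M > 0" "!!t. t <= 1 ==> \<bar>bump p t\<bar> <= M"
proof -
 have "bounded (bump p ` {0..1})"
  by (intro compact_imp_bounded compact_continuous_image continuous_on_bump continuous_on_id) auto
 then obtain M where M: "M > 0" "!!t. t \<in> {0..1} ==> \<bar>bump p t\<bar> <= M" by (auto simp: bounded_pos)
 have "\<bar>bump p t\<bar> <= M" if "t <= 1" for t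
  using M(2)[of t] M(1) that by (cases "t >= 0") (auto simp: bump_def)
 then show thesis using M(1) that by blast
qed

lemma ball_arg_deriv:
 "((%y. ball_arg \<sigma> p y) has_derivative (%v. - 2 * \<sigma>\<^sup>2 * ((y - p) \<bullet> v))) (at y)"
 unfolding ball_arg_def power2_norm_eq_inner
 by (auto intro!: derivative_eq_intros simp: inner_commute)

lemma bump_ball_arg_deriv:
 "((%y. bump q (ball_arg \<sigma> p y)) has_derivative
  (%v. bump (bump_deriv q) (ball_arg \<sigma> p y) * (- 2 * \<sigma>\<^sup>2 * ((y - p) \<bullet> v)))) (at y)"
 using DERIV_compose_FDERIV[OF bump_has_derivative ball_arg_deriv] by (simp add: mult_ac)

lemma smooth_bump_ball_arg: "smooth (%y. bump q (ball_arg \<sigma> p y))"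
 unfolding ball_arg_def
 by (intro smooth_bump smooth_diff smooth_mult smooth_const smooth_norm_sq)

lemma smooth_inner_diff: "smooth (%y. (y - p) \<bullet> c)"
 unfolding inner_diff_left by (intro smooth_diff smooth_inner smooth_const)

lemma ball_arg_le_1: "ball_arg \<sigma> p y <= 1"
 by (simp add: ball_arg_def)

lemma ball_arg_outside:
 assumes "\<sigma> > 0" "y \<notin> cball p (1 / \<sigma>)" shows "ball_arg \<sigma> p y <= 0"
proof -
 have "1 / \<sigma> <= norm (y - p)" using assms by (simp add: dist_norm norm_minus_commute)
 then have "1 <= \<sigma> * norm (y - p)" using assms by (simp add: field_simps)
 then have "1\<^sup>2 <= (\<sigma> * norm (y - p))\<^sup>2" by (intro power_mono) auto
 then show ?thesis by (simp add: ball_arg_def power_mult_distrib)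
qed

lemma bump_ball_arg_test:
 assumes "\<sigma> > 0" "smooth \<psi>"
 shows "(%y. bump q (ball_arg \<sigma> p y) * \<psi> y) \<in> test_functions UNIV"
proof (rule test_functionsI[of _ "cball p (1 / \<sigma>)"])
 show "smooth (%y. bump q (ball_arg \<sigma> p y) * \<psi> y)" by (intro smooth_mult smooth_bump_ball_arg assms(2))
 show "bump q (ball_arg \<sigma> p x) * \<psi> x = 0" if "x \<notin> cball p (1 / \<sigma>)" for x
  using ball_arg_outside[OF assms(1) that] by (simp add: bump_def)
qed auto

text \<open>In dimension n the bracket is \<open>\<sigma>^(1-n)\<close> times the derivative in
  \<sigma> of the mollifier \<open>\<sigma>^n \<beta>'(1 - \<sigma>^2 |y - p|^2)\<close>. The field
  g is known only through weak equations of first order, so the Laplacian is split: A is the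
  divergence equation for g, while B and C use that g is the weak gradient of w. The coordinates
  \<open>(y - p) \<bullet> i\<close> in the test functions produce the required second order
  terms.\<close>

lemma harmonic_gradient_identity:
 fixes g :: "'a::euclidean_space => 'a"
 assumes w: "wgrad UNIV w g" and harm: "!!\<phi>. \<phi> \<in> test_functions UNIV ==> (LBINT x. g x \<bullet> nabla \<phi> x) = 0"
  and s: "\<sigma> > 0" and b: "b \<in> Basis"
 shows "(LBINT y. (g y \<bullet> b) * (DIM('a) * beta1 (ball_arg \<sigma> p y) - 2 * \<sigma>\<^sup>2 * (norm (y - p))\<^sup>2 * beta2 (ball_arg \<sigma> p y))) = 0"
proof -
 note [measurable] = wgradD(1,2)[OF w]
 define \<beta>1 where "\<beta>1 y = beta1 (ball_arg \<sigma> p y)" for y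
 define \<beta>2 where "\<beta>2 y = beta2 (ball_arg \<sigma> p y)" for y
 define q3 where "q3 = bump_deriv (bump_deriv (bump_deriv (1::real poly)))"
 define \<beta>3 where "\<beta>3 y = bump q3 (ball_arg \<sigma> p y)" for y
 have D1: "(\<beta>1 has_derivative (%v. \<beta>2 y * (- 2 * \<sigma>\<^sup>2 * ((y - p) \<bullet> v)))) (at y)" for y
  unfolding \<beta>1_def[abs_def] \<beta>2_def beta1_def beta2_def by (rule bump_ball_arg_deriv)
 have D2: "(\<beta>2 has_derivative (%v. \<beta>3 y * (- 2 * \<sigma>\<^sup>2 * ((y - p) \<bullet> v)))) (at y)" for y
  unfolding \<beta>2_def[abs_def] \<beta>3_def q3_def beta2_def by (rule bump_ball_arg_deriv)
 have t1: "(%y. \<beta>1 y * \<psi> y) \<in> test_functions UNIV" "(%y. \<beta>2 y * \<psi> y) \<in> test_functions UNIV" if "smooth \<psi>" for \<psi>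
  unfolding \<beta>1_def \<beta>2_def beta1_def beta2_def by (intro bump_ball_arg_test s that)+
 have D0: "((%y. (y - p) \<bullet> c) has_derivative (%v. v \<bullet> c)) (at y)" for c y
  by (auto intro!: derivative_eq_intros)
 have ig: "integrable lborel (%y. \<phi> y * (g y \<bullet> v))" if "\<phi> \<in> test_functions UNIV" for \<phi> v
  using loc_int_test[OF loc_int_inner[OF wgradD(4)[OF w]] _ that] by simp
 have iw: "integrable lborel (%y. \<phi> y * w y)" if "\<phi> \<in> test_functions UNIV" for \<phi>
  using loc_int_test[OF wgradD(3,1)[OF w] that] by simp
 \<comment> \<open>\<open>g \<bullet> \<nabla>(\<beta>' u\<^sub>b)\<close> for \<open>u = y - p\<close>\<close>
 have A: "(LBINT y. - 2 * \<sigma>\<^sup>2 * (\<beta>2 y * ((y - p) \<bullet> b) * (g y \<bullet> (y - p))) + \<beta>1 y * (g y \<bullet> b)) = 0"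
 proof -
  have "nabla (%y. \<beta>1 y * ((y - p) \<bullet> b)) y = (- 2 * \<sigma>\<^sup>2 * \<beta>2 y * ((y - p) \<bullet> b)) *\<^sub>R (y - p) + \<beta>1 y *\<^sub>R b" for y
   by (rule nabla_eqI, rule has_derivative_eq_rhs[OF has_derivative_mult[OF D1 D0]])
    (auto simp: inner_add_left inner_commute algebra_simps)
  then show ?thesis using harm[OF t1(1)[OF smooth_inner_diff[of p b]]] by (simp add: inner_add_right inner_diff_right mult_ac)
 qed
 \<comment> \<open>the field is curl free, tested with \<open>\<beta>'' u\<^sub>i u\<^sub>b\<close> and \<open>\<beta>'' u\<^sub>i u\<^sub>i\<close>\<close>
 have B: "(LBINT y. \<beta>2 y * ((y - p) \<bullet> i) * ((y - p) \<bullet> b) * (g y \<bullet> i))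
   - (LBINT y. \<beta>2 y * ((y - p) \<bullet> i) * ((y - p) \<bullet> i) * (g y \<bullet> b))
   = - (if i = b then 0 else (LBINT y. \<beta>2 y * ((y - p) \<bullet> b) * w y))" if i: "i \<in> Basis" for i
 proof -
  have n: "nabla (%y. \<beta>2 y * (((y - p) \<bullet> c) * ((y - p) \<bullet> d))) y = (- 2 * \<sigma>\<^sup>2 * \<beta>3 y * ((y - p) \<bullet> c) * ((y - p) \<bullet> d)) *\<^sub>R (y - p)
    + (\<beta>2 y * ((y - p) \<bullet> d)) *\<^sub>R c + (\<beta>2 y * ((y - p) \<bullet> c)) *\<^sub>R d" for c d y
   by (rule nabla_eqI, rule has_derivative_eq_rhs[OF has_derivative_mult[OF D2 has_derivative_mult[OF D0 D0]]])
    (auto simp: inner_add_left inner_commute algebra_simps)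
  have ts: "(%y. \<beta>2 y * (((y - p) \<bullet> c) * ((y - p) \<bullet> d))) \<in> test_functions UNIV" for c d
   by (intro t1 smooth_mult smooth_inner_diff)
  have e1: "(LBINT y. (nabla (%y. \<beta>2 y * (((y - p) \<bullet> i) * ((y - p) \<bullet> b))) y \<bullet> i) * w y)
    = - (LBINT y. \<beta>2 y * ((y - p) \<bullet> i) * ((y - p) \<bullet> b) * (g y \<bullet> i))"
   using wgradD(5)[OF w ts[of i b], of i] by (simp add: mult.assoc)
  have e2: "(LBINT y. (nabla (%y. \<beta>2 y * (((y - p) \<bullet> i) * ((y - p) \<bullet> i))) y \<bullet> b) * w y)
    = - (LBINT y. \<beta>2 y * ((y - p) \<bullet> i) * ((y - p) \<bullet> i) * (g y \<bullet> b))"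
   using wgradD(5)[OF w ts[of i i], of b] by (simp add: mult.assoc)
  have "(LBINT y. (nabla (%y. \<beta>2 y * (((y - p) \<bullet> i) * ((y - p) \<bullet> b))) y \<bullet> i) * w y)
   - (LBINT y. (nabla (%y. \<beta>2 y * (((y - p) \<bullet> i) * ((y - p) \<bullet> i))) y \<bullet> b) * w y)
   = (LBINT y. (nabla (%y. \<beta>2 y * (((y - p) \<bullet> i) * ((y - p) \<bullet> b))) y \<bullet> i) * w y
    - (nabla (%y. \<beta>2 y * (((y - p) \<bullet> i) * ((y - p) \<bullet> i))) y \<bullet> b) * w y)"
   by (rule Bochner_Integration.integral_diff[symmetric]) (intro iw test_nabla_inner ts)+
  also have "... = (LBINT y. (if i = b then 0 else \<beta>2 y * ((y - p) \<bullet> b) * w y))"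
   unfolding n using i b
   by (intro Bochner_Integration.integral_cong) (auto simp: inner_add_left inner_Basis algebra_simps)
  also have "... = (if i = b then 0 else (LBINT y. \<beta>2 y * ((y - p) \<bullet> b) * w y))" by simp
  finally show ?thesis unfolding e1 e2 by linarith
 qed
 \<comment> \<open>Integrals over the potential itself enter through B; this identity returns them
   to g, so that w drops out of the result.\<close>
 have C: "2 * \<sigma>\<^sup>2 * (LBINT y. \<beta>2 y * ((y - p) \<bullet> b) * w y) = (LBINT y. \<beta>1 y * (g y \<bullet> b))"
 proof -
  have ts: "\<beta>1 \<in> test_functions UNIV" using t1(1)[OF smooth_const[of 1]] by simp
  have n: "nabla \<beta>1 y = (- 2 * \<sigma>\<^sup>2 * \<beta>2 y) *\<^sub>R (y - p)" for y
   by (rule nabla_eqI, rule has_derivative_eq_rhs[OF D1]) (auto simp: algebra_simps)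
  have "(LBINT y. (nabla \<beta>1 y \<bullet> b) * w y) = (LBINT y. (- 2 * \<sigma>\<^sup>2) * (\<beta>2 y * ((y - p) \<bullet> b) * w y))"
   unfolding n by (simp add: mult_ac)
  then show ?thesis using wgradD(5)[OF w ts, of b] by simp
 qed
 define I1 where "I1 = (LBINT y. \<beta>1 y * (g y \<bullet> b))"
 define Iw where "Iw = (LBINT y. \<beta>2 y * ((y - p) \<bullet> b) * w y)"
 have i1: "integrable lborel (%y. \<beta>1 y * (g y \<bullet> v))" for v using ig[OF t1(1)[OF smooth_const[of 1]]] by simp
 have i2: "integrable lborel (%y. \<beta>2 y * ((y - p) \<bullet> c) * ((y - p) \<bullet> d) * (g y \<bullet> v))" for c d v
  using ig[OF t1(2)[OF smooth_mult[OF smooth_inner_diff smooth_inner_diff]], of p c p d v] by (simp add: mult_ac)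
 have r: "\<beta>2 y * ((y - p) \<bullet> b) * (g y \<bullet> (y - p)) = (\<Sum>i\<in>Basis. \<beta>2 y * ((y - p) \<bullet> i) * ((y - p) \<bullet> b) * (g y \<bullet> i))" for y
  by (subst euclidean_inner) (simp add: sum_distrib_left mult_ac)
 have r': "\<beta>2 y * (norm (y - p))\<^sup>2 * (g y \<bullet> b) = (\<Sum>i\<in>Basis. \<beta>2 y * ((y - p) \<bullet> i) * ((y - p) \<bullet> i) * (g y \<bullet> b))" for y
  unfolding power2_norm_eq_inner by (subst euclidean_inner) (simp add: sum_distrib_left sum_distrib_right mult_ac)
 have ir: "integrable lborel (%y. \<beta>2 y * ((y - p) \<bullet> b) * (g y \<bullet> (y - p)))" unfolding r by (intro Bochner_Integration.integrable_sum i2)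
 have ir': "integrable lborel (%y. \<beta>2 y * (norm (y - p))\<^sup>2 * (g y \<bullet> b))" unfolding r' by (intro Bochner_Integration.integrable_sum i2)
 define X where "X = (LBINT y. \<beta>2 y * ((y - p) \<bullet> b) * (g y \<bullet> (y - p)))"
 define Y where "Y = (LBINT y. \<beta>2 y * (norm (y - p))\<^sup>2 * (g y \<bullet> b))"
 have "X - Y = (\<Sum>i\<in>Basis. (LBINT y. \<beta>2 y * ((y - p) \<bullet> i) * ((y - p) \<bullet> b) * (g y \<bullet> i))
   - (LBINT y. \<beta>2 y * ((y - p) \<bullet> i) * ((y - p) \<bullet> i) * (g y \<bullet> b)))"
  unfolding X_def Y_def r r' using i2 by (simp add: sum_subtractf)
 also have "... = (\<Sum>i\<in>Basis. - (if i = b then 0 else Iw))" using B by (intro sum.cong) (auto simp: Iw_def)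
 also have "... = - ((real (DIM('a)) - 1) * Iw)"
 proof -
  have "(\<Sum>i\<in>Basis. - (if i = b then 0 else Iw)) = (\<Sum>i\<in>Basis. (if i = b then Iw else 0) - Iw)"
   by (intro sum.cong) auto
  then show ?thesis using b by (simp add: sum_subtractf sum.delta algebra_simps)
 qed
 finally have XY: "X - Y = - ((real (DIM('a)) - 1) * Iw)" .
 have A': "- 2 * \<sigma>\<^sup>2 * X + I1 = 0"
 proof -
  have "(LBINT y. - 2 * \<sigma>\<^sup>2 * (\<beta>2 y * ((y - p) \<bullet> b) * (g y \<bullet> (y - p))) + \<beta>1 y * (g y \<bullet> b))
   = (LBINT y. - 2 * \<sigma>\<^sup>2 * (\<beta>2 y * ((y - p) \<bullet> b) * (g y \<bullet> (y - p)))) + (LBINT y. \<beta>1 y * (g y \<bullet> b))"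
   by (intro Bochner_Integration.integral_add integrable_mult_right ir i1)
  also have "(LBINT y. - 2 * \<sigma>\<^sup>2 * (\<beta>2 y * ((y - p) \<bullet> b) * (g y \<bullet> (y - p)))) = - 2 * \<sigma>\<^sup>2 * X"
   unfolding X_def by (rule integral_mult_right_zero)
  finally show ?thesis using A by (simp add: I1_def)
 qed
 have C': "2 * \<sigma>\<^sup>2 * Iw = I1" using C by (simp add: Iw_def I1_def)
 have "(LBINT y. (g y \<bullet> b) * (DIM('a) * beta1 (ball_arg \<sigma> p y) - 2 * \<sigma>\<^sup>2 * (norm (y - p))\<^sup>2 * beta2 (ball_arg \<sigma> p y)))
  = (LBINT y. DIM('a) * (\<beta>1 y * (g y \<bullet> b)) - 2 * \<sigma>\<^sup>2 * (\<beta>2 y * (norm (y - p))\<^sup>2 * (g y \<bullet> b)))"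
  by (intro Bochner_Integration.integral_cong) (auto simp: \<beta>1_def \<beta>2_def algebra_simps)
 also have "... = (LBINT y. DIM('a) * (\<beta>1 y * (g y \<bullet> b))) - (LBINT y. 2 * \<sigma>\<^sup>2 * (\<beta>2 y * (norm (y - p))\<^sup>2 * (g y \<bullet> b)))"
  by (intro Bochner_Integration.integral_diff integrable_mult_right ir' i1)
 also have "... = DIM('a) * I1 - 2 * \<sigma>\<^sup>2 * Y"
  unfolding I1_def Y_def by (simp only: integral_mult_right_zero)
 also have "... = 0"
 proof -
  \<comment> \<open>A gives \<open>2 * \<sigma>\<^sup>2 * X = I1\<close> and C gives
    \<open>2 * \<sigma>\<^sup>2 * Iw = I1\<close>, so the relation becomes
    \<open>2 * \<sigma>\<^sup>2 * Y = n * I1\<close> with n the dimension.\<close>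
  have "Y = X + (real (DIM('a)) - 1) * Iw" using XY by simp
  then have "2 * \<sigma>\<^sup>2 * Y = 2 * \<sigma>\<^sup>2 * (X + (real (DIM('a)) - 1) * Iw)" by (simp only:)
  also have "... = 2 * \<sigma>\<^sup>2 * X + (real (DIM('a)) - 1) * (2 * \<sigma>\<^sup>2 * Iw)" by (simp add: algebra_simps)
  finally have "2 * \<sigma>\<^sup>2 * Y = 2 * \<sigma>\<^sup>2 * X + (real (DIM('a)) - 1) * (2 * \<sigma>\<^sup>2 * Iw)" .
  moreover have "2 * \<sigma>\<^sup>2 * X = I1" using A' by simp
  ultimately have "2 * \<sigma>\<^sup>2 * Y = I1 + (real (DIM('a)) - 1) * I1" unfolding C' by simp
  then show ?thesis by (simp add: left_diff_distrib)
 qed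
 finally show ?thesis .
qed

lemma beta_ball_arg_outside:
 assumes "\<sigma> > 0" "y \<notin> cball p (1 / \<sigma>)"
 shows "beta1 (ball_arg \<sigma> p y) = 0" "beta2 (ball_arg \<sigma> p y) = 0"
 using ball_arg_outside[OF assms] by (simp_all add: beta1_def beta2_def bump_def)

lemma continuous_on_beta: "continuous_on S f ==> continuous_on S (%x. beta1 (f x))"
 "continuous_on S f ==> continuous_on S (%x. beta2 (f x))"
 unfolding beta1_def beta2_def by (intro continuous_intros; assumption)+

lemma beta_borel [measurable]: "beta1 \<in> \<B>" "beta2 \<in> \<B>"
 by (intro borel_measurable_continuous_onI continuous_on_beta continuous_on_id)+

text \<open>The hypothesis z says that the derivative of the mean in \<sigma> vanishes. It is
  integrated along the segment \<tau> from a to b, and Fubini exchanges this integral with the one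
  over space.\<close>

lemma mollified_mean_const:
 fixes G :: "'a::euclidean_space => real" and p :: 'a
 assumes [measurable]: "G \<in> \<B>" and G: "loc_int UNIV G"
  and z: "!!\<sigma>. \<sigma> > 0 ==> (LBINT y. G y * (DIM('a) * beta1 (ball_arg \<sigma> p y) - 2 * \<sigma>\<^sup>2 * (norm (y - p))\<^sup>2 * beta2 (ball_arg \<sigma> p y))) = 0"
  and s: "0 < a" "a <= b"
 shows "(LBINT y. G y * (a ^ DIM('a) * beta1 (ball_arg a p y))) = (LBINT y. G y * (b ^ DIM('a) * beta1 (ball_arg b p y)))"
proof -
 define Q where "Q \<sigma> y = DIM('a) * beta1 (ball_arg \<sigma> p y) - 2 * \<sigma>\<^sup>2 * (norm (y - p))\<^sup>2 * beta2 (ball_arg \<sigma> p y)" for \<sigma> y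
 define \<tau> where "\<tau> t = a + t * (b - a)" for t
 define k where "k = DIM('a) - 1"
 have k: "DIM('a) = Suc k" using DIM_positive[where 'a='a] by (simp add: k_def)
 have tau: "a <= \<tau> t" "\<tau> t <= b" "0 < \<tau> t" if "t \<in> {0..1}" for t
 proof -
  show "a <= \<tau> t" using that s by (simp add: \<tau>_def)
  have "t * (b - a) <= 1 * (b - a)" using that s by (intro mult_right_mono) auto
  then show "\<tau> t <= b" by (simp add: \<tau>_def)
  show "0 < \<tau> t" using \<open>a <= \<tau> t\<close> s by linarith
 qed
 have [measurable]: "\<tau> \<in> \<B>" unfolding \<tau>_def[abs_def] by measurable
 have ba [measurable]: "(%z. ball_arg (\<tau> (fst z)) p (snd z)) \<in> borel_measurable (lborel \<Otimes>\<^sub>M lborel)"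
  "ball_arg \<sigma> p \<in> \<B>" for \<sigma>
  unfolding ball_arg_def[abs_def] by measurable
 have [measurable]: "(%z. Q (\<tau> (fst z)) (snd z)) \<in> borel_measurable (lborel \<Otimes>\<^sub>M lborel)"
  unfolding Q_def ball_arg_def by measurable
 have ftc: "(LBINT t. \<I> {0..1} t *\<^sub>R ((b - a) * \<tau> t ^ k * Q (\<tau> t) y))
  = b ^ DIM('a) * beta1 (ball_arg b p y) - a ^ DIM('a) * beta1 (ball_arg a p y)" for y
 proof -
  have "(LBINT t. \<I> {0..1} t *\<^sub>R ((b - a) * \<tau> t ^ k * Q (\<tau> t) y))
   = \<tau> 1 ^ DIM('a) * beta1 (ball_arg (\<tau> 1) p y) - \<tau> 0 ^ DIM('a) * beta1 (ball_arg (\<tau> 0) p y)"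
  proof (rule integral_FTC_atLeastAtMost)
   show "continuous_on {0..1} (%t. (b - a) * \<tau> t ^ k * Q (\<tau> t) y)"
    unfolding Q_def \<tau>_def ball_arg_def by (intro continuous_intros continuous_on_beta)
   fix t :: real
   have d1: "((%t. ball_arg (\<tau> t) p y) has_real_derivative (- 2 * \<tau> t * (b - a) * (norm (y - p))\<^sup>2)) (at t)"
    unfolding ball_arg_def \<tau>_def by (auto intro!: derivative_eq_intros simp: algebra_simps)
   have d2: "((%t. \<tau> t ^ DIM('a)) has_real_derivative (DIM('a) * \<tau> t ^ k * (b - a))) (at t)"
   proof -
    have "(\<tau> has_real_derivative (b - a)) (at t)" unfolding \<tau>_def[abs_def] by (auto intro!: derivative_eq_intros)
    from DERIV_power[OF this, of "DIM('a)"] show ?thesis by (simp add: k mult_ac)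
   qed
   have "((%t. \<tau> t ^ DIM('a) * beta1 (ball_arg (\<tau> t) p y)) has_real_derivative
    DIM('a) * \<tau> t ^ k * (b - a) * beta1 (ball_arg (\<tau> t) p y)
    + beta2 (ball_arg (\<tau> t) p y) * (- 2 * \<tau> t * (b - a) * (norm (y - p))\<^sup>2) * \<tau> t ^ DIM('a)) (at t)"
    by (rule DERIV_mult[OF d2 DERIV_chain2[OF beta1_deriv d1]])
   also have "DIM('a) * \<tau> t ^ k * (b - a) * beta1 (ball_arg (\<tau> t) p y)
    + beta2 (ball_arg (\<tau> t) p y) * (- 2 * \<tau> t * (b - a) * (norm (y - p))\<^sup>2) * \<tau> t ^ DIM('a)
    = (b - a) * \<tau> t ^ k * Q (\<tau> t) y"
    unfolding k by (simp add: Q_def k power2_eq_square algebra_simps)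
   finally show "((%t. \<tau> t ^ DIM('a) * beta1 (ball_arg (\<tau> t) p y)) has_vector_derivative (b - a) * \<tau> t ^ k * Q (\<tau> t) y) (at t within {0..1})"
    by (simp add: has_real_derivative_iff_has_vector_derivative has_vector_derivative_at_within)
  qed simp
  then show ?thesis by (simp add: \<tau>_def)
 qed
 obtain M1 where M1: "M1 > 0" "!!t. t <= 1 ==> \<bar>beta1 t\<bar> <= M1" unfolding beta1_def using bump_bounded by blast
 obtain M2 where M2: "M2 > 0" "!!t. t <= 1 ==> \<bar>beta2 t\<bar> <= M2" unfolding beta2_def using bump_bounded by blast
 \<comment> \<open>The mollifiers live in balls of radius \<open>1 / \<tau> t\<close>, all contained
   in the ball for the smallest parameter a.\<close>
 define K where "K = cball p (1 / a)"
 have [measurable]: "K \<in> sets borel" by (simp add: K_def borel_closed)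
 define C0 where "C0 = (b - a) * b ^ k * (DIM('a) * M1 + 2 * b\<^sup>2 * (1 / a)\<^sup>2 * M2)"
 have C0: "C0 >= 0" unfolding C0_def using s M1(1) M2(1) by (intro mult_nonneg_nonneg add_nonneg_nonneg) auto
 have Qb: "\<bar>(b - a) * \<tau> t ^ k * Q (\<tau> t) y\<bar> <= C0 * \<I> K y" if t: "t \<in> {0..1}" for t y
 proof (cases "y \<in> K")
  case True
  have r: "(norm (y - p))\<^sup>2 <= (1 / a)\<^sup>2"
   using True by (intro power_mono) (auto simp: K_def dist_norm norm_minus_commute)
  have ta: "(\<tau> t)\<^sup>2 <= b\<^sup>2" using tau[OF t] by (intro power_mono) auto
  have "\<bar>Q (\<tau> t) y\<bar> <= \<bar>DIM('a) * beta1 (ball_arg (\<tau> t) p y)\<bar> + \<bar>2 * (\<tau> t)\<^sup>2 * (norm (y - p))\<^sup>2 * beta2 (ball_arg (\<tau> t) p y)\<bar>"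
   unfolding Q_def by (rule abs_triangle_ineq4)
  also have "... <= DIM('a) * M1 + 2 * b\<^sup>2 * (1 / a)\<^sup>2 * M2"
   using M1(2)[OF ball_arg_le_1, of "\<tau> t" p y] M2(2)[OF ball_arg_le_1, of "\<tau> t" p y] r ta
   unfolding abs_mult by (intro add_mono mult_mono) auto
  finally have q: "\<bar>Q (\<tau> t) y\<bar> <= DIM('a) * M1 + 2 * b\<^sup>2 * (1 / a)\<^sup>2 * M2" .
  have "\<bar>\<tau> t ^ k\<bar> <= b ^ k" using tau[OF t] by (simp add: power_mono)
  then have "\<bar>b - a\<bar> * \<bar>\<tau> t ^ k\<bar> * \<bar>Q (\<tau> t) y\<bar> <= (b - a) * b ^ k * (DIM('a) * M1 + 2 * b\<^sup>2 * (1 / a)\<^sup>2 * M2)"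
   using s q by (intro mult_mono) auto
  then show ?thesis using True by (simp add: C0_def abs_mult)
 next
  case False
  have "1 / \<tau> t <= 1 / a" using tau[OF t] s by (simp add: frac_le)
  then have "y \<notin> cball p (1 / \<tau> t)" using False by (auto simp: K_def)
  from beta_ball_arg_outside[OF tau(3)[OF t] this] show ?thesis using False by (simp add: Q_def)
 qed
 have iK: "set_integrable lborel K G" using G by (simp add: loc_int_def K_def)
 define h where "h = (%(t, y). \<I> {0..1} t * (G y * ((b - a) * \<tau> t ^ k * Q (\<tau> t) y)))"
 have hm: "h \<in> borel_measurable (lborel \<Otimes>\<^sub>M lborel)" unfolding h_def case_prod_unfold by measurable
 have ih: "integrable (lborel \<Otimes>\<^sub>M lborel) h"
 proof (rule integrable_pair_bounded[OF hm])
  define C where "C = (\<N> y. ennreal C0 * ennreal \<bar>\<I> K y * G y\<bar>)"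
  have "(\<N> x. ennreal (norm (\<I> K x *\<^sub>R G x))) < \<infinity>"
   using iK unfolding set_integrable_def integrable_iff_bounded by blast
  then show "C < \<infinity>" by (simp add: C_def nn_integral_cmult ennreal_mult_less_top)
  fix t
  show "(\<N> x. ennreal \<bar>h (t, x)\<bar>) <= C * \<I> {0..1} t"
  proof (cases "t \<in> {0..1}")
   case True
   have "ennreal \<bar>h (t, y)\<bar> <= ennreal C0 * ennreal \<bar>\<I> K y * G y\<bar>" for y
   proof -
    have "\<bar>h (t, y)\<bar> <= \<bar>G y\<bar> * (C0 * \<I> K y)"
     using True Qb[OF True, of y] by (simp add: h_def abs_mult mult_left_mono)
    also have "... = C0 * \<bar>\<I> K y * G y\<bar>" by (simp add: abs_mult)
    finally show ?thesis using C0 by (simp add: ennreal_leI flip: ennreal_mult)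
   qed
   then show ?thesis using True by (auto simp: C_def intro!: nn_integral_mono)
  qed (simp add: h_def)
 qed
 have i1: "integrable lborel (%y. G y * (\<sigma> ^ DIM('a) * beta1 (ball_arg \<sigma> p y)))" if "\<sigma> > 0" for \<sigma>
 proof -
  have "(%y. beta1 (ball_arg \<sigma> p y) * \<sigma> ^ DIM('a)) \<in> test_functions UNIV"
   unfolding beta1_def by (rule bump_ball_arg_test[OF that smooth_const])
  from loc_int_test[OF G _ this] show ?thesis by (simp add: mult_ac)
 qed
 have "(LBINT y. G y * (b ^ DIM('a) * beta1 (ball_arg b p y))) - (LBINT y. G y * (a ^ DIM('a) * beta1 (ball_arg a p y)))
  = (LBINT y. G y * (b ^ DIM('a) * beta1 (ball_arg b p y) - a ^ DIM('a) * beta1 (ball_arg a p y)))"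
  using i1[of a] i1[of b] s by (simp add: right_diff_distrib)
 also have "... = (LBINT y. \<integral>t. h (t, y) \<partial>lborel)"
  unfolding ftc[symmetric] h_def by (intro Bochner_Integration.integral_cong refl)
   (simp add: mult.left_commute[of "G _"] flip: integral_mult_right_zero)
 also have "... = (LBINT t. \<integral>y. h (t, y) \<partial>lborel)"
  using lborel_pair.Fubini_integral[of "%t y. h (t, y)"] ih by simp
 also have "... = (\<integral>t. 0 \<partial>(lborel :: real measure))"
 proof (intro Bochner_Integration.integral_cong refl)
  fix t :: real
  show "(LBINT y. h (t, y)) = 0"
  proof (cases "t \<in> {0..1}")
   case True
   have "(LBINT y. h (t, y)) = (LBINT y. ((b - a) * \<tau> t ^ k) * (G y * Q (\<tau> t) y))"
    using True by (simp add: h_def mult_ac)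
   also have "... = ((b - a) * \<tau> t ^ k) * (LBINT y. G y * Q (\<tau> t) y)" by (rule integral_mult_right_zero)
   also have "(LBINT y. G y * Q (\<tau> t) y) = 0" unfolding Q_def by (rule z[OF tau(3)[OF True]])
   finally show ?thesis by simp
  qed (simp add: h_def)
 qed
 finally show ?thesis by simp
qed

text \<open>In dimension n the squared L2 norm of the mollifier is of order
  \<open>\<sigma>^n\<close>: its height contributes \<open>\<sigma>^(2n)\<close> and the volume of
  its support \<open>\<sigma>^(-n)\<close>. By Cauchy-Schwarz the mean tends to 0 with \<sigma>, but
  it does not depend on \<sigma>.\<close>

lemma mollified_mean_zero:
 fixes G :: "'a::euclidean_space => real" and p :: 'a
 assumes [measurable]: "G \<in> \<B>" and G: "loc_int UNIV G" and fin: "gnorm UNIV G < \<infinity>"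
  and z: "!!\<sigma>. \<sigma> > 0 ==> (LBINT y. G y * (DIM('a) * beta1 (ball_arg \<sigma> p y) - 2 * \<sigma>\<^sup>2 * (norm (y - p))\<^sup>2 * beta2 (ball_arg \<sigma> p y))) = 0"
  and s: "\<sigma> > 0"
 shows "(LBINT y. G y * beta1 (ball_arg \<sigma> p y)) = 0"
proof -
 define J where "J \<sigma> = (LBINT y. G y * (\<sigma> ^ DIM('a) * beta1 (ball_arg \<sigma> p y)))" for \<sigma>
 have [measurable]: "ball_arg \<sigma> p \<in> \<B>" for \<sigma> unfolding ball_arg_def[abs_def] by measurable
 obtain M where M: "M > 0" "!!t. t <= 1 ==> \<bar>beta1 t\<bar> <= M" unfolding beta1_def using bump_bounded by blast
 define N where "N = enn2real (gnorm UNIV G)"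
 have N: "gnorm UNIV G = ennreal N" "N >= 0" using fin by (simp_all add: N_def)
 define V where "V = unit_ball_vol (real DIM('a))"
 have V: "V >= 0" by (simp add: V_def)
 have bound: "(J \<tau>)\<^sup>2 <= N * (M\<^sup>2 * V * \<tau> ^ DIM('a))" if t: "\<tau> > 0" for \<tau>
 proof -
  have "(\<N> y. ennreal ((\<tau> ^ DIM('a) * beta1 (ball_arg \<tau> p y))\<^sup>2))
   <= (\<N> y. ennreal ((\<tau> ^ DIM('a) * M)\<^sup>2) * \<I> (cball p (1 / \<tau>)) y)"
  proof (intro nn_integral_mono)
   fix y
   have "\<bar>\<tau> ^ DIM('a) * beta1 (ball_arg \<tau> p y)\<bar> <= \<tau> ^ DIM('a) * M"
    using M(2)[OF ball_arg_le_1, of \<tau> p y] t by (simp add: abs_mult)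
   then have "\<bar>\<tau> ^ DIM('a) * beta1 (ball_arg \<tau> p y)\<bar>\<^sup>2 <= (\<tau> ^ DIM('a) * M)\<^sup>2" by (intro power_mono) auto
   then show "ennreal ((\<tau> ^ DIM('a) * beta1 (ball_arg \<tau> p y))\<^sup>2) <= ennreal ((\<tau> ^ DIM('a) * M)\<^sup>2) * \<I> (cball p (1 / \<tau>)) y"
    using beta_ball_arg_outside(1)[OF t, of y p] by (cases "y \<in> cball p (1 / \<tau>)") (auto intro: ennreal_leI)
  qed
  also have "... = ennreal ((\<tau> ^ DIM('a) * M)\<^sup>2) * emeasure lborel (cball p (1 / \<tau>))"
   by (rule nn_integral_cmult_indicator) (simp add: borel_closed)
  also have "emeasure lborel (cball p (1 / \<tau>)) = ennreal (V * (1 / \<tau>) ^ DIM('a))"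
   using t by (simp add: emeasure_bounded_eq content_cball V_def)
  also have "ennreal ((\<tau> ^ DIM('a) * M)\<^sup>2) * ennreal (V * (1 / \<tau>) ^ DIM('a)) = ennreal (M\<^sup>2 * V * \<tau> ^ DIM('a))"
  proof -
   have "(\<tau> ^ DIM('a) * M)\<^sup>2 * (V * (1 / \<tau>) ^ DIM('a)) = M\<^sup>2 * V * \<tau> ^ DIM('a)"
    using t by (simp add: power2_eq_square power_one_over field_simps)
   then show ?thesis using V t by (simp flip: ennreal_mult)
  qed
  finally have P2: "(\<N> y. ennreal ((\<tau> ^ DIM('a) * beta1 (ball_arg \<tau> p y))\<^sup>2)) <= ennreal (M\<^sup>2 * V * \<tau> ^ DIM('a))" .
  have "ennreal ((J \<tau>)\<^sup>2) <= (\<N> y. ennreal ((G y)\<^sup>2)) * (\<N> y. ennreal ((\<tau> ^ DIM('a) * beta1 (ball_arg \<tau> p y))\<^sup>2))"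
   unfolding J_def by (rule Cauchy_Schwarz_integral) measurable
  also have "(\<N> y. ennreal ((G y)\<^sup>2)) = ennreal N" using N(1) by (simp add: gnorm_def)
  also have "ennreal N * (\<N> y. ennreal ((\<tau> ^ DIM('a) * beta1 (ball_arg \<tau> p y))\<^sup>2)) <= ennreal N * ennreal (M\<^sup>2 * V * \<tau> ^ DIM('a))"
   by (intro mult_left_mono P2) simp
  also have "... = ennreal (N * (M\<^sup>2 * V * \<tau> ^ DIM('a)))" using N V t by (intro ennreal_mult[symmetric]) auto
  finally show ?thesis using N V t by (subst (asm) ennreal_le_iff) auto
 qed
 define h where "h n = \<sigma> * inverse (real (Suc n))" for n
 have h: "h n > 0" "h n <= \<sigma>" for n using s by (auto simp: h_def field_simps)
 have "h \<longlonglongrightarrow> \<sigma> * 0" unfolding h_def[abs_def] by (intro tendsto_intros LIMSEQ_inverse_real_of_nat)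
 then have "h \<longlonglongrightarrow> 0" by simp
 then have "(%n. N * (M\<^sup>2 * V * h n ^ DIM('a))) \<longlonglongrightarrow> N * (M\<^sup>2 * V * 0 ^ DIM('a))" by (intro tendsto_intros)
 moreover have "(J \<sigma>)\<^sup>2 <= N * (M\<^sup>2 * V * h n ^ DIM('a))" for n
  using mollified_mean_const[OF assms(1) G z h(1)[of n] h(2)[of n]] bound[OF h(1)[of n]] by (simp add: J_def)
 ultimately have "(J \<sigma>)\<^sup>2 <= N * (M\<^sup>2 * V * 0 ^ DIM('a))"
  by (intro LIMSEQ_le_const) auto
 then have "J \<sigma> = 0" by (simp add: power_0_left)
 moreover have "J \<sigma> = \<sigma> ^ DIM('a) * (LBINT y. G y * beta1 (ball_arg \<sigma> p y))"
  unfolding J_def by (subst mult.left_commute) (rule integral_mult_right_zero)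
 ultimately show ?thesis using s by simp
qed

text \<open>Here \<sigma> goes to infinity and the kernels form an approximate identity, up to their
  mass c. Fubini moves the kernel onto the test function, which changes it by at most
  \<open>B / \<sigma> * c\<close> thanks to its Lipschitz bound.\<close>

lemma mollified_zero_imp_zero:
 fixes G :: "'a::euclidean_space => real"
 assumes [measurable]: "G \<in> \<B>" and G: "loc_int UNIV G"
  and z: "!!\<sigma> p. \<sigma> > 0 ==> (LBINT y. G y * beta1 (ball_arg \<sigma> p y)) = 0"
 shows "AE x in lborel. G x = 0"
proof -
 have "AE x in lborel. x \<in> UNIV --> G x = 0"
 proof (rule fundamental_lemma[OF open_UNIV assms(1) G])
  fix \<phi> :: "'a => real" assume \<phi>: "\<phi> \<in> test_functions UNIV"
  note [measurable] = test_borel[OF \<phi>]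
  obtain K0 B where K0: "compact K0" "K0 \<subseteq> UNIV" "B > 0" "!!x. \<bar>\<phi> x\<bar> <= B * \<I> K0 x"
   "!!x. norm (nabla \<phi> x) <= B * \<I> K0 x" using test_bounded[OF \<phi>] by blast
  obtain R where R: "!!x. x \<in> K0 ==> norm x <= R" using K0(1) by (meson bounded_iff compact_imp_bounded)
  define K where "K = cball (0::'a) (R + 1)"
  have K [measurable]: "K \<in> sets borel" by (simp add: K_def borel_closed)
  have iK: "integrable lborel (%y. \<I> K y * G y)" using G by (simp add: loc_int_def set_integrable_def K_def)
  have iphi: "integrable lborel \<phi>"
   using loc_int_test[OF loc_int_bounded[of "%_. 1::real" 1] _ \<phi>] by simp
  have phi0: "\<phi> x = 0" if "norm x > R" for x using K0(4)[of x] R[of x] that by (cases "x \<in> K0") auto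
  obtain M where M: "M > 0" "!!t. t <= 1 ==> \<bar>beta1 t\<bar> <= M" unfolding beta1_def using bump_bounded by blast
  define I where "I = (LBINT y. \<phi> y * G y)"
  define C where "C = (LBINT y. \<bar>\<I> K y * G y\<bar>)"
  have lipphi: "\<bar>\<phi> x - \<phi> y\<bar> <= B * norm (x - y)" for x y
  proof -
   have "norm (\<phi> x - \<phi> y) <= B * norm (x - y)"
   proof (rule differentiable_bound[of UNIV \<phi> "%x v. nabla \<phi> x \<bullet> v"])
    fix z
    show "(\<phi> has_derivative (%v. nabla \<phi> z \<bullet> v)) (at z within UNIV)"
     using nabla_has_derivative[OF smooth_differentiable[OF test_smooth[OF \<phi>]]] by simp
    have "norm (nabla \<phi> z) <= B" using K0(5)[of z] K0(3) by (cases "z \<in> K0") auto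
    then show "onorm (%v. nabla \<phi> z \<bullet> v) <= B"
     using order_trans[OF Cauchy_Schwarz_ineq2 mult_right_mono[OF _ norm_ge_zero]]
     by (intro onorm_bound) (auto simp: K0(3) less_imp_le)
   qed auto
   then show ?thesis by simp
  qed
  \<comment> \<open>For \<open>\<sigma> >= 1\<close> the kernels have radius at most 1, so the
    mollified test functions are all supported in the ball of radius \<open>R + 1\<close>.\<close>
  have main: "\<bar>I\<bar> <= B / \<sigma> * C" if s: "\<sigma> >= 1" for \<sigma>
  proof -
   have s0: "\<sigma> > 0" using s by simp
   have ball_sym: "ball_arg \<sigma> p y = ball_arg \<sigma> y p" for p y :: 'a by (simp add: ball_arg_def norm_minus_commute)
   define k where "k p y = beta1 (ball_arg \<sigma> p y)" for p y :: 'a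
   have k0: "k p y >= 0" "k p y <= M" for p y
    using beta1_nonneg M(2)[OF ball_arg_le_1, of \<sigma> p y] by (auto simp: k_def)
   have kout: "k p y = 0" if "norm (p - y) > 1 / \<sigma>" for p y
    using beta_ball_arg_outside(1)[OF s0, of y p] that by (simp add: k_def dist_norm)
   have km [measurable]: "(%z. k (fst z) (snd z)) \<in> borel_measurable (lborel \<Otimes>\<^sub>M lborel)"
    unfolding k_def ball_arg_def by measurable
   have km1 [measurable]: "k p \<in> \<B>" "(%p. k p y) \<in> \<B>" for p y
    unfolding k_def[abs_def] ball_arg_def by measurable
   have ktest: "(%p. k p y) \<in> test_functions UNIV" for y
    using bump_ball_arg_test[OF s0 smooth_const[of 1], of "bump_deriv 1" y] by (simp add: k_def ball_sym[of _ y] beta1_def)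
   have ik: "integrable lborel (%p. k p y)" for y
    using loc_int_test[OF loc_int_bounded[of "%_. 1::real" 1] _ ktest] by simp
   have ikphi: "integrable lborel (%p. k p y * \<phi> p)" for y
   proof -
    have "norm (\<phi> x) <= B" for x using K0(4)[of x] K0(3) by (cases "x \<in> K0") auto
    from loc_int_test[OF loc_int_bounded[OF test_borel(1)[OF \<phi>] this] _ ktest[of y]]
    show ?thesis by simp
   qed
   define c where "c = (LBINT z. k z (0::'a))"
   have c: "(LBINT p. k p y) = c" for y
    using integral_shift[of "%p. k p y" y] by (simp add: c_def k_def ball_arg_def)
   have cpos: "c > 0"
   proof -
    have "c >= 0" unfolding c_def using k0 by (intro integral_nonneg_AE) auto
    moreover have "c ~= 0"
    proof
     assume "c = 0"
     then have "AE z in lborel. k z (0::'a) = 0"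
      using integral_nonneg_eq_0_iff_AE[OF ik[of 0]] k0 by (simp add: c_def)
     moreover have "k z 0 > 0" if "z \<in> ball 0 (1 / \<sigma>)" for z :: 'a
     proof -
      have "\<sigma> * norm z < 1" using that s0 by (simp add: field_simps)
      then have "(\<sigma> * norm z)\<^sup>2 < 1\<^sup>2" using s0 by (intro power_strict_mono) auto
      then show ?thesis unfolding k_def by (intro beta1_pos) (simp add: ball_arg_def power_mult_distrib)
     qed
     ultimately have "AE z in lborel. z \<notin> ball (0::'a) (1 / \<sigma>)" by (auto elim!: eventually_mono) (metis less_irrefl)
     then have "emeasure lborel (ball (0::'a) (1 / \<sigma>)) = 0"
      by (subst (asm) AE_iff_measurable[OF _ refl]) (auto simp: ball_def)
     then have "measure lborel (ball (0::'a) (1 / \<sigma>)) = 0" by (simp add: measure_def)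
     then show False using s0 content_ball_gt_0_iff[of "0::'a" "1 / \<sigma>"] by simp
    qed
    ultimately show ?thesis by simp
   qed
   define \<Phi> where "\<Phi> y = (LBINT p. k p y * \<phi> p)" for y
   have [measurable]: "\<Phi> \<in> \<B>" unfolding \<Phi>_def[abs_def] k_def ball_arg_def by measurable
   have near: "\<bar>c * \<phi> y - \<Phi> y\<bar> <= B / \<sigma> * c" for y
   proof -
    have "c * \<phi> y - \<Phi> y = (LBINT p. k p y * \<phi> y - k p y * \<phi> p)"
     using ik ikphi by (simp add: \<Phi>_def c)
    then have "\<bar>c * \<phi> y - \<Phi> y\<bar> <= (LBINT p. \<bar>k p y * \<phi> y - k p y * \<phi> p\<bar>)" by (simp add: integral_abs_bound)
    also have "... <= (LBINT p. B / \<sigma> * k p y)"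
    proof (intro integral_mono integrable_abs Bochner_Integration.integrable_diff integrable_mult_right integrable_mult_left ik ikphi)
     fix p
     show "\<bar>k p y * \<phi> y - k p y * \<phi> p\<bar> <= B / \<sigma> * k p y"
     proof (cases "norm (p - y) > 1 / \<sigma>")
      case False
      have "\<bar>\<phi> y - \<phi> p\<bar> <= B * norm (y - p)" by (rule lipphi)
      also have "... <= B * (1 / \<sigma>)" using False K0(3) by (intro mult_left_mono) (auto simp: norm_minus_commute)
      finally have "k p y * \<bar>\<phi> y - \<phi> p\<bar> <= k p y * (B * (1 / \<sigma>))" using k0 by (intro mult_left_mono)
      moreover have "\<bar>k p y * \<phi> y - k p y * \<phi> p\<bar> = k p y * \<bar>\<phi> y - \<phi> p\<bar>"
       using k0[of p y] by (simp add: abs_mult flip: right_diff_distrib)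
      ultimately show ?thesis by (simp add: mult_ac)
     qed (simp add: kout)
    qed
    finally show ?thesis by (simp add: c)
   qed
   have Phi0: "\<Phi> y = 0" if "y \<notin> K" for y
   proof -
    have e: "k p y * \<phi> p = 0" for p
    proof (cases "norm p > R")
     case False
     have "norm y > R + 1" using that by (simp add: K_def)
     moreover have "norm y <= norm (p - y) + norm p" using norm_triangle_ineq[of "y - p" p] by (simp add: norm_minus_commute)
     moreover have "1 / \<sigma> <= 1" using s by simp
     ultimately have "norm (p - y) > 1 / \<sigma>" using False by linarith
     then show ?thesis by (simp add: kout)
    qed (simp add: phi0)
    show ?thesis unfolding \<Phi>_def e by simp
   qed
   have Kphi: "\<phi> y = 0" if "y \<notin> K" for y using that by (intro phi0) (simp add: K_def)
   have iPG: "integrable (lborel \<Otimes>\<^sub>M lborel) (%(p, y). k p y * \<phi> p * G y)"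
   proof (rule Bochner_Integration.integrable_bound)
    have "integrable (lborel \<Otimes>\<^sub>M lborel) (%(p::'a, y::'a). (M * \<phi> p) * (\<I> K y * G y))"
    proof (rule lborel_pair.Fubini_integrable)
     show "integrable lborel (%x. \<integral>y. norm (case (x, y) of (p, y) => M * \<phi> p * (\<I> K y * G y)) \<partial>lborel)"
      using iphi by (simp add: abs_mult)
     show "AE x in lborel. integrable lborel (%y. case (x, y) of (p, y) => M * \<phi> p * (\<I> K y * G y))"
      using iK by simp
    qed measurable
    then show "integrable (lborel \<Otimes>\<^sub>M lborel) (%(p::'a, y::'a). (M * \<phi> p) * (\<I> K y * G y))" .
    show "AE x in lborel \<Otimes>\<^sub>M lborel. norm (case x of (p, y) => k p y * \<phi> p * G y) <= norm (case x of (p, y) => (M * \<phi> p) * (\<I> K y * G y))"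
    proof (rule AE_I2)
     fix z :: "'a \<times> 'a"
     obtain p y where zz: "z = (p, y)" by (cases z)
     have "norm (k p y * \<phi> p * G y) <= norm ((M * \<phi> p) * (\<I> K y * G y))"
     proof (cases "y \<in> K")
      case True
      have "\<bar>k p y\<bar> * \<bar>\<phi> p\<bar> * \<bar>G y\<bar> <= M * \<bar>\<phi> p\<bar> * \<bar>G y\<bar>" using k0[of p y] by (intro mult_right_mono) auto
      then show ?thesis using True M(1) by (simp add: abs_mult)
     next
      case False
      have "k p y * \<phi> p = 0"
      proof (cases "norm p > R")
       case False': False
       have "norm y > R + 1" using False by (simp add: K_def)
       moreover have "norm y <= norm (p - y) + norm p" using norm_triangle_ineq[of "y - p" p] by (simp add: norm_minus_commute)
       moreover have "1 / \<sigma> <= 1" using s by simp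
       ultimately have "norm (p - y) > 1 / \<sigma>" using False' by linarith
       then show ?thesis by (simp add: kout)
      qed (simp add: phi0)
      then show ?thesis by auto
     qed
     then show "norm (case z of (p, y) => k p y * \<phi> p * G y) <= norm (case z of (p, y) => (M * \<phi> p) * (\<I> K y * G y))"
      unfolding zz by simp
    qed
   qed measurable
   have "(LBINT y. \<Phi> y * G y) = (LBINT y. \<integral>p. k p y * \<phi> p * G y \<partial>lborel)"
    by (simp add: \<Phi>_def)
   also have "... = (LBINT p. \<integral>y. k p y * \<phi> p * G y \<partial>lborel)"
    by (rule lborel_pair.Fubini_integral[OF iPG])
   also have "... = (LBINT p. \<phi> p * (LBINT y. G y * k p y))"
    by (intro Bochner_Integration.integral_cong refl) (simp add: mult_ac flip: integral_mult_right_zero)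
   also have "... = 0" using z[OF s0] by (simp add: k_def)
   finally have PG: "(LBINT y. \<Phi> y * G y) = 0" .
   have iP: "integrable lborel (%y. \<Phi> y * G y)"
    using lborel_pair.integrable_snd[OF iPG] by (simp add: \<Phi>_def)
   have ip: "integrable lborel (%y. \<phi> y * G y)" using loc_int_test[OF G _ \<phi>] by simp
   have "c * I = (LBINT y. c * (\<phi> y * G y) - \<Phi> y * G y)"
    using iP ip PG by (simp add: I_def)
   then have "\<bar>c * I\<bar> <= (LBINT y. \<bar>c * (\<phi> y * G y) - \<Phi> y * G y\<bar>)" by (simp add: integral_abs_bound)
   also have "... <= (LBINT y. (B / \<sigma> * c) * \<bar>\<I> K y * G y\<bar>)"
   proof (intro integral_mono integrable_abs Bochner_Integration.integrable_diff integrable_mult_right ip iP iK)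
    fix y
    have e: "c * (\<phi> y * G y) - \<Phi> y * G y = (c * \<phi> y - \<Phi> y) * (\<I> K y * G y)"
     using Phi0[of y] Kphi[of y] by (cases "y \<in> K") (auto simp: algebra_simps)
    show "\<bar>c * (\<phi> y * G y) - \<Phi> y * G y\<bar> <= (B / \<sigma> * c) * \<bar>\<I> K y * G y\<bar>"
     unfolding e abs_mult[of "c * \<phi> y - \<Phi> y"] by (rule mult_right_mono[OF near]) simp
   qed
   also have "... = c * (B / \<sigma> * C)" by (simp add: C_def)
   finally have "c * \<bar>I\<bar> <= c * (B / \<sigma> * C)" using cpos by (simp add: abs_mult)
   then show ?thesis using cpos by (rule mult_left_le_imp_le)
  qed
  have "\<bar>I\<bar> <= (B * C) * inverse (real (Suc n))" for n
   using main[of "real (Suc n)"] by (simp add: divide_inverse mult_ac)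
  moreover have "(%n. (B * C) * inverse (real (Suc n))) \<longlonglongrightarrow> (B * C) * 0"
   by (intro tendsto_intros LIMSEQ_inverse_real_of_nat)
  ultimately have "\<bar>I\<bar> <= (B * C) * 0" by (intro LIMSEQ_le_const) auto
  then show "(LBINT x. \<phi> x * G x) = 0" by (simp add: I_def)
 qed
 then show ?thesis by simp
qed

text \<open>The difference of two stray fields of one magnetization satisfies these hypotheses. This
  makes the energy independent of the potential that is chosen in its definition.\<close>

theorem liouville_gradient:
 fixes g :: "'a::euclidean_space => 'a"
 assumes w: "wgrad UNIV w g" and fin: "gnorm UNIV g < \<infinity>"
  and harm: "!!\<phi>. \<phi> \<in> test_functions UNIV ==> (LBINT x. g x \<bullet> nabla \<phi> x) = 0"
 shows "AE x in lborel. g x = 0"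
proof -
 note [measurable] = wgradD(2)[OF w]
 have "AE x in lborel. g x \<bullet> b = 0" if b: "b \<in> Basis" for b
 proof (rule mollified_zero_imp_zero)
  show l: "loc_int UNIV (%x. g x \<bullet> b)" by (rule loc_int_inner[OF wgradD(4)[OF w]])
  have "gnorm UNIV (%x. g x \<bullet> b) <= gnorm UNIV g"
   unfolding gnorm_def using Basis_le_norm[OF b]
   by (intro nn_integral_mono mult_left_mono ennreal_leI power_mono) auto
  then have f: "gnorm UNIV (%x. g x \<bullet> b) < \<infinity>" using fin by (rule le_less_trans)
  show "(LBINT y. g y \<bullet> b * beta1 (ball_arg \<sigma> p y)) = 0" if "\<sigma> > 0" for \<sigma> p
   by (rule mollified_mean_zero[OF _ l f harmonic_gradient_identity[OF w harm _ b] that]) measurable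
 qed measurable
 then have "AE x in lborel. \<forall>b\<in>Basis. g x \<bullet> b = 0" by (intro AE_finite_allI) auto
 then show ?thesis by (rule eventually_mono) (auto intro: euclidean_eqI)
qed

section \<open>Minimal elements of midpoint convex families\<close>

text \<open>The projection argument of Hilbert space for a decreasing sequence of convex sets: N
  stands for the squared norm and d for the squared distance, tied by the parallelogram identity.
  Elements that nearly attain the infima \<delta> form a Cauchy sequence, because these infima
  increase to a finite limit.\<close>

lemma midpoint_minimizing_Cauchy:
 fixes S :: "nat => 'f set" and N :: "'f => real"
 assumes dec: "!!n. S (Suc n) \<subseteq> S n" and ne: "!!n. S n ~= {}"
  and N: "!!x. N x >= 0" "!!n x. x \<in> S n ==> N x <= B"
  and mid: "!!n x y. x \<in> S n ==> y \<in> S n ==> mid x y \<in> S n"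
  and par: "!!x y. x \<in> S 0 ==> y \<in> S 0 ==> d x y = 2 * N x + 2 * N y - 4 * N (mid x y)"
 obtains y where "!!n. y n \<in> S n" "!!\<epsilon>::real. \<epsilon> > 0 ==> \<exists>M. \<forall>n\<ge>M. \<forall>m\<ge>M. d (y n) (y m) <= \<epsilon>"
proof -
 have mono: "S m \<subseteq> S n" if "n <= m" for n m
  using that by (induction rule: dec_induct) (use dec in auto)
 define \<delta> where "\<delta> n = Inf (N ` S n)" for n
 have bb: "bdd_below (N ` S n)" for n by (rule bdd_belowI2[of _ 0]) (rule N(1))
 have lower: "\<delta> n <= N x" if "x \<in> S n" for n x
  unfolding \<delta>_def using that bb by (intro cInf_lower) auto
 have "\<exists>x\<in>S n. N x < \<delta> n + inverse (real (Suc n))" for n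
  using cInf_lessD[of "N ` S n" "\<delta> n + inverse (real (Suc n))"] ne[of n] by (auto simp: \<delta>_def)
 then obtain y where y: "!!n. y n \<in> S n" "!!n. N (y n) < \<delta> n + inverse (real (Suc n))" by metis
 have dmono: "\<delta> n <= \<delta> m" if "n <= m" for n m
  unfolding \<delta>_def using mono[OF that] ne bb by (intro cInf_superset_mono) auto
 have "\<delta> n <= B" for n using lower[OF y(1)] N(2)[OF y(1)] order_trans by blast
 then obtain l where l: "\<delta> \<longlonglongrightarrow> l" "!!n. \<delta> n <= l"
  using incseq_convergent[of \<delta> B] dmono by (auto simp: incseq_def)
 \<comment> \<open>Both elements and their midpoint lie in \<open>S k\<close>, so N of the midpoint
   is at least \<open>\<delta> k\<close>, whereas N of each element exceeds l by at most the error
   for k.\<close>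
 have est: "d (y n) (y m) <= 4 * (l - \<delta> k) + 4 * inverse (real (Suc k))" if "k <= n" "k <= m" for n m k
 proof -
  have "y n \<in> S k" "y m \<in> S k" using y(1) mono that by blast+
  then have "\<delta> k <= N (mid (y n) (y m))" and S0: "y n \<in> S 0" "y m \<in> S 0"
   using lower[OF mid] mono[of 0 k] by auto
  moreover have "inverse (real (Suc n)) <= inverse (real (Suc k))" "inverse (real (Suc m)) <= inverse (real (Suc k))"
   using that by (auto intro!: le_imp_inverse_le)
  moreover define u v w where "u = inverse (real (Suc n))" and "v = inverse (real (Suc m))" and "w = inverse (real (Suc k))"
  ultimately have "\<delta> k <= N (mid (y n) (y m))" "u <= w" "v <= w" by simp_all
  moreover have "N (y n) < \<delta> n + u" "N (y m) < \<delta> m + v" using y(2)[of n] y(2)[of m] by (simp_all add: u_def v_def)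
  moreover note par[OF S0] l(2)[of n] l(2)[of m]
  ultimately have "d (y n) (y m) <= 4 * (l - \<delta> k) + 4 * w" by argo
  then show ?thesis by (simp add: w_def)
 qed
 have "(%k. 4 * (l - \<delta> k) + 4 * inverse (real (Suc k))) \<longlonglongrightarrow> 4 * (l - l) + 4 * 0"
  by (intro tendsto_intros l LIMSEQ_inverse_real_of_nat)
 then have lim0: "(%k. 4 * (l - \<delta> k) + 4 * inverse (real (Suc k))) \<longlonglongrightarrow> 0" by simp
 have "\<exists>M. \<forall>n\<ge>M. \<forall>m\<ge>M. d (y n) (y m) <= \<epsilon>" if "\<epsilon> > 0" for \<epsilon>
 proof -
  from order_tendstoD(2)[OF lim0 \<open>\<epsilon> > 0\<close>]
  have "\<exists>k. \<forall>j\<ge>k. 4 * (l - \<delta> j) + 4 * inverse (real (Suc j)) < \<epsilon>" by (simp only: eventually_sequentially)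
  then obtain k where "4 * (l - \<delta> k) + 4 * inverse (real (Suc k)) < \<epsilon>" by blast
  then have "d (y n) (y m) <= \<epsilon>" if "n >= k" "m >= k" for n m
   using order_trans[OF est[OF that] less_imp_le] by blast
  then show ?thesis by blast
 qed
 with y(1) show thesis by (rule that)
qed

section \<open>Locating a transition\<close>

text \<open>Differences of bad positions take at most \<open>N * N\<close> values, so one of the
  \<open>N * N + 1\<close> disjoint ranges between consecutive L contains none of them. Seen from
  the position before the first long run of 1, the colours at distances in this range to the left
  are then constant, and they have to be -1.\<close>

lemma transition_at_scale:
 fixes c :: "int => int" and L :: "nat => int"
 defines "bad \<equiv> {k. c k = 0 \<or> c (k + 1) ~= c k}"
 assumes vals: "!!k. c k \<in> {-1, 0, 1}" and fin: "finite bad" "card bad <= N"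
  and right: "!!k. k >= k1 ==> c k = 1" and left: "!!k. k <= k0 ==> c k = -1"
  and L: "L 0 >= 1" "!!j. L (Suc j) >= L j + 1"
 shows "\<exists>j\<le>N * N. \<exists>k. \<forall>i. L j <= i & i <= L (Suc j) - L j --> c (k + i) = 1 & c (k - i) = -1"
proof -
 define D where "D = (%(a, b). a - b) ` (bad \<times> bad)"
 have D: "finite D" "card D <= N * N"
 proof -
  have "card D <= card (bad \<times> bad)" unfolding D_def using fin by (intro card_image_le) auto
  also have "... <= N * N" using fin by (simp add: card_cartesian_product mult_mono)
  finally show "card D <= N * N" .
 qed (use fin in \<open>simp add: D_def\<close>)
 have Lmono: "L i <= L j" if "i <= j" for i j
  using that by (induction rule: dec_induct) (use L(2) in \<open>auto intro: order_trans add_increasing2\<close>, smt (verit) L(2))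
 have L1: "L j >= 1" for j using Lmono[of 0 j] L(1) by simp
 have "\<exists>j\<le>N * N. \<forall>d\<in>D. \<not> (L j < d & d <= L (Suc j))"
 proof (rule ccontr)
  assume "\<not> ?thesis"
  \<comment> \<open>A difference picked from each range would inject \<open>N * N + 1\<close>
    indices into D.\<close>
  then obtain f where f: "!!j. j <= N * N ==> f j \<in> D & L j < f j & f j <= L (Suc j)" by metis
  have "inj_on f {..N * N}"
  proof (rule inj_onI)
   fix i j assume ij: "i \<in> {..N * N}" "j \<in> {..N * N}" "f i = f j"
   have False if "a < b" "a <= N * N" "b <= N * N" "f a = f b" for a b
    using f[OF that(2)] f[OF that(3)] that(4) Lmono[of "Suc a" b] that(1) by linarith
   then show "i = j" using ij by (metis atMost_iff linorder_neqE_nat)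
  qed
  moreover have "f ` {..N * N} \<subseteq> D" using f by auto
  ultimately have "card {..N * N} <= card D" using D(1) by (metis card_inj_on_le)
  then show False using D(2) by simp
 qed
 then obtain j where j: "j <= N * N" "!!d. d \<in> D ==> \<not> (L j < d & d <= L (Suc j))" by blast
 \<comment> \<open>T below collects the starting points of runs of 1 that fill
   \<open>W + 1 = L (Suc j) - L j\<close> positions.\<close>
 define W where "W = L (Suc j) - L j - 1"
 have W: "W >= 0" using L(2)[of j] by (simp add: W_def)
 define T where "T = {x. \<forall>i. x <= i & i <= x + W --> c i = 1}"
 have "k1 \<in> T" using right by (simp add: T_def)
 have Tk0: "x > k0" if "x \<in> T" for x
 proof (rule ccontr)
  assume "\<not> x > k0"
  then have "c x = -1" using left by simp
  moreover have "c x = 1" using that W by (simp add: T_def)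
  ultimately show False by simp
 qed
 define m where "m = (LEAST m. k0 + int m \<in> T)"
 have "k0 + int (nat (k1 - k0)) \<in> T" using Tk0[OF \<open>k1 \<in> T\<close>] \<open>k1 \<in> T\<close> by simp
 then have mT: "k0 + int m \<in> T" unfolding m_def by (rule LeastI)
 define x where "x = k0 + int m"
 have xT: "x \<in> T" using mT by (simp add: x_def)
 have least: "x <= x'" if "x' \<in> T" for x'
 proof -
  have "k0 + int (nat (x' - k0)) \<in> T" using Tk0[OF that] that by simp
  then have "m <= nat (x' - k0)" unfolding m_def by (rule Least_le)
  then show ?thesis using Tk0[OF that] by (simp add: x_def)
 qed
 \<comment> \<open>The position before the leftmost such run is bad and serves as the centre of the
   transition.\<close>
 define b where "b = x - 1"
 have cx: "c i = 1" if "x <= i" "i <= x + W" for i using xT that by (simp add: T_def)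
 have cb: "c b ~= 1"
 proof
  assume "c b = 1"
  then have "b \<in> T" using cx by (auto simp: T_def b_def) (smt (verit))
  then show False using least[of b] by (simp add: b_def)
 qed
 have b_bad: "b \<in> bad" using cb cx[of x] W by (simp add: bad_def b_def)
 have nb: "i \<notin> bad" if "b - L (Suc j) <= i" "i < b - L j" for i
 proof
  assume "i \<in> bad"
  then have "b - i \<in> D" using b_bad by (auto simp: D_def)
  then show False using j(2) that by fastforce
 qed
 define a where "a = b - L (Suc j)"
 have const: "c (a + int n) = c a" if "a + int n <= b - L j" for n
  using that
 proof (induction n)
  case (Suc n)
  then have "a + int n \<notin> bad" by (intro nb) (auto simp: a_def)
  then have "c (a + int n + 1) = c (a + int n)" by (simp add: bad_def)
  then show ?case using Suc by (simp add: algebra_simps)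
 qed simp
 have const': "c i = c a" if "a <= i" "i <= b - L j" for i
  using const[of "nat (i - a)"] that by simp
 have "a < b - L j" using L(2)[of j] by (simp add: a_def)
 then have "a \<notin> bad" by (intro nb) (auto simp: a_def)
 then have "c a ~= 0" by (simp add: bad_def)
 \<comment> \<open>Otherwise the constant stretch would itself start a run in T, to the left of the
   leftmost one.\<close>
 moreover have "c a ~= 1"
 proof
  assume "c a = 1"
  then have "a \<in> T" using const' by (auto simp: T_def W_def a_def)
  then show False using least[of a] L1[of "Suc j"] by (simp add: a_def b_def)
 qed
 ultimately have ca: "c a = -1" using vals[of a] by auto
 have "\<forall>i. L j <= i & i <= L (Suc j) - L j --> c (b + i) = 1 & c (b - i) = -1"
 proof (intro allI impI)
  fix i assume i: "L j <= i & i <= L (Suc j) - L j"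
  have "c (b + i) = 1" using i L1[of j] by (intro cx) (auto simp: b_def W_def)
  moreover have "c (b - i) = c a" using i L1[of j] by (intro const') (auto simp: a_def)
  ultimately show "c (b + i) = 1 & c (b - i) = -1" using ca by simp
 qed
 then show ?thesis using j(1) by blast
qed

text \<open>The order of the quantifiers matters: L is fixed before the reach R. If every L failed
  for some reach \<open>R L\<close> and all large n, then scales that leave room for
  \<open>R (L j)\<close> above each \<open>L j\<close> would contradict
  \<open>transition_at_scale\<close> at a single n beyond finitely many thresholds.\<close>

lemma transition_bounded_scale:
 fixes c :: "nat => int => int"
 assumes vals: "!!n k. c n k \<in> {-1, 0, 1}"
  and fin: "!!n. finite {k. c n k = 0 \<or> c n (k + 1) ~= c n k}" "!!n. card {k. c n k = 0 \<or> c n (k + 1) ~= c n k} <= N"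
  and right: "!!n. \<exists>k1. \<forall>k\<ge>k1. c n k = 1" and left: "!!n. \<exists>k0. \<forall>k\<le>k0. c n k = -1"
 shows "\<exists>L. \<forall>R M. \<exists>n\<ge>M. \<exists>k. \<forall>i. L <= i & i <= R --> c n (k + i) = 1 & c n (k - i) = -1"
proof (rule ccontr)
 assume "\<not> ?thesis"
 then obtain R M where RM: "!!L n k. n >= M L ==> \<exists>i. L <= i & i <= R L & \<not> (c n (k + i) = 1 & c n (k - i) = -1)"
  by metis
 define L where "L = rec_nat 1 (%_ l. l + max 1 (R l))"
 have L0: "L 0 >= 1" and LS: "L (Suc j) = L j + max 1 (R (L j))" for j by (simp_all add: L_def)
 define n where "n = Max ((%j. M (L j)) ` {..N * N})"
 have n: "M (L j) <= n" if "j <= N * N" for j unfolding n_def using that by (intro Max_ge) auto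
 obtain k1 where k1: "!!k. k >= k1 ==> c n k = 1" using right by blast
 obtain k0 where k0: "!!k. k <= k0 ==> c n k = -1" using left by blast
 have "L (Suc j) >= L j + 1" for j by (simp add: LS)
 from transition_at_scale[OF vals fin k1 k0 L0 this]
 obtain j k where j: "j <= N * N" "!!i. L j <= i ==> i <= L (Suc j) - L j ==> c n (k + i) = 1 & c n (k - i) = -1"
  by blast
 obtain i where i: "L j <= i" "i <= R (L j)" "\<not> (c n (k + i) = 1 & c n (k - i) = -1)"
  using RM[OF n[OF j(1)]] by blast
 then show False using j(2)[of i] by (simp add: LS)
qed

section \<open>Weak derivatives and Borel representatives\<close>

lemma lebesgue_borel_version:
 fixes h :: "'a::euclidean_space => 'b::euclidean_space"
 assumes "h \<in> borel_measurable lebesgue"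
 obtains h' where "h' \<in> \<B>" "AE x in lborel. h x = h' x"
proof -
 have "\<exists>k. k \<in> \<B> & (AE x in lborel. h x \<bullet> c = k x)" for c
 proof -
  have "(%x. h x \<bullet> c) \<in> borel_measurable lebesgue" using assms by measurable
  from completion_ex_borel_measurable_real[OF this] show ?thesis by auto
 qed
 then obtain k where k: "!!c. k c \<in> \<B>" "!!c. AE x in lborel. h x \<bullet> c = k c x" by metis
 have "AE x in lborel. \<forall>c\<in>Basis. h x \<bullet> c = k c x" by (intro AE_finite_allI k(2)) auto
 then have "AE x in lborel. h x = (\<Sum>c\<in>Basis. k c x *\<^sub>R c)"
 proof eventually_elim
  fix x assume "\<forall>c\<in>Basis. h x \<bullet> c = k c x"
  then have "(\<Sum>c\<in>Basis. k c x *\<^sub>R c) = (\<Sum>c\<in>Basis. (h x \<bullet> c) *\<^sub>R c)" by (intro sum.cong) auto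
  then show "h x = (\<Sum>c\<in>Basis. k c x *\<^sub>R c)" by (simp add: euclidean_representation)
 qed
 moreover have "(%x. \<Sum>c\<in>Basis. k c x *\<^sub>R c) \<in> \<B>" using k(1) by measurable
 ultimately show thesis by (rule that[rotated])
qed

lemma AE_lebesgue_iff: "(AE x in lebesgue. P x) \<longleftrightarrow> (AE x in lborel. P x)"
 by (rule AE_completion_iff)

text \<open>Local integrability speaks only about compact subsets; U is a countable increasing union
  of them.\<close>

lemma locally_integrable_measurable:
 fixes f :: "'a::euclidean_space => 'b::euclidean_space"
 assumes U: "open U" and f: "f locally_integrable_on U"
 shows "(%x. \<I> U x *\<^sub>R f x) \<in> borel_measurable lebesgue"
proof -
 obtain K where K: "!!n. compact (K n)" "!!n. K n \<subseteq> U" "!!n. K n \<subseteq> interior (K (Suc n))" "\<Union>(range K) = U"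
  using open_Union_compact_subsets[OF U] by metis
 show ?thesis
 proof (rule borel_measurable_LIMSEQ_metric)
  show "(%x. \<I> (K n) x *\<^sub>R f x) \<in> borel_measurable lebesgue" for n
   using f K(1,2)[of n] by (auto simp: locally_integrable_on_def set_integrable_def)
  fix x
  show "(%n. \<I> (K n) x *\<^sub>R f x) \<longlonglongrightarrow> \<I> U x *\<^sub>R f x"
  proof (cases "x \<in> U")
   case True
   then obtain i where i: "x \<in> K i" using K(4) by blast
   have "x \<in> K n" if "n >= i" for n
    using that i by (induction rule: dec_induct) (use K(3) interior_subset in blast)+
   then have "\<forall>\<^sub>F n in sequentially. \<I> U x *\<^sub>R f x = \<I> (K n) x *\<^sub>R f x"
    using True by (auto simp: eventually_sequentially intro!: exI[of _ i])
   then show ?thesis by (rule Lim_transform_eventually[OF tendsto_const])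
  next
   case False
   then have "\<I> (K n) x = (0::real)" for n using K(2)[of n] by (auto simp: indicator_def)
   then show ?thesis using False by simp
  qed
 qed
qed

lemma locally_integrable_borel_version:
 fixes f :: "'a::euclidean_space => 'b::euclidean_space"
 assumes U: "open U" and f: "f locally_integrable_on U"
 obtains F where "F \<in> \<B>" "AE x in lborel. x \<in> U --> f x = F x" "loc_int U F"
proof -
 obtain F where F [measurable]: "F \<in> \<B>" and eq: "AE x in lborel. \<I> U x *\<^sub>R f x = F x"
  using lebesgue_borel_version[OF locally_integrable_measurable[OF U f]] by blast
 have "set_integrable lborel K F" if K: "compact K" "K \<subseteq> U" for K
 proof -
  have [measurable]: "K \<in> sets borel" using K by (simp add: borel_compact)
  have "integrable lebesgue (%x. \<I> K x *\<^sub>R f x)"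
   using f K by (auto simp: locally_integrable_on_def set_integrable_def)
  moreover have "AE x in lebesgue. \<I> K x *\<^sub>R f x = \<I> K x *\<^sub>R F x"
   unfolding AE_lebesgue_iff using eq by eventually_elim (use K in \<open>auto simp: indicator_def split: if_splits\<close>)
  moreover have "(%x. \<I> K x *\<^sub>R F x) \<in> borel_measurable lebesgue" by (intro measurable_completion) measurable
  ultimately have "integrable lebesgue (%x. \<I> K x *\<^sub>R F x)"
   by (metis (no_types, lifting) integrable_cong_AE_imp eventually_mono)
  then show ?thesis by (simp add: set_integrable_def integrable_completion)
 qed
 then have "loc_int U F" by (auto simp: loc_int_def)
 moreover have "AE x in lborel. x \<in> U --> f x = F x" using eq by eventually_elim auto
 ultimately show thesis using F that by blast
qed

lemma lebesgue_on_integral_eq: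
 fixes f F :: "'a::euclidean_space => 'b::euclidean_space"
 assumes U: "open U" and [measurable]: "F \<in> \<B>" "\<psi> \<in> \<B>"
  and eq: "AE x in lborel. x \<in> U --> f x = F x" and z: "!!x. x \<notin> U ==> \<psi> x = 0"
 shows "(LINT x|lebesgue_on U. \<psi> x *\<^sub>R f x) = (LBINT x. \<psi> x *\<^sub>R F x)"
proof -
 have "(LINT x|lebesgue_on U. \<psi> x *\<^sub>R f x) = (\<integral>x. \<I> U x *\<^sub>R (\<psi> x *\<^sub>R f x) \<partial>lebesgue)"
  using U by (intro integral_restrict_space) auto
 also have "... = (\<integral>x. \<psi> x *\<^sub>R F x \<partial>lebesgue)"
 proof (rule integral_cong_AE)
  show m: "(%x. \<psi> x *\<^sub>R F x) \<in> borel_measurable lebesgue" by (intro measurable_completion) measurable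
  show e: "AE x in lebesgue. \<I> U x *\<^sub>R \<psi> x *\<^sub>R f x = \<psi> x *\<^sub>R F x"
   unfolding AE_lebesgue_iff using eq by eventually_elim (use z in \<open>auto simp: indicator_def\<close>)
  show "(%x. \<I> U x *\<^sub>R \<psi> x *\<^sub>R f x) \<in> borel_measurable lebesgue"
   by (rule borel_measurable_AE[OF m]) (use e in \<open>auto elim: eventually_mono\<close>)
 qed
 also have "... = (LBINT x. \<psi> x *\<^sub>R F x)" by (rule integral_completion) measurable
 finally show ?thesis .
qed

lemma test_zero_outside:
 assumes "\<phi> \<in> test_functions U" "x \<notin> U" shows "\<phi> x = 0" "nabla \<phi> x = 0"
proof -
 obtain K where "K \<subseteq> U" "!!x. x \<notin> K ==> \<phi> x = 0" "!!x. x \<notin> K ==> nabla \<phi> x = 0"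
  using test_functionsE[OF assms(1)] by metis
 then show "\<phi> x = 0" "nabla \<phi> x = 0" using assms(2) by blast+
qed

text \<open>The bridge between the given definition, with vector valued integrals for
  \<open>lebesgue_on\<close>, and scalar integrals of Borel representatives for
  \<open>lborel\<close>.\<close>

lemma has_weak_pderiv_iff:
 fixes f F g G :: "'a::euclidean_space => 'b::euclidean_space"
 assumes U: "open U" and F [measurable]: "F \<in> \<B>" and G [measurable]: "G \<in> \<B>"
  and f: "AE x in lborel. x \<in> U --> f x = F x" and g: "AE x in lborel. x \<in> U --> g x = G x"
  and l: "loc_int U F" "loc_int U G"
 shows "has_weak_pderiv U b f g \<longleftrightarrow> f locally_integrable_on U & g locally_integrable_on U &
  (\<forall>\<phi>\<in>test_functions U. \<forall>c\<in>Basis. (LBINT x. (nabla \<phi> x \<bullet> b) * (F x \<bullet> c)) = - (LBINT x. \<phi> x * (G x \<bullet> c)))"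
proof -
 have "(LINT x|lebesgue_on U. pderiv_at b \<phi> x *\<^sub>R f x) = - (LINT x|lebesgue_on U. \<phi> x *\<^sub>R g x) \<longleftrightarrow>
  (\<forall>c\<in>Basis. (LBINT x. (nabla \<phi> x \<bullet> b) * (F x \<bullet> c)) = - (LBINT x. \<phi> x * (G x \<bullet> c)))"
  if \<phi>: "\<phi> \<in> test_functions U" for \<phi>
 proof -
  note [measurable] = test_borel[OF \<phi>]
  have e1: "(LINT x|lebesgue_on U. pderiv_at b \<phi> x *\<^sub>R f x) = (LBINT x. (nabla \<phi> x \<bullet> b) *\<^sub>R F x)"
   unfolding test_pderiv[OF \<phi>] by (rule lebesgue_on_integral_eq[OF U F _ f]) (simp_all add: test_zero_outside[OF \<phi>])
  have e2: "(LINT x|lebesgue_on U. \<phi> x *\<^sub>R g x) = (LBINT x. \<phi> x *\<^sub>R G x)"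
   by (rule lebesgue_on_integral_eq[OF U G _ g]) (simp_all add: test_zero_outside[OF \<phi>])
  have i1: "integrable lborel (%x. (nabla \<phi> x \<bullet> b) *\<^sub>R F x)" by (rule loc_int_test[OF l(1) F test_nabla_inner[OF \<phi>]])
  have i2: "integrable lborel (%x. \<phi> x *\<^sub>R G x)" by (rule loc_int_test[OF l(2) G \<phi>])
  have c1: "(LBINT x. (nabla \<phi> x \<bullet> b) *\<^sub>R F x) \<bullet> c = (LBINT x. (nabla \<phi> x \<bullet> b) * (F x \<bullet> c))" for c
   using integral_inner_left[OF i1, of c] by simp
  have c2: "(- (LBINT x. \<phi> x *\<^sub>R G x)) \<bullet> c = - (LBINT x. \<phi> x * (G x \<bullet> c))" for c
   using integral_inner_left[OF i2, of c] by simp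
  show ?thesis unfolding e1 e2 euclidean_eq_iff[of "integral\<^sup>L lborel _"] c1 c2 by (rule refl)
 qed
 then show ?thesis unfolding has_weak_pderiv_def by blast
qed

lemma loc_int_imp_locally_integrable:
 fixes f F :: "'a::euclidean_space => 'b::euclidean_space"
 assumes U: "open U" and [measurable]: "F \<in> \<B>" and eq: "AE x in lborel. x \<in> U --> f x = F x"
  and F: "loc_int U F"
 shows "f locally_integrable_on U"
 unfolding locally_integrable_on_def
proof safe
 fix K assume K: "compact K" "K \<subseteq> U"
 have [measurable]: "K \<in> sets borel" using K by (simp add: borel_compact)
 have "integrable lborel (%x. \<I> K x *\<^sub>R F x)" using F K by (simp add: loc_int_def set_integrable_def)
 then have i: "integrable lebesgue (%x. \<I> K x *\<^sub>R F x)" by (simp add: integrable_completion)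
 have e: "AE x in lebesgue. \<I> K x *\<^sub>R F x = \<I> K x *\<^sub>R f x"
  unfolding AE_lebesgue_iff using eq by eventually_elim (use K in \<open>auto simp: indicator_def\<close>)
 have "(%x. \<I> K x *\<^sub>R f x) \<in> borel_measurable lebesgue"
  by (rule borel_measurable_AE[OF _ e]) (use i in auto)
 from integrable_cong_AE_imp[OF i this] e
 show "set_integrable lebesgue K f" by (auto simp: set_integrable_def elim: eventually_mono)
qed

lemma loc_int_components:
 fixes F :: "'a::euclidean_space => 'b::euclidean_space"
 assumes "!!c. c \<in> Basis ==> loc_int U (%x. F x \<bullet> c)"
 shows "loc_int U F"
proof -
 have "set_integrable lborel K (%x. \<Sum>c\<in>Basis. (F x \<bullet> c) *\<^sub>R c)" if "compact K" "K \<subseteq> U" for K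
  unfolding set_integrable_def scaleR_sum_right
 proof (rule Bochner_Integration.integrable_sum)
  fix c :: 'b assume "c \<in> Basis"
  then have "integrable lborel (%x. \<I> K x *\<^sub>R (F x \<bullet> c))" using assms that by (simp add: loc_int_def set_integrable_def)
  from integrable_scaleR_left[OF this, of c] show "integrable lborel (%x. indicat_real K x *\<^sub>R (F x \<bullet> c) *\<^sub>R c)" by simp
 qed
 then show ?thesis by (auto simp: loc_int_def euclidean_representation)
qed

text \<open>\<open>weak_pderiv\<close> is a choice among the weak derivatives, so uniqueness is what
  identifies the chosen one.\<close>

lemma has_weak_pderiv_unique:
 fixes f :: "'a::euclidean_space => 'b::euclidean_space"
 assumes U: "open U" and g: "has_weak_pderiv U b f g" and h: "has_weak_pderiv U b f h"
 shows "AE x in lborel. x \<in> U --> g x = h x"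
proof -
 obtain F where F: "F \<in> \<B>" "AE x in lborel. x \<in> U --> f x = F x" "loc_int U F"
  using locally_integrable_borel_version[OF U, of f] g by (auto simp: has_weak_pderiv_def)
 obtain G where G: "G \<in> \<B>" "AE x in lborel. x \<in> U --> g x = G x" "loc_int U G"
  using locally_integrable_borel_version[OF U, of g] g by (auto simp: has_weak_pderiv_def)
 obtain H where H: "H \<in> \<B>" "AE x in lborel. x \<in> U --> h x = H x" "loc_int U H"
  using locally_integrable_borel_version[OF U, of h] h by (auto simp: has_weak_pderiv_def)
 note [measurable] = F(1) G(1) H(1)
 note 1 = g[unfolded has_weak_pderiv_iff[OF U F(1) G(1) F(2) G(2) F(3) G(3)]]
 note 2 = h[unfolded has_weak_pderiv_iff[OF U F(1) H(1) F(2) H(2) F(3) H(3)]]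
 have "AE x in lborel. x \<in> U --> (G x - H x) \<bullet> c = 0" if c: "c \<in> Basis" for c
 proof (rule fundamental_lemma[OF U])
  show "loc_int U (%x. (G x - H x) \<bullet> c)" by (intro loc_int_inner loc_int_diff G H)
  fix \<phi> assume \<phi>: "\<phi> \<in> test_functions U"
  have "integrable lborel (%x. \<phi> x * (G x \<bullet> c))" "integrable lborel (%x. \<phi> x * (H x \<bullet> c))"
   using loc_int_test[OF loc_int_inner[OF G(3), of c] _ \<phi>] loc_int_test[OF loc_int_inner[OF H(3), of c] _ \<phi>] by simp_all
  moreover have "(LBINT x. (nabla \<phi> x \<bullet> b) * (F x \<bullet> c)) = - (LBINT x. \<phi> x * (G x \<bullet> c))"
   using 1 \<phi> c by blast
  moreover have "(LBINT x. (nabla \<phi> x \<bullet> b) * (F x \<bullet> c)) = - (LBINT x. \<phi> x * (H x \<bullet> c))"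
   using 2 \<phi> c by blast
  ultimately show "(LBINT x. \<phi> x * ((G x - H x) \<bullet> c)) = 0"
   by (simp add: inner_diff_left right_diff_distrib)
 qed measurable
 then have "AE x in lborel. \<forall>c\<in>Basis. x \<in> U --> (G x - H x) \<bullet> c = 0" by (intro AE_finite_allI) auto
 then show ?thesis using G(2) H(2)
 proof eventually_elim
  fix x assume a: "\<forall>c\<in>Basis. x \<in> U --> (G x - H x) \<bullet> c = 0" "x \<in> U --> g x = G x" "x \<in> U --> h x = H x"
  show "x \<in> U --> g x = h x"
  proof
   assume x: "x \<in> U"
   have "G x - H x = 0" by (rule euclidean_eqI) (use a(1) x in simp)
   then show "g x = h x" using a x by simp
  qed
 qed
qed

text \<open>A partial derivative \<open>H b\<close> belongs to one direction b and has a value in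
  the target; a gradient \<open>G c\<close> belongs to one component c and is a vector of
  directions. G is the transpose of H.\<close>

theorem weakly_differentiable_wgrad:
 fixes f :: "'a::euclidean_space => 'b::euclidean_space"
 assumes U: "open U" and f: "f weakly_differentiable_on U"
 obtains F G where "F \<in> \<B>" "AE x in lborel. x \<in> U --> f x = F x"
  "!!c. c \<in> Basis ==> wgrad U (%x. F x \<bullet> c) (G c)"
  "!!b. b \<in> Basis ==> AE x in lborel. x \<in> U --> weak_pderiv U b f x = (\<Sum>c\<in>Basis. (G c x \<bullet> b) *\<^sub>R c)"
proof -
 define g where "g b = weak_pderiv U b f" for b
 have w: "has_weak_pderiv U b f (g b)" if "b \<in> Basis" for b
  using f that unfolding weakly_differentiable_on_def g_def weak_pderiv_def by (metis someI_ex)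
 obtain b0 :: 'a where "b0 \<in> Basis" using nonempty_Basis by blast
 obtain F where F: "F \<in> \<B>" "AE x in lborel. x \<in> U --> f x = F x" "loc_int U F"
  using locally_integrable_borel_version[OF U, of f] w[OF \<open>b0 \<in> Basis\<close>] by (auto simp: has_weak_pderiv_def)
 have "\<exists>H. H \<in> \<B> & (AE x in lborel. x \<in> U --> g b x = H x) & loc_int U H" if "b \<in> Basis" for b
  using locally_integrable_borel_version[OF U, of "g b"] w[OF that] by (auto simp: has_weak_pderiv_def)
 then obtain H where H: "!!b. b \<in> Basis ==> H b \<in> \<B>"
   "!!b. b \<in> Basis ==> AE x in lborel. x \<in> U --> g b x = H b x" "!!b. b \<in> Basis ==> loc_int U (H b)"
  by metis
 define G where "G c x = (\<Sum>b\<in>Basis. (H b x \<bullet> c) *\<^sub>R b)" for c x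
 have Gb: "G c x \<bullet> b = H b x \<bullet> c" if "b \<in> Basis" for b c x
  using that by (simp add: G_def inner_sum_left_Basis)
 have "wgrad U (%x. F x \<bullet> c) (G c)" if c: "c \<in> Basis" for c
  unfolding wgrad_def
 proof (intro conjI ballI allI)
  note [measurable] = F(1) H(1)
  show "(%x. F x \<bullet> c) \<in> \<B>" by measurable
  show "G c \<in> \<B>" unfolding G_def[abs_def] by measurable
  show "loc_int U (%x. F x \<bullet> c)" by (rule loc_int_inner[OF F(3)])
  show l: "loc_int U (G c)"
   by (rule loc_int_components) (simp add: Gb loc_int_inner H(3))
  fix \<phi> v assume \<phi>: "\<phi> \<in> test_functions U"
  note [measurable] = test_borel[OF \<phi>]
  have i1: "integrable lborel (%x. (nabla \<phi> x \<bullet> b) * (F x \<bullet> c))" for b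
   using loc_int_test[OF loc_int_inner[OF F(3)] _ test_nabla_inner[OF \<phi>], of c b] by simp
  have i2: "integrable lborel (%x. \<phi> x * (G c x \<bullet> b))" for b
   using loc_int_test[OF loc_int_inner[OF l] _ \<phi>, of b] \<open>G c \<in> \<B>\<close> by simp
  have eb: "(LBINT x. (nabla \<phi> x \<bullet> b) * (F x \<bullet> c)) = - (LBINT x. \<phi> x * (G c x \<bullet> b))" if b: "b \<in> Basis" for b
   using w[OF b, unfolded has_weak_pderiv_iff[OF U F(1) H(1)[OF b] F(2) H(2)[OF b] F(3) H(3)[OF b]]] \<phi> c
   by (simp add: Gb[OF b])
  have "(LBINT x. (nabla \<phi> x \<bullet> v) * (F x \<bullet> c)) = (LBINT x. (\<Sum>b\<in>Basis. (v \<bullet> b) * ((nabla \<phi> x \<bullet> b) * (F x \<bullet> c))))"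
   by (intro Bochner_Integration.integral_cong refl) (simp add: euclidean_inner[of "nabla \<phi> _" v] sum_distrib_right sum_distrib_left mult_ac)
  also have "... = (\<Sum>b\<in>Basis. (v \<bullet> b) * (LBINT x. (nabla \<phi> x \<bullet> b) * (F x \<bullet> c)))" using i1 by simp
  also have "... = - (\<Sum>b\<in>Basis. (v \<bullet> b) * (LBINT x. \<phi> x * (G c x \<bullet> b)))" by (simp add: eb sum_negf)
  also have "(\<Sum>b\<in>Basis. (v \<bullet> b) * (LBINT x. \<phi> x * (G c x \<bullet> b))) = (LBINT x. (\<Sum>b\<in>Basis. (v \<bullet> b) * (\<phi> x * (G c x \<bullet> b))))"
   using i2 by simp
  also have "... = (LBINT x. \<phi> x * (G c x \<bullet> v))"
   by (intro Bochner_Integration.integral_cong refl) (simp add: euclidean_inner[of "G c _" v] sum_distrib_left mult_ac)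
  finally show "(LBINT x. (nabla \<phi> x \<bullet> v) * (F x \<bullet> c)) = - (LBINT x. \<phi> x * (G c x \<bullet> v))" .
 qed
 moreover have "AE x in lborel. x \<in> U --> weak_pderiv U b f x = (\<Sum>c\<in>Basis. (G c x \<bullet> b) *\<^sub>R c)" if b: "b \<in> Basis" for b
  using H(2)[OF b] by eventually_elim (simp add: g_def Gb[OF b] euclidean_representation)
 ultimately show thesis using F that by blast
qed

theorem wgrad_weakly_differentiable:
 fixes f F :: "'a::euclidean_space => 'b::euclidean_space"
 assumes U: "open U" and [measurable]: "F \<in> \<B>" and eq: "AE x in lborel. x \<in> U --> f x = F x"
  and w: "!!c. c \<in> Basis ==> wgrad U (%x. F x \<bullet> c) (G c)"
 shows "f weakly_differentiable_on U"
  "!!b. b \<in> Basis ==> has_weak_pderiv U b f (weak_pderiv U b f)"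
  "!!b. b \<in> Basis ==> AE x in lborel. x \<in> U --> weak_pderiv U b f x = (\<Sum>c\<in>Basis. (G c x \<bullet> b) *\<^sub>R c)"
proof -
 have [measurable]: "!!c. c \<in> Basis ==> G c \<in> \<B>" using wgradD(2)[OF w] .
 have lF: "loc_int U F" using wgradD(3)[OF w] by (rule loc_int_components)
 have h: "has_weak_pderiv U b f (%x. \<Sum>c\<in>Basis. (G c x \<bullet> b) *\<^sub>R c)" if b: "b \<in> Basis" for b
 proof -
  have m: "(%x. \<Sum>c\<in>Basis. (G c x \<bullet> b) *\<^sub>R c) \<in> \<B>" by measurable
  have l: "loc_int U (%x. \<Sum>c\<in>Basis. (G c x \<bullet> b) *\<^sub>R c)"
   by (rule loc_int_components) (simp add: inner_sum_left_Basis loc_int_inner wgradD(4)[OF w])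
  show ?thesis
   unfolding has_weak_pderiv_iff[OF U assms(2) m eq AE_I2[of lborel, OF impI[OF refl]] lF l]
  proof (intro conjI ballI)
   show "f locally_integrable_on U" by (rule loc_int_imp_locally_integrable[OF U assms(2) eq lF])
   show "(%x. \<Sum>c\<in>Basis. (G c x \<bullet> b) *\<^sub>R c) locally_integrable_on U"
    by (rule loc_int_imp_locally_integrable[OF U m _ l]) simp
   fix \<phi> c assume "\<phi> \<in> test_functions U" "c \<in> (Basis :: 'b set)"
   then show "(LBINT x. (nabla \<phi> x \<bullet> b) * (F x \<bullet> c)) = - (LBINT x. \<phi> x * ((\<Sum>c\<in>Basis. (G c x \<bullet> b) *\<^sub>R c) \<bullet> c))"
    using wgradD(5)[OF w, of c \<phi> b] by (simp add: inner_sum_left_Basis)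
  qed
 qed
 show "f weakly_differentiable_on U" unfolding weakly_differentiable_on_def using h by blast
 show hw: "has_weak_pderiv U b f (weak_pderiv U b f)" if "b \<in> Basis" for b
  unfolding weak_pderiv_def by (rule someI[of "has_weak_pderiv U b f", OF h[OF that]])
 show "AE x in lborel. x \<in> U --> weak_pderiv U b f x = (\<Sum>c\<in>Basis. (G c x \<bullet> b) *\<^sub>R c)" if "b \<in> Basis" for b
  by (rule has_weak_pderiv_unique[OF U hw[OF that] h[OF that]])
qed

text \<open>The squared Frobenius norm of the derivative, summed over gradients of components
  instead of partial derivatives.\<close>

lemma dirichlet_energy_eq:
 fixes f :: "'a::euclidean_space => 'b::euclidean_space"
 assumes U: "open U" and f: "f weakly_differentiable_on U"
  and [measurable]: "!!c. c \<in> Basis ==> G c \<in> \<B>"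
  and eq: "!!b. b \<in> Basis ==> AE x in lborel. x \<in> U --> weak_pderiv U b f x = (\<Sum>c\<in>Basis. (G c x \<bullet> b) *\<^sub>R c)"
 shows "dirichlet_energy U f = (\<Sum>c\<in>Basis. gnorm U (G c))"
proof -
 have [measurable]: "U \<in> sets borel" using U by simp
 have "dirichlet_energy U f = (\<integral>\<^sup>+x. ennreal (\<Sum>b\<in>Basis. (norm (weak_pderiv U b f x))\<^sup>2) * \<I> U x \<partial>lebesgue)"
  unfolding dirichlet_energy_def using f U by (simp add: nn_integral_restrict_space)
 also have "... = (\<integral>\<^sup>+x. (\<Sum>c\<in>Basis. \<I> U x * ennreal ((norm (G c x))\<^sup>2)) \<partial>lebesgue)"
 proof (rule nn_integral_cong_AE)
  have "AE x in lborel. \<forall>b\<in>Basis. x \<in> U --> weak_pderiv U b f x = (\<Sum>c\<in>Basis. (G c x \<bullet> b) *\<^sub>R c)"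
   by (intro AE_finite_allI eq) auto
  then show "AE x in lebesgue. ennreal (\<Sum>b\<in>Basis. (norm (weak_pderiv U b f x))\<^sup>2) * \<I> U x
   = (\<Sum>c\<in>Basis. \<I> U x * ennreal ((norm (G c x))\<^sup>2))"
   unfolding AE_lebesgue_iff
  proof eventually_elim
   fix x assume h: "\<forall>b\<in>Basis. x \<in> U --> weak_pderiv U b f x = (\<Sum>c\<in>Basis. (G c x \<bullet> b) *\<^sub>R c)"
   show "ennreal (\<Sum>b\<in>Basis. (norm (weak_pderiv U b f x))\<^sup>2) * \<I> U x
    = (\<Sum>c\<in>Basis. \<I> U x * ennreal ((norm (G c x))\<^sup>2))"
   proof (cases "x \<in> U")
    case True
    have "(norm (weak_pderiv U b f x))\<^sup>2 = (\<Sum>c\<in>Basis. (G c x \<bullet> b)\<^sup>2)" if "b \<in> Basis" for b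
    proof -
     have "(norm (weak_pderiv U b f x))\<^sup>2 = (\<Sum>c\<in>Basis. (weak_pderiv U b f x \<bullet> c) * (weak_pderiv U b f x \<bullet> c))"
      unfolding power2_norm_eq_inner by (rule euclidean_inner)
     then show ?thesis using h that True by (simp add: inner_sum_left_Basis power2_eq_square)
    qed
    then have "(\<Sum>b\<in>Basis. (norm (weak_pderiv U b f x))\<^sup>2) = (\<Sum>b\<in>Basis. \<Sum>c\<in>Basis. (G c x \<bullet> b)\<^sup>2)" by simp
    also have "... = (\<Sum>c\<in>Basis. \<Sum>b\<in>Basis. (G c x \<bullet> b)\<^sup>2)" by (rule sum.swap)
    also have "... = (\<Sum>c\<in>Basis. (norm (G c x))\<^sup>2)"
     unfolding power2_norm_eq_inner by (intro sum.cong refl) (subst euclidean_inner, simp add: power2_eq_square)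
    finally show ?thesis using True by (simp add: sum_ennreal)
   qed simp
  qed
 qed
 also have "... = (\<N> x. (\<Sum>c\<in>Basis. \<I> U x * ennreal ((norm (G c x))\<^sup>2)))"
  by (rule nn_integral_completion)
 also have "... = (\<Sum>c\<in>Basis. gnorm U (G c))"
  unfolding gnorm_def by (rule nn_integral_sum) measurable
 finally show ?thesis .
qed

lemma L2_iff:
 fixes f F :: "'a::euclidean_space => 'b::euclidean_space"
 assumes U: "open U" and [measurable]: "F \<in> \<B>" and eq: "AE x in lborel. x \<in> U --> f x = F x"
 shows "f \<in> L2 U \<longleftrightarrow> gnorm U F < \<infinity>"
proof -
 have [measurable]: "U \<in> sets borel" using U by simp
 have F: "(%x. \<I> U x *\<^sub>R F x) \<in> borel_measurable lebesgue" by (intro measurable_completion) measurable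
 have "(%x. \<I> U x *\<^sub>R f x) \<in> borel_measurable lebesgue"
  by (rule borel_measurable_AE[OF F]) (use eq in \<open>auto simp: AE_lebesgue_iff indicator_def elim!: eventually_mono\<close>)
 then have m: "f \<in> borel_measurable (lebesgue_on U)"
  using U by (subst borel_measurable_restrict_space_iff) (auto simp: mult.commute)
 have "(\<integral>\<^sup>+x. ennreal (norm ((norm (f x))\<^sup>2)) \<partial>lebesgue_on U) = (\<integral>\<^sup>+x. ennreal ((norm (f x))\<^sup>2) * \<I> U x \<partial>lebesgue)"
  using U by (simp add: nn_integral_restrict_space)
 also have "... = (\<integral>\<^sup>+x. \<I> U x * ennreal ((norm (F x))\<^sup>2) \<partial>lebesgue)"
  by (rule nn_integral_cong_AE) (use eq in \<open>auto simp: AE_lebesgue_iff indicator_def elim!: eventually_mono\<close>)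
 also have "... = gnorm U F" unfolding gnorm_def by (rule nn_integral_completion)
 finally show ?thesis using m by (simp add: L2_def integrable_iff_bounded)
qed

lemma H1I:
 fixes f F :: "'a::euclidean_space => 'b::euclidean_space"
 assumes U: "open U" and F [measurable]: "F \<in> \<B>" and eq: "AE x in lborel. x \<in> U --> f x = F x"
  and w: "!!c. c \<in> Basis ==> wgrad U (%x. F x \<bullet> c) (G c)"
  and fin: "gnorm U F < \<infinity>" "!!c. c \<in> Basis ==> gnorm U (G c) < \<infinity>"
 shows "f \<in> H1 U"
proof -
 have [measurable]: "!!c. c \<in> Basis ==> G c \<in> \<B>" "U \<in> sets borel"
  using wgradD(2)[OF w] U by auto
 have wd1: "f weakly_differentiable_on U" by (rule wgrad_weakly_differentiable(1)[OF U F eq w])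
 have wd3: "AE x in lborel. x \<in> U --> weak_pderiv U b f x = (\<Sum>c\<in>Basis. (G c x \<bullet> b) *\<^sub>R c)" if "b \<in> Basis" for b
  by (rule wgrad_weakly_differentiable(3)[OF U F eq w that])
 have "weak_pderiv U b f \<in> L2 U" if b: "b \<in> Basis" for b
 proof -
  have "gnorm U (%x. \<Sum>c\<in>Basis. (G c x \<bullet> b) *\<^sub>R c) <= (\<N> x. (\<Sum>c\<in>Basis. \<I> U x * ennreal ((norm (G c x))\<^sup>2)))"
   unfolding gnorm_def
  proof (intro nn_integral_mono)
   fix x
   define y where "y = (\<Sum>c\<in>Basis. (G c x \<bullet> b) *\<^sub>R (c::'b))"
   have "(norm y)\<^sup>2 = (\<Sum>c\<in>Basis. (y \<bullet> c) * (y \<bullet> c))" unfolding power2_norm_eq_inner by (rule euclidean_inner)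
   also have "... = (\<Sum>c\<in>Basis. (G c x \<bullet> b)\<^sup>2)" by (simp add: y_def inner_sum_left_Basis power2_eq_square)
   also have "... <= (\<Sum>c\<in>Basis. (norm (G c x))\<^sup>2)"
    using Basis_le_norm[OF b] by (intro sum_mono) (metis abs_ge_zero power2_abs power_mono)
   finally have "ennreal ((norm y)\<^sup>2) <= (\<Sum>c\<in>Basis. ennreal ((norm (G c x))\<^sup>2))"
    by (simp add: sum_ennreal ennreal_leI)
   then show "\<I> U x * ennreal ((norm (\<Sum>c\<in>Basis. (G c x \<bullet> b) *\<^sub>R c))\<^sup>2) <= (\<Sum>c\<in>Basis. \<I> U x * ennreal ((norm (G c x))\<^sup>2))"
    by (simp add: y_def mult_left_mono flip: sum_distrib_left)
  qed
  also have "... = (\<Sum>c\<in>Basis. gnorm U (G c))" unfolding gnorm_def by (rule nn_integral_sum) measurable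
  also have "... < \<infinity>" using fin(2) by (simp add: less_top)
  finally show ?thesis by (subst L2_iff[OF U _ wd3[OF b]]) measurable
 qed
 moreover have "f \<in> L2 U" using fin(1) L2_iff[OF U F eq] by simp
 ultimately show ?thesis using wd1 by (simp add: H1_def)
qed

section \<open>Estimates on the wire\<close>

abbreviation ex :: space where "ex \<equiv> (1, 0, 0)"
abbreviation ey :: space where "ey \<equiv> (0, 1, 0)"
abbreviation ez :: space where "ez \<equiv> (0, 0, 1)"

lemma space_Basis: "(Basis :: space set) = {ex, ey, ez}"
 by (auto simp: Basis_prod_def zero_prod_def)

lemma space_inner: "p \<bullet> ex = fst p" "p \<bullet> ey = fst (snd p)" "p \<bullet> ez = snd (snd p)" for p :: space
 by (cases p; simp add: inner_prod_def)+

lemma space_norm_sq: "(norm p)\<^sup>2 = (p \<bullet> ex)\<^sup>2 + (p \<bullet> ey)\<^sup>2 + (p \<bullet> ez)\<^sup>2" for p :: space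
 by (cases p) (simp add: norm_prod_def inner_prod_def)

text \<open>Norm at most 1, instead of equal to 1, keeps the set of states closed under midpoints
  and can be demanded everywhere. \<open>G c\<close> is the gradient of the component along c and H
  is the stray field; they are carried as data so that the energy is a quadratic expression in the
  triple.\<close>

definition state :: "space set => (space => space) => (space => space => space) => (space => space) => bool" where
 "state \<Omega> m G H \<longleftrightarrow> m \<in> \<B> & (\<forall>p. norm (m p) <= 1) &
  (\<forall>c\<in>Basis. wgrad \<Omega> (%p. m p \<bullet> c) (G c)) & (\<exists>u. wgrad UNIV u H) &
  (\<forall>\<phi>\<in>test_functions UNIV. (LBINT p. H p \<bullet> nabla \<phi> p) = (LBINT p. \<I> \<Omega> p * (m p \<bullet> nabla \<phi> p)))"

text \<open>The gradients count only inside the wire, the stray field in all of space; S restricts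
  both.\<close>

definition local_energy :: "space set => space set => (space => space => space) => (space => space) => ennreal" where
 "local_energy \<Omega> S G H = (\<Sum>c\<in>Basis. gnorm (\<Omega> \<inter> S) (G c)) + gnorm S H"

lemma stateD:
 assumes "state \<Omega> m G H"
 shows "m \<in> \<B>" "norm (m p) <= 1" "c \<in> Basis ==> wgrad \<Omega> (%p. m p \<bullet> c) (G c)"
  "\<exists>u. wgrad UNIV u H" "H \<in> \<B>" "c \<in> Basis ==> G c \<in> \<B>"
  "\<phi> \<in> test_functions UNIV ==> (LBINT p. H p \<bullet> nabla \<phi> p) = (LBINT p. \<I> \<Omega> p * (m p \<bullet> nabla \<phi> p))"
proof -
 note s = assms[unfolded state_def]
 show "m \<in> \<B>" "norm (m p) <= 1" using s by blast+
 show w: "wgrad \<Omega> (%p. m p \<bullet> c) (G c)" if "c \<in> Basis" for c using s that by blast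
 show u: "\<exists>u. wgrad UNIV u H" using s by blast
 show "H \<in> \<B>" using u wgradD(2) by blast
 show "c \<in> Basis ==> G c \<in> \<B>" using wgradD(2)[OF w] .
 show "\<phi> \<in> test_functions UNIV ==> (LBINT p. H p \<bullet> nabla \<phi> p) = (LBINT p. \<I> \<Omega> p * (m p \<bullet> nabla \<phi> p))"
  using s by blast
qed

section \<open>Translations along the wire\<close>

lemma gnorm_shift:
 fixes g :: "'a::euclidean_space => 'b::euclidean_space"
 assumes [measurable]: "g \<in> \<B>" "U \<in> sets borel" and V: "!!x. x \<in> V \<longleftrightarrow> x + a \<in> U"
 shows "gnorm V (%x. g (x + a)) = gnorm U g"
proof -
 have "gnorm V (%x. g (x + a)) = (\<N> x. \<I> U (x + a) * ennreal ((norm (g (x + a)))\<^sup>2))"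
  unfolding gnorm_def using V by (intro nn_integral_cong) (simp add: indicator_def)
 also have "... = gnorm U g"
  unfolding gnorm_def by (rule nn_integral_shift[where F="%x. \<I> U x * ennreal ((norm (g x))\<^sup>2)"]) measurable
 finally show ?thesis .
qed

lemma wgrad_shift:
 fixes f :: "'a::euclidean_space => real"
 assumes w: "wgrad U f g" and V: "!!x. x \<in> V \<longleftrightarrow> x + a \<in> U"
 shows "wgrad V (%x. f (x + a)) (%x. g (x + a))"
proof -
 note [measurable] = wgradD(1,2)[OF w]
 have l: "loc_int V (%x. h (x + a))" if "loc_int U h" for h :: "'a => 'c::euclidean_space"
  unfolding loc_int_def
 proof safe
  fix K assume K: "compact K" "K \<subseteq> V"
  have "compact ((+) a ` K)" using K by (intro compact_translation)
  moreover have "(+) a ` K \<subseteq> U" using K V by (auto simp: add.commute)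
  ultimately have "set_integrable lborel ((+) a ` K) h" using that by (simp add: loc_int_def)
  from integrable_shift[OF this[unfolded set_integrable_def], of a]
  show "set_integrable lborel K (%x. h (x + a))"
   by (simp add: set_integrable_def indicator_def image_iff add.commute[of a])
 qed
 have "(LBINT x. (nabla \<phi> x \<bullet> v) * f (x + a)) = - (LBINT x. \<phi> x * (g (x + a) \<bullet> v))"
  if \<phi>: "\<phi> \<in> test_functions V" for \<phi> v
 proof -
  note [measurable] = test_borel[OF \<phi>]
  have t: "(%x. \<phi> (x - a)) \<in> test_functions U" using V by (intro test_shift[OF \<phi>]) auto
  have "(LBINT x. (nabla \<phi> (x - a) \<bullet> v) * f x) = - (LBINT x. \<phi> (x - a) * (g x \<bullet> v))"
   using wgradD(5)[OF w t, of v] by (simp add: nabla_shift[OF test_smooth[OF \<phi>]])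
  then show ?thesis
   using integral_shift[of "%x. (nabla \<phi> (x - a) \<bullet> v) * f x" a] integral_shift[of "%x. \<phi> (x - a) * (g x \<bullet> v)" a] by simp
 qed
 then show ?thesis using l[OF wgradD(3)[OF w]] l[OF wgradD(4)[OF w]] by (simp add: wgrad_def)
qed

lemma state_shift:
 assumes s: "state (UNIV \<times> \<omega>) m G H" and om [measurable]: "\<omega> \<in> sets borel"
 shows "state (UNIV \<times> \<omega>) (%p. m (p + t *\<^sub>R ex)) (%c p. G c (p + t *\<^sub>R ex)) (%p. H (p + t *\<^sub>R ex))"
proof -
 note [measurable] = stateD(1,5)[OF s]
 have O [measurable]: "(UNIV \<times> \<omega> :: space set) \<in> sets borel" by (simp add: borel_Times)
 have V: "x \<in> UNIV \<times> \<omega> \<longleftrightarrow> x + t *\<^sub>R ex \<in> UNIV \<times> \<omega>" for x :: space by (cases x) simp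
 obtain u where u: "wgrad UNIV u H" using stateD(4)[OF s] by blast
 have "(LBINT p. H (p + t *\<^sub>R ex) \<bullet> nabla \<phi> p) = (LBINT p. \<I> (UNIV \<times> \<omega>) p * (m (p + t *\<^sub>R ex) \<bullet> nabla \<phi> p))"
  if \<phi>: "\<phi> \<in> test_functions UNIV" for \<phi>
 proof -
  note [measurable] = test_borel[OF \<phi>]
  have t: "(%x. \<phi> (x - t *\<^sub>R ex)) \<in> test_functions UNIV" by (intro test_shift[OF \<phi>]) auto
  have "(LBINT p. H p \<bullet> nabla \<phi> (p - t *\<^sub>R ex)) = (LBINT p. \<I> (UNIV \<times> \<omega>) p * (m p \<bullet> nabla \<phi> (p - t *\<^sub>R ex)))"
   using stateD(7)[OF s t] by (simp only: nabla_shift[OF test_smooth[OF \<phi>]])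
  moreover have "(LBINT p. H p \<bullet> nabla \<phi> (p - t *\<^sub>R ex)) = (LBINT p. H (p + t *\<^sub>R ex) \<bullet> nabla \<phi> p)"
   using integral_shift[of "%p. H p \<bullet> nabla \<phi> (p - t *\<^sub>R ex)" "t *\<^sub>R ex"] by simp
  moreover have "(LBINT p. \<I> (UNIV \<times> \<omega>) p * (m p \<bullet> nabla \<phi> (p - t *\<^sub>R ex)))
   = (LBINT p. \<I> (UNIV \<times> \<omega>) (p + t *\<^sub>R ex) * (m (p + t *\<^sub>R ex) \<bullet> nabla \<phi> p))"
   using integral_shift[of "%p. \<I> (UNIV \<times> \<omega>) p * (m p \<bullet> nabla \<phi> (p - t *\<^sub>R ex))" "t *\<^sub>R ex"] by simp
  moreover have "\<I> (UNIV \<times> \<omega>) (p + t *\<^sub>R ex) = (\<I> (UNIV \<times> \<omega>) p :: real)" for p :: space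
   by (simp only: indicator_def V[symmetric])
  ultimately show ?thesis by simp
 qed
 moreover have "wgrad (UNIV \<times> \<omega>) (%p. m (p + t *\<^sub>R ex) \<bullet> c) (%p. G c (p + t *\<^sub>R ex))" if "c \<in> Basis" for c
  by (rule wgrad_shift[OF stateD(3)[OF s that] V])
 moreover have "wgrad UNIV (%p. u (p + t *\<^sub>R ex)) (%p. H (p + t *\<^sub>R ex))"
  by (rule wgrad_shift[OF u]) simp
 ultimately show ?thesis using stateD(2)[OF s] by (auto simp: state_def)
qed

text \<open>In the local frame the domain lies above a graph, so moving in the direction n preserves
  the inequality that describes it. Halving r for the ball and the step keeps all points where this
  description is valid.\<close>

lemma C1_domain_inward:
 assumes om: "C1_domain \<omega>" and q: "q \<in> closure \<omega>" "q \<notin> \<omega>"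
 shows "\<exists>r>0. \<exists>n. q + n \<in> \<omega> & (\<forall>x\<in>\<omega> \<inter> ball q r. \<forall>t\<in>{0..1}. x + t *\<^sub>R n \<in> \<omega>)"
proof -
 have "open \<omega>" using om by (simp add: C1_domain_def)
 then have "q \<in> frontier \<omega>" using q by (simp add: frontier_def interior_open)
 then obtain r e n \<gamma> where r: "r > 0" and ne: "norm n = 1" "e \<bullet> n = 0" and \<gamma>: "\<gamma> C1_differentiable_on UNIV"
  and S: "\<omega> \<inter> ball q r = {x \<in> ball q r. x \<bullet> n > \<gamma> (x \<bullet> e)}"
  using om unfolding C1_domain_def by blast
 have Sx: "x \<in> \<omega> \<longleftrightarrow> x \<bullet> n > \<gamma> (x \<bullet> e)" if "x \<in> ball q r" for x
  using S that by blast
 have nn: "n \<bullet> n = 1" "n \<bullet> e = 0" using ne by (simp_all add: inner_commute flip: power2_norm_eq_inner)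
 have cont: "continuous_on UNIV \<gamma>" using C1_differentiable_imp_continuous_on[OF \<gamma>] .
 \<comment> \<open>Points of the closure satisfy the inequality in its weak form, by continuity of
   \<gamma>; the shift by \<nu> makes it strict.\<close>
 have qn: "q \<bullet> n >= \<gamma> (q \<bullet> e)"
 proof -
  obtain s where s: "!!i. s i \<in> \<omega>" "s \<longlonglongrightarrow> q" using q(1) by (auto simp: closure_sequential)
  have "isCont \<gamma> (q \<bullet> e)" using cont by (simp add: continuous_on_eq_continuous_at)
  then have "(%i. \<gamma> (s i \<bullet> e)) \<longlonglongrightarrow> \<gamma> (q \<bullet> e)"
   by (rule isCont_tendsto_compose) (intro tendsto_intros s)
  moreover have "(%i. s i \<bullet> n) \<longlonglongrightarrow> q \<bullet> n" by (intro tendsto_intros s)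
  moreover have "\<forall>\<^sub>F i in sequentially. \<gamma> (s i \<bullet> e) <= s i \<bullet> n"
   using tendstoD[OF s(2) r]
  proof eventually_elim
   case (elim i)
   then have "s i \<in> ball q r" by (simp add: dist_commute)
   then show ?case using Sx[of "s i"] s(1)[of i] by simp
  qed
  ultimately show ?thesis by (intro tendsto_le[OF sequentially_bot])
 qed
 define \<nu> where "\<nu> = (r / 2) *\<^sub>R n"
 have "q + \<nu> \<in> ball q r" using r ne by (simp add: \<nu>_def dist_norm)
 moreover have "(q + \<nu>) \<bullet> n > \<gamma> ((q + \<nu>) \<bullet> e)"
  using qn r nn by (simp add: \<nu>_def inner_add_left)
 ultimately have "q + \<nu> \<in> \<omega>" using Sx by blast
 moreover have "x + t *\<^sub>R \<nu> \<in> \<omega>" if x: "x \<in> \<omega>" "x \<in> ball q (r / 2)" and t: "t \<in> {0..1}" for x t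
 proof -
  have "norm (t *\<^sub>R \<nu>) <= r / 2" using t r ne by (simp add: \<nu>_def mult_left_le_one_le)
  then have "dist q (x + t *\<^sub>R \<nu>) < r"
   using x(2) dist_triangle[of q "x + t *\<^sub>R \<nu>" x] by (simp add: dist_norm)
  moreover have "x \<bullet> n > \<gamma> (x \<bullet> e)" using Sx[of x] x r by auto
  then have "(x + t *\<^sub>R \<nu>) \<bullet> n > \<gamma> ((x + t *\<^sub>R \<nu>) \<bullet> e)"
   using t r nn by (simp add: \<nu>_def inner_add_left add_strict_increasing2 add.commute)
    (smt (verit) mult_nonneg_nonneg divide_nonneg_pos)
  ultimately show ?thesis using Sx by simp
 qed
 moreover have "r / 2 > 0" using r by simp
 ultimately show ?thesis by blast
qed

text \<open>The larger cylinder over \<open>{-1<..<3}\<close> moves its end faces away from K, so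
  only lateral boundary points of K need an inward translation, and this one is purely
  transversal.\<close>

lemma wire_poincare:
 assumes om: "C1_domain \<omega>" "bounded \<omega>"
 shows "\<exists>c\<ge>0. \<forall>f g. wgrad (UNIV \<times> \<omega> :: space set) f g -->
  osc ({0..2} \<times> \<omega>) ({0..2} \<times> \<omega>) f <= ennreal c * gnorm ((UNIV \<times> \<omega>) \<inter> ({-1<..<3} \<times> UNIV)) g"
proof -
 define U :: "space set" where "U = (UNIV \<times> \<omega>) \<inter> ({-1<..<3} \<times> UNIV)"
 have Ueq: "U = {-1<..<3} \<times> \<omega>" by (auto simp: U_def)
 have o: "open \<omega>" "connected \<omega>" using om by (auto simp: C1_domain_def)
 have "open U" unfolding Ueq by (intro open_Times o) auto
 moreover have "connected U" unfolding Ueq by (intro connected_Times o) auto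
 moreover define K :: "space set" where "K = {0..2} \<times> closure \<omega>"
 have "compact K" unfolding K_def using om(2) by (intro compact_Times) (auto simp: compact_closure)
 moreover have "\<exists>r>0. \<exists>v. p + v \<in> U & (\<forall>x\<in>U \<inter> ball p r. \<forall>t\<in>{0..1}. x + t *\<^sub>R v \<in> U)" if p: "p \<in> K" "p \<notin> U" for p
 proof -
  obtain x q where pq: "p = (x, q)" by (cases p)
  have q: "x \<in> {0..2}" "q \<in> closure \<omega>" "q \<notin> \<omega>" using p by (auto simp: pq K_def Ueq)
  obtain r n where r: "r > 0" "q + n \<in> \<omega>" "!!x t. x \<in> \<omega> ==> x \<in> ball q r ==> t \<in> {0..1} ==> x + t *\<^sub>R n \<in> \<omega>"
   using C1_domain_inward[OF om(1) q(2,3)] by blast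
  have "p + (0, n) \<in> U" using q r by (simp add: pq Ueq)
  moreover have "y + t *\<^sub>R (0, n) \<in> U" if "y \<in> U \<inter> ball p r" "t \<in> {0..1}" for y t
  proof -
   obtain a b where y: "y = (a, b)" by (cases y)
   have "dist q b <= dist p y" using dist_snd_le[of p y] by (simp add: pq y)
   then have "b \<in> ball q r" using that by simp
   then show ?thesis using that r(3)[of b t] by (simp add: y Ueq)
  qed
  ultimately show ?thesis using r(1) by blast
 qed
 ultimately have "\<exists>c\<ge>0. \<forall>f g. wgrad U f g --> osc (K \<inter> U) (K \<inter> U) f <= ennreal c * gnorm U g"
  by (rule poincare)
 moreover have "K \<inter> U = {0..2} \<times> \<omega>" using closure_subset[of \<omega>] by (auto simp: K_def Ueq)
 moreover have "wgrad U f g" if "wgrad (UNIV \<times> \<omega>) f g" for f g using that by (rule wgrad_subset) (auto simp: U_def)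
 ultimately show ?thesis unfolding U_def[symmetric] by metis
qed

text \<open>The cutoff used to test the stray field equation: \<open>hat x\<close> times a linear function
 near the wire.\<close>

definition hat :: "real => real" where "hat x = bump 1 x * bump 1 (2 - x)"
definition hat' :: "real => real" where
 "hat' x = bump (bump_deriv 1) x * bump 1 (2 - x) - bump 1 x * bump (bump_deriv 1) (2 - x)"

lemma hat_deriv: "(hat has_real_derivative hat' x) (at x)"
proof -
 have "((%x. bump 1 (2 - x)) has_real_derivative bump (bump_deriv 1) (2 - x) * (- 1)) (at x)"
  by (rule DERIV_chain2[OF bump_has_derivative]) (auto intro!: derivative_eq_intros)
 from DERIV_mult[OF bump_has_derivative this, of 1] show ?thesis
  unfolding hat_def[abs_def] hat'_def by (simp add: algebra_simps)
qed

lemma hat_outside: "x \<notin> {0..2} ==> hat x = 0" "x \<notin> {0..2} ==> hat' x = 0"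
 and hat_pos: "0 < x ==> x < 2 ==> hat x > 0" and hat_bounds: "0 <= hat x" "hat x <= 1"
 by (auto simp: hat_def hat'_def bump_def intro!: mult_le_one)

lemma hat_cont: "continuous_on S hat" "continuous_on S hat'"
 unfolding hat_def[abs_def] hat'_def[abs_def] by (intro continuous_intros)+

lemma hat_borel [measurable]: "hat \<in> \<B>" "hat' \<in> \<B>"
 by (intro borel_measurable_continuous_onI hat_cont)+

lemma hat'_bounded: obtains M where "M > 0" "!!x. \<bar>hat' x\<bar> <= M"
proof -
 obtain B where "B > 0" "!!x. norm (hat' x) <= B"
  using continuous_compact_support_bounded[OF hat_cont(2) compact_Icc[of 0 2] hat_outside(2)] by blast
 then show thesis by (intro that[of B]) auto
qed

text \<open>Through this vanishing mean the axial component enters the tested stray field equation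
  only by its oscillation.\<close>

lemma hat'_integral: "(LBINT x. hat' x) = 0"
proof -
 have "(LBINT x. \<I> {0..2} x *\<^sub>R hat' x) = hat 2 - hat 0"
  by (rule integral_FTC_atLeastAtMost)
   (use hat_deriv hat_cont in \<open>auto simp: has_real_derivative_iff_has_vector_derivative[symmetric] intro: has_field_derivative_at_within\<close>)
 moreover have "\<I> {0..2} x *\<^sub>R hat' x = hat' x" for x using hat_outside(2)[of x] by (cases "x \<in> {0..2}") auto
 ultimately have "(LBINT x. hat' x) = hat 2 - hat 0" by (simp only:)
 then show ?thesis by (simp add: hat_def bump_def)
qed

text \<open>The linear factor \<open>p \<bullet> c\<close> has gradient c, so testing with \<phi>
  produces a weighted mean of the transversal component along c and an axial term with the weight
  \<open>hat'\<close>. The cutoff \<zeta> is 1 near the wire and does not show in the gradient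
  there.\<close>

lemma wire_test_function:
 assumes om: "bounded \<omega>" and c: "c \<bullet> ex = 0"
 obtains \<phi> where "\<phi> \<in> test_functions ({-1<..<3} \<times> UNIV :: space set)"
  "!!p. p \<in> UNIV \<times> \<omega> ==> nabla \<phi> p = (hat' (p \<bullet> ex) * (p \<bullet> c)) *\<^sub>R ex + hat (p \<bullet> ex) *\<^sub>R c"
proof -
 obtain R where R: "R > 0" "!!q. q \<in> \<omega> ==> norm q <= R" using om by (auto simp: bounded_pos)
 \<comment> \<open>The squared distance to the axis, written through terms that are known to be
   smooth.\<close>
 define rr :: "space => real" where "rr p = (norm (p - 0))\<^sup>2 - (p \<bullet> ex) * (p \<bullet> ex)" for p
 have rr: "rr p = (norm (snd p))\<^sup>2" for p
  by (cases p) (simp add: rr_def norm_prod_def power2_eq_square inner_prod_def)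
 have srr: "smooth rr" unfolding rr_def[abs_def] by (intro smooth_diff smooth_norm_sq smooth_mult smooth_inner)
 define A where "A p = (R + 2)\<^sup>2 - rr p" for p
 define B where "B p = rr p - (R + 1)\<^sup>2" for p
 have sA: "smooth (%p. bump 1 (A p))" "smooth (%p. bump 1 (B p))"
  unfolding A_def B_def by (intro smooth_bump smooth_diff smooth_const srr)+
 \<comment> \<open>A is positive within distance \<open>R + 2\<close> of the axis and B beyond
   \<open>R + 1\<close>. Their sum is the constant \<open>2 * R + 3\<close>, so the denominator in
   \<zeta> below has no zero.\<close>
 have AB: "A p > 0 \<or> B p > 0" for p
 proof -
  have "A p + B p = 2 * R + 3" by (simp add: A_def B_def power2_eq_square algebra_simps)
  then show ?thesis using R(1) by linarith
 qed
 have pos: "bump 1 (A p) + bump 1 (B p) ~= 0" for p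
  using AB[of p] bump_1_bounds(1)[of "A p"] bump_1_bounds(1)[of "B p"] bump_1_bounds(3)[of "A p"] bump_1_bounds(3)[of "B p"]
  by linarith
 define \<zeta> where "\<zeta> p = bump 1 (A p) * inverse (bump 1 (A p) + bump 1 (B p))" for p
 have s\<zeta>: "smooth \<zeta>" unfolding \<zeta>_def[abs_def] by (intro smooth_mult smooth_inverse smooth_add sA pos)
 define \<phi> where "\<phi> p = (bump 1 (p \<bullet> ex) * bump 1 (2 - p \<bullet> ex)) * ((p \<bullet> c) * \<zeta> p)" for p
 have s\<phi>: "smooth \<phi>"
  unfolding \<phi>_def[abs_def] by (intro smooth_mult smooth_bump smooth_diff smooth_const smooth_inner s\<zeta>)
 have test: "\<phi> \<in> test_functions ({-1<..<3} \<times> UNIV)"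
 proof (rule test_functionsI[OF s\<phi>])
  show "compact ({0..2::real} \<times> cball (0::real \<times> real) (R + 2))" by (intro compact_Times) auto
  show "{0..2::real} \<times> cball 0 (R + 2) \<subseteq> {- 1<..<3} \<times> (UNIV :: (real \<times> real) set)" by auto
  fix p :: space assume p: "p \<notin> {0..2} \<times> cball 0 (R + 2)"
  show "\<phi> p = 0"
  proof (cases "fst p \<in> {0..2}")
   case True
   then have "norm (snd p) > R + 2" using p by (cases p) auto
   then have "(norm (snd p))\<^sup>2 >= (R + 2)\<^sup>2" using R(1) by (intro power_mono) auto
   then have "bump 1 (A p) = 0" by (intro bump_1_bounds(4)) (simp add: A_def rr)
   then show ?thesis by (simp add: \<phi>_def \<zeta>_def)
  next
   case False
   then have "hat (p \<bullet> ex) = 0" unfolding space_inner by (rule hat_outside)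
   then show ?thesis by (simp add: \<phi>_def hat_def)
  qed
 qed
 have "nabla \<phi> p = (hat' (p \<bullet> ex) * (p \<bullet> c)) *\<^sub>R ex + hat (p \<bullet> ex) *\<^sub>R c" if p: "p \<in> UNIV \<times> \<omega>" for p
 proof (rule nabla_eqI)
  have D1: "((%p::space. hat (p \<bullet> ex)) has_derivative (%v. hat' (p \<bullet> ex) * (v \<bullet> ex))) (at p)"
  proof -
   have "((%p::space. p \<bullet> ex) has_derivative (%v. v \<bullet> ex)) (at p)" by (auto intro!: derivative_eq_intros)
   from DERIV_compose_FDERIV[OF hat_deriv this] show ?thesis by (simp add: mult.commute)
  qed
  have D2: "((%p::space. p \<bullet> c) has_derivative (%v. v \<bullet> c)) (at p)" by (auto intro!: derivative_eq_intros)
  have D: "((%p. hat (p \<bullet> ex) * (p \<bullet> c)) has_derivative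
    (%v. ((hat' (p \<bullet> ex) * (p \<bullet> c)) *\<^sub>R ex + hat (p \<bullet> ex) *\<^sub>R c) \<bullet> v)) (at p)"
   by (rule has_derivative_eq_rhs[OF has_derivative_mult[OF D1 D2]])
    (auto simp: inner_add_left inner_commute algebra_simps fun_eq_iff)
  show "(\<phi> has_derivative (%v. ((hat' (p \<bullet> ex) * (p \<bullet> c)) *\<^sub>R ex + hat (p \<bullet> ex) *\<^sub>R c) \<bullet> v)) (at p)"
  proof (rule has_derivative_transform_within_open[OF D])
   show "open (UNIV \<times> ball 0 (R + 1) :: space set)" by (intro open_Times) auto
   show "p \<in> UNIV \<times> ball 0 (R + 1)" using p R(2)[of "snd p"] by (cases p) auto
   fix y :: space assume "y \<in> UNIV \<times> ball 0 (R + 1)"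
   then have "norm (snd y) < R + 1" by (cases y) auto
   then have "(norm (snd y))\<^sup>2 <= (R + 1)\<^sup>2" by (intro power_mono) auto
   then have B0: "bump 1 (B y) = 0" by (intro bump_1_bounds(4)) (simp add: B_def rr)
   then have "bump 1 (A y) ~= 0" using pos[of y] by simp
   then have "\<zeta> y = 1" using B0 by (simp add: \<zeta>_def)
   then show "hat (y \<bullet> ex) * (y \<bullet> c) = \<phi> y" by (simp add: \<phi>_def hat_def)
  qed
 qed
 with test show thesis by (rule that)
qed

section \<open>Energy bounds for the transversal components\<close>

lemma gnorm_scale:
 fixes f :: "'a::euclidean_space => 'b::euclidean_space"
 assumes [measurable]: "f \<in> \<B>" "U \<in> sets borel"
 shows "gnorm U (%x. a *\<^sub>R f x) = ennreal (a\<^sup>2) * gnorm U f"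
proof -
 have "gnorm U (%x. a *\<^sub>R f x) = (\<N> x. ennreal (a\<^sup>2) * (\<I> U x * ennreal ((norm (f x))\<^sup>2)))"
  unfolding gnorm_def by (intro nn_integral_cong) (simp add: power_mult_distrib ennreal_mult mult_ac)
 also have "... = ennreal (a\<^sup>2) * gnorm U f" unfolding gnorm_def by (rule nn_integral_cmult) measurable
 finally show ?thesis .
qed

lemma gnorm_const:
 assumes "bounded A" and [measurable]: "A \<in> sets borel"
 shows "gnorm A (%x. a) = ennreal ((norm a)\<^sup>2 * measure lborel A)"
proof -
 have "gnorm A (%x. a) = (\<N> x. ennreal ((norm a)\<^sup>2) * \<I> A x)"
  unfolding gnorm_def by (simp add: mult.commute)
 also have "... = ennreal ((norm a)\<^sup>2) * emeasure lborel A" by (rule nn_integral_cmult_indicator) simp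
 finally show ?thesis by (simp add: emeasure_bounded_eq[OF assms(1)] ennreal_mult)
qed

lemma inner_integral_bound:
 fixes H K :: "'a::euclidean_space => 'b::euclidean_space"
 assumes [measurable]: "H \<in> \<B>" "K \<in> \<B>" "S \<in> sets borel"
  and z: "!!x. x \<notin> S ==> K x = 0"
 shows "ennreal ((LBINT x. H x \<bullet> K x)\<^sup>2) <= gnorm S H * gnorm UNIV K"
proof (cases "integrable lborel (%x. H x \<bullet> K x)")
 case True
 have "ennreal ((LBINT x. H x \<bullet> K x)\<^sup>2) = (ennreal (norm (LBINT x. H x \<bullet> K x)))\<^sup>2" by (simp add: ennreal_power)
 also have "... <= (\<N> x. ennreal (norm (H x \<bullet> K x)))\<^sup>2"
  by (intro power_mono integral_norm_bound_ennreal True) auto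
 also have "... <= (\<N> x. (\<I> S x * ennreal (norm (H x))) * ennreal (norm (K x)))\<^sup>2"
 proof (intro power_mono nn_integral_mono)
  fix x
  show "ennreal (norm (H x \<bullet> K x)) <= \<I> S x * ennreal (norm (H x)) * ennreal (norm (K x))"
   using z[of x] Cauchy_Schwarz_ineq2[of "H x" "K x"]
   by (cases "x \<in> S") (auto intro: ennreal_leI simp flip: ennreal_mult)
 qed simp
 also have "... <= (\<N> x. (\<I> S x * ennreal (norm (H x)))\<^sup>2) * (\<N> x. (ennreal (norm (K x)))\<^sup>2)"
  by (intro Cauchy_Schwarz_nn_integral) auto
 also have "(\<N> x. (\<I> S x * ennreal (norm (H x)))\<^sup>2) = gnorm S H"
  unfolding gnorm_def by (intro nn_integral_cong) (auto simp: indicator_def ennreal_power)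
 also have "(\<N> x. (ennreal (norm (K x)))\<^sup>2) = gnorm UNIV K"
  unfolding gnorm_def by (intro nn_integral_cong) (auto simp: ennreal_power)
 finally show ?thesis .
qed (simp add: not_integrable_integral_eq)

lemma bounded_support_integrable:
 fixes f :: "'a::euclidean_space => real"
 assumes [measurable]: "f \<in> \<B>" "A \<in> sets borel" and "bounded A" "!!x. \<bar>f x\<bar> <= M * \<I> A x"
 shows "integrable lborel f"
proof (rule Bochner_Integration.integrable_bound)
 show "integrable lborel (%x. M * \<I> A x)"
  using emeasure_bounded_finite[OF assms(3)] by (simp add: integrable_indicator_iff)
 show "AE x in lborel. norm (f x) <= norm (M * \<I> A x)"
  using assms(4) by (auto intro!: AE_I2 order_trans[OF _ abs_ge_self])
qed simp

text \<open>Stray fields penalise transversal magnetization. Tested with \<phi>, the field equation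
  says that the integral of \<open>H p \<bullet> nabla \<phi> p\<close> is \<open>J' + J\<close>,
  where J is a weighted mean of the component along c and J' is small when the axial component
  oscillates little. The field term and J' are bounded by the local energy, hence so is J, and the
  Poincare inequality passes from the mean to the component itself.\<close>

lemma transversal_estimate:
 assumes om: "C1_domain \<omega>" "bounded \<omega>" and c: "c \<in> {ey, ez}"
 shows "\<exists>C\<ge>0. \<forall>m G H. state (UNIV \<times> \<omega>) m G H -->
  gnorm ({0..2} \<times> \<omega>) (%p. m p \<bullet> c) <= ennreal C * local_energy (UNIV \<times> \<omega>) ({-1<..<3} \<times> UNIV) G H"
proof -
 have cB: "c \<in> Basis" "c \<bullet> ex = 0" using c by (auto simp: space_Basis)
 have o: "open \<omega>" "\<omega> ~= {}" using om by (auto simp: C1_domain_def)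
 then have om_m [measurable]: "\<omega> \<in> sets borel" by simp
 define A :: "space set" where "A = {0..2} \<times> \<omega>"
 define S :: "space set" where "S = {-1<..<3} \<times> UNIV"
 have Am [measurable]: "A \<in> sets borel" unfolding A_def by (intro borel_Times) auto
 have Sm [measurable]: "S \<in> sets borel" unfolding S_def by (intro borel_open open_Times) auto
 have Ab: "bounded A" unfolding A_def using om(2) by (intro bounded_Times) auto
 obtain R where R: "R > 0" "!!p. p \<in> A ==> norm p <= R" using Ab by (auto simp: bounded_pos)
 obtain c1 where c1: "c1 >= 0" "!!f g. wgrad (UNIV \<times> \<omega>) f g ==> osc A A f <= ennreal c1 * gnorm ((UNIV \<times> \<omega>) \<inter> S) g"
  using wire_poincare[OF om] unfolding A_def S_def by blast
 obtain \<phi> where \<phi>: "\<phi> \<in> test_functions S"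
  "!!p. p \<in> UNIV \<times> \<omega> ==> nabla \<phi> p = (hat' (p \<bullet> ex) * (p \<bullet> c)) *\<^sub>R ex + hat (p \<bullet> ex) *\<^sub>R c"
  using wire_test_function[OF om(2) cB(2)] unfolding S_def by blast
 note [measurable] = test_borel[OF \<phi>(1)]
 obtain M where M: "M > 0" "!!x. \<bar>hat' x\<bar> <= M" using hat'_bounded by blast
 define w where "w p = \<I> A p * hat (p \<bullet> ex)" for p
 define w' where "w' p = \<I> A p * (hat' (p \<bullet> ex) * (p \<bullet> c))" for p
 have [measurable]: "w \<in> \<B>" "w' \<in> \<B>" unfolding w_def[abs_def] w'_def[abs_def] by measurable
 have wb: "\<bar>w p\<bar> <= 1 * \<I> A p" for p using hat_bounds[of "p \<bullet> ex"] by (simp add: w_def indicator_def)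
 have w'b: "\<bar>w' p\<bar> <= (M * R) * \<I> A p" for p
 proof (cases "p \<in> A")
  case True
  have "\<bar>p \<bullet> c\<bar> <= R" using Basis_le_norm[OF cB(1), of p] R(2)[OF True] by linarith
  then have "\<bar>hat' (p \<bullet> ex)\<bar> * \<bar>p \<bullet> c\<bar> <= M * R" using M by (intro mult_mono) auto
  then show ?thesis using True by (simp add: w'_def abs_mult)
 qed (simp add: w'_def)
 have iw: "integrable lborel w" "integrable lborel w'"
  by (rule bounded_support_integrable[OF _ Am Ab wb] bounded_support_integrable[OF _ Am Ab w'b]; simp)+
 \<comment> \<open>By Fubini: for each fixed transversal position the integral of
   \<open>hat'\<close> along the wire is 0.\<close>
 have w'0: "(LBINT p. w' p) = 0"
 proof -
  have e: "w' = (%(x, q). hat' x * (\<I> \<omega> q * (q \<bullet> snd c)))"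
  proof (rule ext, clarify)
   fix x y z :: real
   show "w' (x, y, z) = hat' x * (\<I> \<omega> (y, z) * ((y, z) \<bullet> snd c))"
    using hat_outside(2)[of x] c by (cases "x \<in> {0..2}") (auto simp: w'_def A_def indicator_def inner_prod_def)
  qed
  have "integrable (lborel \<Otimes>\<^sub>M lborel) (%(x, q). hat' x * (\<I> \<omega> q * (q \<bullet> snd c)))"
   using iw(2) unfolding e lborel_prod[symmetric] .
  from lborel_pair.integral_snd[OF this]
  have "(LBINT p. w' p) = (LBINT q. (LBINT x. hat' x * (\<I> \<omega> q * (q \<bullet> snd c))))"
   unfolding e lborel_prod[symmetric] by simp
  also have "... = 0" by (simp add: hat'_integral)
  finally show ?thesis .
 qed
 define \<alpha> where "\<alpha> = (LBINT p. w p)"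
 define V where "V = measure lborel A"
 have V: "V > 0" and \<alpha>: "\<alpha> > 0"
 proof -
  have op: "open ({0<..<2} \<times> \<omega> :: space set)" using o by (intro open_Times) auto
  have ne: "({0<..<2} \<times> \<omega> :: space set) ~= {}" using o by auto
  have nn: "\<not> negligible ({0<..<2} \<times> \<omega> :: space set)" using open_not_negligible[OF op ne] .
  show "\<alpha> > 0"
  proof -
   have w0: "w p >= 0" for p using hat_bounds by (simp add: w_def)
   have "\<alpha> >= 0" unfolding \<alpha>_def using w0 by (intro integral_nonneg_AE) auto
   moreover have "\<alpha> ~= 0"
   proof
    assume "\<alpha> = 0"
    then have "AE p in lborel. w p = 0" using integral_nonneg_eq_0_iff_AE[OF iw(1)] w0 by (simp add: \<alpha>_def)
    then have "AE p in lborel. p \<notin> ({0<..<2} \<times> \<omega> :: space set)"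
    proof eventually_elim
     fix p assume "w p = 0"
     then show "p \<notin> {0<..<2} \<times> \<omega>"
      using hat_pos[of "fst p"] by (cases p) (auto simp: w_def A_def space_inner indicator_def split: if_splits)
    qed
    then have "({0<..<2} \<times> \<omega> :: space set) \<in> null_sets lborel"
     using op by (subst AE_iff_null_sets) auto
    then have "negligible ({0<..<2} \<times> \<omega> :: space set)" by (simp add: negligible_iff_null_sets null_sets_completionI)
    then show False using nn by simp
   qed
   ultimately show ?thesis by simp
  qed
  moreover have "\<alpha> <= V"
  proof -
   have iA: "integrable lborel (\<I> A :: space => real)"
    using emeasure_bounded_finite[OF Ab] by (simp add: integrable_indicator_iff)
   have "\<alpha> <= (LBINT p. \<I> A p)" unfolding \<alpha>_def
    using wb by (intro integral_mono iw iA) (auto simp: abs_le_iff)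
   then show ?thesis by (simp add: V_def)
  qed
  ultimately show "V > 0" by simp
 qed
 define P where "P = enn2real (gnorm UNIV (nabla \<phi>))"
 have P: "gnorm UNIV (nabla \<phi>) = ennreal P" "P >= 0"
 proof -
  obtain K B where K: "compact K" "K \<subseteq> S" "B > 0" "!!x. \<bar>\<phi> x\<bar> <= B * \<I> K x"
   "!!x. norm (nabla \<phi> x) <= B * \<I> K x" using test_bounded[OF \<phi>(1)] by blast
  have [measurable]: "K \<in> sets borel" using K by (simp add: borel_compact)
  have "gnorm UNIV (nabla \<phi>) <= (\<N> x. ennreal (B\<^sup>2) * \<I> K x)"
   unfolding gnorm_def
  proof (intro nn_integral_mono)
   fix x
   have "(norm (nabla \<phi> x))\<^sup>2 <= (B * \<I> K x)\<^sup>2" by (intro power_mono K) auto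
   then show "\<I> UNIV x * ennreal ((norm (nabla \<phi> x))\<^sup>2) <= ennreal (B\<^sup>2) * \<I> K x"
    by (cases "x \<in> K") (auto intro: ennreal_leI)
  qed
  also have "... < \<infinity>"
   by (subst nn_integral_cmult_indicator) (use emeasure_compact_finite[OF K(1)] in \<open>auto simp: ennreal_mult_less_top\<close>)
  finally show "gnorm UNIV (nabla \<phi>) = ennreal P" by (simp add: P_def)
 qed (simp add: P_def)
 \<comment> \<open>C2 comes from \<open>weighted_average_osc\<close> with the bound
   \<open>M * R\<close> for the weight w'. C3 collects the two terms of the final triangle
   inequality, divided by the square of the mass \<alpha> of w.\<close>
 define C2 where "C2 = (M * R)\<^sup>2 * V * c1 / V"
 define C3 where "C3 = (2 * (V * c1) + 2 * V * (2 * P + 2 * C2)) / \<alpha>\<^sup>2"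
 have C23: "C2 >= 0" "C3 >= 0" using M R V c1(1) P(2) by (simp_all add: C2_def C3_def)
 have "gnorm A (%p. m p \<bullet> c) <= ennreal C3 * local_energy (UNIV \<times> \<omega>) S G H" if s: "state (UNIV \<times> \<omega>) m G H" for m G H
 proof -
  note [measurable] = stateD(1,5)[OF s]
  define e where "e = local_energy (UNIV \<times> \<omega>) S G H"
  have eG: "gnorm ((UNIV \<times> \<omega>) \<inter> S) (G d) <= e" if "d \<in> Basis" for d
  proof -
   have "gnorm ((UNIV \<times> \<omega>) \<inter> S) (G d) <= (\<Sum>c\<in>Basis. gnorm ((UNIV \<times> \<omega>) \<inter> S) (G c))"
    by (rule member_le_sum) (use that in auto)
   also have "... <= e" unfolding e_def local_energy_def by simp
   finally show ?thesis .
  qed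
  have eH: "gnorm S H <= e" unfolding e_def local_energy_def by simp
  have os: "osc A A (%p. m p \<bullet> d) <= ennreal c1 * e" if "d \<in> Basis" for d
   using c1(2)[OF stateD(3)[OF s that]] eG[OF that] by (meson mult_left_mono order_trans zero_le)
  have mb: "\<bar>m p \<bullet> d\<bar> <= 1" if "d \<in> Basis" for d p
   using Basis_le_norm[OF that, of "m p"] stateD(2)[OF s, of p] by linarith
  define J where "J = (LBINT p. w p * (m p \<bullet> c))"
  define J' where "J' = (LBINT p. w' p * (m p \<bullet> ex))"
  have exB: "ex \<in> Basis" by (simp add: space_Basis)
  have iJ: "integrable lborel (%p. w p * (m p \<bullet> c))"
   by (rule bounded_support_integrable[OF _ Am Ab, of _ 1])
    (use wb mb[OF cB(1)] in \<open>auto simp: abs_mult intro: mult_le_one order_trans[OF mult_mono[OF wb mb[OF cB(1)]]]\<close>)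
  have iJ': "integrable lborel (%p. w' p * (m p \<bullet> ex))"
  proof (rule bounded_support_integrable[OF _ Am Ab, of _ "M * R"])
   fix p
   have "\<bar>w' p\<bar> * \<bar>m p \<bullet> ex\<bar> <= \<bar>w' p\<bar>" using mb[OF exB, of p] by (simp add: mult_left_le)
   then show "\<bar>w' p * (m p \<bullet> ex)\<bar> <= M * R * \<I> A p" using w'b[of p] by (simp add: abs_mult)
  qed simp
  have eq: "(LBINT p. H p \<bullet> nabla \<phi> p) = J' + J"
  proof -
   have "\<phi> \<in> test_functions UNIV" using \<phi>(1) test_functions_mono[of S UNIV] by auto
   from stateD(7)[OF s this]
   have "(LBINT p. H p \<bullet> nabla \<phi> p) = (LBINT p. \<I> (UNIV \<times> \<omega>) p * (m p \<bullet> nabla \<phi> p))" .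
   also have "... = (LBINT p. w' p * (m p \<bullet> ex) + w p * (m p \<bullet> c))"
   proof (intro Bochner_Integration.integral_cong refl)
    fix p :: space
    show "\<I> (UNIV \<times> \<omega>) p * (m p \<bullet> nabla \<phi> p) = w' p * (m p \<bullet> ex) + w p * (m p \<bullet> c)"
    proof (cases "p \<in> UNIV \<times> \<omega>")
     case True
     have "\<I> A p * hat (p \<bullet> ex) = hat (p \<bullet> ex)" "\<I> A p * hat' (p \<bullet> ex) = hat' (p \<bullet> ex)"
      using True hat_outside[of "fst p"] by (cases p; auto simp: A_def indicator_def space_inner)+
     then have ww: "w p = hat (p \<bullet> ex)" "w' p = hat' (p \<bullet> ex) * (p \<bullet> c)" by (simp_all add: w_def w'_def flip: mult.assoc)
     show ?thesis unfolding \<phi>(2)[OF True] inner_add_right inner_scaleR_right ww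
      using True by (simp only: indicator_simps if_True mult_1)
    next
     case False
     then have "p \<notin> A" by (auto simp: A_def)
     then show ?thesis using False by (simp add: w_def w'_def)
    qed
   qed
   also have "... = J' + J" unfolding J_def J'_def using iJ iJ' by simp
   finally show ?thesis .
  qed
  have HP: "ennreal ((J' + J)\<^sup>2) <= ennreal P * e"
  proof -
   have "ennreal ((J' + J)\<^sup>2) <= gnorm S H * gnorm UNIV (nabla \<phi>)"
    unfolding eq[symmetric] by (rule inner_integral_bound) (use test_zero_outside[OF \<phi>(1)] in auto)
   also have "... <= e * ennreal P" unfolding P(1) using eH by (rule mult_right_mono) simp
   finally show ?thesis by (simp add: mult.commute)
  qed
  have J'2: "ennreal (J'\<^sup>2) <= ennreal C2 * e"
  proof -
   \<comment> \<open>Since w' has mean zero, the function on the left is the constant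
     \<open>- J'\<close>, with squared norm \<open>J'\<^sup>2 * V\<close>.\<close>
   have "gnorm A (%p. (LBINT y. w' y) * (m p \<bullet> ex) - J') <= ennreal ((M * R)\<^sup>2 * measure lborel A) * osc A A (%p. m p \<bullet> ex)"
    unfolding J'_def by (rule weighted_average_osc[OF _ _ Am Am Ab w'b iJ']) simp_all
   then have "ennreal (J'\<^sup>2 * V) <= ennreal ((M * R)\<^sup>2 * V) * osc A A (%p. m p \<bullet> ex)"
    unfolding w'0 using gnorm_const[OF Ab Am, of "- J'"] by (simp add: V_def)
   also have "... <= ennreal ((M * R)\<^sup>2 * V) * (ennreal c1 * e)" by (intro mult_left_mono os exB) simp
   finally have "ennreal (1 / V) * ennreal (J'\<^sup>2 * V) <= ennreal (1 / V) * (ennreal ((M * R)\<^sup>2 * V) * (ennreal c1 * e))"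
    by (rule mult_left_mono) simp
   moreover have "ennreal (1 / V) * ennreal (J'\<^sup>2 * V) = ennreal (J'\<^sup>2)" using V by (simp flip: ennreal_mult)
   moreover have "ennreal (1 / V) * ennreal ((M * R)\<^sup>2 * V) * ennreal c1 = ennreal C2"
    using V c1(1) by (simp add: C2_def flip: ennreal_mult)
   ultimately show ?thesis by (simp only: mult.assoc[symmetric])
  qed
  have J2: "ennreal (J\<^sup>2) <= ennreal (2 * P + 2 * C2) * e"
  proof -
   have "ennreal (J\<^sup>2) <= 2 * ennreal ((J' + J)\<^sup>2) + 2 * ennreal (J'\<^sup>2)"
    using ennreal_square_triangle[of J "- J'" 0] ennreal_square_triangle[of "J' + J" J' 0] by (simp add: add.commute)
   also have "... <= 2 * (ennreal P * e) + 2 * (ennreal C2 * e)" by (intro add_mono mult_left_mono HP J'2) auto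
   also have "... = ennreal (2 * P + 2 * C2) * e" using P(2) C23 by (simp add: ennreal_mult distrib_right mult.assoc)
   finally show ?thesis .
  qed
  have a1: "gnorm A (%p. \<alpha> * (m p \<bullet> c) - J) <= ennreal V * (ennreal c1 * e)"
  proof -
   have "gnorm A (%p. (LBINT y. w y) * (m p \<bullet> c) - J) <= ennreal (1\<^sup>2 * measure lborel A) * osc A A (%p. m p \<bullet> c)"
    unfolding J_def by (rule weighted_average_osc[OF _ _ Am Am Ab wb iJ]) simp_all
   also have "... <= ennreal V * (ennreal c1 * e)" by (simp add: V_def) (intro mult_left_mono os cB, simp)
   finally show ?thesis by (simp add: \<alpha>_def)
  qed
  have "ennreal (\<alpha>\<^sup>2) * gnorm A (%p. m p \<bullet> c) = gnorm A (%p. \<alpha> * (m p \<bullet> c) - 0)"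
   using gnorm_scale[of "%p. m p \<bullet> c" A \<alpha>] by simp
  also have "... <= 2 * gnorm A (%p. \<alpha> * (m p \<bullet> c) - J) + 2 * gnorm A (%p. J - 0)"
   by (rule gnorm_triangle) measurable
  also have "gnorm A (%p. J - 0) = ennreal V * ennreal (J\<^sup>2)" using gnorm_const[OF Ab Am, of J] V by (simp add: V_def ennreal_mult mult.commute)
  also have "2 * gnorm A (%p. \<alpha> * (m p \<bullet> c) - J) + 2 * (ennreal V * ennreal (J\<^sup>2))
   <= 2 * (ennreal V * (ennreal c1 * e)) + 2 * (ennreal V * (ennreal (2 * P + 2 * C2) * e))"
   by (intro add_mono mult_left_mono a1 J2) auto
  also have "... = ennreal (2 * (V * c1) + 2 * V * (2 * P + 2 * C2)) * e"
  proof -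
   define Y where "Y = 2 * P + 2 * C2"
   have "Y >= 0" using P(2) C23 by (simp add: Y_def)
   then show ?thesis unfolding Y_def[symmetric] using V c1(1) by (simp add: ennreal_mult distrib_right mult.assoc)
  qed
  finally have "ennreal (1 / \<alpha>\<^sup>2) * (ennreal (\<alpha>\<^sup>2) * gnorm A (%p. m p \<bullet> c)) <= ennreal (1 / \<alpha>\<^sup>2) * (ennreal (2 * (V * c1) + 2 * V * (2 * P + 2 * C2)) * e)"
   by (rule mult_left_mono) simp
  moreover have "ennreal (1 / \<alpha>\<^sup>2) * ennreal (\<alpha>\<^sup>2) = 1" using \<alpha> by (simp flip: ennreal_mult)
  moreover have "ennreal (1 / \<alpha>\<^sup>2) * ennreal (2 * (V * c1) + 2 * V * (2 * P + 2 * C2)) = ennreal C3"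
   using V c1(1) P(2) C23(1) by (subst ennreal_mult[symmetric]) (auto simp: C3_def)
  ultimately show ?thesis unfolding e_def[symmetric] by (simp only: mult.assoc[symmetric] mult_1)
 qed
 then show ?thesis using C23(2) unfolding A_def S_def by blast
qed

section \<open>Cells of the wire, their averages and energies\<close>

definition cell0 :: "(real \<times> real) set => space set" where "cell0 \<omega> = {0..<1} \<times> \<omega>"
definition strip0 :: "space set" where "strip0 = {-1<..<3} \<times> UNIV"
definition shift :: "int => (space => 'b) => space => 'b" where "shift k f p = f (p + real_of_int k *\<^sub>R ex)"
definition cell_avg :: "(real \<times> real) set => (space => space) => real" where
 "cell_avg \<omega> m = (LBINT p. \<I> (cell0 \<omega>) p * (m p \<bullet> ex)) / measure lborel (cell0 \<omega>)"
definition cell_energy :: "(real \<times> real) set => (space => space => space) => (space => space) => int => ennreal" where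
 "cell_energy \<omega> G H k = local_energy (UNIV \<times> \<omega>) strip0 (%c. shift k (G c)) (shift k H)"
text \<open>Colour 0 marks an average without a definite sign. The threshold 1/2 leaves a gap of
  length 1 between the colours 1 and -1, too wide for neighbouring cells of small energy.\<close>

definition color :: "real => int" where
 "color b = (if b >= 1/2 then 1 else if b <= -1/2 then -1 else 0)"

lemma shift_measurable [measurable (raw)]:
 fixes f :: "space => 'b::topological_space"
 assumes [measurable]: "f \<in> \<B>" shows "shift k f \<in> \<B>"
 unfolding shift_def[abs_def] by measurable

lemma shift_0: "shift 0 f = f"
 by (rule ext) (simp only: shift_def of_int_0 scaleR_zero_left add_0_right)

lemma shift_shift: "shift j (shift k f) = shift (k + j) f"
 by (rule ext) (simp add: shift_def algebra_simps flip: scaleR_add_left)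

lemma state_shift_int:
 assumes "state (UNIV \<times> \<omega>) m G H" "\<omega> \<in> sets borel"
 shows "state (UNIV \<times> \<omega>) (shift k m) (%c. shift k (G c)) (shift k H)"
 using state_shift[OF assms, of "real_of_int k"] unfolding shift_def[abs_def] .

lemma cell0_facts:
 assumes "open \<omega>" "bounded \<omega>" "\<omega> ~= {}"
 shows "cell0 \<omega> \<in> sets borel" "bounded (cell0 \<omega>)" "measure lborel (cell0 \<omega>) > 0" "strip0 \<in> sets borel"
proof -
 show m: "cell0 \<omega> \<in> sets borel" unfolding cell0_def using assms(1) by (intro borel_Times) auto
 show b: "bounded (cell0 \<omega>)" unfolding cell0_def using assms(2) by (intro bounded_Times) auto
 show "strip0 \<in> sets borel" unfolding strip0_def by (intro borel_open open_Times) auto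
 obtain q r where q: "r > 0" "ball q r \<subseteq> \<omega>" using assms(1,3) by (metis ex_in_conv open_contains_ball)
 define r' where "r' = min r (1/2)"
 have "ball (1/2, q) r' \<subseteq> cell0 \<omega>"
 proof
  fix p assume p: "p \<in> ball (1/2 :: real, q) r'"
  have "dist (1/2) (fst p) < r'" "dist q (snd p) < r'"
   using p dist_fst_le[of "(1/2, q)" p] dist_snd_le[of "(1/2, q)" p] by auto
  then have "dist (1/2) (fst p) < 1/2" "snd p \<in> \<omega>" using q(2) by (auto simp: r'_def)
  then have "\<bar>1/2 - fst p\<bar> < 1/2" by (simp add: dist_real_def)
  then have "0 <= fst p" "fst p < 1" by linarith+
  then show "p \<in> cell0 \<omega>" using \<open>snd p \<in> \<omega>\<close> by (cases p) (auto simp: cell0_def)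
 qed
 then have "measure lborel (ball (1/2 :: real, q) r') <= measure lborel (cell0 \<omega>)"
  using m b emeasure_bounded_finite[OF b] by (intro measure_mono_fmeasurable) (auto intro: fmeasurableI)
 moreover have "measure lborel (ball (1/2 :: real, q) r') > 0" using q(1) by (intro content_ball_gt_0_iff[THEN iffD2]) (simp add: r'_def)
 ultimately show "measure lborel (cell0 \<omega>) > 0" by linarith
qed

text \<open>The third estimate covers two cells, so that the average over one cell can be compared
  with the values on the next.\<close>

lemma cell_estimate:
 assumes om: "C1_domain \<omega>" "bounded \<omega>"
 shows "\<exists>C\<ge>0. \<forall>m G H. state (UNIV \<times> \<omega>) m G H -->
  gnorm (cell0 \<omega>) (%p. m p \<bullet> ey) <= ennreal C * cell_energy \<omega> G H 0 &
  gnorm (cell0 \<omega>) (%p. m p \<bullet> ez) <= ennreal C * cell_energy \<omega> G H 0 &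
  gnorm ({0..2} \<times> \<omega>) (%p. m p \<bullet> ex - cell_avg \<omega> m) <= ennreal C * cell_energy \<omega> G H 0"
proof -
 have o: "open \<omega>" "\<omega> ~= {}" using om by (auto simp: C1_domain_def)
 note cf = cell0_facts[OF o(1) om(2) o(2)]
 note [measurable] = cf(1,4)
 define A :: "space set" where "A = {0..2} \<times> \<omega>"
 have Am [measurable]: "A \<in> sets borel" unfolding A_def using o by (intro borel_Times) auto
 have QA: "cell0 \<omega> \<subseteq> A" by (auto simp: A_def cell0_def)
 obtain Cy where Cy: "Cy >= 0" "!!m G H. state (UNIV \<times> \<omega>) m G H ==> gnorm A (%p. m p \<bullet> ey) <= ennreal Cy * local_energy (UNIV \<times> \<omega>) strip0 G H"
  using transversal_estimate[OF om, of ey] unfolding A_def strip0_def by blast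
 obtain Cz where Cz: "Cz >= 0" "!!m G H. state (UNIV \<times> \<omega>) m G H ==> gnorm A (%p. m p \<bullet> ez) <= ennreal Cz * local_energy (UNIV \<times> \<omega>) strip0 G H"
  using transversal_estimate[OF om, of ez] unfolding A_def strip0_def by blast
 obtain c1 where c1: "c1 >= 0" "!!f g. wgrad (UNIV \<times> \<omega>) f g ==> osc A A f <= ennreal c1 * gnorm ((UNIV \<times> \<omega>) \<inter> strip0) g"
  using wire_poincare[OF om] unfolding A_def strip0_def by blast
 define \<mu> where "\<mu> = measure lborel (cell0 \<omega>)"
 have mu: "\<mu> > 0" using cf(3) by (simp add: \<mu>_def)
 define C where "C = max (max Cy Cz) (c1 / \<mu>)"
 have C: "C >= 0" "Cy <= C" "Cz <= C" "c1 / \<mu> <= C" using Cy(1) by (auto simp: C_def)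
 have "gnorm (cell0 \<omega>) (%p. m p \<bullet> ey) <= ennreal C * cell_energy \<omega> G H 0 &
  gnorm (cell0 \<omega>) (%p. m p \<bullet> ez) <= ennreal C * cell_energy \<omega> G H 0 &
  gnorm A (%p. m p \<bullet> ex - cell_avg \<omega> m) <= ennreal C * cell_energy \<omega> G H 0" if s: "state (UNIV \<times> \<omega>) m G H" for m G H
 proof -
  note [measurable] = stateD(1)[OF s]
  define e where "e = cell_energy \<omega> G H 0"
  have e: "e = local_energy (UNIV \<times> \<omega>) strip0 G H" by (simp add: e_def cell_energy_def shift_0)
  have le: "x <= ennreal C * e" if "x <= ennreal D * e" "D <= C" for x D
   using that by (meson ennreal_leI mult_right_mono order_trans zero_le)
  have exB: "ex \<in> Basis" by (simp add: space_Basis)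
  have eG: "gnorm ((UNIV \<times> \<omega>) \<inter> strip0) (G ex) <= e"
  proof -
   have "gnorm ((UNIV \<times> \<omega>) \<inter> strip0) (G ex) <= (\<Sum>c\<in>Basis. gnorm ((UNIV \<times> \<omega>) \<inter> strip0) (G c))"
    by (rule member_le_sum) (use exB in auto)
   also have "... <= e" unfolding e local_energy_def by simp
   finally show ?thesis .
  qed
  have ib: "integrable lborel (%p. \<I> (cell0 \<omega>) p * (m p \<bullet> ex))"
  proof (rule bounded_support_integrable[OF _ cf(1,2), of _ 1])
   fix p
   have "\<bar>m p \<bullet> ex\<bar> <= 1" using Basis_le_norm[OF exB, of "m p"] stateD(2)[OF s, of p] by linarith
   then show "\<bar>\<I> (cell0 \<omega>) p * (m p \<bullet> ex)\<bar> <= 1 * \<I> (cell0 \<omega>) p" by (simp add: indicator_def)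
  qed measurable
  have "gnorm A (%p. (LBINT y. \<I> (cell0 \<omega>) y) * (m p \<bullet> ex) - (LBINT p. \<I> (cell0 \<omega>) p * (m p \<bullet> ex)))
   <= ennreal (1\<^sup>2 * measure lborel (cell0 \<omega>)) * osc A (cell0 \<omega>) (%p. m p \<bullet> ex)"
   by (rule weighted_average_osc[OF _ _ Am cf(1,2) _ ib]) (simp_all add: indicator_def)
  also have "(%p. (LBINT y. \<I> (cell0 \<omega>) y) * (m p \<bullet> ex) - (LBINT p. \<I> (cell0 \<omega>) p * (m p \<bullet> ex)))
   = (%p. \<mu> *\<^sub>R (m p \<bullet> ex - cell_avg \<omega> m))"
   using mu by (simp add: cell_avg_def \<mu>_def right_diff_distrib)
  also have "gnorm A ... = ennreal (\<mu>\<^sup>2) * gnorm A (%p. m p \<bullet> ex - cell_avg \<omega> m)" by (rule gnorm_scale) measurable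
  also have "ennreal (1\<^sup>2 * measure lborel (cell0 \<omega>)) * osc A (cell0 \<omega>) (%p. m p \<bullet> ex) <= ennreal \<mu> * (ennreal c1 * e)"
  proof -
   have "osc A (cell0 \<omega>) (%p. m p \<bullet> ex) <= osc A A (%p. m p \<bullet> ex)" by (rule osc_mono[OF order_refl QA])
   also have "... <= ennreal c1 * gnorm ((UNIV \<times> \<omega>) \<inter> strip0) (G ex)" by (rule c1(2)[OF stateD(3)[OF s exB]])
   also have "... <= ennreal c1 * e" by (intro mult_left_mono eG) simp
   finally show ?thesis by (simp add: \<mu>_def mult_left_mono)
  qed
  finally have "ennreal (1 / \<mu>\<^sup>2) * (ennreal (\<mu>\<^sup>2) * gnorm A (%p. m p \<bullet> ex - cell_avg \<omega> m)) <= ennreal (1 / \<mu>\<^sup>2) * (ennreal \<mu> * (ennreal c1 * e))"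
   by (rule mult_left_mono) simp
  moreover have "ennreal (1 / \<mu>\<^sup>2) * ennreal (\<mu>\<^sup>2) = 1" using mu by (simp flip: ennreal_mult)
  moreover have "ennreal (1 / \<mu>\<^sup>2) * ennreal \<mu> * ennreal c1 = ennreal (c1 / \<mu>)"
   using mu c1(1) by (simp add: power2_eq_square flip: ennreal_mult)
  ultimately have "gnorm A (%p. m p \<bullet> ex - cell_avg \<omega> m) <= ennreal (c1 / \<mu>) * e" by (simp only: mult.assoc[symmetric] mult_1)
  moreover have "gnorm (cell0 \<omega>) (%p. m p \<bullet> ey) <= ennreal Cy * e"
   using order_trans[OF gnorm_mono[OF QA] Cy(2)[OF s]] by (simp add: e)
  moreover have "gnorm (cell0 \<omega>) (%p. m p \<bullet> ez) <= ennreal Cz * e"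
   using order_trans[OF gnorm_mono[OF QA] Cz(2)[OF s]] by (simp add: e)
  ultimately show ?thesis unfolding e_def[symmetric] using le C by blast
 qed
 then show ?thesis using C(1) unfolding A_def by blast
qed

text \<open>Bounded overlap: a point lies in at most five of the translated strips.\<close>

lemma sum_shift_gnorm:
 fixes g :: "space => 'b::euclidean_space" and \<omega> :: "(real \<times> real) set"
 assumes [measurable]: "g \<in> \<B>" and om: "\<omega> \<in> sets borel" and I: "finite I"
 shows "(\<Sum>k\<in>I. gnorm ((UNIV \<times> \<omega>) \<inter> strip0) (shift k g)) <= 5 * gnorm (UNIV \<times> \<omega>) g"
proof -
 define T where "T k = {p :: space. p + real_of_int (- k) *\<^sub>R ex \<in> (UNIV \<times> \<omega>) \<inter> strip0}" for k :: int
 have [measurable]: "strip0 \<in> sets borel" unfolding strip0_def by (intro borel_open open_Times) auto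
 have [measurable]: "(UNIV \<times> \<omega> :: space set) \<in> sets borel" using om by (intro borel_Times) auto
 have T: "p \<in> T k \<longleftrightarrow> snd p \<in> \<omega> & real_of_int k - 1 < fst p & fst p < real_of_int k + 3" for p k
  by (cases p) (auto simp: T_def strip0_def)
 have [measurable]: "T k \<in> sets borel" for k unfolding T_def by measurable
 have sh: "gnorm ((UNIV \<times> \<omega>) \<inter> strip0) (shift k g) = gnorm (T k) g" for k
  unfolding shift_def[abs_def] by (rule gnorm_shift) (auto simp: T_def)
 have "(\<Sum>k\<in>I. gnorm (T k) g) = (\<N> p. (\<Sum>k\<in>I. \<I> (T k) p * ennreal ((norm (g p))\<^sup>2)))"
  unfolding gnorm_def by (rule nn_integral_sum[symmetric]) measurable
 also have "... <= (\<N> p. 5 * (\<I> (UNIV \<times> \<omega>) p * ennreal ((norm (g p))\<^sup>2)))"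
 proof (intro nn_integral_mono)
  fix p :: space
  have "(\<Sum>k\<in>I. \<I> (T k) p) <= (5 * \<I> (UNIV \<times> \<omega>) p :: ennreal)"
  proof (cases "snd p \<in> \<omega>")
   case True
   \<comment> \<open>The strip of k is \<open>k - 1 < x < k + 3\<close>, which confines k to five
     consecutive integers around the floor of x.\<close>
   have sub: "{k \<in> I. p \<in> T k} \<subseteq> {\<lfloor>fst p\<rfloor> - 3..\<lfloor>fst p\<rfloor> + 1}"
    unfolding T by auto linarith+
   have "(\<Sum>k\<in>I. \<I> (T k) p) = (\<Sum>k\<in>{k\<in>I. p \<in> T k}. 1 :: ennreal)"
    using I by (intro sum.mono_neutral_cong_right) (auto simp: indicator_def)
   also have "... = of_nat (card {k\<in>I. p \<in> T k})" by simp
   also have "card {k\<in>I. p \<in> T k} <= card {\<lfloor>fst p\<rfloor> - 3..\<lfloor>fst p\<rfloor> + 1}" by (rule card_mono[OF _ sub]) simp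
   then have "of_nat (card {k\<in>I. p \<in> T k}) <= (of_nat 5 :: ennreal)" by (intro of_nat_mono) simp
   finally show ?thesis using True by (cases p) (simp add: indicator_def)
  next
   case False
   then have "p \<notin> T k" for k by (simp add: T)
   then show ?thesis by simp
  qed
  then show "(\<Sum>k\<in>I. \<I> (T k) p * ennreal ((norm (g p))\<^sup>2)) <= 5 * (\<I> (UNIV \<times> \<omega>) p * ennreal ((norm (g p))\<^sup>2))"
   unfolding sum_distrib_right[symmetric] mult.assoc[symmetric] by (rule mult_right_mono) simp
 qed
 also have "... = 5 * gnorm (UNIV \<times> \<omega>) g" unfolding gnorm_def by (rule nn_integral_cmult) measurable
 finally show ?thesis by (simp add: sh)
qed

lemma sum_cell_energy:
 assumes [measurable]: "!!c. c \<in> Basis ==> G c \<in> \<B>" "H \<in> \<B>"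
  and om: "\<omega> \<in> sets borel" and I: "finite I"
 shows "(\<Sum>k\<in>I. cell_energy \<omega> G H k) <= 5 * local_energy (UNIV \<times> \<omega>) UNIV G H"
proof -
 have "(\<Sum>k\<in>I. cell_energy \<omega> G H k)
  = (\<Sum>c\<in>Basis. \<Sum>k\<in>I. gnorm ((UNIV \<times> \<omega>) \<inter> strip0) (shift k (G c))) + (\<Sum>k\<in>I. gnorm strip0 (shift k H))"
  unfolding cell_energy_def local_energy_def sum.distrib by (subst sum.swap) (rule refl)
 also have "... <= (\<Sum>c\<in>Basis. 5 * gnorm (UNIV \<times> \<omega>) (G c)) + 5 * gnorm UNIV H"
  using sum_shift_gnorm[of H UNIV I] I
  by (intro add_mono sum_mono sum_shift_gnorm om) simp_all
 also have "... = 5 * local_energy (UNIV \<times> \<omega>) UNIV G H"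
  by (simp add: local_energy_def distrib_left sum_distrib_left)
 finally show ?thesis .
qed

text \<open>If |b| < 1/2, then either |x| <= 3/4 and the other coordinates carry at least 7/16, or x
  is at distance at least 1/4 from b. The second estimate says that a unit vector with small
  transversal part and axial part close to b is close to the pole s on the side of b.\<close>

lemma unit_vector_estimates:
 fixes x y z b :: real
 assumes "x\<^sup>2 + y\<^sup>2 + z\<^sup>2 = 1"
 shows "\<bar>b\<bar> < 1/2 ==> 1/16 <= y\<^sup>2 + z\<^sup>2 + (x - b)\<^sup>2"
  "\<bar>s\<bar> = 1 ==> s * b >= 1/2 ==> (x - s)\<^sup>2 <= y\<^sup>2 + z\<^sup>2 + 16 * (x - b)\<^sup>2"
proof -
 have x: "\<bar>x\<bar> <= 1" using assms zero_le_power2[of y] zero_le_power2[of z] by (intro abs_square_le_1[THEN iffD1]) linarith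
 show "1/16 <= y\<^sup>2 + z\<^sup>2 + (x - b)\<^sup>2" if b: "\<bar>b\<bar> < 1/2"
 proof (cases "\<bar>x\<bar> <= 3/4")
  case True
  then have "\<bar>x\<bar>\<^sup>2 <= (3/4)\<^sup>2" by (intro power_mono) auto
  then have "x\<^sup>2 <= 9/16" by (simp add: power2_eq_square)
  then show ?thesis using assms zero_le_power2[of "x - b"] by linarith
 next
  case False
  then have "1/4 <= \<bar>x - b\<bar>" using b by linarith
  then have "(1/4)\<^sup>2 <= \<bar>x - b\<bar>\<^sup>2" by (intro power_mono) auto
  then have "1/16 <= (x - b)\<^sup>2" by (simp add: power_divide)
  then show ?thesis using zero_le_power2[of y] zero_le_power2[of z] by linarith
 qed
 show "(x - s)\<^sup>2 <= y\<^sup>2 + z\<^sup>2 + 16 * (x - b)\<^sup>2" if s: "\<bar>s\<bar> = 1" "s * b >= 1/2"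
 proof -
  have ss: "s = 1 \<or> s = -1" using s(1) by linarith
  show ?thesis
  proof (cases "s * x >= 0")
   case True
   \<comment> \<open>On the correct hemisphere this amounts to
     \<open>(s * x)\<^sup>2 <= s * x\<close>.\<close>
   have "(x - s)\<^sup>2 <= 1 - x\<^sup>2"
   proof -
    have "0 <= (s * x) * (1 - s * x)" by (rule mult_nonneg_nonneg[OF True]) (use x ss in auto)
    then show ?thesis using ss by (auto simp: power2_eq_square algebra_simps)
   qed
   then show ?thesis using assms zero_le_power2[of "x - b"] by linarith
  next
   case False
   \<comment> \<open>On the wrong hemisphere x and b are on different sides of 0. The factor 16
     lifts \<open>(1/2)\<^sup>2\<close> to 4, the trivial bound for
     \<open>(x - s)\<^sup>2\<close>.\<close>
   have "1/2 <= \<bar>x - b\<bar>" using False s ss by auto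
   then have "(1/2)\<^sup>2 <= \<bar>x - b\<bar>\<^sup>2" by (intro power_mono) auto
   then have "4 <= 16 * (x - b)\<^sup>2" by (simp add: power2_eq_square)
   moreover have "\<bar>x - s\<bar>\<^sup>2 <= 2\<^sup>2" using x s by (intro power_mono) auto
   then have "(x - s)\<^sup>2 <= 4" by simp
   ultimately show ?thesis using zero_le_power2[of y] zero_le_power2[of z] by linarith
  qed
 qed
qed

lemma unit_AE_integrated:
 assumes [measurable]: "m \<in> \<B>" "Q \<in> sets borel" and Q: "bounded Q"
  and unit: "AE p in lborel. p \<in> Q --> norm (m p) = 1"
 shows "\<bar>b\<bar> < 1/2 ==> ennreal (measure lborel Q / 16) <= gnorm Q (%p. m p \<bullet> ey) + gnorm Q (%p. m p \<bullet> ez) + gnorm Q (%p. m p \<bullet> ex - b)"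
  "\<bar>s\<bar> = 1 ==> s * b >= 1/2 ==> gnorm Q (%p. m p \<bullet> ex - s) <= gnorm Q (%p. m p \<bullet> ey) + gnorm Q (%p. m p \<bullet> ez) + 16 * gnorm Q (%p. m p \<bullet> ex - b)"
proof -
 have u: "AE p in lborel. p \<in> Q --> (m p \<bullet> ex)\<^sup>2 + (m p \<bullet> ey)\<^sup>2 + (m p \<bullet> ez)\<^sup>2 = 1"
  using unit by eventually_elim (simp flip: space_norm_sq)
 have gen: "(\<N> p. \<I> Q p * ennreal (l p)) <= gnorm Q (%p. m p \<bullet> ey) + gnorm Q (%p. m p \<bullet> ez) + ennreal K * gnorm Q (%p. m p \<bullet> ex - b)"
  if l: "!!p. (m p \<bullet> ex)\<^sup>2 + (m p \<bullet> ey)\<^sup>2 + (m p \<bullet> ez)\<^sup>2 = 1 ==> l p <= (m p \<bullet> ey)\<^sup>2 + (m p \<bullet> ez)\<^sup>2 + K * (m p \<bullet> ex - b)\<^sup>2"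
   and K: "K >= 0" for l K
 proof -
  have "(\<N> p. \<I> Q p * ennreal (l p))
   <= (\<N> p. \<I> Q p * ennreal ((m p \<bullet> ey)\<^sup>2) + \<I> Q p * ennreal ((m p \<bullet> ez)\<^sup>2) + ennreal K * (\<I> Q p * ennreal ((m p \<bullet> ex - b)\<^sup>2)))"
  proof (rule nn_integral_mono_AE)
   show "AE p in lborel. \<I> Q p * ennreal (l p) <= \<I> Q p * ennreal ((m p \<bullet> ey)\<^sup>2) + \<I> Q p * ennreal ((m p \<bullet> ez)\<^sup>2) + ennreal K * (\<I> Q p * ennreal ((m p \<bullet> ex - b)\<^sup>2))"
    using u
   proof eventually_elim
    fix p assume h: "p \<in> Q --> (m p \<bullet> ex)\<^sup>2 + (m p \<bullet> ey)\<^sup>2 + (m p \<bullet> ez)\<^sup>2 = 1"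
    show "\<I> Q p * ennreal (l p) <= \<I> Q p * ennreal ((m p \<bullet> ey)\<^sup>2) + \<I> Q p * ennreal ((m p \<bullet> ez)\<^sup>2) + ennreal K * (\<I> Q p * ennreal ((m p \<bullet> ex - b)\<^sup>2))"
    proof (cases "p \<in> Q")
     case True
     then have "ennreal (l p) <= ennreal ((m p \<bullet> ey)\<^sup>2 + (m p \<bullet> ez)\<^sup>2 + K * (m p \<bullet> ex - b)\<^sup>2)"
      using h l by (intro ennreal_leI) blast
     also have "... = ennreal ((m p \<bullet> ey)\<^sup>2) + ennreal ((m p \<bullet> ez)\<^sup>2) + ennreal K * ennreal ((m p \<bullet> ex - b)\<^sup>2)"
      using K by (simp add: ennreal_mult)
     finally show ?thesis using True by simp
    qed simp
   qed
  qed
  also have "... = gnorm Q (%p. m p \<bullet> ey) + gnorm Q (%p. m p \<bullet> ez) + ennreal K * gnorm Q (%p. m p \<bullet> ex - b)"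
   unfolding gnorm_def real_norm_def power2_abs by (simp add: nn_integral_add nn_integral_cmult)
  finally show ?thesis .
 qed
 show "ennreal (measure lborel Q / 16) <= gnorm Q (%p. m p \<bullet> ey) + gnorm Q (%p. m p \<bullet> ez) + gnorm Q (%p. m p \<bullet> ex - b)" if "\<bar>b\<bar> < 1/2"
 proof -
  have "(\<N> p. \<I> Q p * ennreal (1/16)) = ennreal (measure lborel Q / 16)"
   by (subst nn_integral_multc) (simp_all add: emeasure_bounded_eq[OF Q] flip: ennreal_mult)
  then show ?thesis using gen[of "%_. 1/16" 1] unit_vector_estimates(1)[OF _ that] by simp
 qed
 show "gnorm Q (%p. m p \<bullet> ex - s) <= gnorm Q (%p. m p \<bullet> ey) + gnorm Q (%p. m p \<bullet> ez) + 16 * gnorm Q (%p. m p \<bullet> ex - b)"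
  if "\<bar>s\<bar> = 1" "s * b >= 1/2"
  using gen[of "%p. (m p \<bullet> ex - s)\<^sup>2" 16] unit_vector_estimates(2)[OF _ that] by (simp add: gnorm_def)
qed

text \<open>Chebyshev's inequality for the counting measure on the integers, with the total sum
  replaced by the bound for all finite partial sums.\<close>

lemma finite_large_cells:
 fixes e :: "int => ennreal"
 assumes sum: "!!I. finite I ==> (\<Sum>k\<in>I. e k) <= ennreal E" and E: "E >= 0" and c: "c > 0"
 shows "finite {k. e k >= ennreal c}" "card {k. e k >= ennreal c} <= nat \<lfloor>E / c\<rfloor>"
proof -
 have "card I <= nat \<lfloor>E / c\<rfloor>" if I: "finite I" "I \<subseteq> {k. e k >= ennreal c}" for I
 proof -
  have "ennreal (real (card I) * c) = (\<Sum>k\<in>I. ennreal c)"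
   using c by (simp add: ennreal_mult ennreal_of_nat_eq_real_of_nat)
  also have "... <= (\<Sum>k\<in>I. e k)" using I by (intro sum_mono) auto
  also have "... <= ennreal E" by (rule sum[OF I(1)])
  finally have "real (card I) * c <= E" using E by (subst (asm) ennreal_le_iff) auto
  then have "real (card I) <= E / c" using c by (simp add: field_simps)
  then show ?thesis by (simp add: le_nat_floor)
 qed
 from finite_if_finite_subsets_card_bdd[of "{k. e k >= ennreal c}" "nat \<lfloor>E / c\<rfloor>"] this
 show "finite {k. e k >= ennreal c}" "card {k. e k >= ennreal c} <= nat \<lfloor>E / c\<rfloor>" by blast+
qed

text \<open>Jensen's inequality for the average over the cell, in the form of Cauchy-Schwarz against
  its indicator.\<close>

lemma cell_avg_bound:
 assumes om: "open \<omega>" "bounded \<omega>" "\<omega> ~= {}" and [measurable]: "m \<in> \<B>" and b: "!!p. norm (m p) <= 1"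
 shows "ennreal (measure lborel (cell0 \<omega>) * (cell_avg \<omega> m - s)\<^sup>2) <= gnorm (cell0 \<omega>) (%p. m p \<bullet> ex - s)"
proof -
 note cf = cell0_facts[OF om]
 note [measurable] = cf(1)
 define \<mu> where "\<mu> = measure lborel (cell0 \<omega>)"
 have mu: "\<mu> > 0" using cf(3) by (simp add: \<mu>_def)
 have exB: "ex \<in> Basis" by (simp add: space_Basis)
 have i1: "integrable lborel (%p. \<I> (cell0 \<omega>) p * (m p \<bullet> ex))"
 proof (rule bounded_support_integrable[OF _ cf(1,2), of _ 1])
  fix p
  have "\<bar>m p \<bullet> ex\<bar> <= 1" using Basis_le_norm[OF exB, of "m p"] b[of p] by linarith
  then show "\<bar>\<I> (cell0 \<omega>) p * (m p \<bullet> ex)\<bar> <= 1 * \<I> (cell0 \<omega>) p" by (simp add: indicator_def)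
 qed measurable
 have i2: "integrable lborel (%p. \<I> (cell0 \<omega>) p * s)"
  using emeasure_bounded_finite[OF cf(2)] by (simp add: integrable_indicator_iff)
 have "\<mu> * (cell_avg \<omega> m - s) = (LBINT p. \<I> (cell0 \<omega>) p * (m p \<bullet> ex)) - (LBINT p. \<I> (cell0 \<omega>) p * s)"
  using mu by (simp add: cell_avg_def \<mu>_def right_diff_distrib)
 also have "... = (LBINT p. \<I> (cell0 \<omega>) p * (m p \<bullet> ex) - \<I> (cell0 \<omega>) p * s)"
  by (rule Bochner_Integration.integral_diff[OF i1 i2, symmetric])
 also have "... = (LBINT p. \<I> (cell0 \<omega>) p * (\<I> (cell0 \<omega>) p * (m p \<bullet> ex - s)))"
  by (intro Bochner_Integration.integral_cong refl) (simp add: indicator_def)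
 finally have "ennreal ((\<mu> * (cell_avg \<omega> m - s))\<^sup>2) <= (\<N> p. ennreal ((\<I> (cell0 \<omega>) p)\<^sup>2)) * (\<N> p. ennreal ((\<I> (cell0 \<omega>) p * (m p \<bullet> ex - s))\<^sup>2))"
  using Cauchy_Schwarz_integral[of "\<I> (cell0 \<omega>)" lborel "%p. \<I> (cell0 \<omega>) p * (m p \<bullet> ex - s)"] by simp
 also have "(\<N> p. ennreal ((\<I> (cell0 \<omega>) p)\<^sup>2)) = (\<N> p. \<I> (cell0 \<omega>) p)"
  by (intro nn_integral_cong) (simp add: indicator_def)
 also have "... = ennreal \<mu>" by (simp add: emeasure_bounded_eq[OF cf(2)] \<mu>_def)
 also have "(\<N> p. ennreal ((\<I> (cell0 \<omega>) p * (m p \<bullet> ex - s))\<^sup>2)) = gnorm (cell0 \<omega>) (%p. m p \<bullet> ex - s)"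
  unfolding gnorm_def by (intro nn_integral_cong) (simp add: indicator_def)
 finally have "ennreal (1 / \<mu>) * ennreal ((\<mu> * (cell_avg \<omega> m - s))\<^sup>2) <= ennreal (1 / \<mu>) * (ennreal \<mu> * gnorm (cell0 \<omega>) (%p. m p \<bullet> ex - s))"
  by (rule mult_left_mono) simp
 moreover have "ennreal (1 / \<mu>) * ennreal ((\<mu> * (cell_avg \<omega> m - s))\<^sup>2) = ennreal (\<mu> * (cell_avg \<omega> m - s)\<^sup>2)"
  using mu by (simp add: power_mult_distrib power2_eq_square[of \<mu>] flip: ennreal_mult)
 moreover have "ennreal (1 / \<mu>) * ennreal \<mu> = 1" using mu by (simp flip: ennreal_mult)
 ultimately show ?thesis unfolding \<mu>_def[symmetric] by (simp only: mult.assoc[symmetric] mult_1)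
qed

lemma gnorm_pointwise_mono:
 assumes "!!x. x \<in> A ==> norm (f x) <= norm (g x)" shows "gnorm A f <= gnorm A g"
 unfolding gnorm_def
proof (rule nn_integral_mono)
 fix x
 show "\<I> A x * ennreal ((norm (f x))\<^sup>2) <= \<I> A x * ennreal ((norm (g x))\<^sup>2)"
  by (cases "x \<in> A") (use assms in \<open>auto intro!: ennreal_leI power_mono\<close>)
qed

lemma gnorm_cong_AE:
 assumes "AE x in lborel. x \<in> A --> f x = g x" shows "gnorm A f = gnorm A g"
 unfolding gnorm_def
proof (rule nn_integral_cong_AE)
 show "AE x in lborel. \<I> A x * ennreal ((norm (f x))\<^sup>2) = \<I> A x * ennreal ((norm (g x))\<^sup>2)"
  using assms by eventually_elim (auto simp: indicator_def)
qed

lemma gnorm_components: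
 fixes f :: "'a::euclidean_space => 'b::euclidean_space"
 assumes [measurable]: "f \<in> \<B>" "U \<in> sets borel"
 shows "gnorm U f = (\<Sum>b\<in>Basis. gnorm U (%x. f x \<bullet> b))"
proof -
 have "gnorm U f = (\<N> x. (\<Sum>b\<in>Basis. \<I> U x * ennreal ((norm (f x \<bullet> b))\<^sup>2)))"
  unfolding gnorm_def
 proof (rule nn_integral_cong)
  fix x
  have "(norm (f x))\<^sup>2 = (\<Sum>b\<in>Basis. (norm (f x \<bullet> b))\<^sup>2)"
   by (subst norm_eq_sqrt_inner, subst euclidean_inner) (simp add: sum_nonneg power2_eq_square)
  then show "\<I> U x * ennreal ((norm (f x))\<^sup>2) = (\<Sum>b\<in>Basis. \<I> U x * ennreal ((norm (f x \<bullet> b))\<^sup>2))"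
   by (simp only: sum_distrib_left[symmetric] sum_ennreal[OF zero_le_power2])
 qed
 also have "... = (\<Sum>b\<in>Basis. gnorm U (%x. f x \<bullet> b))"
  unfolding gnorm_def by (rule nn_integral_sum) measurable
 finally show ?thesis .
qed

lemma gnorm_exhaustion:
 fixes f :: "'a::euclidean_space => 'b::euclidean_space"
 assumes [measurable]: "f \<in> \<B>" "!!n. K n \<in> sets borel"
  and K: "!!n. K n \<subseteq> K (Suc n)" "A \<subseteq> (\<Union>n. K n)" and B: "!!n. gnorm (K n) f <= B"
 shows "gnorm A f <= B"
proof -
 have "gnorm A f <= gnorm (\<Union>n. K n) f" by (rule gnorm_mono[OF K(2)])
 also have "... <= (\<N> x. (SUP n. \<I> (K n) x * ennreal ((norm (f x))\<^sup>2)))"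
  unfolding gnorm_def
 proof (rule nn_integral_mono)
  fix x
  show "\<I> (\<Union>n. K n) x * ennreal ((norm (f x))\<^sup>2) <= (SUP n. \<I> (K n) x * ennreal ((norm (f x))\<^sup>2))"
  proof (cases "x \<in> (\<Union>n. K n)")
   case True
   then obtain n where "x \<in> K n" by blast
   then show ?thesis by (intro SUP_upper2[of n]) (auto simp: indicator_def)
  qed simp
 qed
 also have "... = (SUP n. gnorm (K n) f)" unfolding gnorm_def
 proof (rule nn_integral_monotone_convergence_SUP)
  show "incseq (%n x. \<I> (K n) x * ennreal ((norm (f x))\<^sup>2))"
   using K(1) by (intro incseq_SucI le_funI mult_right_mono) (auto simp: indicator_def)
 qed measurable
 also have "... <= B" using B by (rule SUP_least)
 finally show ?thesis .
qed

definition unit_on :: "space set => (space => space) => bool" where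
 "unit_on \<Omega> m \<longleftrightarrow> (AE p in lborel. p \<in> \<Omega> --> norm (m p) = 1)"

lemma unit_on_shift:
 assumes "unit_on (UNIV \<times> \<omega>) m" shows "unit_on (UNIV \<times> \<omega>) (shift k m)"
proof -
 have "AE p in distr lborel borel ((+) (of_int k *\<^sub>R ex)). p \<in> UNIV \<times> \<omega> --> norm (m p) = 1"
  using assms by (simp only: unit_on_def lborel_distr_plus)
 from AE_distrD[OF _ this] have "AE p in lborel. of_int k *\<^sub>R ex + p \<in> UNIV \<times> \<omega> --> norm (m (of_int k *\<^sub>R ex + p)) = 1"
  by measurable
 then show ?thesis unfolding unit_on_def
 proof eventually_elim
  fix p assume "of_int k *\<^sub>R ex + p \<in> UNIV \<times> \<omega> --> norm (m (of_int k *\<^sub>R ex + p)) = 1"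
  moreover have "of_int k *\<^sub>R ex + p \<in> UNIV \<times> \<omega> \<longleftrightarrow> p \<in> UNIV \<times> \<omega>" by (cases p) simp
  ultimately show "p \<in> UNIV \<times> \<omega> --> norm (shift k m p) = 1" by (simp only: shift_def add.commute)
 qed
qed

text \<open>The last estimate compares the next cell with the average over the present one; after
  the translation the next cell is the part over \<open>{1..<2}\<close> of the double cell.\<close>

lemma cell_estimates_shift:
 assumes om: "C1_domain \<omega>" "bounded \<omega>"
 obtains C where "C >= 0" "!!m G H k. state (UNIV \<times> \<omega>) m G H ==>
  gnorm (cell0 \<omega>) (%p. shift k m p \<bullet> ey) <= ennreal C * cell_energy \<omega> G H k &
  gnorm (cell0 \<omega>) (%p. shift k m p \<bullet> ez) <= ennreal C * cell_energy \<omega> G H k &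
  gnorm (cell0 \<omega>) (%p. shift k m p \<bullet> ex - cell_avg \<omega> (shift k m)) <= ennreal C * cell_energy \<omega> G H k &
  gnorm (cell0 \<omega>) (%p. shift (k + 1) m p \<bullet> ex - cell_avg \<omega> (shift k m)) <= ennreal C * cell_energy \<omega> G H k"
proof -
 have o: "open \<omega>" "\<omega> ~= {}" using om by (auto simp: C1_domain_def)
 obtain C where C: "C >= 0" "!!m G H. state (UNIV \<times> \<omega>) m G H ==>
  gnorm (cell0 \<omega>) (%p. m p \<bullet> ey) <= ennreal C * cell_energy \<omega> G H 0 &
  gnorm (cell0 \<omega>) (%p. m p \<bullet> ez) <= ennreal C * cell_energy \<omega> G H 0 &
  gnorm ({0..2} \<times> \<omega>) (%p. m p \<bullet> ex - cell_avg \<omega> m) <= ennreal C * cell_energy \<omega> G H 0"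
  using cell_estimate[OF om] by blast
 show ?thesis
 proof (rule that[OF C(1)])
  fix m G H and k :: int assume s: "state (UNIV \<times> \<omega>) m G H"
  have ob: "\<omega> \<in> sets borel" using o(1) by simp
  have sk: "state (UNIV \<times> \<omega>) (shift k m) (%c. shift k (G c)) (shift k H)" by (rule state_shift_int[OF s ob])
  have e: "cell_energy \<omega> (%c. shift k (G c)) (shift k H) 0 = cell_energy \<omega> G H k"
   by (simp only: cell_energy_def shift_0)
  note c = C(2)[OF sk, unfolded e]
  let ?f = "%p. shift k m p \<bullet> ex - cell_avg \<omega> (shift k m)"
  have [measurable]: "?f \<in> \<B>" "{1..<2::real} \<times> \<omega> \<in> sets borel"
   using stateD(1)[OF sk] ob by (auto intro!: borel_Times borel_measurable_diff borel_measurable_inner)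
  have 1: "gnorm (cell0 \<omega>) ?f <= gnorm ({0..2} \<times> \<omega>) ?f" by (rule gnorm_mono) (auto simp: cell0_def)
  have "gnorm (cell0 \<omega>) (%p. ?f (p + ex)) = gnorm ({1..<2} \<times> \<omega>) ?f"
   by (rule gnorm_shift) (auto simp: cell0_def)
  also have "... <= gnorm ({0..2} \<times> \<omega>) ?f" by (rule gnorm_mono) auto
  finally have 2: "gnorm (cell0 \<omega>) (%p. shift (k + 1) m p \<bullet> ex - cell_avg \<omega> (shift k m)) <= gnorm ({0..2} \<times> \<omega>) ?f"
   by (simp only: shift_def of_int_add of_int_1 scaleR_add_left scaleR_one add_ac)
  show "gnorm (cell0 \<omega>) (%p. shift k m p \<bullet> ey) <= ennreal C * cell_energy \<omega> G H k &
   gnorm (cell0 \<omega>) (%p. shift k m p \<bullet> ez) <= ennreal C * cell_energy \<omega> G H k &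
   gnorm (cell0 \<omega>) ?f <= ennreal C * cell_energy \<omega> G H k &
   gnorm (cell0 \<omega>) (%p. shift (k + 1) m p \<bullet> ex - cell_avg \<omega> (shift k m)) <= ennreal C * cell_energy \<omega> G H k"
   using c order_trans[OF 1] order_trans[OF 2] by blast
 qed
qed

lemma unit_AE_cell:
 assumes "unit_on (UNIV \<times> \<omega>) m" shows "AE p in lborel. p \<in> cell0 \<omega> --> norm (m p) = 1"
 using assms unfolding unit_on_def by eventually_elim (auto simp: cell0_def)

text \<open>At most \<open>5 * E / c0\<close> cells have energy at least c0. On every other cell the
  average has modulus at least 1/2 and differs from the next average by at most 1/8. So colour 0 or
  a change of colour requires large energy on the cell or on its right neighbour, whence the factor
  2 in N.\<close>

lemma transition_cells_bound:
 assumes om: "C1_domain \<omega>" "bounded \<omega>" and E: "E >= 0"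
 obtains N where "!!m G H. state (UNIV \<times> \<omega>) m G H ==> unit_on (UNIV \<times> \<omega>) m ==>
  local_energy (UNIV \<times> \<omega>) UNIV G H <= ennreal E ==>
  (let c = (%k. color (cell_avg \<omega> (shift k m))) in
  finite {k. c k = 0 \<or> c (k + 1) ~= c k} & card {k. c k = 0 \<or> c (k + 1) ~= c k} <= N)"
proof -
 have o: "open \<omega>" "\<omega> ~= {}" "\<omega> \<in> sets borel" using om by (auto simp: C1_domain_def)
 note cf = cell0_facts[OF o(1) om(2) o(2)]
 obtain C where C: "C >= 0" and est: "!!m G H k. state (UNIV \<times> \<omega>) m G H ==>
  gnorm (cell0 \<omega>) (%p. shift k m p \<bullet> ey) <= ennreal C * cell_energy \<omega> G H k &
  gnorm (cell0 \<omega>) (%p. shift k m p \<bullet> ez) <= ennreal C * cell_energy \<omega> G H k &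
  gnorm (cell0 \<omega>) (%p. shift k m p \<bullet> ex - cell_avg \<omega> (shift k m)) <= ennreal C * cell_energy \<omega> G H k &
  gnorm (cell0 \<omega>) (%p. shift (k + 1) m p \<bullet> ex - cell_avg \<omega> (shift k m)) <= ennreal C * cell_energy \<omega> G H k"
  using cell_estimates_shift[OF om] by blast
 define \<mu> where "\<mu> = measure lborel (cell0 \<omega>)"
 have mu: "\<mu> > 0" using cf(3) by (simp add: \<mu>_def)
 \<comment> \<open>This ensures \<open>C * c0 <= \<mu> / 64\<close>. Three such terms stay below the
   lower bound \<open>\<mu> / 16\<close> from \<open>unit_AE_integrated\<close>, and one of them
   bounds \<mu> times the squared difference of neighbouring averages, which gives 1/8.\<close>
 define c0 where "c0 = (\<mu> / 64) / (C + 1)"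
 have c0: "c0 > 0" using mu C by (simp add: c0_def)
 have Cc0: "C * c0 <= \<mu> / 64"
 proof -
  have "C * c0 <= (C + 1) * c0" using c0 by simp
  also have "... = \<mu> / 64"
  proof -
   have ne: "C + 1 ~= 0" using C by simp
   show ?thesis using nonzero_divide_eq_eq[OF ne, THEN iffD1, OF c0_def[symmetric]] by (simp only: mult.commute)
  qed
  finally show ?thesis .
 qed
 define N where "N = 2 * nat \<lfloor>5 * E / c0\<rfloor>"
 show ?thesis
 proof (rule that[of N])
  fix m G H assume s: "state (UNIV \<times> \<omega>) m G H" and u: "unit_on (UNIV \<times> \<omega>) m"
   and en: "local_energy (UNIV \<times> \<omega>) UNIV G H <= ennreal E"
  define b where "b k = cell_avg \<omega> (shift k m)" for k
  define e where "e k = cell_energy \<omega> G H k" for k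
  have sm: "(\<Sum>k\<in>I. e k) <= ennreal (5 * E)" if "finite I" for I
  proof -
   have "(\<Sum>k\<in>I. e k) <= 5 * local_energy (UNIV \<times> \<omega>) UNIV G H"
    unfolding e_def using stateD(5,6)[OF s] o(3) that by (intro sum_cell_energy)
   also have "... <= 5 * ennreal E" by (intro mult_left_mono en) simp
   finally show ?thesis using E by (simp add: ennreal_mult)
  qed
  note big = finite_large_cells[of e "5 * E" c0, OF sm _ c0]
  define Big where "Big = {k. e k >= ennreal c0}"
  have fin: "finite Big" "card Big <= nat \<lfloor>5 * E / c0\<rfloor>" using big E unfolding Big_def by auto
  have small: "ennreal C * e k <= ennreal (\<mu> / 64)" if "k \<notin> Big" for k
  proof -
   have "ennreal C * e k <= ennreal C * ennreal c0" using that by (intro mult_left_mono) (auto simp: Big_def)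
   also have "... = ennreal (C * c0)" using C c0 by (simp add: ennreal_mult)
   also have "... <= ennreal (\<mu> / 64)" by (intro ennreal_leI Cc0)
   finally show ?thesis .
  qed
  note est' = est[OF s, folded b_def e_def]
  have ms: "shift k m \<in> \<B>" for k using stateD(1)[OF s] by measurable
  have half: "\<bar>b k\<bar> >= 1/2" if k: "k \<notin> Big" for k
  proof (rule ccontr)
   assume "\<not> ?thesis"
   then have "ennreal (\<mu> / 16) <= gnorm (cell0 \<omega>) (%p. shift k m p \<bullet> ey) + gnorm (cell0 \<omega>) (%p. shift k m p \<bullet> ez) + gnorm (cell0 \<omega>) (%p. shift k m p \<bullet> ex - b k)"
    unfolding \<mu>_def by (intro unit_AE_integrated(1)[OF ms cf(1,2) unit_AE_cell[OF unit_on_shift[OF u]]]) simp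
   also have "... <= ennreal (\<mu> / 64) + ennreal (\<mu> / 64) + ennreal (\<mu> / 64)"
    using est'[of k] small[OF k] order_trans by (intro add_mono) blast+
   also have "... = ennreal (\<mu> / 64 + \<mu> / 64 + \<mu> / 64)"
   proof -
    have "0 <= \<mu> / 64" using mu by simp
    then show ?thesis by (simp only: ennreal_plus add_nonneg_nonneg)
   qed
   finally have "\<mu> / 16 <= \<mu> / 64 + \<mu> / 64 + \<mu> / 64" using mu by (subst (asm) ennreal_le_iff) auto
   then show False using mu by (simp add: field_simps)
  qed
  have close: "\<bar>b (k + 1) - b k\<bar> <= 1/8" if k: "k \<notin> Big" for k
  proof -
   have "ennreal (\<mu> * (b (k + 1) - b k)\<^sup>2) <= gnorm (cell0 \<omega>) (%p. shift (k + 1) m p \<bullet> ex - b k)"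
    unfolding \<mu>_def b_def[of "k + 1"] using stateD(2)[OF s]
    by (intro cell_avg_bound[OF o(1) om(2) o(2) ms]) (simp add: shift_def)
   also have "... <= ennreal (\<mu> / 64)" using est'[of k] small[OF k] order_trans by blast
   finally have "\<mu> * (b (k + 1) - b k)\<^sup>2 <= \<mu> * (1/64)" using mu by (subst (asm) ennreal_le_iff) auto
   then have "(b (k + 1) - b k)\<^sup>2 <= (1/8)\<^sup>2" by (simp only: mult_le_cancel_left_pos[OF mu]) (simp add: power_divide)
   then have "\<bar>b (k + 1) - b k\<bar> <= \<bar>1/8\<bar>" by (rule abs_le_square_iff[THEN iffD2])
   then show ?thesis by simp
  qed
  define bad where "bad = {k. color (b k) = 0 \<or> color (b (k + 1)) ~= color (b k)}"
  have "bad \<subseteq> Big \<union> (%k. k - 1) ` Big"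
  proof
   fix k assume k: "k \<in> bad"
   have "k \<in> Big \<or> k + 1 \<in> Big"
   proof (rule ccontr)
    assume "\<not> ?thesis"
    then have h: "\<bar>b k\<bar> >= 1/2" "\<bar>b (k + 1)\<bar> >= 1/2" "\<bar>b (k + 1) - b k\<bar> <= 1/8"
     using half close by auto
    then have "color (b k) ~= 0 & color (b (k + 1)) = color (b k)"
     unfolding color_def by (auto simp: abs_if split: if_splits)
    then show False using k by (simp add: bad_def)
   qed
   then show "k \<in> Big \<union> (%k. k - 1) ` Big" by (auto simp: image_iff intro: bexI[of _ "k + 1"])
  qed
  moreover have "card (Big \<union> (%k. k - 1) ` Big) <= N"
   using card_Un_le[of Big "(%k. k - 1) ` Big"] card_image_le[OF fin(1), of "%k. k - 1"] fin(2) by (simp add: N_def)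
  ultimately have "finite bad & card bad <= N"
   using fin(1) card_mono[of "Big \<union> (%k. k - 1) ` Big" bad] finite_subset by fastforce
  then show "let c = (%k. color (cell_avg \<omega> (shift k m))) in
   finite {k. c k = 0 \<or> c (k + 1) ~= c k} & card {k. c k = 0 \<or> c (k + 1) ~= c k} <= N"
   unfolding Let_def bad_def b_def .
 qed
qed

section \<open>Comparison with the reference profile far out on the wire\<close>

lemma e_bar_eq: "e_bar p = max (-1) (min 1 (fst p)) *\<^sub>R ex"
 by (cases p) (auto simp: max_def min_def)

lemma e_bar_borel [measurable]: "e_bar \<in> \<B>"
 unfolding e_bar_eq[abs_def] by (intro borel_measurable_continuous_onI continuous_intros)

lemma shift_e_bar:
 assumes "p \<in> cell0 \<omega>" "\<bar>j\<bar> >= 2" shows "shift j e_bar p = (if j > 0 then 1 else -1) *\<^sub>R ex"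
proof -
 have f: "fst (p + of_int j *\<^sub>R ex) = fst p + of_int j" by (simp only: fst_add fst_scaleR fst_conv) simp
 have p: "0 <= fst p" "fst p < 1" using assms(1) by (auto simp: cell0_def)
 show ?thesis
 proof (cases "j > 0")
  case True
  then have "real_of_int j >= 2" using assms(2) by simp
  then show ?thesis using p True by (simp only: shift_def e_bar_eq f) simp
 next
  case False
  then have "j <= -2" using assms(2) by simp
  then have "real_of_int j <= -2" by linarith
  then show ?thesis using p False by (simp only: shift_def e_bar_eq f) simp
 qed
qed

text \<open>A finite L2 distance from \<open>e_bar\<close> leaves only finitely many cells with
  squared distance at least \<open>\<mu> / 4\<close>. On the other cells far out the average is
  within 1/2 of the value 1 or -1 of the profile.\<close>

lemma color_ends:
 assumes om: "open \<omega>" "bounded \<omega>" "\<omega> ~= {}" and m [measurable]: "m \<in> \<B>" and n: "!!p. norm (m p) <= 1"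
  and fin: "gnorm (UNIV \<times> \<omega>) (%p. m p - e_bar p) < \<infinity>"
 shows "\<exists>k1. \<forall>k\<ge>k1. color (cell_avg \<omega> (shift k m)) = 1" "\<exists>k0. \<forall>k\<le>k0. color (cell_avg \<omega> (shift k m)) = -1"
proof -
 have ob: "\<omega> \<in> sets borel" using om(1) by simp
 note cf = cell0_facts[OF om]
 define \<mu> where "\<mu> = measure lborel (cell0 \<omega>)"
 have mu: "\<mu> > 0" using cf(3) by (simp add: \<mu>_def)
 define D where "D p = m p - e_bar p" for p
 have D: "D \<in> \<B>" unfolding D_def[abs_def] by measurable
 define a where "a k = gnorm ((UNIV \<times> \<omega>) \<inter> strip0) (shift k D)" for k
 define E where "E = enn2real (5 * gnorm (UNIV \<times> \<omega>) D)"
 have E: "ennreal E = 5 * gnorm (UNIV \<times> \<omega>) D" "E >= 0"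
  using fin by (simp_all add: E_def D_def[abs_def] ennreal_mult_less_top)
 have "finite {k. a k >= ennreal (\<mu> / 4)}"
 proof (rule finite_large_cells(1)[OF _ E(2)])
  show "(\<Sum>k\<in>I. a k) <= ennreal E" if "finite I" for I
   unfolding E(1) a_def by (rule sum_shift_gnorm[OF D ob that])
 qed (use mu in simp)
 then have "bdd_above (abs ` {k. a k >= ennreal (\<mu> / 4)})" by (intro bdd_above_finite finite_imageI)
 then obtain M where M: "!!k. a k >= ennreal (\<mu> / 4) ==> \<bar>k\<bar> <= M" by (auto simp: bdd_above_def)
 have key: "\<bar>cell_avg \<omega> (shift k m) - s\<bar> < 1/2" if k: "\<bar>k\<bar> >= max 2 (M + 1)" and s: "s = (if k > 0 then 1 else -1)" for k s
 proof -
  have "ennreal (\<mu> * (cell_avg \<omega> (shift k m) - s)\<^sup>2) <= gnorm (cell0 \<omega>) (%p. shift k m p \<bullet> ex - s)"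
   unfolding \<mu>_def using n by (intro cell_avg_bound[OF om]) (measurable, simp add: shift_def)
  also have "... <= gnorm (cell0 \<omega>) (shift k D)"
  proof (rule gnorm_pointwise_mono)
   fix p assume p: "p \<in> cell0 \<omega>"
   have "shift k e_bar p = s *\<^sub>R ex" using shift_e_bar[OF p, of k] k s by simp
   then have "shift k D p \<bullet> ex = (shift k m p - s *\<^sub>R ex) \<bullet> ex" by (simp only: shift_def D_def)
   also have "... = shift k m p \<bullet> ex - s" by (simp only: inner_diff_left inner_scaleR_left) (simp add: inner_prod_def)
   finally show "norm (shift k m p \<bullet> ex - s) <= norm (shift k D p)"
    using Basis_le_norm[of ex "shift k D p"] by (simp add: space_Basis)
  qed
  also have "... <= a k" unfolding a_def by (rule gnorm_mono) (auto simp: cell0_def strip0_def)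
  also have "a k < ennreal (\<mu> / 4)" using M[of k] k by fastforce
  finally have "\<mu> * (cell_avg \<omega> (shift k m) - s)\<^sup>2 < \<mu> * (1 / 4)" using mu by (subst (asm) ennreal_less_iff) auto
  then have "(cell_avg \<omega> (shift k m) - s)\<^sup>2 < (1/2)\<^sup>2" by (simp only: mult_less_cancel_left_pos[OF mu]) (simp add: power_divide)
  then have "\<bar>cell_avg \<omega> (shift k m) - s\<bar>\<^sup>2 < (1/2)\<^sup>2" by (simp only: power2_abs)
  then show ?thesis by (rule power_less_imp_less_base) simp
 qed
 have "\<forall>k\<ge>max 2 (M + 1). color (cell_avg \<omega> (shift k m)) = 1"
 proof safe
  fix k assume "k >= max 2 (M + 1)"
  then have "\<bar>cell_avg \<omega> (shift k m) - 1\<bar> < 1/2" using key[of k 1] by auto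
  then show "color (cell_avg \<omega> (shift k m)) = 1" unfolding color_def by (simp add: abs_if split: if_splits)
 qed
 then show "\<exists>k1. \<forall>k\<ge>k1. color (cell_avg \<omega> (shift k m)) = 1" by blast
 have "\<forall>k\<le>- max 2 (M + 1). color (cell_avg \<omega> (shift k m)) = -1"
 proof safe
  fix k assume "k <= - max 2 (M + 1)"
  then have "\<not> k > 0" "\<bar>k\<bar> >= max 2 (M + 1)" by (auto simp: max_def split: if_splits)
  then have "\<bar>cell_avg \<omega> (shift k m) - (-1)\<bar> < 1/2" using key[of k "-1"] by simp
  then show "color (cell_avg \<omega> (shift k m)) = -1" unfolding color_def by (simp add: abs_if split: if_splits)
 qed
 then show "\<exists>k0. \<forall>k\<le>k0. color (cell_avg \<omega> (shift k m)) = -1" by blast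
qed

text \<open>A converse of \<open>color_ends\<close> for states of finite energy, and the reason why
  the limit belongs to the class. Far out the correct sign of the average lets the cell energy
  control the distance from the pole; for the remaining cells, finitely many, the trivial bound is
  enough.\<close>

lemma distance_from_e_bar_finite:
 assumes om: "C1_domain \<omega>" "bounded \<omega>" and s: "state (UNIV \<times> \<omega>) m G H" and u: "unit_on (UNIV \<times> \<omega>) m"
  and fin: "local_energy (UNIV \<times> \<omega>) UNIV G H < \<infinity>"
  and L: "!!j. j >= L ==> cell_avg \<omega> (shift j m) >= 1/2 & cell_avg \<omega> (shift (- j) m) <= -1/2"
 shows "gnorm (UNIV \<times> \<omega>) (%p. m p - e_bar p) < \<infinity>"
proof -
 have o: "open \<omega>" "\<omega> ~= {}" and ob [measurable]: "\<omega> \<in> sets borel" using om by (auto simp: C1_domain_def)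
 note cf = cell0_facts[OF o(1) om(2) o(2)]
 note [measurable] = stateD(1)[OF s] cf(1)
 obtain C where C: "C >= 0" and est: "!!k.
  gnorm (cell0 \<omega>) (%p. shift k m p \<bullet> ey) <= ennreal C * cell_energy \<omega> G H k &
  gnorm (cell0 \<omega>) (%p. shift k m p \<bullet> ez) <= ennreal C * cell_energy \<omega> G H k &
  gnorm (cell0 \<omega>) (%p. shift k m p \<bullet> ex - cell_avg \<omega> (shift k m)) <= ennreal C * cell_energy \<omega> G H k"
  by (rule cell_estimates_shift[OF om]) (use s in blast)
 define \<mu> where "\<mu> = measure lborel (cell0 \<omega>)"
 have mu: "\<mu> > 0" using cf(3) by (simp add: \<mu>_def)
 define D where "D p = m p - e_bar p" for p
 have D [measurable]: "D \<in> \<B>" unfolding D_def[abs_def] by measurable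
 \<comment> \<open>From 2 on the profile \<open>e_bar\<close> is constant on the cells, and from L
   on the averages have the correct sign.\<close>
 define J where "J = max 2 L"
 define e where "e k = cell_energy \<omega> G H k" for k
 note est' = est[folded e_def]
 have ms: "shift k m \<in> \<B>" for k by measurable
 have far: "gnorm (cell0 \<omega>) (shift j D) <= 20 * (ennreal C * e j)" if j: "\<bar>j\<bar> >= J" for j
 proof -
  define t where "t = (if j > 0 then 1 else -1 :: real)"
  define b where "b = cell_avg \<omega> (shift j m)"
  have tb: "\<bar>t\<bar> = 1" "t * b >= 1/2" using L[of "\<bar>j\<bar>"] j by (auto simp: t_def b_def J_def abs_if split: if_splits)
  have Deq: "shift j D p = shift j m p - t *\<^sub>R ex" if "p \<in> cell0 \<omega>" for p
   using shift_e_bar[OF that, of j] j by (simp only: shift_def D_def t_def J_def)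
  have "gnorm (cell0 \<omega>) (shift j D) = (\<Sum>c\<in>Basis. gnorm (cell0 \<omega>) (%p. shift j D p \<bullet> c))"
   by (rule gnorm_components) measurable
  also have "... <= gnorm (cell0 \<omega>) (%p. shift j m p \<bullet> ex - t) + (gnorm (cell0 \<omega>) (%p. shift j m p \<bullet> ey) + gnorm (cell0 \<omega>) (%p. shift j m p \<bullet> ez))"
   unfolding space_Basis
   by (simp add: zero_prod_def)
    (intro add_mono gnorm_pointwise_mono; simp only: Deq inner_diff_left inner_scaleR_left; simp add: inner_prod_def)
  \<comment> \<open>The axial term costs 1 + 1 + 16 and the two transversal terms 1 each, 20 in
    all.\<close>
  also have "... <= (ennreal C * e j + ennreal C * e j + 16 * (ennreal C * e j)) + (ennreal C * e j + ennreal C * e j)"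
  proof (intro add_mono)
   have "gnorm (cell0 \<omega>) (%p. shift j m p \<bullet> ex - t) <= gnorm (cell0 \<omega>) (%p. shift j m p \<bullet> ey) + gnorm (cell0 \<omega>) (%p. shift j m p \<bullet> ez) + 16 * gnorm (cell0 \<omega>) (%p. shift j m p \<bullet> ex - b)"
    by (rule unit_AE_integrated(2)[OF ms cf(1,2) unit_AE_cell[OF unit_on_shift[OF u]] tb])
   also have "... <= ennreal C * e j + ennreal C * e j + 16 * (ennreal C * e j)"
    unfolding b_def using est'[of j] by (intro add_mono mult_left_mono) auto
   finally show "gnorm (cell0 \<omega>) (%p. shift j m p \<bullet> ex - t) <= ..." .
  qed (use est'[of j] in auto)
  also have "... = (1 + 1 + 16 + 1 + 1) * (ennreal C * e j)" by (simp only: distrib_right mult_1 add.assoc)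
  also have "1 + 1 + 16 + 1 + 1 = (20 :: ennreal)" by simp
  finally show ?thesis .
 qed
 have near: "gnorm (cell0 \<omega>) (shift j D) <= ennreal (4 * \<mu>)" for j
 proof -
  have "gnorm (cell0 \<omega>) (shift j D) <= gnorm (cell0 \<omega>) (%p. 2 :: real)"
  proof (rule gnorm_pointwise_mono)
   fix p
   have "norm (e_bar q) <= 1" for q unfolding e_bar_eq norm_scaleR by (simp add: norm_prod_def)
   then show "norm (shift j D p) <= norm (2::real)"
    using norm_triangle_ineq4[of "m (p + of_int j *\<^sub>R ex)" "e_bar (p + of_int j *\<^sub>R ex)"] stateD(2)[OF s, of "p + of_int j *\<^sub>R ex"]
    by (simp only: shift_def D_def) (smt (verit) real_norm_def)
  qed
  also have "... = ennreal (4 * \<mu>)" using gnorm_const[OF cf(2,1), of "2::real"] by (simp add: \<mu>_def)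
  finally show ?thesis .
 qed
 define T where "T j = {p :: space. p + of_int (- j) *\<^sub>R ex \<in> cell0 \<omega>}" for j :: int
 have T: "p \<in> T j \<longleftrightarrow> snd p \<in> \<omega> & of_int j <= fst p & fst p < of_int j + 1" for p j
  by (cases p) (auto simp: T_def cell0_def)
 have [measurable]: "T j \<in> sets borel" for j unfolding T_def by measurable
 have shT: "gnorm (cell0 \<omega>) (shift k D) = gnorm (T k) D" for k
  unfolding shift_def[abs_def] by (rule gnorm_shift) (auto simp: T_def)
 define K where "K n = {- real n..<real n} \<times> \<omega>" for n :: nat
 have [measurable]: "K n \<in> sets borel" for n unfolding K_def using ob by (intro borel_Times) auto
 define B where "B = 20 * ennreal C * (5 * local_energy (UNIV \<times> \<omega>) UNIV G H) + of_nat (card {-J..J}) * ennreal (4 * \<mu>)"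
 have KB: "gnorm (K n) D <= B" for n
 proof -
  define I where "I = {- int n..<int n}"
  have "gnorm (K n) D <= (\<N> p. (\<Sum>j\<in>I. \<I> (T j) p * ennreal ((norm (D p))\<^sup>2)))"
   unfolding gnorm_def
  proof (rule nn_integral_mono)
   fix p
   show "\<I> (K n) p * ennreal ((norm (D p))\<^sup>2) <= (\<Sum>j\<in>I. \<I> (T j) p * ennreal ((norm (D p))\<^sup>2))"
   proof (cases "p \<in> K n")
    case True
    then have "\<lfloor>fst p\<rfloor> \<in> I" "p \<in> T \<lfloor>fst p\<rfloor>" unfolding K_def T I_def by (auto simp: le_floor_iff floor_less_iff)
    then show ?thesis
     using True member_le_sum[of "\<lfloor>fst p\<rfloor>" I "%j. \<I> (T j) p * ennreal ((norm (D p))\<^sup>2)"] by (simp add: I_def)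
   qed simp
  qed
  also have "... = (\<Sum>j\<in>I. gnorm (T j) D)" unfolding gnorm_def by (rule nn_integral_sum) measurable
  also have "... <= (\<Sum>j\<in>I. 20 * ennreal C * e j + \<I> {-J..J} j * ennreal (4 * \<mu>))"
  proof (rule sum_mono)
   fix j
   show "gnorm (T j) D <= 20 * ennreal C * e j + \<I> {-J..J} j * ennreal (4 * \<mu>)"
   proof (cases "\<bar>j\<bar> >= J")
    case True
    then show ?thesis using far[OF True] by (simp add: shT mult.assoc add_increasing2)
   next
    case False
    then show ?thesis using near[of j] by (simp add: shT indicator_def abs_if add_increasing split: if_splits)
   qed
  qed
  also have "... = 20 * ennreal C * (\<Sum>j\<in>I. e j) + (\<Sum>j\<in>I. \<I> {-J..J} j) * ennreal (4 * \<mu>)"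
   by (simp add: sum.distrib sum_distrib_left sum_distrib_right)
  also have "... <= B" unfolding B_def
  proof (intro add_mono mult_left_mono mult_right_mono)
   show "(\<Sum>j\<in>I. e j) <= 5 * local_energy (UNIV \<times> \<omega>) UNIV G H"
    unfolding e_def using stateD(5,6)[OF s] ob by (intro sum_cell_energy) (auto simp: I_def)
   have "(\<Sum>j\<in>I. \<I> {-J..J} j) = (\<Sum>j\<in>I \<inter> {-J..J}. 1 :: ennreal)"
    by (rule sum.mono_neutral_cong_right) (auto simp: I_def)
   also have "... = of_nat (card (I \<inter> {-J..J}))" by simp
   also have "... <= of_nat (card {-J..J})" by (intro of_nat_mono card_mono) auto
   finally show "(\<Sum>j\<in>I. \<I> {-J..J} j) <= (of_nat (card {-J..J}) :: ennreal)" .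
  qed simp_all
  finally show ?thesis .
 qed
 have "gnorm (UNIV \<times> \<omega>) D <= B"
 proof (rule gnorm_exhaustion[of D K, OF _ _ _ _ KB])
  show "UNIV \<times> \<omega> \<subseteq> (\<Union>n. K n)"
  proof
   fix p :: space assume p: "p \<in> UNIV \<times> \<omega>"
   obtain n :: nat where "real n > \<bar>fst p\<bar>" using reals_Archimedean2 by blast
   then show "p \<in> (\<Union>n. K n)" using p by (cases p) (auto simp: K_def intro!: exI[of _ n])
  qed
  show "K n \<subseteq> K (Suc n)" for n by (auto simp: K_def)
 qed measurable
 also have "B < \<infinity>" using fin by (simp add: B_def ennreal_mult_less_top of_nat_less_top)
 finally show ?thesis by (simp add: D_def[abs_def])
qed

section \<open>Existence of a minimizer\<close>

lemma wgrad_cong_AE: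
 assumes w: "wgrad U f g" and [measurable]: "f' \<in> \<B>" and eq: "AE x in lborel. x \<in> U --> f x = f' x"
 shows "wgrad U f' g"
proof (rule wgrad_limit[OF w])
 show "g \<in> \<B>" by (rule wgradD(2)[OF w])
 show "(%n. gnorm K (%x. f x - f' x)) \<longlonglongrightarrow> 0" if "K \<subseteq> U" for K
 proof -
  have "AE x in lborel. x \<in> K --> f x - f' x = 0" using eq by eventually_elim (use that in auto)
  then have "gnorm K (%x. f x - f' x) = gnorm K (%x. 0 :: real)" by (rule gnorm_cong_AE)
  then show ?thesis by (simp add: gnorm_def)
 qed
qed (simp_all add: gnorm_def)

lemma inner_nabla_integral:
 fixes H :: "'a::euclidean_space => 'a"
 assumes [measurable]: "H \<in> \<B>" and H: "loc_int U H" and \<phi>: "\<phi> \<in> test_functions U"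
 shows "integrable lborel (%x. H x \<bullet> nabla \<phi> x)"
  "(LBINT x. H x \<bullet> nabla \<phi> x) = (\<Sum>b\<in>Basis. \<integral>x. (nabla \<phi> x \<bullet> b) * (H x \<bullet> b) \<partial>lborel)"
proof -
 have i: "integrable lborel (%x. (nabla \<phi> x \<bullet> b) * (H x \<bullet> b))" for b
  using loc_int_test[OF loc_int_inner[OF H, of b] _ test_nabla_inner[OF \<phi>, of b]] by simp
 have eq: "H x \<bullet> nabla \<phi> x = (\<Sum>b\<in>Basis. (nabla \<phi> x \<bullet> b) * (H x \<bullet> b))" for x
  by (subst euclidean_inner) (simp add: mult.commute)
 show "integrable lborel (%x. H x \<bullet> nabla \<phi> x)" unfolding eq using i by simp
 show "(LBINT x. H x \<bullet> nabla \<phi> x) = (\<Sum>b\<in>Basis. \<integral>x. (nabla \<phi> x \<bullet> b) * (H x \<bullet> b) \<partial>lborel)"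
  unfolding eq using i by (simp add: Bochner_Integration.integral_sum)
qed

text \<open>The classical equation is insensitive to the choice of representatives.\<close>

lemma field_equation_iff:
 fixes \<Omega> :: "space set" and m m' H :: "space => space"
 assumes \<Omega>: "open \<Omega>" and [measurable]: "m' \<in> \<B>" "H \<in> \<B>"
  and eq: "AE p in lborel. p \<in> \<Omega> --> m p = m' p"
  and D: "!!b. b \<in> Basis ==> AE p in lborel. p \<in> UNIV --> D b p = H p \<bullet> b" and \<phi>: "\<phi> \<in> test_functions UNIV"
 shows "(LINT x|lebesgue. (\<Sum>b\<in>Basis. D b x * pderiv_at b \<phi> x)) = (LINT x|lebesgue_on \<Omega>. (\<Sum>b\<in>Basis. (m x \<bullet> b) * pderiv_at b \<phi> x))
  \<longleftrightarrow> (LBINT p. H p \<bullet> nabla \<phi> p) = (LBINT p. \<I> \<Omega> p * (m' p \<bullet> nabla \<phi> p))"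
proof -
 note [measurable] = test_borel[OF \<phi>]
 have [measurable]: "\<Omega> \<in> sets borel" using \<Omega> by simp
 note pd = test_pderiv[OF \<phi>]
 have "AE p in lborel. \<forall>b\<in>Basis. D b p = H p \<bullet> b"
  by (rule AE_finite_allI) (use D in simp_all)
 then have "AE p in lborel. p \<in> UNIV --> (\<Sum>b\<in>Basis. D b p * pderiv_at b \<phi> p) = H p \<bullet> nabla \<phi> p"
 proof eventually_elim
  fix p assume "\<forall>b\<in>Basis. D b p = H p \<bullet> b"
  then have "(\<Sum>b\<in>Basis. D b p * pderiv_at b \<phi> p) = (\<Sum>b\<in>Basis. (H p \<bullet> b) * (nabla \<phi> p \<bullet> b))"
   by (intro sum.cong refl) (simp only: pd)
  then show "p \<in> UNIV --> (\<Sum>b\<in>Basis. D b p * pderiv_at b \<phi> p) = H p \<bullet> nabla \<phi> p"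
   by (simp only: euclidean_inner[symmetric] simp_thms)
 qed
 from lebesgue_on_integral_eq[OF open_UNIV _ _ this, of "%_. 1"]
 have 1: "(LINT x|lebesgue. (\<Sum>b\<in>Basis. D b x * pderiv_at b \<phi> x)) = (LBINT p. H p \<bullet> nabla \<phi> p)"
  by (simp add: lebesgue_on_UNIV_eq)
 have "AE p in lborel. p \<in> \<Omega> --> (\<Sum>b\<in>Basis. (m p \<bullet> b) * pderiv_at b \<phi> p) = m' p \<bullet> nabla \<phi> p"
  using eq
 proof eventually_elim
  fix p assume "p \<in> \<Omega> --> m p = m' p"
  then show "p \<in> \<Omega> --> (\<Sum>b\<in>Basis. (m p \<bullet> b) * pderiv_at b \<phi> p) = m' p \<bullet> nabla \<phi> p"
   by (auto simp only: pd euclidean_inner[symmetric])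
 qed
 from lebesgue_on_integral_eq[OF \<Omega> _ _ this, of "\<I> \<Omega>"]
 have "(LINT x|lebesgue_on \<Omega>. \<I> \<Omega> x *\<^sub>R (\<Sum>b\<in>Basis. (m x \<bullet> b) * pderiv_at b \<phi> x)) = (LBINT p. \<I> \<Omega> p *\<^sub>R (m' p \<bullet> nabla \<phi> p))"
  by simp
 moreover have "(LINT x|lebesgue_on \<Omega>. \<I> \<Omega> x *\<^sub>R (\<Sum>b\<in>Basis. (m x \<bullet> b) * pderiv_at b \<phi> x)) = (LINT x|lebesgue_on \<Omega>. (\<Sum>b\<in>Basis. (m x \<bullet> b) * pderiv_at b \<phi> x))"
  by (intro Bochner_Integration.integral_cong refl) (simp add: indicator_def)
 ultimately show ?thesis by (simp add: 1)
qed

lemma gnorm_diff_finite: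
 fixes f g :: "'a::euclidean_space => 'b::euclidean_space"
 assumes [measurable]: "U \<in> sets borel" "f \<in> \<B>" "g \<in> \<B>"
  and "gnorm U f < \<infinity>" "gnorm U g < \<infinity>"
 shows "gnorm U (%x. f x - g x) < \<infinity>"
proof -
 have "gnorm U (%x. f x - g x) <= 2 * gnorm U (%x. f x - 0) + 2 * gnorm U (%x. 0 - g x)"
  by (rule gnorm_triangle) measurable
 also have "... < \<infinity>" using assms by (simp add: ennreal_mult_less_top gnorm_def)
 finally show ?thesis .
qed

text \<open>Extracts from any potential a Borel stray field of the same energy, so the one chosen in
  \<open>stray_field_energy\<close> can be treated like every other.\<close>

lemma potential_field:
 assumes \<Omega>: "open \<Omega>" and [measurable]: "m' \<in> \<B>" and eq: "AE p in lborel. p \<in> \<Omega> --> m p = m' p"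
  and u: "stray_field_potential \<Omega> m u"
 obtains U H where "wgrad UNIV U H" "gnorm UNIV H < \<infinity>" "dirichlet_energy UNIV u = gnorm UNIV H"
  "!!\<phi>. \<phi> \<in> test_functions UNIV ==> (LBINT p. H p \<bullet> nabla \<phi> p) = (LBINT p. \<I> \<Omega> p * (m' p \<bullet> nabla \<phi> p))"
proof -
 have ud: "u weakly_differentiable_on UNIV" using u by (simp add: stray_field_potential_def)
 obtain U Gu where "U \<in> \<B>" "AE x in lborel. x \<in> UNIV --> u x = U x"
  and U: "!!c. c \<in> Basis ==> wgrad UNIV (%x. U x \<bullet> c) (Gu c)"
  "!!b. b \<in> Basis ==> AE x in lborel. x \<in> UNIV --> weak_pderiv UNIV b u x = (\<Sum>c\<in>Basis. (Gu c x \<bullet> b) *\<^sub>R c)"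
  by (rule weakly_differentiable_wgrad[OF open_UNIV ud]) blast
 define H where "H = Gu 1"
 have w: "wgrad UNIV U H" using U(1)[of 1] by (simp add: H_def)
 note [measurable] = wgradD(2)[OF w]
 have D: "AE x in lborel. x \<in> UNIV --> weak_pderiv UNIV b u x = H x \<bullet> b" if "b \<in> Basis" for b
  using U(2)[OF that] by (simp add: H_def)
 have en: "dirichlet_energy UNIV u = gnorm UNIV H"
  using dirichlet_energy_eq[OF open_UNIV ud wgradD(2)[OF U(1)] U(2)] by (simp add: H_def)
 have "gnorm UNIV (%x. H x \<bullet> b) < \<infinity>" if "b \<in> Basis" for b
 proof -
  have "weak_pderiv UNIV b u \<in> L2 UNIV" using u that by (simp add: stray_field_potential_def)
  then show ?thesis using L2_iff[OF open_UNIV _ D[OF that]] by simp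
 qed
 then have fin: "gnorm UNIV H < \<infinity>" by (subst gnorm_components) auto
 have "(LBINT p. H p \<bullet> nabla \<phi> p) = (LBINT p. \<I> \<Omega> p * (m' p \<bullet> nabla \<phi> p))" if \<phi>: "\<phi> \<in> test_functions UNIV" for \<phi>
  by (rule iffD1[OF field_equation_iff[OF \<Omega> assms(2) wgradD(2)[OF w] eq D \<phi>]
     bspec[OF conjunct2[OF conjunct2[OF u[unfolded stray_field_potential_def]]] \<phi>]])
 from that[OF w fin en this] show ?thesis .
qed

theorem admissible_state:
 assumes \<Omega>: "open \<Omega>" and m: "m \<in> admissible \<Omega>" and fin: "energy \<Omega> m < \<infinity>"
 obtains m' G H where "state \<Omega> m' G H" "unit_on \<Omega> m'" "gnorm \<Omega> (%p. m' p - e_bar p) < \<infinity>"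
  "local_energy \<Omega> UNIV G H = energy \<Omega> m"
proof -
 have fin2: "dirichlet_energy \<Omega> m ~= \<infinity>" "stray_field_energy \<Omega> m ~= \<infinity>" using fin by (auto simp: energy_def)
 have md: "m weakly_differentiable_on \<Omega>" using fin2(1) by (auto simp: dirichlet_energy_def split: if_splits)
 obtain F G where F [measurable]: "F \<in> \<B>" and mF: "AE x in lborel. x \<in> \<Omega> --> m x = F x"
  and G: "!!c. c \<in> Basis ==> wgrad \<Omega> (%x. F x \<bullet> c) (G c)"
   "!!b. b \<in> Basis ==> AE x in lborel. x \<in> \<Omega> --> weak_pderiv \<Omega> b m x = (\<Sum>c\<in>Basis. (G c x \<bullet> b) *\<^sub>R c)"
  by (rule weakly_differentiable_wgrad[OF \<Omega> md]) blast
 \<comment> \<open>F is known to have norm 1 only where it agrees with m in the wire; setting its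
   large values to 0 gives the bound everywhere, as \<open>state\<close> demands.\<close>
 define m' where "m' p = (if norm (F p) <= 1 then F p else 0)" for p
 have m'b [measurable]: "m' \<in> \<B>" unfolding m'_def[abs_def] by measurable
 have nm: "norm (m p) = 1" if "p \<in> \<Omega>" for p using m that by (auto simp: admissible_def)
 have mF': "m' p = F p" if "p \<in> \<Omega>" "m p = F p" for p using nm[OF that(1)] that(2) by (simp add: m'_def)
 have mm': "AE p in lborel. p \<in> \<Omega> --> m p = m' p" using mF by eventually_elim (metis mF')
 have Fm': "AE p in lborel. p \<in> \<Omega> --> F p \<bullet> c = m' p \<bullet> c" for c using mF by eventually_elim (metis mF')
 have "unit_on \<Omega> m'" unfolding unit_on_def using mm' by eventually_elim (metis nm)
 define u where "u = (SOME u. stray_field_potential \<Omega> m u)"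
 have ex: "\<exists>u. stray_field_potential \<Omega> m u" using fin2(2) by (auto simp: stray_field_energy_def split: if_splits)
 then have u: "stray_field_potential \<Omega> m u" unfolding u_def by (rule someI_ex)
 obtain U H where H: "wgrad UNIV U H" "dirichlet_energy UNIV u = gnorm UNIV H"
  "!!\<phi>. \<phi> \<in> test_functions UNIV ==> (LBINT p. H p \<bullet> nabla \<phi> p) = (LBINT p. \<I> \<Omega> p * (m' p \<bullet> nabla \<phi> p))"
  by (rule potential_field[OF \<Omega> m'b mm' u]) blast
 have "wgrad \<Omega> (%p. m' p \<bullet> c) (G c)" if "c \<in> Basis" for c
  by (rule wgrad_cong_AE[OF G(1)[OF that] _ Fm']) measurable
 then have st: "state \<Omega> m' G H" unfolding state_def using H(1,3) by (auto simp: m'_def)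
 have "local_energy \<Omega> UNIV G H = energy \<Omega> m"
  using dirichlet_energy_eq[OF \<Omega> md wgradD(2)[OF G(1)] G(2)] H(2) ex
  by (simp add: local_energy_def energy_def stray_field_energy_def u_def)
 moreover have "gnorm \<Omega> (%p. m' p - e_bar p) < \<infinity>"
 proof -
  have "(%p. m p - e_bar p) \<in> L2 \<Omega>" using m by (simp add: admissible_def H1_def)
  moreover have "AE p in lborel. p \<in> \<Omega> --> m p - e_bar p = m' p - e_bar p" using mm' by eventually_elim auto
  ultimately show ?thesis using L2_iff[OF \<Omega>, of "%p. m' p - e_bar p" "%p. m p - e_bar p"] by simp
 qed
 ultimately show ?thesis using that[OF st \<open>unit_on \<Omega> m'\<close>] by blast
qed

section \<open>Profiles that depend only on the axial variable\<close>

lemma wgrad_fst: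
 fixes h h' :: "real => real"
 assumes L: "!!s t. \<bar>h s - h t\<bar> <= L * \<bar>s - t\<bar>" and [measurable]: "h' \<in> \<B>" and hL: "!!t. \<bar>h' t\<bar> <= L"
  and D: "!!t. t ~= 1 ==> t ~= -1 ==> (h has_real_derivative h' t) (at t)"
 shows "wgrad UNIV (%p :: space. h (fst p)) (%p. h' (fst p) *\<^sub>R ex)"
proof (rule wgrad_lipschitz[where L=L])
 fix p q :: space
 have "0 <= L" using hL[of 0] by linarith
 then show "\<bar>h (fst p) - h (fst q)\<bar> <= L * norm (p - q)"
  using L[of "fst p" "fst q"] norm_fst_le[of "fst p - fst q" "snd p - snd q"] mult_left_mono[of "\<bar>fst p - fst q\<bar>" "norm (p - q)" L]
  by (simp add: fst_diff snd_diff flip: minus_prod_def)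
next
 show "norm (h' (fst p) *\<^sub>R ex) <= L" for p :: space using hL[of "fst p"] by (simp only: norm_scaleR) (simp add: norm_prod_def)
 have n: "AE p in lborel. fst (p :: space) ~= c" for c :: real
 proof -
  have "negligible {p :: space. p \<bullet> ex = c}" by (rule negligible_standard_hyperplane) (simp add: space_Basis)
  then have "AE p in lebesgue. p \<notin> {p :: space. p \<bullet> ex = c}" by (intro AE_not_in) (simp add: negligible_iff_null_sets)
  then show ?thesis unfolding AE_lebesgue_iff by (simp add: space_inner)
 qed
 have "AE p in lborel. fst (p :: space) ~= 1 & fst p ~= -1" using n[of 1] n[of "-1"] by auto
 then show "AE p in lborel. ((%p :: space. h (fst p)) has_derivative (%v. (h' (fst p) *\<^sub>R ex) \<bullet> v)) (at p)"
 proof eventually_elim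
  fix p :: space assume p: "fst p ~= 1 & fst p ~= -1"
  have "(h has_derivative (*) (h' (fst p))) (at (fst p))" using D[of "fst p"] p by (simp add: has_field_derivative_def)
  from has_derivative_compose[OF has_derivative_fst[OF has_derivative_ident] this]
  show "((%p :: space. h (fst p)) has_derivative (%v. (h' (fst p) *\<^sub>R ex) \<bullet> v)) (at p)"
   by (simp only: inner_scaleR_left inner_commute[of ex] space_inner)
 qed
next
 show "(%p :: space. h' (fst p) *\<^sub>R ex) \<in> \<B>"
  by (intro borel_measurable_scaleR borel_measurable_const
    measurable_compose[OF borel_measurable_continuous_onI[OF continuous_on_fst[OF continuous_on_id]] assms(2)])
qed

definition clamp1 :: "real => real" where "clamp1 t = max (-1) (min 1 t)"

text \<open>Serves both \<open>e_bar\<close> and the trial profile. Differentiability may fail only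
  on the two hyperplanes where the axial variable is 1 or -1, which are null sets.\<close>

lemma wgrad_clamped:
 fixes g g' :: "real => real"
 assumes L: "!!s t. \<bar>g s - g t\<bar> <= L * \<bar>s - t\<bar>" "L >= 0" and g: "!!t. (g has_real_derivative g' t) (at t)" "!!t. \<bar>g' t\<bar> <= L"
  and [measurable]: "g' \<in> \<B>"
 shows "wgrad UNIV (%p :: space. g (clamp1 (fst p))) (%p. (\<I> {-1<..<1} (fst p) * g' (fst p)) *\<^sub>R ex)"
proof (rule wgrad_fst[where L=L])
 show "\<bar>g (clamp1 s) - g (clamp1 t)\<bar> <= L * \<bar>s - t\<bar>" for s t
 proof -
  have "\<bar>clamp1 s - clamp1 t\<bar> <= \<bar>s - t\<bar>" by (auto simp: clamp1_def max_def min_def)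
  then show ?thesis using L(1)[of "clamp1 s" "clamp1 t"] mult_left_mono[OF _ L(2)] order_trans by blast
 qed
 show "\<bar>\<I> {-1<..<1} t * g' t\<bar> <= L" for t using g(2)[of t] L(2) by (simp add: indicator_def)
 fix t :: real assume t: "t ~= 1" "t ~= -1"
 consider "\<bar>t\<bar> < 1" | "t > 1" | "t < -1" using t by linarith
 then show "((%t. g (clamp1 t)) has_real_derivative \<I> {-1<..<1} t * g' t) (at t)"
 proof cases
  case 1
  then have "t \<in> {-1<..<1}" by auto
  then have "((%t. g (clamp1 t)) has_real_derivative g' t) (at t)"
   by (intro has_field_derivative_transform_within_open[OF g(1) open_greaterThanLessThan]) (auto simp: clamp1_def)
  then show ?thesis using \<open>t \<in> {-1<..<1}\<close> by simp
 next
  case 2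
  have "((%t. g (clamp1 t)) has_real_derivative 0) (at t)"
   by (intro has_field_derivative_transform_within_open[OF DERIV_const[of "g 1"] open_greaterThan[of 1]]) (use 2 in \<open>auto simp: clamp1_def\<close>)
  then show ?thesis using 2 by simp
 next
  case 3
  have "((%t. g (clamp1 t)) has_real_derivative 0) (at t)"
   by (intro has_field_derivative_transform_within_open[OF DERIV_const[of "g (-1)"] open_lessThan[of "-1"]]) (use 3 in \<open>auto simp: clamp1_def\<close>)
  then show ?thesis using 3 by simp
 qed
qed measurable

definition clamp_grad :: "space => space => space" where
 "clamp_grad c p = (\<I> {-1<..<1} (fst p) * (ex \<bullet> c)) *\<^sub>R ex"

lemma wgrad_e_bar: "wgrad UNIV (%p. e_bar p \<bullet> c) (clamp_grad c)"
proof -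
 have "wgrad UNIV (%p :: space. (ex \<bullet> c) * clamp1 (fst p)) (%p. (\<I> {-1<..<1} (fst p) * (ex \<bullet> c)) *\<^sub>R ex)"
  by (rule wgrad_clamped[where L="\<bar>ex \<bullet> c\<bar>"]) (auto intro!: derivative_eq_intros simp: abs_mult simp flip: right_diff_distrib)
 then show ?thesis unfolding e_bar_eq clamp_grad_def[abs_def] clamp1_def inner_scaleR_left by (simp only: mult.commute)
qed

lemma clamp_grad_borel [measurable]: "clamp_grad c \<in> \<B>"
 by (rule wgradD(2)[OF wgrad_e_bar])

lemma gnorm_slab_finite:
 fixes g :: "space => 'b::euclidean_space"
 assumes om: "bounded \<omega>" "\<omega> \<in> sets borel" and g: "!!p. \<bar>fst p\<bar> > 1 ==> g p = 0" "!!p. norm (g p) <= B"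
 shows "gnorm (UNIV \<times> \<omega>) g < \<infinity>"
proof -
 define S :: "space set" where "S = {-1..1} \<times> \<omega>"
 have S: "bounded S" "S \<in> sets borel" unfolding S_def using om by (auto intro: bounded_Times borel_Times)
 have "gnorm (UNIV \<times> \<omega>) g = gnorm S g" unfolding gnorm_def
 proof (rule nn_integral_cong)
  fix p :: space
  have "\<I> (UNIV \<times> \<omega>) p = (\<I> S p :: ennreal) \<or> g p = 0" using g(1)[of p] by (cases p) (auto simp: S_def indicator_def)
  then show "\<I> (UNIV \<times> \<omega>) p * ennreal ((norm (g p))\<^sup>2) = \<I> S p * ennreal ((norm (g p))\<^sup>2)" by auto
 qed
 also have "... <= gnorm S (%p. B)" by (rule gnorm_pointwise_mono) (simp only: real_norm_def, rule order_trans[OF g(2) abs_ge_self])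
 also have "... < \<infinity>" by (simp add: gnorm_const[OF S])
 finally show ?thesis .
qed

lemma in_admissible:
 assumes om: "open \<omega>" "bounded \<omega>" and m [measurable]: "m \<in> \<B>"
  and eq: "AE p in lborel. p \<in> UNIV \<times> \<omega> --> m0 p = m p"
  and w: "!!c. c \<in> Basis ==> wgrad (UNIV \<times> \<omega>) (%p. m p \<bullet> c) (G c)" and fin: "!!c. c \<in> Basis ==> gnorm (UNIV \<times> \<omega>) (G c) < \<infinity>"
   "gnorm (UNIV \<times> \<omega>) (%p. m p - e_bar p) < \<infinity>" and u: "!!p. norm (m0 p) = 1"
 shows "m0 \<in> admissible (UNIV \<times> \<omega>)"
proof -
 have O: "open (UNIV \<times> \<omega> :: space set)" using om by (intro open_Times) auto
 have "(%p. m0 p - e_bar p) \<in> H1 (UNIV \<times> \<omega>)"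
 proof (rule H1I[OF O, of "%p. m p - e_bar p" _ "%c p. G c p - clamp_grad c p"])
  show "AE p in lborel. p \<in> UNIV \<times> \<omega> --> m0 p - e_bar p = m p - e_bar p" using eq by eventually_elim auto
  fix c :: space assume c: "c \<in> Basis"
  show "wgrad (UNIV \<times> \<omega>) (%p. (m p - e_bar p) \<bullet> c) (%p. G c p - clamp_grad c p)"
   unfolding inner_diff_left by (rule wgrad_diff[OF w[OF c] wgrad_subset[OF wgrad_e_bar subset_UNIV]])
  have "gnorm (UNIV \<times> \<omega>) (clamp_grad c) < \<infinity>"
  proof (rule gnorm_slab_finite[OF om(2), where B="\<bar>ex \<bullet> c\<bar>"])
   show "\<omega> \<in> sets borel" using om by simp
   show "clamp_grad c p = 0" if "\<bar>fst p\<bar> > 1" for p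
   proof -
    have "fst p \<notin> {-1<..<1}" using that by auto
    then show ?thesis by (simp only: clamp_grad_def indicator_simps simp_thms mult_zero_left scaleR_zero_left)
   qed
   show "norm (clamp_grad c p) <= \<bar>ex \<bullet> c\<bar>" for p unfolding clamp_grad_def norm_scaleR by (simp add: norm_prod_def indicator_def)
  qed
  then show "gnorm (UNIV \<times> \<omega>) (%p. G c p - clamp_grad c p) < \<infinity>"
   using wgradD(2)[OF w[OF c]] O fin(1)[OF c] by (intro gnorm_diff_finite) auto
 qed (use fin in simp_all)
 then show ?thesis using u by (auto simp: admissible_def)
qed

text \<open>Admissible maps are unit vectors at every point of the wire, so the exceptional null set
  is overwritten with \<open>ex\<close>. The stray field energy is that of a chosen potential, whose
  field H' equals H almost everywhere by the Liouville theorem.\<close>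

theorem state_admissible:
 assumes om: "open \<omega>" "bounded \<omega>" and s: "state (UNIV \<times> \<omega>) m G H" and u: "unit_on (UNIV \<times> \<omega>) m"
  and d: "gnorm (UNIV \<times> \<omega>) (%p. m p - e_bar p) < \<infinity>" and fin: "local_energy (UNIV \<times> \<omega>) UNIV G H < \<infinity>"
 obtains m0 where "m0 \<in> admissible (UNIV \<times> \<omega>)" "energy (UNIV \<times> \<omega>) m0 = local_energy (UNIV \<times> \<omega>) UNIV G H"
proof -
 let ?\<Omega> = "UNIV \<times> \<omega> :: space set"
 have O: "open ?\<Omega>" using om by (intro open_Times) auto
 note [measurable] = stateD(1,5)[OF s]
 define m0 where "m0 p = (if norm (m p) = 1 then m p else ex)" for p
 have eq: "AE p in lborel. p \<in> ?\<Omega> --> m0 p = m p" using u unfolding unit_on_def by eventually_elim (simp add: m0_def)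
 have fG: "gnorm ?\<Omega> (G c) < \<infinity>" if "c \<in> Basis" for c
 proof -
  have "gnorm ?\<Omega> (G c) <= (\<Sum>c\<in>Basis. gnorm ?\<Omega> (G c))" by (rule member_le_sum) (use that in auto)
  also have "... < \<infinity>" using fin by (simp add: local_energy_def)
  finally show ?thesis .
 qed
 have fH: "gnorm UNIV H < \<infinity>" using fin by (simp add: local_energy_def)
 have adm: "m0 \<in> admissible ?\<Omega>"
  by (rule in_admissible[OF om stateD(1)[OF s] eq stateD(3)[OF s] fG d]) (auto simp: m0_def norm_prod_def)
 have dir: "dirichlet_energy ?\<Omega> m0 = (\<Sum>c\<in>Basis. gnorm ?\<Omega> (G c))"
  using wgrad_weakly_differentiable(1,3)[OF O stateD(1)[OF s] eq stateD(3)[OF s]] stateD(6)[OF s]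
  by (intro dirichlet_energy_eq[OF O]) auto
 obtain U where U: "wgrad UNIV U H" using stateD(4)[OF s] by blast
 have wU: "wgrad UNIV (%x. U x \<bullet> c) H" if "c \<in> Basis" for c using U that by simp
 note ud = wgrad_weakly_differentiable[OF open_UNIV wgradD(1)[OF U] AE_I2, of U "%_. H", OF _ wU]
 have D: "AE x in lborel. x \<in> UNIV --> weak_pderiv UNIV b U x = H x \<bullet> b" if "b \<in> Basis" for b
  using ud(3)[OF _ _ that] by simp
 have "weak_pderiv UNIV b U \<in> L2 UNIV" if "b \<in> Basis" for b
 proof -
  have "gnorm UNIV (%x. H x \<bullet> b) <= gnorm UNIV H"
   by (rule gnorm_pointwise_mono) (use Basis_le_norm[OF that] in simp)
  then show ?thesis using L2_iff[OF open_UNIV _ D[OF that]] fH by (simp add: le_less_trans)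
 qed
 moreover have "U weakly_differentiable_on UNIV" using ud(1) by simp
 ultimately have pot: "stray_field_potential ?\<Omega> m0 U"
  unfolding stray_field_potential_def using field_equation_iff[OF O stateD(1)[OF s] wgradD(2)[OF U] eq D] stateD(7)[OF s] by blast
 define u0 where "u0 = (SOME u. stray_field_potential ?\<Omega> m0 u)"
 have u0: "stray_field_potential ?\<Omega> m0 u0" unfolding u0_def by (rule someI[of "stray_field_potential ?\<Omega> m0", OF pot])
 obtain U' H' where H': "wgrad UNIV U' H'" "gnorm UNIV H' < \<infinity>" "dirichlet_energy UNIV u0 = gnorm UNIV H'"
  "!!\<phi>. \<phi> \<in> test_functions UNIV ==> (LBINT p. H' p \<bullet> nabla \<phi> p) = (LBINT p. \<I> ?\<Omega> p * (m p \<bullet> nabla \<phi> p))"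
  by (rule potential_field[OF O stateD(1)[OF s] eq u0]) blast
 have "AE p in lborel. H p - H' p = 0"
 proof (rule liouville_gradient[OF wgrad_diff[OF U H'(1)]])
  show "gnorm UNIV (%p. H p - H' p) < \<infinity>" using wgradD(2)[OF H'(1)] fH H'(2) by (intro gnorm_diff_finite) auto
  show "(LBINT p. (H p - H' p) \<bullet> nabla \<phi> p) = 0" if \<phi>: "\<phi> \<in> test_functions UNIV" for \<phi>
   using inner_nabla_integral(1)[OF wgradD(2,4)[OF U] \<phi>] inner_nabla_integral(1)[OF wgradD(2,4)[OF H'(1)] \<phi>] H'(4)[OF \<phi>] stateD(7)[OF s \<phi>]
   by (simp add: inner_diff_left Bochner_Integration.integral_diff)
 qed
 then have "gnorm UNIV H' = gnorm UNIV H" by (intro gnorm_cong_AE) auto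
 then have "stray_field_energy ?\<Omega> m0 = gnorm UNIV H" using pot H'(3) by (auto simp: stray_field_energy_def u0_def)
 with adm dir show ?thesis by (intro that[of m0]) (simp_all add: energy_def local_energy_def)
qed

text \<open>A half turn in the plane of \<open>ex\<close> and \<open>ey\<close>, carried out for |x|
  <= 1. It is used when the infimum is infinite: then every admissible map is a minimizer, but there
  has to be one.\<close>

lemma admissible_nonempty:
 assumes om: "open \<omega>" "bounded \<omega>" shows "admissible (UNIV \<times> \<omega>) ~= {}"
proof -
 \<comment> \<open>At the clamped values 1 and -1 the sine is then 1 and -1, so the map agrees with
   \<open>e_bar\<close> for |x| > 1.\<close>
 define q where "q = pi / 2"
 have q: "q >= 0" by (simp add: q_def)
 define m :: "space => space" where "m p = sin (q * clamp1 (fst p)) *\<^sub>R ex + cos (q * clamp1 (fst p)) *\<^sub>R ey" for p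
 have lip: "\<bar>sin s - sin t\<bar> <= \<bar>s - t\<bar>" "\<bar>cos s - cos t\<bar> <= \<bar>s - t\<bar>" for s t :: real
 proof -
  have "\<bar>sin s - sin t\<bar> = 2 * (\<bar>sin ((s - t) / 2)\<bar> * \<bar>cos ((s + t) / 2)\<bar>)" by (simp add: sin_diff_sin abs_mult)
  also have "... <= 2 * (\<bar>(s - t) / 2\<bar> * 1)" by (intro mult_left_mono mult_mono abs_sin_x_le_abs_x abs_cos_le_one) auto
  finally show "\<bar>sin s - sin t\<bar> <= \<bar>s - t\<bar>" by simp
  have "\<bar>cos s - cos t\<bar> = 2 * (\<bar>sin ((s + t) / 2)\<bar> * \<bar>sin ((t - s) / 2)\<bar>)" by (simp add: cos_diff_cos abs_mult)
  also have "... <= 2 * (1 * \<bar>(t - s) / 2\<bar>)" by (intro mult_left_mono mult_mono abs_sin_x_le_abs_x abs_sin_le_one) auto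
  finally show "\<bar>cos s - cos t\<bar> <= \<bar>s - t\<bar>" by simp
 qed
 have qd: "\<bar>q * s - q * t\<bar> = q * \<bar>s - t\<bar>" for s t using q by (simp add: abs_mult flip: right_diff_distrib)
 have ws: "wgrad UNIV (%p :: space. sin (q * clamp1 (fst p))) (%p. (\<I> {-1<..<1} (fst p) * (q * cos (q * fst p))) *\<^sub>R ex)"
  using q lip(1)[of "q * s" "q * t" for s t] abs_cos_le_one
  by (intro wgrad_clamped[where g="%t. sin (q * t)" and L=q]) (auto intro!: derivative_eq_intros mult_left_le simp: qd abs_mult)
 have wc: "wgrad UNIV (%p :: space. cos (q * clamp1 (fst p))) (%p. (\<I> {-1<..<1} (fst p) * (- q * sin (q * fst p))) *\<^sub>R ex)"
  using q lip(2)[of "q * s" "q * t" for s t] abs_sin_le_one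
  by (intro wgrad_clamped[where g="%t. cos (q * t)" and L=q]) (auto intro!: derivative_eq_intros mult_left_le simp: qd abs_mult)
 define G :: "space => space => space" where
  "G c p = (ex \<bullet> c) *\<^sub>R ((\<I> {-1<..<1} (fst p) * (q * cos (q * fst p))) *\<^sub>R ex) + (ey \<bullet> c) *\<^sub>R ((\<I> {-1<..<1} (fst p) * (- q * sin (q * fst p))) *\<^sub>R ex)" for c p
 have w: "wgrad UNIV (%p. m p \<bullet> c) (G c)" for c
  using wgrad_lincomb[OF ws wc, of "ex \<bullet> c" "ey \<bullet> c"] unfolding m_def G_def[abs_def] inner_add_left inner_scaleR_left
  by (simp only: mult.commute)
 have nm: "norm (m p) = 1" for p
 proof -
  have "(norm (m p))\<^sup>2 = 1" unfolding space_norm_sq m_def by (simp add: inner_prod_def)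
  then show ?thesis by (smt (verit) norm_ge_zero power2_eq_1_iff)
 qed
 have mb: "m \<in> \<B>" unfolding m_def[abs_def] clamp1_def
  by (intro borel_measurable_continuous_onI continuous_intros)
 have out: "m p = e_bar p" "G c p = 0" if "\<bar>fst p\<bar> > 1" for p :: space and c
 proof -
  have "fst p \<notin> {-1<..<1}" using that by auto
  then show "G c p = 0" by (simp only: G_def indicator_simps simp_thms mult_zero_left scaleR_zero_left scaleR_zero_right add_0_right)
  show "m p = e_bar p"
  proof (cases "fst p > 1")
   case True then show ?thesis by (simp add: m_def e_bar_eq clamp1_def q_def)
  next
   case False
   then have "fst p < -1" using that by linarith
   then show ?thesis by (simp add: m_def e_bar_eq clamp1_def q_def)
  qed
 qed
 have "m \<in> admissible (UNIV \<times> \<omega>)"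
 proof (rule in_admissible[OF om mb AE_I2 wgrad_subset[OF w subset_UNIV]])
  have ob: "\<omega> \<in> sets borel" using om by simp
  have eb: "norm (e_bar p) <= 1" for p unfolding e_bar_eq norm_scaleR by (simp add: norm_prod_def)
  show "gnorm (UNIV \<times> \<omega>) (%p. m p - e_bar p) < \<infinity>"
  proof (rule gnorm_slab_finite[OF om(2) ob, where B=2])
   show "norm (m p - e_bar p) <= 2" for p using norm_triangle_ineq4[of "m p" "e_bar p"] eb[of p] nm[of p] by linarith
  qed (simp add: out)
  fix c :: space assume c: "c \<in> Basis"
  show "gnorm (UNIV \<times> \<omega>) (G c) < \<infinity>"
  proof (rule gnorm_slab_finite[OF om(2) ob, where B="2 * q"])
   fix p :: space
   have c1: "\<bar>ex \<bullet> c\<bar> <= 1" "\<bar>ey \<bullet> c\<bar> <= 1" using c by (auto simp: space_Basis inner_prod_def)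
   have b: "\<bar>x * (\<I> {-1<..<1} (fst p) * (q * y))\<bar> <= q" if "\<bar>x\<bar> <= 1" "\<bar>y\<bar> <= 1" for x y :: real
   proof -
    have "\<bar>x\<bar> * (q * \<bar>y\<bar>) <= 1 * (q * 1)" using that q by (intro mult_mono) auto
    then show ?thesis using q by (auto simp: abs_mult indicator_def)
   qed
   have "norm (G c p) <= \<bar>(ex \<bullet> c) * (\<I> {-1<..<1} (fst p) * (q * cos (q * fst p)))\<bar> + \<bar>(ey \<bullet> c) * (\<I> {-1<..<1} (fst p) * (q * (- sin (q * fst p))))\<bar>"
    unfolding G_def scaleR_scaleR
    by (rule order_trans[OF norm_triangle_ineq]) (simp only: norm_scaleR, simp add: norm_prod_def abs_mult)
   also have "... <= q + q" by (intro add_mono b c1) (simp_all add: abs_sin_le_one abs_cos_le_one)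
   finally show "norm (G c p) <= 2 * q" by simp
  qed (rule out(2))
 qed (use nm in auto)
 then show ?thesis by blast
qed

section \<open>Convexity of the energy and strong limits of states\<close>

lemma gnorm_parallelogram:
 fixes f g :: "'a::euclidean_space => 'b::euclidean_space"
 assumes [measurable]: "f \<in> \<B>" "g \<in> \<B>" "U \<in> sets borel"
 shows "4 * gnorm U (%x. (1/2) *\<^sub>R f x + (1/2) *\<^sub>R g x) + gnorm U (%x. f x - g x) = 2 * gnorm U f + 2 * gnorm U g"
proof -
 have pt: "4 * ennreal ((norm ((1/2) *\<^sub>R a + (1/2) *\<^sub>R b))\<^sup>2) + ennreal ((norm (a - b))\<^sup>2) = 2 * ennreal ((norm a)\<^sup>2) + 2 * ennreal ((norm b)\<^sup>2)"
  for a b :: 'b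
 proof -
  have "4 * (norm ((1/2) *\<^sub>R a + (1/2) *\<^sub>R b))\<^sup>2 + (norm (a - b))\<^sup>2 = 2 * (norm a)\<^sup>2 + 2 * (norm b)\<^sup>2"
   by (simp add: power2_norm_eq_inner inner_add_left inner_add_right inner_diff_left inner_diff_right inner_commute[of b a] add_divide_distrib diff_divide_distrib)
  then have "ennreal (4 * (norm ((1/2) *\<^sub>R a + (1/2) *\<^sub>R b))\<^sup>2 + (norm (a - b))\<^sup>2) = ennreal (2 * (norm a)\<^sup>2 + 2 * (norm b)\<^sup>2)"
   by (rule arg_cong)
  then show ?thesis by (simp add: ennreal_mult)
 qed
 have "4 * gnorm U (%x. (1/2) *\<^sub>R f x + (1/2) *\<^sub>R g x) + gnorm U (%x. f x - g x)
  = (\<N> x. 4 * (\<I> U x * ennreal ((norm ((1/2) *\<^sub>R f x + (1/2) *\<^sub>R g x))\<^sup>2)) + \<I> U x * ennreal ((norm (f x - g x))\<^sup>2))"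
  unfolding gnorm_def by (subst nn_integral_add) (simp_all add: nn_integral_cmult)
 also have "... = (\<N> x. 2 * (\<I> U x * ennreal ((norm (f x))\<^sup>2)) + 2 * (\<I> U x * ennreal ((norm (g x))\<^sup>2)))"
 proof (rule nn_integral_cong)
  fix x
  show "4 * (\<I> U x * ennreal ((norm ((1/2) *\<^sub>R f x + (1/2) *\<^sub>R g x))\<^sup>2)) + \<I> U x * ennreal ((norm (f x - g x))\<^sup>2)
   = 2 * (\<I> U x * ennreal ((norm (f x))\<^sup>2)) + 2 * (\<I> U x * ennreal ((norm (g x))\<^sup>2))"
   by (cases "x \<in> U") (simp_all only: indicator_simps simp_thms mult_1 mult_zero_left mult_zero_right add_0_right pt)
 qed
 also have "... = 2 * gnorm U f + 2 * gnorm U g"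
  unfolding gnorm_def by (subst nn_integral_add) (simp_all add: nn_integral_cmult)
 finally show ?thesis .
qed

lemma local_energy_parallelogram:
 assumes "!!c. c \<in> Basis ==> G c \<in> \<B>" "H \<in> \<B>"
  "!!c. c \<in> Basis ==> G' c \<in> \<B>" "H' \<in> \<B>" "\<Omega> \<in> sets borel"
 shows "4 * local_energy \<Omega> UNIV (%c p. (1/2) *\<^sub>R G c p + (1/2) *\<^sub>R G' c p) (%p. (1/2) *\<^sub>R H p + (1/2) *\<^sub>R H' p)
   + local_energy \<Omega> UNIV (%c p. G c p - G' c p) (%p. H p - H' p)
  = 2 * local_energy \<Omega> UNIV G H + 2 * local_energy \<Omega> UNIV G' H'"
proof -
 have 1: "4 * gnorm \<Omega> (%p. (1/2) *\<^sub>R G c p + (1/2) *\<^sub>R G' c p) + gnorm \<Omega> (%p. G c p - G' c p) = 2 * gnorm \<Omega> (G c) + 2 * gnorm \<Omega> (G' c)"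
  if "c \<in> Basis" for c using assms that by (intro gnorm_parallelogram) auto
 have 2: "4 * gnorm UNIV (%p. (1/2) *\<^sub>R H p + (1/2) *\<^sub>R H' p) + gnorm UNIV (%p. H p - H' p) = 2 * gnorm UNIV H + 2 * gnorm UNIV H'"
  using assms by (intro gnorm_parallelogram) auto
 have 3: "(\<Sum>c\<in>Basis. 4 * gnorm \<Omega> (%p. (1/2) *\<^sub>R G c p + (1/2) *\<^sub>R G' c p) + gnorm \<Omega> (%p. G c p - G' c p)) = (\<Sum>c\<in>Basis. 2 * gnorm \<Omega> (G c) + 2 * gnorm \<Omega> (G' c))"
  by (rule sum.cong[OF refl 1])
 have r: "4 * (a + b) + (c + d) = (4 * a + c) + (4 * b + d)" "2 * (a + b) + 2 * (c + d) = (2 * a + 2 * c) + (2 * b + 2 * d)" for a b c d :: ennreal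
  by (simp_all only: distrib_left add_ac)
 show ?thesis unfolding local_energy_def Int_UNIV_right r 2
  using 3 by (simp only: sum.distrib sum_distrib_left)
qed

text \<open>Young's inequality for the mixed term. With small t it yields continuity of the squared
  norm under strong convergence without subtracting extended numbers.\<close>

lemma gnorm_perturb:
 fixes f g :: "'a::euclidean_space => 'b::euclidean_space"
 assumes [measurable]: "f \<in> \<B>" "g \<in> \<B>" "U \<in> sets borel" and t: "t > 0"
 shows "gnorm U g <= ennreal (1 + t) * gnorm U f + ennreal (1 + 1/t) * gnorm U (%x. f x - g x)"
proof -
 have pt: "ennreal ((norm b)\<^sup>2) <= ennreal (1 + t) * ennreal ((norm a)\<^sup>2) + ennreal (1 + 1/t) * ennreal ((norm (a - b))\<^sup>2)" for a b :: 'b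
 proof -
  define x where "x = norm a"
  define y where "y = norm (a - b)"
  have "norm b <= x + y" using norm_triangle_ineq4[of a "a - b"] by (simp add: x_def y_def)
  then have "(norm b)\<^sup>2 <= (x + y)\<^sup>2" by (intro power_mono) auto
  also have "(x + y)\<^sup>2 <= (1 + t) * x\<^sup>2 + (1 + 1/t) * y\<^sup>2"
  proof -
   have "0 <= (t * x - y)\<^sup>2 / t" using t by simp
   also have "(t * x - y)\<^sup>2 / t = t * x\<^sup>2 + y\<^sup>2 / t - 2 * x * y" using t by (simp add: power2_eq_square field_simps)
   finally show ?thesis by (simp add: power2_eq_square algebra_simps)
  qed
  finally have "ennreal ((norm b)\<^sup>2) <= ennreal ((1 + t) * x\<^sup>2 + (1 + 1/t) * y\<^sup>2)" by (rule ennreal_leI)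
  also have "... = ennreal ((1 + t) * x\<^sup>2) + ennreal ((1 + 1/t) * y\<^sup>2)" using t by (intro ennreal_plus) auto
  also have "... = ennreal (1 + t) * ennreal (x\<^sup>2) + ennreal (1 + 1/t) * ennreal (y\<^sup>2)" using t by (simp only: ennreal_mult'' zero_le_power2)
  finally show ?thesis by (simp only: x_def y_def)
 qed
 have "gnorm U g <= (\<N> x. ennreal (1 + t) * (\<I> U x * ennreal ((norm (f x))\<^sup>2)) + ennreal (1 + 1/t) * (\<I> U x * ennreal ((norm (f x - g x))\<^sup>2)))"
  unfolding gnorm_def
 proof (rule nn_integral_mono)
  fix x
  show "\<I> U x * ennreal ((norm (g x))\<^sup>2) <= ennreal (1 + t) * (\<I> U x * ennreal ((norm (f x))\<^sup>2)) + ennreal (1 + 1/t) * (\<I> U x * ennreal ((norm (f x - g x))\<^sup>2))"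
   by (cases "x \<in> U") (simp_all only: indicator_simps simp_thms mult_1 mult_zero_left zero_le pt)
 qed
 also have "... = ennreal (1 + t) * gnorm U f + ennreal (1 + 1/t) * gnorm U (%x. f x - g x)"
  unfolding gnorm_def by (subst nn_integral_add) (simp_all add: nn_integral_cmult)
 finally show ?thesis .
qed

text \<open>For fixed t the perturbation disappears as n grows; afterwards t tends to 0 along
  \<open>1 / real (Suc n)\<close>.\<close>

lemma local_energy_limit:
 assumes mG: "!!n c. c \<in> Basis ==> G n c \<in> \<B>" "!!n. H n \<in> \<B>"
  "!!c. c \<in> Basis ==> G0 c \<in> \<B>" "H0 \<in> \<B>" "\<Omega> \<in> sets borel"
  and lim: "!!c. c \<in> Basis ==> (%n. gnorm \<Omega> (%p. G n c p - G0 c p)) \<longlonglongrightarrow> 0" "(%n. gnorm UNIV (%p. H n p - H0 p)) \<longlonglongrightarrow> 0"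
  and b: "!!n. local_energy \<Omega> UNIV (G n) (H n) <= ennreal (b n)" and b0: "b \<longlonglongrightarrow> b0"
 shows "local_energy \<Omega> UNIV G0 H0 <= ennreal b0"
proof -
 define D where "D n = local_energy \<Omega> UNIV (%c p. G n c p - G0 c p) (%p. H n p - H0 p)" for n
 have "D \<longlonglongrightarrow> (\<Sum>c\<in>(Basis :: space set). 0) + 0"
  unfolding D_def local_energy_def Int_UNIV_right by (intro tendsto_add tendsto_sum lim)
 then have D: "D \<longlonglongrightarrow> 0" by simp
 have le: "local_energy \<Omega> UNIV G0 H0 <= ennreal (1 + t) * ennreal b0" if t: "t > 0" for t
 proof (rule LIMSEQ_le_const)
  have "(%n. ennreal (1 + t) * ennreal (b n) + ennreal (1 + 1/t) * D n) \<longlonglongrightarrow> ennreal (1 + t) * ennreal b0 + ennreal (1 + 1/t) * 0"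
   by (intro tendsto_add ennreal_tendsto_cmult tendsto_ennrealI b0 D) simp_all
  then show "(%n. ennreal (1 + t) * ennreal (b n) + ennreal (1 + 1/t) * D n) \<longlonglongrightarrow> ennreal (1 + t) * ennreal b0" by simp
  have "local_energy \<Omega> UNIV G0 H0 <= ennreal (1 + t) * ennreal (b n) + ennreal (1 + 1/t) * D n" for n
  proof -
   have "local_energy \<Omega> UNIV G0 H0 <= (\<Sum>c\<in>Basis. ennreal (1 + t) * gnorm \<Omega> (G n c) + ennreal (1 + 1/t) * gnorm \<Omega> (%p. G n c p - G0 c p))
    + (ennreal (1 + t) * gnorm UNIV (H n) + ennreal (1 + 1/t) * gnorm UNIV (%p. H n p - H0 p))"
    unfolding local_energy_def Int_UNIV_right using mG t by (intro add_mono sum_mono gnorm_perturb) auto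
   also have "... = ennreal (1 + t) * local_energy \<Omega> UNIV (G n) (H n) + ennreal (1 + 1/t) * D n"
    unfolding local_energy_def D_def Int_UNIV_right by (simp only: sum.distrib sum_distrib_left distrib_left add_ac)
   also have "... <= ennreal (1 + t) * ennreal (b n) + ennreal (1 + 1/t) * D n" by (intro add_mono mult_left_mono b) auto
   finally show ?thesis .
  qed
  then show "\<exists>N. \<forall>n\<ge>N. local_energy \<Omega> UNIV G0 H0 <= ennreal (1 + t) * ennreal (b n) + ennreal (1 + 1/t) * D n" by blast
 qed
 have "(%n. ennreal (1 + 1 / real (Suc n)) * ennreal b0) \<longlonglongrightarrow> ennreal (1 + 0) * ennreal b0"
 proof (cases "b0 >= 0")
  case True
  have "(%n. ennreal ((1 + inverse (real (Suc n))) * b0)) \<longlonglongrightarrow> ennreal ((1 + 0) * b0)"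
   by (intro tendsto_ennrealI tendsto_intros LIMSEQ_inverse_real_of_nat)
  then show ?thesis using True by (simp add: ennreal_mult inverse_eq_divide)
 next
  case False
  then show ?thesis by (simp add: ennreal_neg)
 qed
 then have "local_energy \<Omega> UNIV G0 H0 <= ennreal (1 + 0) * ennreal b0"
  by (rule LIMSEQ_le_const) (intro exI allI impI le, simp)
 then show ?thesis by simp
qed

lemma gnorm_dominated_limit:
 fixes f :: "nat => 'a::euclidean_space => 'b::euclidean_space"
 assumes [measurable]: "!!n. f n \<in> \<B>" "f0 \<in> \<B>" "K \<in> sets borel" and K: "bounded K"
  and b: "!!n x. norm (f n x) <= 1" "!!x. norm (f0 x) <= 1"
  and lim: "AE x in lborel. x \<in> K --> (%n. f n x) \<longlonglongrightarrow> f0 x"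
 shows "(%n. gnorm K (%x. f n x - f0 x)) \<longlonglongrightarrow> 0"
proof -
 have "(%n. \<integral>\<^sup>+x. \<I> K x * ennreal ((norm (f n x - f0 x))\<^sup>2) \<partial>lborel) \<longlonglongrightarrow> (\<integral>\<^sup>+x. 0 \<partial>(lborel :: 'a measure))"
 proof (rule nn_integral_dominated_convergence[where w="%x. \<I> K x * ennreal 4"])
  show "AE x in lborel. \<I> K x * ennreal ((norm (f n x - f0 x))\<^sup>2) <= \<I> K x * ennreal 4" for n
  proof (rule AE_I2, intro mult_left_mono ennreal_leI)
   fix x
   have "norm (f n x - f0 x) <= 2" using norm_triangle_ineq4[of "f n x" "f0 x"] b(1)[of n x] b(2)[of x] by linarith
   then have "(norm (f n x - f0 x))\<^sup>2 <= 2\<^sup>2" by (rule power_mono) simp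
   then show "(norm (f n x - f0 x))\<^sup>2 <= 4" by simp
  qed simp
  have "(\<N> x. \<I> K x * ennreal 4) = emeasure lborel K * ennreal 4" by (subst nn_integral_multc) auto
  also have "... < \<infinity>" using emeasure_bounded_finite[OF K] by (simp add: ennreal_mult_less_top)
  finally show "(\<N> x. \<I> K x * ennreal 4) < \<infinity>" .
  show "AE x in lborel. (%n. \<I> K x * ennreal ((norm (f n x - f0 x))\<^sup>2)) \<longlonglongrightarrow> 0"
   using lim
  proof eventually_elim
   fix x assume l: "x \<in> K --> (%n. f n x) \<longlonglongrightarrow> f0 x"
   show "(%n. \<I> K x * ennreal ((norm (f n x - f0 x))\<^sup>2)) \<longlonglongrightarrow> 0"
   proof (cases "x \<in> K")
    case True
    then have "(%n. ennreal ((norm (f n x - f0 x))\<^sup>2)) \<longlonglongrightarrow> ennreal ((norm (f0 x - f0 x))\<^sup>2)"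
     using l by (intro tendsto_ennrealI tendsto_intros) auto
    then show ?thesis using True by simp
   qed simp
  qed
 qed measurable
 then show ?thesis by (simp add: gnorm_def)
qed

lemma state_field_integrable:
 assumes s: "state \<Omega> m G H" and \<Omega> [measurable]: "\<Omega> \<in> sets borel" and \<phi>: "\<phi> \<in> test_functions UNIV"
 shows "integrable lborel (%p. H p \<bullet> nabla \<phi> p)" "integrable lborel (%p. \<I> \<Omega> p * (m p \<bullet> nabla \<phi> p))"
proof -
 note [measurable] = test_borel[OF \<phi>] stateD(1,5)[OF s]
 obtain u where u: "wgrad UNIV u H" using stateD(4)[OF s] by blast
 show "integrable lborel (%p. H p \<bullet> nabla \<phi> p)" by (rule inner_nabla_integral(1)[OF wgradD(2,4)[OF u] \<phi>])
 have "integrable lborel (%p. (\<I> \<Omega> p *\<^sub>R m p) \<bullet> nabla \<phi> p)"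
 proof (rule inner_nabla_integral(1)[OF _ loc_int_bounded \<phi>])
  show "norm (\<I> \<Omega> p *\<^sub>R m p) <= 1" for p using stateD(2)[OF s, of p] by (simp add: indicator_def)
 qed measurable
 then show "integrable lborel (%p. \<I> \<Omega> p * (m p \<bullet> nabla \<phi> p))" by simp
qed

text \<open>All conditions of a state are linear except the bound on the norm, which is
  convex.\<close>

lemma state_midpoint:
 assumes s: "state \<Omega> m G H" "state \<Omega> m' G' H'" and \<Omega>: "\<Omega> \<in> sets borel"
 shows "state \<Omega> (%p. (1/2) *\<^sub>R m p + (1/2) *\<^sub>R m' p) (%c p. (1/2) *\<^sub>R G c p + (1/2) *\<^sub>R G' c p) (%p. (1/2) *\<^sub>R H p + (1/2) *\<^sub>R H' p)"
 unfolding state_def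
proof (intro conjI ballI allI)
 note [measurable] = stateD(1)[OF s(1)] stateD(1)[OF s(2)]
 show "(%p. (1/2) *\<^sub>R m p + (1/2) *\<^sub>R m' p) \<in> \<B>" by measurable
 show "norm ((1/2) *\<^sub>R m p + (1/2) *\<^sub>R m' p) <= 1" for p
  using norm_triangle_ineq[of "(1/2) *\<^sub>R m p" "(1/2) *\<^sub>R m' p"] stateD(2)[OF s(1), of p] stateD(2)[OF s(2), of p] by simp
 show "wgrad \<Omega> (%p. ((1/2) *\<^sub>R m p + (1/2) *\<^sub>R m' p) \<bullet> c) (%p. (1/2) *\<^sub>R G c p + (1/2) *\<^sub>R G' c p)" if "c \<in> Basis" for c
  using wgrad_lincomb[OF stateD(3)[OF s(1) that] stateD(3)[OF s(2) that], of "1/2" "1/2"] by (simp only: inner_add_left inner_scaleR_left)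
 obtain u u' where "wgrad UNIV u H" "wgrad UNIV u' H'" using stateD(4)[OF s(1)] stateD(4)[OF s(2)] by blast
 from wgrad_lincomb[OF this, of "1/2" "1/2"] show "\<exists>u. wgrad UNIV u (%p. (1/2) *\<^sub>R H p + (1/2) *\<^sub>R H' p)" by blast
 fix \<phi> :: "space => real" assume \<phi>: "\<phi> \<in> test_functions UNIV"
 note i = state_field_integrable[OF s(1) \<Omega> \<phi>] state_field_integrable[OF s(2) \<Omega> \<phi>]
 have "(LBINT p. ((1/2) *\<^sub>R H p + (1/2) *\<^sub>R H' p) \<bullet> nabla \<phi> p) = (LBINT p. (1/2) * (H p \<bullet> nabla \<phi> p) + (1/2) * (H' p \<bullet> nabla \<phi> p))"
  by (simp only: inner_add_left inner_scaleR_left)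
 also have "... = (1/2) * (LBINT p. H p \<bullet> nabla \<phi> p) + (1/2) * (LBINT p. H' p \<bullet> nabla \<phi> p)"
  using i by (subst Bochner_Integration.integral_add) auto
 also have "... = (LBINT p. (1/2) * (\<I> \<Omega> p * (m p \<bullet> nabla \<phi> p)) + (1/2) * (\<I> \<Omega> p * (m' p \<bullet> nabla \<phi> p)))"
  using i by (subst Bochner_Integration.integral_add) (auto simp: stateD(7)[OF s(1) \<phi>] stateD(7)[OF s(2) \<phi>])
 also have "... = (LBINT p. \<I> \<Omega> p * (((1/2) *\<^sub>R m p + (1/2) *\<^sub>R m' p) \<bullet> nabla \<phi> p))"
  by (intro Bochner_Integration.integral_cong refl) (simp only: inner_add_left inner_scaleR_left distrib_left mult.left_commute)
 finally show "(LBINT p. ((1/2) *\<^sub>R H p + (1/2) *\<^sub>R H' p) \<bullet> nabla \<phi> p) = (LBINT p. \<I> \<Omega> p * (((1/2) *\<^sub>R m p + (1/2) *\<^sub>R m' p) \<bullet> nabla \<phi> p))" .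
qed

text \<open>Gradients and fields converge strongly, the magnetizations only pointwise; together with
  the bound 1 this is local L2 convergence, which suffices for the weak equations. That H0 is again
  a gradient comes from \<open>gradients_closed\<close>, since nothing is known about convergence of
  the potentials.\<close>

lemma state_limit:
 assumes s: "!!n. state \<Omega> (m n) (G n) (H n)" and \<Omega>: "open \<Omega>"
  and m0 [measurable]: "m0 \<in> \<B>" "!!p. norm (m0 p) <= 1" and mG: "!!c. c \<in> Basis ==> G0 c \<in> \<B>" "H0 \<in> \<B>"
  and lm: "AE p in lborel. p \<in> \<Omega> --> (%n. m n p) \<longlonglongrightarrow> m0 p"
  and lim: "!!c. c \<in> Basis ==> (%n. gnorm \<Omega> (%p. G n c p - G0 c p)) \<longlonglongrightarrow> 0" "(%n. gnorm UNIV (%p. H n p - H0 p)) \<longlonglongrightarrow> 0"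
 shows "state \<Omega> m0 G0 H0"
 unfolding state_def
proof (intro conjI ballI allI m0)
 have [measurable]: "\<Omega> \<in> sets borel" using \<Omega> by simp
 note [measurable] = mG(2) stateD(1,5)[OF s]
 have small: "(%n. gnorm K (f n)) \<longlonglongrightarrow> 0" if "(%n. gnorm L (f n)) \<longlonglongrightarrow> 0" "K \<subseteq> L" for K L and f :: "nat => space => space"
  by (rule tendsto_sandwich[OF always_eventually always_eventually tendsto_const that(1)]) (use gnorm_mono[OF that(2)] in auto)
 show "wgrad \<Omega> (%p. m0 p \<bullet> c) (G0 c)" if c: "c \<in> Basis" for c
 proof (rule wgrad_limit[OF stateD(3)[OF s c] _ mG(1)[OF c]])
  fix K assume K: "compact K" "K \<subseteq> \<Omega>"
  show "(%n. gnorm K (%x. G n c x - G0 c x)) \<longlonglongrightarrow> 0" by (rule small[OF lim(1)[OF c] K(2)])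
  have KB: "K \<in> sets borel" using K(1) by (intro borel_closed compact_imp_closed)
  have "(%n. gnorm K (%p. m n p - m0 p)) \<longlonglongrightarrow> 0"
  proof (rule gnorm_dominated_limit[OF _ m0(1) KB compact_imp_bounded[OF K(1)] stateD(2)[OF s] m0(2)])
   show "AE p in lborel. p \<in> K --> (%n. m n p) \<longlonglongrightarrow> m0 p" using lm by eventually_elim (use K(2) in auto)
  qed measurable
  from gnorm_inner_limit[OF this KB stateD(1)[OF s] m0(1), of c] show "(%n. gnorm K (%x. m n x \<bullet> c - m0 x \<bullet> c)) \<longlonglongrightarrow> 0" .
 qed measurable
 have "\<forall>n. \<exists>u. wgrad UNIV u (H n)" using stateD(4)[OF s] by blast
 then obtain u where u: "!!n. wgrad UNIV (u n) (H n)" by metis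
 obtain u0 where u0: "wgrad UNIV u0 H0" using gradients_closed[OF u mG(2) lim(2)] by blast
 then show "\<exists>u. wgrad UNIV u H0" by blast
 fix \<phi> :: "space => real" assume \<phi>: "\<phi> \<in> test_functions UNIV"
 note [measurable] = test_borel[OF \<phi>]
 obtain K B where K: "compact K" "B > 0" "!!x. norm (nabla \<phi> x) <= B * \<I> K x"
  by (rule test_bounded[OF \<phi>], (rule that; simp))
 have KB [measurable]: "K \<in> sets borel" using K(1) by (intro borel_closed compact_imp_closed)
 have i: "integrable lborel (%x. (nabla \<phi> x \<bullet> b) * (h x \<bullet> b))" if "wgrad UNIV v h" for v and h :: "space => space" and b
  using loc_int_test[OF loc_int_inner[OF wgradD(4)[OF that], of b] _ test_nabla_inner[OF \<phi>, of b]] wgradD(2)[OF that] by simp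
 have l: "(%n. \<integral>x. (nabla \<phi> x \<bullet> b) * (H n x \<bullet> b) \<partial>lborel) \<longlonglongrightarrow> (LBINT x. (nabla \<phi> x \<bullet> b) * (H0 x \<bullet> b))" if b: "b \<in> Basis" for b
 proof (rule L2_integral_limit[OF _ _ _ KB compact_imp_bounded[OF K(1)] _ i[OF u] i[OF u0]])
  show "\<bar>nabla \<phi> x \<bullet> b\<bar> <= B * \<I> K x" for x using Basis_le_norm[OF b, of "nabla \<phi> x"] K(3)[of x] by linarith
  show "(%n. gnorm K (%x. H n x \<bullet> b - H0 x \<bullet> b)) \<longlonglongrightarrow> 0"
   by (rule gnorm_inner_limit[OF small[OF lim(2) subset_UNIV] KB]) measurable
 qed measurable
 have l1: "(%n. \<integral>p. H n p \<bullet> nabla \<phi> p \<partial>lborel) \<longlonglongrightarrow> (LBINT p. H0 p \<bullet> nabla \<phi> p)"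
  unfolding inner_nabla_integral(2)[OF wgradD(2,4)[OF u] \<phi>] inner_nabla_integral(2)[OF wgradD(2,4)[OF u0] \<phi>] by (intro tendsto_sum l)
 have "(%n. \<integral>p. \<I> \<Omega> p * (m n p \<bullet> nabla \<phi> p) \<partial>lborel) \<longlonglongrightarrow> (LBINT p. \<I> \<Omega> p * (m0 p \<bullet> nabla \<phi> p))"
 proof (rule integral_dominated_convergence[where w="%p. B * \<I> K p"])
  show "integrable lborel (%p. B * \<I> K p)"
   by (rule bounded_support_integrable[OF _ KB compact_imp_bounded[OF K(1)], of _ B]) (use K(2) in auto)
  show "AE p in lborel. norm (\<I> \<Omega> p * (m n p \<bullet> nabla \<phi> p)) <= B * \<I> K p" for n
  proof (rule AE_I2)
   fix p
   have "\<bar>m n p \<bullet> nabla \<phi> p\<bar> <= norm (m n p) * norm (nabla \<phi> p)" by (rule Cauchy_Schwarz_ineq2)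
   also have "... <= 1 * (B * \<I> K p)" by (intro mult_mono stateD(2)[OF s] K(3)) auto
   finally show "norm (\<I> \<Omega> p * (m n p \<bullet> nabla \<phi> p)) <= B * \<I> K p" using K(2) by (auto simp: indicator_def)
  qed
  show "AE p in lborel. (%n. \<I> \<Omega> p * (m n p \<bullet> nabla \<phi> p)) \<longlonglongrightarrow> \<I> \<Omega> p * (m0 p \<bullet> nabla \<phi> p)"
   using lm
  proof eventually_elim
   fix p assume a: "p \<in> \<Omega> --> (%n. m n p) \<longlonglongrightarrow> m0 p"
   show "(%n. \<I> \<Omega> p * (m n p \<bullet> nabla \<phi> p)) \<longlonglongrightarrow> \<I> \<Omega> p * (m0 p \<bullet> nabla \<phi> p)"
   proof (cases "p \<in> \<Omega>")
    case True
    then show ?thesis using a by (intro tendsto_intros) auto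
   qed simp
  qed
 qed measurable
 with l1 show "(LBINT p. H0 p \<bullet> nabla \<phi> p) = (LBINT p. \<I> \<Omega> p * (m0 p \<bullet> nabla \<phi> p))"
  unfolding stateD(7)[OF s \<phi>] by (rule LIMSEQ_unique)
qed

text \<open>Minimal elements of the convex sets of averages of tails converge strongly, whereas their
magnetizations keep the pointwise limit.\<close>

theorem lower_semicontinuity:
 assumes \<Omega>: "open \<Omega>" and s: "!!n. state \<Omega> (m n) (G n) (H n)" and I: "I >= 0"
  and en: "!!n. local_energy \<Omega> UNIV (G n) (H n) <= ennreal (I + 1 / real (Suc n))"
  and m0: "m0 \<in> \<B>" "!!p. norm (m0 p) <= 1"
  and lm: "AE p in lborel. p \<in> \<Omega> --> (%n. m n p) \<longlonglongrightarrow> m0 p"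
 obtains G0 H0 where "state \<Omega> m0 G0 H0" "local_energy \<Omega> UNIV G0 H0 <= ennreal I"
proof -
 have ob: "\<Omega> \<in> sets borel" using \<Omega> by simp
 define b where "b n = I + 1 / real (Suc n)" for n
 have b: "b n >= 0" "b (Suc n) <= b n" "b n <= I + 1" for n using I by (auto simp: b_def field_simps)
 have bI: "b \<longlonglongrightarrow> I"
  using tendsto_add[OF tendsto_const[of I] LIMSEQ_inverse_real_of_nat] by (simp add: b_def[abs_def] inverse_eq_divide)
 \<comment> \<open>The last condition is what membership in the closed convex hull of the tail
   \<open>m k\<close>, \<open>k >= n\<close>, yields at a single point: every ball about m0 that
   contains the tail contains m'. It is stable under midpoints and forces m' to follow the tail to
   m0.\<close>
 define S where "S n = {(m', G', H'). state \<Omega> m' G' H' & local_energy \<Omega> UNIV G' H' <= ennreal (b n) &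
  (\<forall>p \<epsilon>. (\<forall>k\<ge>n. norm (m k p - m0 p) <= \<epsilon>) --> norm (m' p - m0 p) <= \<epsilon>)}" for n
 define N where "N x = (case x of (m' :: space => space, G', H') => enn2real (local_energy \<Omega> UNIV G' H'))" for x
 define mid where "mid x y = (case x of (m1 :: space => space, G1 :: space => space => space, Ha :: space => space) => case y of (m2 :: space => space, G2 :: space => space => space, H2 :: space => space) =>
  (%p. (1/2) *\<^sub>R m1 p + (1/2) *\<^sub>R m2 p, %c p. (1/2) *\<^sub>R G1 c p + (1/2) *\<^sub>R G2 c p, %p. (1/2) *\<^sub>R Ha p + (1/2) *\<^sub>R H2 p))" for x y
 define d where "d x y = (case x of (m1 :: space => space, G1, Ha) => case y of (m2 :: space => space, G2, H2) =>
  enn2real (local_energy \<Omega> UNIV (%c p. G1 c p - G2 c p) (%p. Ha p - H2 p)))" for x y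
 \<comment> \<open>All four energies are finite, so the parallelogram identity can be read in the
   reals, where \<open>midpoint_minimizing_Cauchy\<close> needs it.\<close>
 have fin: "\<exists>e e1 e2 e'. local_energy \<Omega> UNIV G1 Ha = ennreal e1 & local_energy \<Omega> UNIV G2 H2 = ennreal e2 &
   local_energy \<Omega> UNIV (%c p. (1/2) *\<^sub>R G1 c p + (1/2) *\<^sub>R G2 c p) (%p. (1/2) *\<^sub>R Ha p + (1/2) *\<^sub>R H2 p) = ennreal e &
   local_energy \<Omega> UNIV (%c p. G1 c p - G2 c p) (%p. Ha p - H2 p) = ennreal e' & 4 * e + e' = 2 * e1 + 2 * e2 & 0 <= e & 0 <= e' & 0 <= e1 & 0 <= e2"
  if st: "state \<Omega> m1 G1 Ha" "state \<Omega> m2 G2 H2" and f: "local_energy \<Omega> UNIV G1 Ha < \<infinity>" "local_energy \<Omega> UNIV G2 H2 < \<infinity>"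
  for m1 G1 Ha m2 G2 H2
 proof -
  let ?a = "local_energy \<Omega> UNIV (%c p. (1/2) *\<^sub>R G1 c p + (1/2) *\<^sub>R G2 c p) (%p. (1/2) *\<^sub>R Ha p + (1/2) *\<^sub>R H2 p)"
  let ?b = "local_energy \<Omega> UNIV (%c p. G1 c p - G2 c p) (%p. Ha p - H2 p)"
  have par: "4 * ?a + ?b = 2 * local_energy \<Omega> UNIV G1 Ha + 2 * local_energy \<Omega> UNIV G2 H2"
   by (rule local_energy_parallelogram[OF stateD(6)[OF st(1)] stateD(5)[OF st(1)] stateD(6)[OF st(2)] stateD(5)[OF st(2)] ob])
  have "4 * ?a + ?b < \<infinity>" unfolding par using f by (simp add: ennreal_mult_less_top)
  then have fa: "?a < \<infinity>" and fb: "?b < \<infinity>" by (auto simp: ennreal_mult_less_top)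
  have fr: "\<exists>r. x = ennreal r & 0 <= r" if "x < \<infinity>" for x using that by (cases x) auto
  obtain e where e1: "?a = ennreal e" "0 <= e" using fr[OF fa] by (elim exE conjE)
  obtain e' where e2: "?b = ennreal e'" "0 <= e'" using fr[OF fb] by (elim exE conjE)
  note e = e1(1) e2(1) e1(2) e2(2)
  obtain e1 where f1: "local_energy \<Omega> UNIV G1 Ha = ennreal e1" "0 <= e1" using fr[OF f(1)] by (elim exE conjE)
  obtain e2 where f2: "local_energy \<Omega> UNIV G2 H2 = ennreal e2" "0 <= e2" using fr[OF f(2)] by (elim exE conjE)
  note f' = f1(1) f2(1) f1(2) f2(2)
  have "ennreal (4 * e + e') = ennreal (2 * e1 + 2 * e2)" using par e f' by (simp add: ennreal_mult)
  then have "4 * e + e' = 2 * e1 + 2 * e2" using e f' by (subst (asm) ennreal_inj) auto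
  then show ?thesis using e f' by (intro exI conjI)
 qed
 have S: "state \<Omega> (fst x) (fst (snd x)) (snd (snd x))" "local_energy \<Omega> UNIV (fst (snd x)) (snd (snd x)) <= ennreal (b n)"
  "!!p \<epsilon>. (\<forall>k\<ge>n. norm (m k p - m0 p) <= \<epsilon>) ==> norm (fst x p - m0 p) <= \<epsilon>" if "x \<in> S n" for x n
  using that by (auto simp: S_def split_beta)
 have Sfin: "local_energy \<Omega> UNIV (fst (snd x)) (snd (snd x)) < \<infinity>" if "x \<in> S n" for x n
  using S(2)[OF that] by (simp add: le_less_trans)
 note fin' = fin[OF S(1) S(1) Sfin Sfin]
 obtain y where y: "!!n. y n \<in> S n" "!!\<epsilon>::real. \<epsilon> > 0 ==> \<exists>M. \<forall>n\<ge>M. \<forall>k\<ge>M. d (y n) (y k) <= \<epsilon>"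
 proof (rule midpoint_minimizing_Cauchy[of S N "I + 1" mid d])
  show "S (Suc n) \<subseteq> S n" for n
   unfolding S_def using order_trans[OF _ ennreal_leI[OF b(2)[of n]]] by (auto dest: Suc_leD)
  show "S n ~= {}" for n
  proof -
   have "(m n, G n, H n) \<in> S n" unfolding S_def using s en by (auto simp: b_def)
   then show ?thesis by blast
  qed
  show "N x >= 0" for x by (cases x) (simp add: N_def)
  show "N x <= I + 1" if "x \<in> S n" for x n
  proof -
   have "local_energy \<Omega> UNIV (fst (snd x)) (snd (snd x)) <= ennreal (I + 1)" by (rule order_trans[OF S(2)[OF that] ennreal_leI[OF b(3)]])
   then show ?thesis using I by (auto simp: N_def split_beta intro: enn2real_leI)
  qed
  show "d x y' = 2 * N x + 2 * N y' - 4 * N (mid x y')" if "x \<in> S 0" "y' \<in> S 0" for x y'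
  proof -
   show ?thesis using fin'[OF that that] by (auto simp: d_def N_def mid_def split_beta)
  qed
  show "mid x y' \<in> S n" if x: "x \<in> S n" "y' \<in> S n" for n x y'
  proof -
   obtain e e1 e2 e' where e: "local_energy \<Omega> UNIV (fst (snd x)) (snd (snd x)) = ennreal e1" "local_energy \<Omega> UNIV (fst (snd y')) (snd (snd y')) = ennreal e2"
    "local_energy \<Omega> UNIV (%c p. (1/2) *\<^sub>R fst (snd x) c p + (1/2) *\<^sub>R fst (snd y') c p) (%p. (1/2) *\<^sub>R snd (snd x) p + (1/2) *\<^sub>R snd (snd y') p) = ennreal e"
    "4 * e + e' = 2 * e1 + 2 * e2" "0 <= e'" "0 <= e1" "0 <= e2" using fin'[OF x x] by blast
   have "e1 <= b n" "e2 <= b n" using S(2)[OF x(1)] S(2)[OF x(2)] e b(1)[of n] by (simp_all add: ennreal_le_iff)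
   \<comment> \<open>Convexity of the energy: the nonnegative e' is dropped from the parallelogram
     identity.\<close>
   then have "e <= b n" using e(4,5) by argo
   moreover have "norm ((1/2) *\<^sub>R fst x p + (1/2) *\<^sub>R fst y' p - m0 p) <= \<epsilon>" if "\<forall>k\<ge>n. norm (m k p - m0 p) <= \<epsilon>" for p \<epsilon>
   proof -
    have h: "(1/2) *\<^sub>R m0 p + (1/2) *\<^sub>R m0 p = m0 p" by (simp only: scaleR_add_left[symmetric]) simp
    have "(1/2) *\<^sub>R fst x p + (1/2) *\<^sub>R fst y' p - m0 p = (1/2) *\<^sub>R (fst x p - m0 p) + (1/2) *\<^sub>R (fst y' p - m0 p)"
     by (simp only: scaleR_right_diff_distrib add_diff_add[symmetric] h)
    then show ?thesis
     using norm_triangle_ineq[of "(1/2) *\<^sub>R (fst x p - m0 p)" "(1/2) *\<^sub>R (fst y' p - m0 p)"] S(3)[OF x(1) that] S(3)[OF x(2) that] by simp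
   qed
   ultimately show ?thesis
    using state_midpoint[OF S(1)[OF x(1)] S(1)[OF x(2)] ob] e(3) by (auto simp: S_def mid_def split_beta intro: ennreal_leI)
  qed
 next
  fix y assume a: "!!n. y n \<in> S n" "!!\<epsilon>::real. \<epsilon> > 0 ==> \<exists>M. \<forall>n\<ge>M. \<forall>k\<ge>M. d (y n) (y k) <= \<epsilon>"
  show thesis by (rule that[of y, OF a])
 qed
 define m1 where "m1 n = fst (y n)" for n
 define G1 where "G1 n = fst (snd (y n))" for n
 define Ha where "Ha n = snd (snd (y n))" for n
 note y' = S[OF y(1), folded m1_def G1_def Ha_def]
 have cau: "\<exists>M. \<forall>n\<ge>M. \<forall>k\<ge>M. local_energy \<Omega> UNIV (%c p. G1 n c p - G1 k c p) (%p. Ha n p - Ha k p) <= ennreal \<epsilon>" if e0: "\<epsilon> > 0" for \<epsilon>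
 proof -
  obtain M where M: "!!n k. n >= M ==> k >= M ==> d (y n) (y k) <= \<epsilon>" using y(2)[OF e0] by blast
  have "local_energy \<Omega> UNIV (%c p. G1 n c p - G1 k c p) (%p. Ha n p - Ha k p) <= ennreal \<epsilon>" if "n >= M" "k >= M" for n k
  proof -
   have "local_energy \<Omega> UNIV (%c p. G1 n c p - G1 k c p) (%p. Ha n p - Ha k p) = ennreal (d (y n) (y k))"
    using fin'[OF y(1)[of n] y(1)[of k] y(1)[of n] y(1)[of k]] by (auto simp: d_def split_beta G1_def Ha_def)
   also have "... <= ennreal \<epsilon>" by (intro ennreal_leI M that)
   finally show ?thesis .
  qed
  then show ?thesis by blast
 qed
 have "\<forall>c\<in>Basis. \<exists>g. g \<in> \<B> & (%n. gnorm \<Omega> (%p. G1 n c p - g p)) \<longlonglongrightarrow> 0"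
 proof
  fix c :: space assume c: "c \<in> Basis"
  have K: "\<Omega> \<in> sets borel" "\<Omega> \<subseteq> \<Omega>" using ob by auto
  have "\<exists>M. \<forall>n\<ge>M. \<forall>k\<ge>M. gnorm \<Omega> (%p. G1 n c p - G1 k c p) <= ennreal \<epsilon>" if "\<epsilon> > 0" for \<epsilon>
  proof -
   have le: "gnorm \<Omega> (%p. G1 n c p - G1 k c p) <= local_energy \<Omega> UNIV (%c p. G1 n c p - G1 k c p) (%p. Ha n p - Ha k p)" for n k
    unfolding local_energy_def Int_UNIV_right
    using member_le_sum[OF c, of "%c. gnorm \<Omega> (%p. G1 n c p - G1 k c p)"] by (simp add: add_increasing2)
   show ?thesis using cau[OF that]
   proof (elim exE)
    fix M assume M: "\<forall>n\<ge>M. \<forall>k\<ge>M. local_energy \<Omega> UNIV (%c p. G1 n c p - G1 k c p) (%p. Ha n p - Ha k p) <= ennreal \<epsilon>"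
    show ?thesis by (intro exI[of _ M] allI impI order_trans[OF le] M[rule_format])
   qed
  qed
  note cG = this
  show "\<exists>g. g \<in> \<B> & (%n. gnorm \<Omega> (%p. G1 n c p - g p)) \<longlonglongrightarrow> 0"
  proof (rule locally_L2_Cauchy[of "%n. G1 n c" "%_. \<Omega>", OF stateD(6)[OF y'(1) c] K cG])
   fix r g assume a: "g \<in> \<B>" "!!j :: nat. (%n. gnorm \<Omega> (%p. G1 n c p - g p)) \<longlonglongrightarrow> 0"
   show ?thesis by (rule exI[of _ g], rule conjI[OF a(1) a(2)])
  qed
 qed
 from bchoice[OF this]
 obtain G0 where g0: "\<forall>c\<in>Basis. G0 c \<in> \<B> & (%n. gnorm \<Omega> (%p. G1 n c p - G0 c p)) \<longlonglongrightarrow> 0" ..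
 note G0 = conjunct1[OF bspec[OF g0]] conjunct2[OF bspec[OF g0]]
 have "\<exists>M. \<forall>n\<ge>M. \<forall>k\<ge>M. gnorm UNIV (%p. Ha n p - Ha k p) <= ennreal \<epsilon>" if "\<epsilon> > 0" for \<epsilon>
 proof -
  have le: "gnorm UNIV (%p. Ha n p - Ha k p) <= local_energy \<Omega> UNIV (%c p. G1 n c p - G1 k c p) (%p. Ha n p - Ha k p)" for n k
   unfolding local_energy_def by (simp add: add_increasing)
  show ?thesis using cau[OF that]
   proof (elim exE)
    fix M assume M: "\<forall>n\<ge>M. \<forall>k\<ge>M. local_energy \<Omega> UNIV (%c p. G1 n c p - G1 k c p) (%p. Ha n p - Ha k p) <= ennreal \<epsilon>"
    show ?thesis by (intro exI[of _ M] allI impI order_trans[OF le] M[rule_format])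
   qed
 qed
 note cH = this
 have "\<exists>g. g \<in> \<B> & (%n. gnorm UNIV (%p. Ha n p - g p)) \<longlonglongrightarrow> 0"
 proof (rule locally_L2_Cauchy[of Ha "%_. UNIV", OF stateD(5)[OF y'(1)] _ _ cH])
  fix r g assume a: "g \<in> \<B>" "!!j :: nat. (%n. gnorm UNIV (%p. Ha n p - g p)) \<longlonglongrightarrow> 0"
  show ?thesis by (rule exI[of _ g], rule conjI[OF a(1) a(2)])
 qed simp_all
 then obtain H0 where H0: "H0 \<in> \<B>" "(%n. gnorm UNIV (%p. Ha n p - H0 p)) \<longlonglongrightarrow> 0" by (elim exE conjE)
 \<comment> \<open>The last condition in S, applied with the radius of the tail, transfers the
   convergence to the averages.\<close>
 have lm1: "AE p in lborel. p \<in> \<Omega> --> (%n. m1 n p) \<longlonglongrightarrow> m0 p"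
  using lm
 proof eventually_elim
  fix p assume a: "p \<in> \<Omega> --> (%n. m n p) \<longlonglongrightarrow> m0 p"
  show "p \<in> \<Omega> --> (%n. m1 n p) \<longlonglongrightarrow> m0 p"
  proof (intro impI LIMSEQ_I)
   fix r :: real assume "p \<in> \<Omega>" "r > 0"
   then obtain n0 where n0: "!!k. k >= n0 ==> norm (m k p - m0 p) < r / 2" using a LIMSEQ_D[of "%n. m n p" "m0 p" "r / 2"] by auto
   have "norm (m1 n p - m0 p) < r" if "n >= n0" for n
   proof -
    have "norm (m1 n p - m0 p) <= r / 2" using n0 that by (intro y'(3)[of n]) (auto intro: less_imp_le)
    then show ?thesis using \<open>r > 0\<close> by simp
   qed
   then show "\<exists>no. \<forall>n\<ge>no. norm (m1 n p - m0 p) < r" by blast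
  qed
 qed
 show ?thesis
 proof (rule that)
  show "state \<Omega> m0 G0 H0" by (rule state_limit[OF y'(1) \<Omega> m0 G0(1) H0(1) lm1 G0(2) H0(2)])
  show "local_energy \<Omega> UNIV G0 H0 <= ennreal I"
   by (rule local_energy_limit[OF stateD(6)[OF y'(1)] stateD(5)[OF y'(1)] G0(1) H0(1) ob G0(2) H0(2) y'(2) bI])
 qed
qed

section \<open>Limits of translated states and the minimizer\<close>

lemma local_energy_shift:
 assumes s: "state (UNIV \<times> \<omega>) m G H" and om: "\<omega> \<in> sets borel"
 shows "local_energy (UNIV \<times> \<omega>) UNIV (%c. shift k (G c)) (shift k H) = local_energy (UNIV \<times> \<omega>) UNIV G H"
proof -
 have O: "(UNIV \<times> \<omega> :: space set) \<in> sets borel" using om by (intro borel_Times) auto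
 have "gnorm (UNIV \<times> \<omega>) (shift k g) = gnorm (UNIV \<times> \<omega>) g" "gnorm UNIV (shift k g) = gnorm UNIV g"
  if "g \<in> \<B>" for g :: "space => space"
  unfolding shift_def[abs_def] by (rule gnorm_shift[OF that]; use O in auto)+
 then show ?thesis using stateD(5,6)[OF s] unfolding local_energy_def Int_UNIV_right by (intro arg_cong2[where f="(+)"] sum.cong) auto
qed

lemma cell_avg_limit:
 assumes om: "open \<omega>" "bounded \<omega>" "\<omega> ~= {}" and f [measurable]: "!!n. f n \<in> \<B>" "f0 \<in> \<B>"
  and b: "!!n p. norm (f n p) <= 1" and lim: "AE p in lborel. p \<in> UNIV \<times> \<omega> --> (%n. f n p) \<longlonglongrightarrow> f0 p"
 shows "(%n. cell_avg \<omega> (shift j (f n))) \<longlonglongrightarrow> cell_avg \<omega> (shift j f0)"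
proof -
 note cf = cell0_facts[OF om]
 note [measurable] = cf(1)
 define T where "T = {p :: space. p + of_int (- j) *\<^sub>R ex \<in> cell0 \<omega>}"
 have Tm: "T \<in> sets borel" unfolding T_def by measurable
 note [measurable] = Tm
 have T: "p + of_int j *\<^sub>R ex \<in> T \<longleftrightarrow> p \<in> cell0 \<omega>" for p by (cases p) (auto simp: T_def)
 have "T \<subseteq> (+) (of_int j *\<^sub>R ex) ` cell0 \<omega>"
 proof
  fix p assume "p \<in> T"
  then have "p + of_int (- j) *\<^sub>R ex \<in> cell0 \<omega>" by (simp only: T_def mem_Collect_eq)
  then show "p \<in> (+) (of_int j *\<^sub>R ex) ` cell0 \<omega>"
   by (rule rev_image_eqI) (cases p, simp)
 qed
 then have Tb: "bounded T" using bounded_translation[OF cf(2)] bounded_subset by blast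
 have TO: "p \<in> UNIV \<times> \<omega>" if "p \<in> T" for p using that by (cases p) (auto simp: T_def cell0_def)
 have av: "cell_avg \<omega> (shift j h) = (LBINT p. \<I> T p * (h p \<bullet> ex)) / measure lborel (cell0 \<omega>)"
  if h: "h \<in> \<B>" for h
 proof -
  have "(LBINT p. \<I> (cell0 \<omega>) p * (shift j h p \<bullet> ex)) = (LBINT p. \<I> T (p + of_int j *\<^sub>R ex) * (h (p + of_int j *\<^sub>R ex) \<bullet> ex))"
   by (simp only: indicator_def T shift_def)
  also have "... = (LBINT p. \<I> T p * (h p \<bullet> ex))"
   by (rule integral_shift[where F="%p. \<I> T p * (h p \<bullet> ex)"])
    (rule borel_measurable_times[OF borel_measurable_indicator[OF Tm] borel_measurable_inner[OF h borel_measurable_const[of ex]]])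
  finally show ?thesis by (simp only: cell_avg_def)
 qed
 have exB: "ex \<in> Basis" by (simp add: space_Basis)
 have "(%n. \<integral>p. \<I> T p * (f n p \<bullet> ex) \<partial>lborel) \<longlonglongrightarrow> (LBINT p. \<I> T p * (f0 p \<bullet> ex))"
 proof (rule integral_dominated_convergence[where w="%p. \<I> T p"])
  show "(%p. \<I> T p * (f0 p \<bullet> ex)) \<in> borel_measurable lborel"
   using borel_measurable_times[OF borel_measurable_indicator[OF Tm] borel_measurable_inner[OF f(2) borel_measurable_const[of ex]]] by simp
  show "(%p. \<I> T p * (f n p \<bullet> ex)) \<in> borel_measurable lborel" for n
   using borel_measurable_times[OF borel_measurable_indicator[OF Tm] borel_measurable_inner[OF f(1)[of n] borel_measurable_const[of ex]]] by simp
  show "integrable lborel (%p. \<I> T p :: real)"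
   using emeasure_bounded_finite[OF Tb] by (simp add: integrable_indicator_iff)
  show "AE p in lborel. norm (\<I> T p * (f n p \<bullet> ex)) <= \<I> T p" for n
  proof (rule AE_I2)
   fix p
   have "\<bar>f n p \<bullet> ex\<bar> <= 1" using Basis_le_norm[OF exB, of "f n p"] b[of n p] by linarith
   then show "norm (\<I> T p * (f n p \<bullet> ex)) <= \<I> T p" by (simp add: indicator_def)
  qed
  show "AE p in lborel. (%n. \<I> T p * (f n p \<bullet> ex)) \<longlonglongrightarrow> \<I> T p * (f0 p \<bullet> ex)"
   using lim
  proof eventually_elim
   fix p assume a: "p \<in> UNIV \<times> \<omega> --> (%n. f n p) \<longlonglongrightarrow> f0 p"
   show "(%n. \<I> T p * (f n p \<bullet> ex)) \<longlonglongrightarrow> \<I> T p * (f0 p \<bullet> ex)"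
   proof (cases "p \<in> T")
    case True
    then have "(%n. f n p) \<longlonglongrightarrow> f0 p" using a TO by blast
    then show ?thesis by (intro tendsto_mult tendsto_inner tendsto_const)
   next
    case False
    then show ?thesis by (simp only: indicator_simps simp_thms mult_zero_left tendsto_const)
   qed
  qed
 qed
 then show ?thesis unfolding av[OF f(1)] av[OF f(2)] by (intro tendsto_divide tendsto_const) (use cf(3) in auto)
qed

text \<open>Since each translate has boundedly many cells without a definite sign, suitable
translations move a transition from \<open>-1\<close> to \<open>1\<close> into a fixed bounded region, up to ever
larger distances.\<close>

lemma translated_limit:
 assumes om: "C1_domain \<omega>" "bounded \<omega>" and s: "!!n. state (UNIV \<times> \<omega>) (m n) (G n) (H n)" and u: "!!n. unit_on (UNIV \<times> \<omega>) (m n)"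
  and d: "!!n. gnorm (UNIV \<times> \<omega>) (%p. m n p - e_bar p) < \<infinity>"
  and en: "!!n. local_energy (UNIV \<times> \<omega>) UNIV (G n) (H n) <= ennreal E" and E: "E >= 0"
 obtains q :: "nat => nat" and k m0 L where "!!n. n <= q n" "m0 \<in> \<B>" "!!p. norm (m0 p) <= 1" "unit_on (UNIV \<times> \<omega>) m0"
  "AE p in lborel. p \<in> UNIV \<times> \<omega> --> (%n. shift (k n) (m (q n)) p) \<longlonglongrightarrow> m0 p"
  "!!j. j >= L ==> cell_avg \<omega> (shift j m0) >= 1/2 & cell_avg \<omega> (shift (- j) m0) <= -1/2"
proof -
 let ?\<Omega> = "UNIV \<times> \<omega> :: space set"
 have o: "open \<omega>" "\<omega> ~= {}" and ob: "\<omega> \<in> sets borel" using om by (auto simp: C1_domain_def)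
 have O: "open ?\<Omega>" using o by (intro open_Times) auto
 obtain N where N: "!!m G H. state ?\<Omega> m G H ==> unit_on ?\<Omega> m ==> local_energy ?\<Omega> UNIV G H <= ennreal E ==>
  (let c = (%k. color (cell_avg \<omega> (shift k m))) in
  finite {k. c k = 0 \<or> c (k + 1) ~= c k} & card {k. c k = 0 \<or> c (k + 1) ~= c k} <= N)"
 proof (rule transition_cells_bound[OF om E])
  fix N assume a: "!!m G H. state ?\<Omega> m G H ==> unit_on ?\<Omega> m ==> local_energy ?\<Omega> UNIV G H <= ennreal E ==>
  (let c = (%k. color (cell_avg \<omega> (shift k m))) in
  finite {k. c k = 0 \<or> c (k + 1) ~= c k} & card {k. c k = 0 \<or> c (k + 1) ~= c k} <= N)"
  show thesis by (rule that[of N, OF a])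
 qed
 define c where "c n k = color (cell_avg \<omega> (shift k (m n)))" for n k
 have "\<exists>L. \<forall>R M. \<exists>n\<ge>M. \<exists>k. \<forall>i. L <= i & i <= R --> c n (k + i) = 1 & c n (k - i) = -1"
 proof (rule transition_bounded_scale)
  show "c n k \<in> {-1, 0, 1}" for n k by (auto simp: c_def color_def)
  show "finite {k. c n k = 0 \<or> c n (k + 1) ~= c n k}" "card {k. c n k = 0 \<or> c n (k + 1) ~= c n k} <= N" for n
   using N[OF s[of n] u[of n] en[of n]] unfolding Let_def c_def by blast+
  show "\<exists>k1. \<forall>k\<ge>k1. c n k = 1" "\<exists>k0. \<forall>k\<le>k0. c n k = -1" for n
   unfolding c_def by (rule color_ends[OF o(1) om(2) o(2) stateD(1)[OF s] stateD(2)[OF s] d])+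
 qed
 then obtain L where L: "!!R M. \<exists>n\<ge>M. \<exists>k. \<forall>i. L <= i & i <= R --> c n (k + i) = 1 & c n (k - i) = -1" by blast
 \<comment> \<open>The pair x consists of an index and a translation. For the reach r an index of at
   least r is chosen, so index and reach both tend to infinity while L stays the same.\<close>
 have "\<forall>r. \<exists>x. r <= fst x & (\<forall>i. L <= i & i <= int r --> c (fst x) (snd x + i) = 1 & c (fst x) (snd x - i) = -1)"
 proof
  fix r
  obtain n k where nk: "n >= r" "\<forall>i. L <= i & i <= int r --> c n (k + i) = 1 & c n (k - i) = -1"
   using L[where R="int r" and M=r] by blast
  show "\<exists>x. r <= fst x & (\<forall>i. L <= i & i <= int r --> c (fst x) (snd x + i) = 1 & c (fst x) (snd x - i) = -1)"
   by (rule exI[of _ "(n, k)"], unfold fst_conv snd_conv, rule conjI[OF nk])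
 qed
 from choice[OF this]
 obtain x where x: "\<forall>r. r <= fst (x r) & (\<forall>i. L <= i & i <= int r --> c (fst (x r)) (snd (x r) + i) = 1 & c (fst (x r)) (snd (x r) - i) = -1)" ..
 define nn where "nn r = fst (x r)" for r
 define kk where "kk r = snd (x r)" for r
 have nk: "nn r >= r" "L <= i ==> i <= int r ==> c (nn r) (kk r + i) = 1 & c (nn r) (kk r - i) = -1" for r i
  using spec[OF x, of r] unfolding nn_def kk_def by blast+
 define f where "f r = shift (kk r) (m (nn r))" for r
 have sf: "state ?\<Omega> (f r) (%c. shift (kk r) (G (nn r) c)) (shift (kk r) (H (nn r)))" for r
  unfolding f_def by (rule state_shift_int[OF s ob])
 obtain \<rho> g where \<rho>: "strict_mono (\<rho> :: nat => nat)" and g: "g \<in> \<B>"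
  and fg: "AE p in lborel. p \<in> ?\<Omega> --> (%n. f (\<rho> n) p) \<longlonglongrightarrow> g p"
 proof (rule translation_compactness[OF O stateD(1)[OF sf] stateD(2)[OF sf] E])
  fix n A and v :: space assume A: "A \<in> sets borel" and seg: "!!x t. x \<in> A ==> t \<in> {0..1} ==> x + t *\<^sub>R v \<in> ?\<Omega>"
  have fm: "(%x. f n (x + v)) \<in> \<B>" "f n \<in> \<B>"
   using stateD(1)[OF sf, of n] by measurable
  have "gnorm A (%x. f n (x + v) - f n x) = (\<Sum>c\<in>Basis. gnorm A (%x. (f n (x + v) - f n x) \<bullet> c))"
   by (rule gnorm_components[OF borel_measurable_diff[OF fm] A])
  also have "... <= (\<Sum>c\<in>Basis. ennreal ((norm v)\<^sup>2) * gnorm ?\<Omega> (shift (kk n) (G (nn n) c)))"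
  proof (rule sum_mono)
   fix c :: space assume c: "c \<in> Basis"
   show "gnorm A (%x. (f n (x + v) - f n x) \<bullet> c) <= ennreal ((norm v)\<^sup>2) * gnorm ?\<Omega> (shift (kk n) (G (nn n) c))"
    using wgrad_translation_bound[OF O stateD(3)[OF sf c] A seg] by (simp add: gnorm_def inner_diff_left)
  qed
  also have "... <= ennreal ((norm v)\<^sup>2) * local_energy ?\<Omega> UNIV (%c. shift (kk n) (G (nn n) c)) (shift (kk n) (H (nn n)))"
   unfolding local_energy_def Int_UNIV_right sum_distrib_left[symmetric] by (intro mult_left_mono) simp_all
  also have "... <= ennreal ((norm v)\<^sup>2) * ennreal E"
   unfolding local_energy_shift[OF s ob] by (intro mult_left_mono en) simp
  also have "... = ennreal (E * (norm v)\<^sup>2)" using E by (simp add: ennreal_mult mult.commute)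
  finally show "gnorm A (%x. f n (x + v) - f n x) <= ennreal (E * (norm v)\<^sup>2)" .
 next
  fix r g assume a: "strict_mono (r :: nat => nat)" "g \<in> \<B>" "AE p in lborel. p \<in> ?\<Omega> --> (%n. f (r n) p) \<longlonglongrightarrow> g p"
  show thesis by (rule that[OF a])
 qed
 \<comment> \<open>The limit g is known to have norm 1 only almost everywhere in the wire;
   \<open>ex\<close> elsewhere makes the norm 1 at every point.\<close>
 define m0 where "m0 p = (if norm (g p) = 1 then g p else ex)" for p
 have m0: "m0 \<in> \<B>" unfolding m0_def[abs_def]
  by (rule measurable_If[OF g borel_measurable_const borel_measurable_eq[OF measurable_compose[OF g borel_measurable_norm] borel_measurable_const]])
 have m0n: "norm (m0 p) = 1" for p by (simp add: m0_def norm_prod_def)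
 have uf: "AE p in lborel. \<forall>r. p \<in> ?\<Omega> --> norm (f r p) = 1"
  unfolding AE_all_countable f_def using unit_on_shift[OF u] by (simp add: unit_on_def)
 have lim: "AE p in lborel. p \<in> ?\<Omega> --> (%n. f (\<rho> n) p) \<longlonglongrightarrow> m0 p"
  using fg uf
 proof eventually_elim
  fix p assume a: "p \<in> ?\<Omega> --> (%n. f (\<rho> n) p) \<longlonglongrightarrow> g p" "\<forall>r. p \<in> ?\<Omega> --> norm (f r p) = 1"
  show "p \<in> ?\<Omega> --> (%n. f (\<rho> n) p) \<longlonglongrightarrow> m0 p"
  proof
   assume p: "p \<in> ?\<Omega>"
   have e: "(%n. norm (f (\<rho> n) p)) = (%n. 1)" using a(2) p by (intro ext) blast
   have t: "(%n. norm (f (\<rho> n) p)) \<longlonglongrightarrow> norm (g p)" by (rule tendsto_norm[OF mp[OF a(1) p]])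
   have "norm (g p) = 1" by (rule LIMSEQ_unique[OF t[unfolded e] tendsto_const])
   then have "m0 p = g p" by (simp only: m0_def simp_thms if_True)
   then show "(%n. f (\<rho> n) p) \<longlonglongrightarrow> m0 p" using mp[OF a(1) p] by (simp only:)
  qed
 qed
 have avl: "(%n. cell_avg \<omega> (shift j (f (\<rho> n)))) \<longlonglongrightarrow> cell_avg \<omega> (shift j m0)" for j
  by (rule cell_avg_limit[OF o(1) om(2) o(2) stateD(1)[OF sf] m0 stateD(2)[OF sf] lim])
 have col: "color b = 1 ==> b >= 1/2" "color b = -1 ==> b <= -1/2" for b by (auto simp: color_def split: if_splits)
 have av: "cell_avg \<omega> (shift j m0) >= 1/2 & cell_avg \<omega> (shift (- j) m0) <= -1/2" if j: "j >= L" for j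
 proof
  \<comment> \<open>A fixed j is within reach of all late members of the sequence, so the signs of
    their averages there pass to the limit.\<close>
  have big: "j <= int (\<rho> n)" if "n >= nat j" for n using that seq_suble[OF \<rho>, of n] by linarith
  have "cell_avg \<omega> (shift j (f (\<rho> n))) >= 1/2" if "n >= nat j" for n
   using nk(2)[OF j big[OF that]] col(1) by (simp add: f_def shift_shift c_def)
  then show "cell_avg \<omega> (shift j m0) >= 1/2" by (intro LIMSEQ_le_const[OF avl]) blast
  have "cell_avg \<omega> (shift (- j) (f (\<rho> n))) <= -1/2" if "n >= nat j" for n
   using nk(2)[OF j big[OF that]] col(2) by (simp add: f_def shift_shift c_def)
  then show "cell_avg \<omega> (shift (- j) m0) <= -1/2" by (intro LIMSEQ_le_const2[OF avl]) blast
 qed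
 show ?thesis
 proof (rule that[of "%n. nn (\<rho> n)" m0 "%n. kk (\<rho> n)" L])
  show "n <= nn (\<rho> n)" for n using nk(1)[of "\<rho> n"] seq_suble[OF \<rho>, of n] by linarith
  show "AE p in lborel. p \<in> ?\<Omega> --> (%n. shift (kk (\<rho> n)) (m (nn (\<rho> n))) p) \<longlonglongrightarrow> m0 p"
   using lim unfolding f_def .
  show "unit_on ?\<Omega> m0" using m0n by (simp add: unit_on_def)
 qed (use m0 m0n av in simp_all)
qed

theorem theorem2p1:
  fixes \<omega> :: "(real \<times> real) set" and \<Omega> :: "(real \<times> real \<times> real) set"
  assumes "C1_domain \<omega>" and "bounded \<omega>"
    and "\<Omega> = UNIV \<times> \<omega>"
  shows "\<exists>m\<^sub>0 \<in> admissible \<Omega>. energy \<Omega> m\<^sub>0 = (INF m \<in> admissible \<Omega>. energy \<Omega> m)"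
proof -
 have o: "open \<omega>" and ob: "\<omega> \<in> sets borel" using assms(1) by (auto simp: C1_domain_def)
 have O: "open \<Omega>" unfolding assms(3) using o by (intro open_Times) auto
 define J where "J = (INF m \<in> admissible \<Omega>. energy \<Omega> m)"
 have lower: "J <= energy \<Omega> m" if "m \<in> admissible \<Omega>" for m unfolding J_def using that by (rule INF_lower)
 have "\<exists>m0\<in>admissible \<Omega>. energy \<Omega> m0 <= J"
 proof (cases "J = \<infinity>")
  case True
  obtain m where "m \<in> admissible \<Omega>" using admissible_nonempty[OF o assms(2)] by (auto simp: assms(3))
  then show ?thesis using True by auto
 next
  case False
  then obtain I where I: "J = ennreal I" "I >= 0" by (cases J) auto
  have "\<forall>n. \<exists>x. state \<Omega> (fst x) (fst (snd x)) (snd (snd x)) & unit_on \<Omega> (fst x) & gnorm \<Omega> (%p. fst x p - e_bar p) < \<infinity> &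
   local_energy \<Omega> UNIV (fst (snd x)) (snd (snd x)) <= ennreal (I + 1 / real (Suc n))"
  proof
   fix n
   have "J < ennreal (I + 1 / real (Suc n))" unfolding I(1) by (rule ennreal_lessI) (use I(2) in \<open>simp_all add: add_nonneg_pos\<close>)
   then obtain m where m: "m \<in> admissible \<Omega>" "energy \<Omega> m < ennreal (I + 1 / real (Suc n))" unfolding J_def INF_less_iff by blast
   have fin: "energy \<Omega> m < \<infinity>" using m(2) by (rule less_trans) simp
   show "\<exists>x. state \<Omega> (fst x) (fst (snd x)) (snd (snd x)) & unit_on \<Omega> (fst x) & gnorm \<Omega> (%p. fst x p - e_bar p) < \<infinity> &
    local_energy \<Omega> UNIV (fst (snd x)) (snd (snd x)) <= ennreal (I + 1 / real (Suc n))" (is "\<exists>x. ?P x")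
   proof (rule admissible_state[OF O m(1) fin])
    fix m' G H assume a: "state \<Omega> m' G H" "unit_on \<Omega> m'" "gnorm \<Omega> (%p. m' p - e_bar p) < \<infinity>" "local_energy \<Omega> UNIV G H = energy \<Omega> m"
    have "local_energy \<Omega> UNIV G H <= ennreal (I + 1 / real (Suc n))" unfolding a(4) using m(2) by (rule less_imp_le)
    with a(1-3) have "?P (m', G, H)" unfolding fst_conv snd_conv by (intro conjI)
    then show "\<exists>x. ?P x" by (rule exI[of ?P "(m', G, H)"])
   qed
  qed
  from choice[OF this]
  obtain x where x: "\<forall>n. state \<Omega> (fst (x n)) (fst (snd (x n))) (snd (snd (x n))) & unit_on \<Omega> (fst (x n)) & gnorm \<Omega> (%p. fst (x n) p - e_bar p) < \<infinity> &
   local_energy \<Omega> UNIV (fst (snd (x n))) (snd (snd (x n))) <= ennreal (I + 1 / real (Suc n))" ..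
  define m where "m n = fst (x n)" for n
  define G where "G n = fst (snd (x n))" for n
  define H where "H n = snd (snd (x n))" for n
  note x' = spec[OF x, folded m_def G_def H_def]
  note s = conjunct1[OF x'] conjunct1[OF conjunct2[OF x']] conjunct1[OF conjunct2[OF conjunct2[OF x']]]
  note en = conjunct2[OF conjunct2[OF conjunct2[OF x']]]
  note s' = s[unfolded assms(3)]
  have en1: "local_energy (UNIV \<times> \<omega>) UNIV (G n) (H n) <= ennreal (I + 1)" for n
   unfolding assms(3)[symmetric] by (rule order_trans[OF en]) (intro ennreal_leI, simp)
  have I1: "0 <= I + 1" using I(2) by simp
  show ?thesis
  proof (rule translated_limit[OF assms(1,2) s' en1 I1])
  fix q :: "nat => nat" and k m0 L
  assume q: "!!n. n <= q n" and m0: "m0 \<in> \<B>" "!!p. norm (m0 p) <= 1" "unit_on (UNIV \<times> \<omega>) m0"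
   and lm: "AE p in lborel. p \<in> UNIV \<times> \<omega> --> (%n. shift (k n) (m (q n)) p) \<longlonglongrightarrow> m0 p"
   and av: "!!j. j >= L ==> cell_avg \<omega> (shift j m0) >= 1/2 & cell_avg \<omega> (shift (- j) m0) <= -1/2"
  have sq: "state (UNIV \<times> \<omega>) (shift (k n) (m (q n))) (%c. shift (k n) (G (q n) c)) (shift (k n) (H (q n)))" for n
   by (rule state_shift_int[OF s'(1) ob])
  have eq: "local_energy (UNIV \<times> \<omega>) UNIV (%c. shift (k n) (G (q n) c)) (shift (k n) (H (q n))) <= ennreal (I + 1 / real (Suc n))" for n
  proof -
   \<comment> \<open>From \<open>n <= q n\<close> the rate \<open>1 / real (Suc n)\<close> persists
     along the selected indices.\<close>
   have "local_energy (UNIV \<times> \<omega>) UNIV (G (q n)) (H (q n)) <= ennreal (I + 1 / real (Suc n))"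
    unfolding assms(3)[symmetric]
    by (rule order_trans[OF en]) (intro ennreal_leI add_left_mono divide_left_mono, use q[of n] in auto)
   then show ?thesis by (simp only: local_energy_shift[OF s'(1) ob])
  qed
  show ?thesis
  proof (rule lower_semicontinuity[OF O[unfolded assms(3)] sq I(2) eq m0(1,2) lm])
  fix G0 H0 assume st: "state (UNIV \<times> \<omega>) m0 G0 H0" and le: "local_energy (UNIV \<times> \<omega>) UNIV G0 H0 <= ennreal I"
  have fin: "local_energy (UNIV \<times> \<omega>) UNIV G0 H0 < \<infinity>" using le by (rule le_less_trans) simp
  \<comment> \<open>Along the sequence this distance is known to be finite for each n only, with no
    common bound. For the limit it is obtained from the finite energy and the signs of the
    averages.\<close>
  have dist: "gnorm (UNIV \<times> \<omega>) (%p. m0 p - e_bar p) < \<infinity>"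
   by (rule distance_from_e_bar_finite[OF assms(1,2) st m0(3) fin av])
  show ?thesis
  proof (rule state_admissible[OF o assms(2) st m0(3) dist fin])
   fix m1 assume "m1 \<in> admissible (UNIV \<times> \<omega>)" "energy (UNIV \<times> \<omega>) m1 = local_energy (UNIV \<times> \<omega>) UNIV G0 H0"
   then show ?thesis using le I(1) unfolding assms(3) by (intro bexI[of _ m1]) simp_all
  qed
  qed
  qed
 qed
 then obtain m0 where "m0 \<in> admissible \<Omega>" "energy \<Omega> m0 <= J" by blast
 then show ?thesis using lower[of m0] unfolding J_def[symmetric] by (intro bexI[of _ m0] antisym)
qed

end
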